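(* In the setting described in the context (in particular under assumptions (A1), (A2) with constant $K\ge 0$, (T1), (T2), (T3)), for every $1<p<\infty$, with $p^*=\max\left(p,\frac{p}{p-1}\right)$, the vector of Riesz transforms $\mathbf{R}f=(R_1f,\ldots,R_df)$ satisfies $$\left\|\mathbf{R} f\right\|_{p}\leq 24\,(1+\sqrt{K})\,(p^*-1)\,\|\Pi f\|_{p},\qquad f\in L^p(X,\mu).$$
   Context: All functions are real-valued and $\mathbb{N}=\{0,1,2,\ldots\}$. Let $d\ge 1$. For $i=1,\ldots,d$ let $X_i=(\sigma_i,\Sigma_i)$, $-\infty\le\sigma_i<\Sigma_i\le\infty$, and let $d\mu_i(x_i)=w_i(x_i)\,dx_i$ with $w_i\in C^\infty(X_i)$ positive. Put $X=X_1\times\cdots\times X_d$, $\mu=\mu_1\otimes\cdots\otimes\mu_d$, $L^p=L^p(X,\mu)$, $\|\cdot\|_p=\|\cdot\|_{L^p}$; for vector-valued $\mathbf{g}=(g_1,\ldots,g_N)$, $\|\mathbf{g}\|_p=\big(\int_X|\mathbf{g}|^p\,d\mu\big)^{1/p}$ with $|\cdot|$ the Euclidean norm. Let $p_i,q_i\in C^\infty(X_i)$ be real-valued with $p_i(x_i)\ne0$ for all $x_i\in X_i$, and let $a_i\ge0$ be constants. Define (acting in the variable $x_i$) $\delta_i=p_i\partial_{x_i}+q_i$, its formal adjoint $\delta_i^*f=-\frac{1}{w_i}\partial_{x_i}(p_iw_if)+q_if$, and $\mathfrak{d}_i=p_i\partial_{x_i}$. The commutator $[\delta_i,\delta_i^*]=\delta_i\delta_i^*-\delta_i^*\delta_i$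 is multiplication by the function $v_i=p_i\big(2q_i'-(p_i\frac{w_i'}{w_i})'-p_i''\big)$. Put $L_i=\delta_i^*\delta_i+a_i$ and $L=\sum_{i=1}^dL_i$. One has $L_i=\mathfrak{d}_i^*\mathfrak{d}_i+r_i$ with $\mathfrak{d}_i^*f=-\frac1{w_i}\partial_{x_i}(p_iw_if)$ and $r_i=a_i+q_i^2-p_iq_i'-p_i'q_i-p_iq_i\frac{w_i'}{w_i}$; put $r(x)=\sum_{i=1}^dr_i(x_i)$. Assume that for each $i$ there is an orthonormal basis $\{\varphi^i_{k_i}\}_{k_i\in\mathbb{N}}$ of $L^2(X_i,\mu_i)$ with $L_i\varphi^i_{k_i}=\lambda^i_{k_i}\varphi^i_{k_i}$, where $\lambda^i_{k_i}\ge0$, the sequence $\{\lambda^i_{k_i}\}_{k_i}$ is strictly increasing and tends to $\infty$ (the $\varphi^i_{k_i}$ are then $C^\infty$ by ellipticity). For $k\in\mathbb{N}^d$ put $\varphi_k=\varphi^1_{k_1}\otimes\cdots\otimes\varphi^d_{k_d}$ and $\lambda_k=\lambda^1_{k_1}+\cdots+\lambda^d_{k_d}$. Put $\mathcal{D}=\mathrm{lin}\{\varphi_k:k\in\mathbb{N}^d\}$ and $\mathcal{D}_i=\mathrm{lin}\{\delta_i\varphi_k:k\in\mathbb{N}^d\}$. Assumptions: (A1) each $v_i$, $i=1,\ldots,d$, is non-negative. (A2) there is a constant $K\ge0$ with $\sum_{i=1}^dq_i^2(x_i)\le K\,r(x)$ for all $x\in X$. (T1) $\langle\delta_i\varphi^i_{k_i},\delta_i\varphi^i_{m_i}\rangle_{L^2(X_i,\mu_i)}=\langle\delta_i^*\delta_i\varphi^i_{k_i},\varphi^i_{m_i}\rangle_{L^2(X_i,\mu_i)}$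 for all $i$ and $k_i,m_i\in\mathbb{N}$. (T2) for each $i$, each $z_i\in\{\sigma_i,\Sigma_i\}$, all $k_i\in\mathbb{N}$ and all $s_1,s_2>0$: $\lim_{x_i\to z_i}\big[(1+|\varphi^i_{k_i}|^{s_1}+|\delta_i\varphi^i_{k_i}|^{s_2})\,p_i^2w_i\,\partial_{x_i}\varphi^i_{k_i}\big](x_i)=0$ and $\lim_{x_i\to z_i}\big[(1+|\varphi^i_{k_i}|^{s_1}+|\delta_i\varphi^i_{k_i}|^{s_2})\,p_i^2w_i\,\partial_{x_i}\delta_i\varphi^i_{k_i}\big](x_i)=0$. (T3) $\mathcal{D}$ and each $\mathcal{D}_i$, $i=1,\ldots,d$, are dense subspaces of $L^p$ for every $1\le p<\infty$. Let $\Lambda_0=\lambda^1_0+\cdots+\lambda^d_0$; put $\mathbb{N}^d_\Lambda=\mathbb{N}^d$ if $\Lambda_0>0$ and $\mathbb{N}^d_\Lambda=\mathbb{N}^d\setminus\{(0,\ldots,0)\}$ if $\Lambda_0=0$. Define $\Pi f=\sum_{k\in\mathbb{N}^d_\Lambda}\langle f,\varphi_k\rangle_{L^2}\varphi_k$ (so $\Pi=I$ if $\Lambda_0>0$, and $\Pi f=f-\langle f,\varphi_0\rangle\varphi_0$ if $\Lambda_0=0$, which makes sense on every $L^p$, $1<p<\infty$, by (T3)). The Riesz transforms are $R_if=\sum_{k\in\mathbb{N}^d_\Lambda}\lambda_k^{-1/2}\langle f,\varphi_k\rangle_{L^2}\,\delta_i\varphi_k$ for $f\in L^2$. For $f\in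 L^p$, $\mathbf{R}f$ is understood as the continuous extension of $\mathbf{R}$ from the dense subspace $\mathcal{D}$ to $L^p$ (whose existence is part of the claim). *)

theory Defs
  imports "HOL-Analysis.Analysis"
begin

section \<open>Lebesgue spaces\<close>

text \<open>
  Elements of \<open>L\<^sup>p\<close> are represented by measurable functions, so equality in \<open>L\<^sup>p\<close>
  is vanishing of the seminorm below.  The codomain is \<open>real\<close> for scalar functions and
  \<open>real ^ 'd\<close> (with its Euclidean norm) for vector-valued ones.
\<close>

definition Lp :: "'a measure \<Rightarrow> real \<Rightarrow> ('a \<Rightarrow> 'b :: euclidean_space) set" where
  "Lp M s = {f \<in> borel_measurable M. integrable M (\<lambda>x. norm (f x) powr s)}"

definition Lp_norm :: "'a measure \<Rightarrow> real \<Rightarrow> ('a \<Rightarrow> 'b :: euclidean_space) \<Rightarrow> real" where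
  "Lp_norm M s f = (\<integral>x. norm (f x) powr s \<partial>M) powr (1 / s)"

definition L2_inner :: "'a measure \<Rightarrow> ('a \<Rightarrow> real) \<Rightarrow> ('a \<Rightarrow> real) \<Rightarrow> real" where
  "L2_inner M f g = (\<integral>x. f x * g x \<partial>M)"

definition lin :: "('k \<Rightarrow> 'a \<Rightarrow> real) \<Rightarrow> ('a \<Rightarrow> real) set" where
  "lin e = {\<lambda>x. \<Sum>k\<in>A. c k * e k x | A c. finite A}"

definition dense_in_Lp :: "'a measure \<Rightarrow> real \<Rightarrow> ('a \<Rightarrow> real) set \<Rightarrow> bool" where
  "dense_in_Lp M s V \<longleftrightarrow>
     V \<subseteq> Lp M s \<and> (\<forall>f\<in>Lp M s. \<forall>\<epsilon>>0. \<exists>g\<in>V. Lp_norm M s (\<lambda>x. f x - g x) < \<epsilon>)"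

definition orthonormal_basis_L2 :: "'a measure \<Rightarrow> ('k \<Rightarrow> 'a \<Rightarrow> real) \<Rightarrow> bool" where
  "orthonormal_basis_L2 M e \<longleftrightarrow>
     (\<forall>k m. L2_inner M (e k) (e m) = (if k = m then 1 else 0)) \<and> dense_in_Lp M 2 (lin e)"

text \<open>Unconditional convergence in \<open>L\<^sup>2\<close> of the series of the \<open>F k\<close>, \<open>k \<in> A\<close>, to \<open>g\<close>.\<close>

definition has_L2_sum ::
    "'a measure \<Rightarrow> ('k \<Rightarrow> 'a \<Rightarrow> real) \<Rightarrow> 'k set \<Rightarrow> ('a \<Rightarrow> real) \<Rightarrow> bool" where
  "has_L2_sum M F A g \<longleftrightarrow>
     g \<in> Lp M 2 \<and> (\<forall>k\<in>A. F k \<in> Lp M 2) \<and>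
     ((\<lambda>B. Lp_norm M 2 (\<lambda>x. g x - (\<Sum>k\<in>B. F k x))) \<longlongrightarrow> 0) (finite_subsets_at_top A)"


section \<open>One variable\<close>

text \<open>The underlying interval is \<open>einterval s t\<close>, with \<open>s < t\<close> extended reals.\<close>

definition smooth_fun_on :: "real set \<Rightarrow> (real \<Rightarrow> real) \<Rightarrow> bool" where
  "smooth_fun_on S f \<longleftrightarrow> (\<forall>n. \<forall>x\<in>S. (deriv ^^ n) f differentiable (at x))"

definition weighted_measure :: "ereal \<Rightarrow> ereal \<Rightarrow> (real \<Rightarrow> real) \<Rightarrow> real measure" where
  "weighted_measure s t w = density (restrict_space lborel (einterval s t)) (\<lambda>x. ennreal (w x))"

definition delta :: "(real \<Rightarrow> real) \<Rightarrow> (real \<Rightarrow> real) \<Rightarrow> (real \<Rightarrow> real) \<Rightarrow> real \<Rightarrow> real" where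
  "delta p q f x = p x * deriv f x + q x * f x"

definition delta_star ::
    "(real \<Rightarrow> real) \<Rightarrow> (real \<Rightarrow> real) \<Rightarrow> (real \<Rightarrow> real) \<Rightarrow> (real \<Rightarrow> real) \<Rightarrow> real \<Rightarrow> real" where
  "delta_star w p q f x = - (1 / w x) * deriv (\<lambda>y. p y * w y * f y) x + q x * f x"

definition L_op ::
    "(real \<Rightarrow> real) \<Rightarrow> (real \<Rightarrow> real) \<Rightarrow> (real \<Rightarrow> real) \<Rightarrow> real \<Rightarrow> (real \<Rightarrow> real) \<Rightarrow> real \<Rightarrow> real" where
  "L_op w p q a f x = delta_star w p q (delta p q f) x + a * f x"

text \<open>The commutator of \<open>delta p q\<close> and \<open>delta_star w p q\<close> is multiplication by:\<close>

definition v_fun ::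
    "(real \<Rightarrow> real) \<Rightarrow> (real \<Rightarrow> real) \<Rightarrow> (real \<Rightarrow> real) \<Rightarrow> real \<Rightarrow> real" where
  "v_fun w p q x =
     p x * (2 * deriv q x - deriv (\<lambda>y. p y * (deriv w y / w y)) x - deriv (deriv p) x)"

text \<open>
  The potential in \<open>L_op w p q a = D\<^sup>* D + r\<close>, where \<open>D = delta p (\<lambda>_. 0)\<close> and
  \<open>D\<^sup>* = delta_star w p (\<lambda>_. 0)\<close>:
\<close>

definition r_fun ::
    "(real \<Rightarrow> real) \<Rightarrow> (real \<Rightarrow> real) \<Rightarrow> (real \<Rightarrow> real) \<Rightarrow> real \<Rightarrow> real \<Rightarrow> real" where
  "r_fun w p q a x =
     a + (q x)\<^sup>2 - p x * deriv q x - deriv p x * q x - p x * q x * (deriv w x / w x)"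


section \<open>Several variables\<close>

text \<open>
  The dimension is the cardinality of the finite index type \<open>'d\<close>; points are functions
  \<open>'d \<Rightarrow> real\<close> and multi-indices are functions \<open>'d \<Rightarrow> nat\<close>.
\<close>

definition product_measure ::
    "('d :: finite \<Rightarrow> ereal) \<Rightarrow> ('d \<Rightarrow> ereal) \<Rightarrow> ('d \<Rightarrow> real \<Rightarrow> real) \<Rightarrow> ('d \<Rightarrow> real) measure" where
  "product_measure s t w = (\<Pi>\<^sub>M i\<in>UNIV. weighted_measure (s i) (t i) (w i))"

definition delta_coord ::
    "('d \<Rightarrow> real \<Rightarrow> real) \<Rightarrow> ('d \<Rightarrow> real \<Rightarrow> real) \<Rightarrow> 'd \<Rightarrow> (('d \<Rightarrow> real) \<Rightarrow> real) \<Rightarrow> ('d \<Rightarrow> real) \<Rightarrow> real" where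
  "delta_coord p q i f x = delta (p i) (q i) (\<lambda>y. f (x(i := y))) (x i)"

definition tensor ::
    "('d :: finite \<Rightarrow> nat \<Rightarrow> real \<Rightarrow> real) \<Rightarrow> ('d \<Rightarrow> nat) \<Rightarrow> ('d \<Rightarrow> real) \<Rightarrow> real" where
  "tensor \<phi> k x = (\<Prod>i\<in>UNIV. \<phi> i (k i) (x i))"

definition eigval :: "('d :: finite \<Rightarrow> nat \<Rightarrow> real) \<Rightarrow> ('d \<Rightarrow> nat) \<Rightarrow> real" where
  "eigval ev k = (\<Sum>i\<in>UNIV. ev i (k i))"

definition index_set :: "('d :: finite \<Rightarrow> nat \<Rightarrow> real) \<Rightarrow> ('d \<Rightarrow> nat) set" where
  "index_set ev = (if eigval ev (\<lambda>_. 0) > 0 then UNIV else UNIV - {\<lambda>_. 0})"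

text \<open>
  The operator \<open>f \<mapsto> \<Sum>k\<in>index_set ev. \<langle>f, \<phi>\<^sub>k\<rangle> \<phi>\<^sub>k\<close>, written in the closed form that makes sense
  on every \<open>L\<^sup>p\<close>: it leaves out the component along \<open>\<phi>\<^sub>0\<close> exactly when \<open>0\<close> is an eigenvalue.
\<close>

definition Pi_proj ::
    "('d \<Rightarrow> real) measure \<Rightarrow> ('d :: finite \<Rightarrow> nat \<Rightarrow> real \<Rightarrow> real) \<Rightarrow> ('d \<Rightarrow> nat \<Rightarrow> real) \<Rightarrow>
     (('d \<Rightarrow> real) \<Rightarrow> real) \<Rightarrow> ('d \<Rightarrow> real) \<Rightarrow> real" where
  "Pi_proj M \<phi> ev f =
     (if eigval ev (\<lambda>_. 0) > 0 then f
      else (\<lambda>x. f x - L2_inner M f (tensor \<phi> (\<lambda>_. 0)) * tensor \<phi> (\<lambda>_. 0) x))"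

text \<open>\<open>g\<close> represents the \<open>i\<close>-th Riesz transform of \<open>f \<in> L\<^sup>2\<close>.\<close>

definition is_Riesz ::
    "('d \<Rightarrow> real) measure \<Rightarrow> ('d \<Rightarrow> real \<Rightarrow> real) \<Rightarrow> ('d \<Rightarrow> real \<Rightarrow> real) \<Rightarrow>
     ('d :: finite \<Rightarrow> nat \<Rightarrow> real \<Rightarrow> real) \<Rightarrow> ('d \<Rightarrow> nat \<Rightarrow> real) \<Rightarrow>
     'd \<Rightarrow> (('d \<Rightarrow> real) \<Rightarrow> real) \<Rightarrow> (('d \<Rightarrow> real) \<Rightarrow> real) \<Rightarrow> bool" where
  "is_Riesz M p q \<phi> ev i f g \<longleftrightarrow>
     has_L2_sum M
       (\<lambda>k x. eigval ev k powr (- 1 / 2) * L2_inner M f (tensor \<phi> k) * delta_coord p q i (tensor \<phi> k) x)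
       (index_set ev) g"

text \<open>
  \<open>T\<close> is the continuous extension to \<open>L\<^sup>s\<close>, with values in \<open>L\<^sup>s(\<dots>; \<real>\<^sup>d)\<close>, of the vector of Riesz
  transforms on the dense subspace \<open>lin (tensor \<phi>)\<close>.  Continuity for the seminorms makes \<open>T\<close>
  respect equality almost everywhere; together with density it determines \<open>T\<close> up to it.
\<close>

definition Riesz_extension ::
    "('d \<Rightarrow> real) measure \<Rightarrow> ('d \<Rightarrow> real \<Rightarrow> real) \<Rightarrow> ('d \<Rightarrow> real \<Rightarrow> real) \<Rightarrow>
     ('d :: finite \<Rightarrow> nat \<Rightarrow> real \<Rightarrow> real) \<Rightarrow> ('d \<Rightarrow> nat \<Rightarrow> real) \<Rightarrow> real \<Rightarrow>
     ((('d \<Rightarrow> real) \<Rightarrow> real) \<Rightarrow> ('d \<Rightarrow> real) \<Rightarrow> real ^ 'd) \<Rightarrow> bool" where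
  "Riesz_extension M p q \<phi> ev s T \<longleftrightarrow>
     (\<forall>f\<in>Lp M s. T f \<in> Lp M s) \<and>
     (\<forall>f\<in>lin (tensor \<phi>). \<forall>i. is_Riesz M p q \<phi> ev i f (\<lambda>x. T f x $ i)) \<and>
     (\<forall>f\<in>Lp M s. \<forall>\<epsilon>>0. \<exists>\<eta>>0. \<forall>g\<in>Lp M s.
        Lp_norm M s (\<lambda>x. f x - g x) < \<eta> \<longrightarrow> Lp_norm M s (\<lambda>x. T f x - T g x) < \<epsilon>)"

end

(* Bilinear embedding with an explicit Bellman function. By duality and density it suffices to bound
   <R f, g> for finite sums f of eigenfunctions phi_k and g_i of the functions delta_i phi_k, where
   <R f, g> = - 4 * sum_i int int t * (delta_i F) * (d/dt G_i) dt dmu, F and G_i being the Poisson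
   extensions in t, damped by exp (- t * sqrt lambda_k). By the commutator identity G_i solves an equation
   of the same type as F with the larger potential r + v_i, so with u = (F, G_1, ..., G_d) the function
   b = Phi (|F|^2 + e) (|G|^2 + e) satisfies (d/dt)^2 b + (elliptic part of b) >= c * alpha * beta, where
   alpha, beta are the full gradient lengths of F and G; the potential is kept in them, so that (A2) yields
   |delta F| <= (1 + sqrt K) * alpha. Integrate against min t (2 T - t) in t and against cutoffs in x
   that are piecewise affine in int 1 / (p_i^2 w_i), and remove the cutoffs by (T2); then let T tend to
   infinity and e to 0. This gives a bound by int |f|^s + |g|^s', and optimising over the scaling of f and
   g turns it into a bound by the product of the norms. *)

theory Submission
  imports Defs
begin

section \<open>The Bellman function\<close>

text \<open>A Bellman function that is smooth away from the axes can be differentiated twice along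
  the extensions without mollification; \<open>e\<close> keeps both arguments positive, and
  subtracting the value at the origin is forced because \<open>M\<close> may have infinite mass. The
  obstacle is the boundary: (T2) is a statement in one variable and tests the flux of an
  eigenfunction only against powers belonging to the same index. So every bound has to factorise
  over the coordinates, and the cutoffs are products of ramps that are affine in the scale where the
  flux is an ordinary derivative; after two integrations by parts only values and mean slopes of the
  Bellman function at the ends are left. Only one exponent is at least 2, while the input is scalar
  and the output a vector; the set \<open>L\<close> decides which of the two sits in the first slot
  of \<open>Phi\<close>. The 24 arises as follows. The Hessian bound contributes 24/5 * q (q - 1) /
  12, the time integral divides by 4, and the function is at most 7/6 of the two powers, both
  normalised to 1. This gives 70/3 divided by q (q - 1), and 1 / (q - 1) = p - 1, q > 1, 70/3 <
  24.\<close>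

locale bellman =
  fixes p q :: real
  assumes p_ge: "2 \<le> p" and conj: "(p - 1) * (q - 1) = 1"
begin

text \<open>
  A smooth variant of the Nazarov-Treil function.  \<open>U\<close> and \<open>V\<close> stand for \<open>\<bar>F\<bar>\<^sup>2\<close> and \<open>\<bar>G\<bar>\<^sup>2\<close>;
  replacing the maximum of \<open>V\<close> and \<open>U powr (p - 1)\<close> by their sum \<open>Zf U V\<close> avoids its case distinction.
\<close>

definition "kap = (2 - q) / 2"
definition "gam = (p - 2) / 2"
text \<open>\<open>12 * del\<close> is the constant q (q - 1) of the Hessian of
  \<open>V powr (q / 2)\<close>, twice what is lost in the term with \<open>U\<close>.\<close>

definition "del = q * (q - 1) / 12"
definition "Zf U V = V + U powr (p - 1)"
definition "Phi U V = V powr (q / 2) + del * (U * Zf U V powr kap)"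
definition "Phi_U U V = del * (Zf U V powr kap + gam * U powr (p - 1) * Zf U V powr (kap - 1))"
definition "Phi_V U V = q / 2 * V powr (q / 2 - 1) + del * kap * U * Zf U V powr (kap - 1)"
definition "Phi_UU U V = del * gam * U powr (p - 2) *
  (p * Zf U V powr (kap - 1) + (kap - 1) * (p - 1) * U powr (p - 1) * Zf U V powr (kap - 2))"
definition "Phi_UV U V = del * kap *
  (Zf U V powr (kap - 1) + (kap - 1) * (p - 1) * U powr (p - 1) * Zf U V powr (kap - 2))"
definition "Phi_VV U V = q / 2 * (q / 2 - 1) * V powr (q / 2 - 2)
  + del * kap * (kap - 1) * U * Zf U V powr (kap - 2)"

lemma q_eq: "q = p / (p - 1)"
  using conj p_ge by (simp add: field_simps)

lemma q_gt: "1 < q" and q_le: "q \<le> 2"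
  using p_ge by (simp_all add: q_eq field_simps)

lemma pq: "p * q = p + q" "(p - 1) * q = p"
  using conj by (simp_all add: algebra_simps)

lemma kap_bounds: "0 \<le> kap" "kap \<le> 1 / 2"
  using q_gt q_le by (simp_all add: kap_def)

lemma gam_nonneg: "0 \<le> gam"
  using p_ge by (simp add: gam_def)

lemma del_pos: "0 < del"
  using q_gt by (simp add: del_def)

lemma del_le: "del \<le> 1 / 6"
proof -
  have "q * (q - 1) \<le> 2 * 1"
    using q_gt q_le by (intro mult_mono) auto
  then show ?thesis by (simp add: del_def)
qed

text \<open>This is the homogeneity behind the choice of \<open>kap\<close>: on V = U powr (p - 1)
  the three quantities V powr (q / 2), U * V powr kap and U powr (p / 2) coincide.\<close>

lemma kap_gam: "kap * (p - 1) = gam"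
  using pq by (simp add: kap_def gam_def field_simps)

lemma kap_p: "(kap - 1) * (p - 1) = - (p / 2)"
  using pq by (simp add: kap_def field_simps)

lemma Zf_pos: "0 < U \<Longrightarrow> 0 < V \<Longrightarrow> 0 < Zf U V"
  by (simp add: Zf_def add_pos_nonneg)

lemma DERIV_powr_const:
  assumes "(f has_real_derivative D) (at y within T)" "0 < f y"
  shows "((\<lambda>y. f y powr c) has_real_derivative (c * f y powr (c - 1) * D)) (at y within T)"
  using assms by (auto intro!: derivative_eq_intros simp: powr_diff field_simps)

lemma DERIV_Zf:
  assumes "(U has_real_derivative U') (at y within T)" "(V has_real_derivative V') (at y within T)" "0 < U y"
  shows "((\<lambda>y. Zf (U y) (V y)) has_real_derivative
    (V' + (p - 1) * U y powr (p - 2) * U')) (at y within T)"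
proof -
  have e: "p - 1 - 1 = p - 2" by simp
  show ?thesis
    unfolding Zf_def by (rule derivative_eq_intros DERIV_powr_const assms refl)+ (simp add: e)
qed

lemma DERIV_Phi:
  assumes "(U has_real_derivative U') (at y within T)" "(V has_real_derivative V') (at y within T)" "0 < U y" "0 < V y"
  shows "((\<lambda>y. Phi (U y) (V y)) has_real_derivative
    (Phi_U (U y) (V y) * U' + Phi_V (U y) (V y) * V')) (at y within T)"
proof -
  have up: "U y powr (p - 2) * U y = U y powr (p - 1)"
    using assms(3) by (simp add: powr_diff field_simps power2_eq_square)
  show ?thesis
    unfolding Phi_def
    apply (rule derivative_eq_intros DERIV_powr_const DERIV_Zf assms Zf_pos refl)+
    unfolding Phi_U_def Phi_V_def kap_gam[symmetric] up[symmetric]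
    by (simp add: algebra_simps)
qed

lemma DERIV_Phi_U:
  assumes "(U has_real_derivative U') (at y within T)" "(V has_real_derivative V') (at y within T)" "0 < U y" "0 < V y"
  shows "((\<lambda>y. Phi_U (U y) (V y)) has_real_derivative
    (Phi_UU (U y) (V y) * U' + Phi_UV (U y) (V y) * V')) (at y within T)"
proof -
  have e: "p - 1 - 1 = p - 2" "kap - 1 - 1 = kap - 2" by auto
  show ?thesis
    unfolding Phi_U_def
    apply (rule derivative_eq_intros DERIV_powr_const DERIV_Zf assms Zf_pos refl)+
    unfolding Phi_UU_def Phi_UV_def kap_gam[symmetric] e
    by (simp add: algebra_simps)
qed

lemma DERIV_Phi_V:
  assumes "(U has_real_derivative U') (at y within T)" "(V has_real_derivative V') (at y within T)" "0 < U y" "0 < V y"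
  shows "((\<lambda>y. Phi_V (U y) (V y)) has_real_derivative
    (Phi_UV (U y) (V y) * U' + Phi_VV (U y) (V y) * V')) (at y within T)"
proof -
  have up: "U y powr (p - 2) * U y = U y powr (p - 1)"
    using assms(3) by (simp add: powr_diff field_simps power2_eq_square)
  have e: "kap - 1 - 1 = kap - 2" "q / 2 - 1 - 1 = q / 2 - 2" by auto
  show ?thesis
    unfolding Phi_V_def
    apply (rule derivative_eq_intros DERIV_powr_const DERIV_Zf assms Zf_pos refl)+
    unfolding Phi_UV_def Phi_VV_def up[symmetric] e
    by (simp add: algebra_simps)
qed

text \<open>With k = \<open>Zf U V powr kap\<close> this reads U * k / Z <= 1 / k, the trade of the
  weight k of the first variable for the weight 1 / k of the second. It comes from U = (U powr (p -
  1)) powr (q - 1) and q - 1 + 2 * kap = 1.\<close>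

lemma U_Zf_le:
  assumes "0 < U" "0 < V"
  shows "U * (Zf U V powr kap)\<^sup>2 \<le> Zf U V"
proof -
  have Z: "0 < Zf U V" using assms by (rule Zf_pos)
  have "U = (U powr (p - 1)) powr (q - 1)"
    using assms conj by (simp add: powr_powr)
  also have "\<dots> \<le> Zf U V powr (q - 1)"
    using assms q_gt by (intro powr_mono2) (auto simp: Zf_def)
  finally have "U * (Zf U V powr kap)\<^sup>2 \<le> Zf U V powr (q - 1) * (Zf U V powr kap)\<^sup>2"
    by (rule mult_right_mono) simp
  also have "\<dots> = Zf U V powr (q - 1 + kap + kap)"
    by (simp only: powr_add power2_eq_square mult.assoc)
  also have "q - 1 + kap + kap = 1" by (simp add: kap_def field_simps)
  finally show ?thesis using Z by simp
qed

text \<open>Since q / 2 - 1 = - kap and V is at most \<open>Zf U V\<close>. Through this the Hessian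
  of \<open>V powr (q / 2)\<close> reaches the weight 1 / k.\<close>

lemma V_powr_ge:
  assumes "0 < U" "0 < V"
  shows "1 / Zf U V powr kap \<le> V powr (q / 2 - 1)"
proof -
  have "Zf U V powr (q / 2 - 1) \<le> V powr (q / 2 - 1)"
    using assms q_le by (intro powr_mono2') (auto simp: Zf_def)
  moreover have "q / 2 - 1 = - kap" by (simp add: kap_def field_simps)
  ultimately show ?thesis by (simp add: powr_minus_divide)
qed

text \<open>
  The contribution of \<open>U * Zf U V powr kap\<close> to the Hessian, divided by \<open>del\<close>, with \<open>W = U powr (p - 1)\<close>
  and \<open>k = Z powr kap\<close>; the Hessian of \<open>V powr (q / 2)\<close> compensates the loss \<open>6 * (b2 / k)\<close>.
\<close>

lemma Psi_Hess_algebra: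
  fixes U V W Z k a2 b2 fa gb :: real
  assumes pos: "0 < U" "0 < V" "0 \<le> W" "0 < k" and Z: "Z = V + W" and key: "U * k\<^sup>2 \<le> Z"
    and a2: "0 \<le> a2" and b2: "0 \<le> b2" and fa: "fa\<^sup>2 \<le> U * a2" and gb: "gb\<^sup>2 \<le> V * b2"
  shows "2 * (k + gam * W * (k / Z)) * a2 + 2 * (kap * U * (k / Z)) * b2
    + 4 * (gam * (W / U) * (p * (k / Z) + (kap - 1) * (p - 1) * W * (k / Z\<^sup>2)) * fa\<^sup>2
      + 2 * (kap * (k / Z + (kap - 1) * (p - 1) * W * (k / Z\<^sup>2))) * (fa * gb)
      + kap * (kap - 1) * U * (k / Z\<^sup>2) * gb\<^sup>2)
    \<ge> a2 * k - 6 * (b2 / k)"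
proof -
  have Zp: "0 < Z" using pos Z by simp
  have Uk: "U * k / Z \<le> 1 / k"
    using key pos Zp by (simp add: field_simps power2_eq_square)
  have VZ: "V / Z \<le> 1" and WZ: "W / Z \<le> 1" using pos Z by simp_all
  have k1: "0 \<le> kap" "kap \<le> 1/2" by (fact kap_bounds)+
  \<comment> \<open>Balance: of the term 2 * k * a2 one copy of k * a2 is spent in
    \<open>T4a\<close>; the losses in b2 / k are 4 in \<open>T4a\<close>, 1 in \<open>T4b\<close>
    and 1 in \<open>T5\<close>, together the 6 of the claim.\<close>
  have T12: "0 \<le> 2 * (gam * W * (k / Z)) * a2" "0 \<le> 2 * (kap * U * (k / Z)) * b2"
    using pos Zp a2 b2 gam_nonneg k1 by simp_all
  \<comment> \<open>At least half of the positive term in fa^2 survives, because W / Z <= 1. Writing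
    gam = kap * (p - 1) prepares the square completed in \<open>T4b\<close>.\<close>
  have T3: "4 * (gam * (W / U) * (p * (k / Z) + (kap - 1) * (p - 1) * W * (k / Z\<^sup>2)) * fa\<^sup>2)
    \<ge> 2 * kap * (W * k / Z) * (p * (p - 1) / U * fa\<^sup>2)"
  proof -
    have "p * (k / Z) + (kap - 1) * (p - 1) * W * (k / Z\<^sup>2) = p * (k / Z) * (1 - W / Z / 2)"
      unfolding kap_p using Zp by (simp add: field_simps power2_eq_square)
    also have "\<dots> \<ge> p * (k / Z) * (1 / 2)"
      using WZ Zp pos p_ge by (intro mult_left_mono) auto
    finally have "4 * (gam * (W / U)) * (p * (k / Z) * (1 / 2)) * fa\<^sup>2 \<le>
       4 * (gam * (W / U)) * (p * (k / Z) + (kap - 1) * (p - 1) * W * (k / Z\<^sup>2)) * fa\<^sup>2"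
      using gam_nonneg pos by (intro mult_right_mono mult_left_mono) auto
    moreover have "4 * (gam * (W / U)) * (p * (k / Z) * (1 / 2)) * fa\<^sup>2
      = 2 * kap * (W * k / Z) * (p * (p - 1) / U * fa\<^sup>2)"
    proof -
      have "4 * (kap * r * (W / U)) * (p * (k / Z) * (1 / 2)) * fa\<^sup>2
        = 2 * kap * (W * k / Z) * (p * r / U * fa\<^sup>2)" for r
        by (simp add: mult_ac)
      then show ?thesis unfolding kap_gam[symmetric] .
    qed
    ultimately show ?thesis by (simp add: algebra_simps)
  qed
  have T5: "4 * (kap * (kap - 1) * U * (k / Z\<^sup>2) * gb\<^sup>2) \<ge> - (b2 / k)"
  proof -
    have "4 * (kap * (1 - kap)) \<le> 1"
      using sum_squares_ge_zero[of "1 - 2 * kap" 0] by (simp add: algebra_simps power2_eq_square)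
    then have "4 * (kap * (1 - kap)) * (U * (k / Z\<^sup>2) * gb\<^sup>2) \<le> 1 * (U * (k / Z\<^sup>2) * (V * b2))"
      using gb pos k1 by (intro mult_mono) auto
    also have "\<dots> = (U * k / Z) * (V / Z) * b2" by (simp add: power2_eq_square)
    also have "\<dots> \<le> (1 / k) * 1 * b2"
      using Uk VZ b2 pos Zp by (intro mult_right_mono mult_mono) auto
    finally show ?thesis by (simp add: algebra_simps)
  qed
  \<comment> \<open>The mixed term has two parts. This one is independent of W and is handled by the
    inequality of means; the part with W is handled in \<open>T4b\<close> with the help of
    \<open>T3\<close>.\<close>
  have T4a: "8 * kap * (k / Z) * (fa * gb) \<ge> - (a2 * k + 4 * (b2 / k))"
  proof -
    define x where "x = 8 * kap * (k / Z) * (fa * gb)"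
    have "x\<^sup>2 = (8 * kap)\<^sup>2 * ((k / Z)\<^sup>2 * (fa\<^sup>2 * gb\<^sup>2))"
      by (simp add: x_def power_mult_distrib power_divide)
    also have "\<dots> \<le> 4\<^sup>2 * ((k / Z)\<^sup>2 * ((U * a2) * (V * b2)))"
      using k1 fa gb pos Zp a2 by (intro mult_mono power_mono) auto
    also have "\<dots> = 16 * (U * k\<^sup>2 / Z) * (V / Z) * (a2 * b2)"
      by (simp add: power2_eq_square power_divide)
    also have "\<dots> \<le> 16 * 1 * 1 * (a2 * b2)"
      using key VZ Zp pos a2 b2 by (intro mult_right_mono mult_mono) auto
    also have "\<dots> \<le> (a2 * k + 4 * (b2 / k))\<^sup>2"
    proof -
      have "16 * (X * Y) \<le> (X + 4 * Y)\<^sup>2" for X Y :: real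
        using sum_squares_ge_zero[of "X - 4 * Y" 0] by (simp add: power2_eq_square algebra_simps)
      moreover have "16 * 1 * 1 * (a2 * b2) = 16 * ((a2 * k) * (b2 / k))" using pos by simp
      ultimately show ?thesis by (simp only:)
    qed
    finally have "\<bar>x\<bar> \<le> \<bar>a2 * k + 4 * (b2 / k)\<bar>"
      by (simp only: abs_le_square_iff)
    moreover have "0 \<le> a2 * k + 4 * (b2 / k)" using a2 b2 pos by simp
    ultimately show ?thesis unfolding x_def by linarith
  qed
  have T4b: "2 * kap * (W * k / Z) * (p * (p - 1) / U * fa\<^sup>2) - 4 * p * kap * W * (k / Z\<^sup>2) * (fa * gb)
     \<ge> - (b2 / k)"
  proof -
    have "0 \<le> 2 * kap * (W * k / Z) * ((p * fa - q * U * gb / Z)\<^sup>2 / (q * U))"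
      using k1 pos Zp q_gt by simp
    also have "(p * fa - q * U * gb / Z)\<^sup>2 / (q * U) = p * (p - 1) / U * fa\<^sup>2 - 2 * p * fa * gb / Z + q * U * gb\<^sup>2 / Z\<^sup>2"
    proof -
      \<comment> \<open>Conjugacy of the exponents is what makes the surviving part of
        \<open>T3\<close> and the mixed term two thirds of an exact square.\<close>
      have "p * (p - 1) = p\<^sup>2 / q" using pq q_gt by (simp add: field_simps power2_eq_square)
      then show ?thesis using q_gt pos Zp by (simp add: power2_eq_square field_simps)
    qed
    finally have "2 * kap * (W * k / Z) * (p * (p - 1) / U * fa\<^sup>2) - 4 * p * kap * W * (k / Z\<^sup>2) * (fa * gb)
       \<ge> - (2 * kap * (W * k / Z) * (q * U * gb\<^sup>2 / Z\<^sup>2))"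
      by (simp add: algebra_simps power2_eq_square)
    moreover have "2 * kap * (W * k / Z) * (q * U * gb\<^sup>2 / Z\<^sup>2) \<le> b2 / k"
    proof -
      have "2 * kap * q \<le> 1"
        using sum_squares_ge_zero[of "1 - q" 0] by (simp add: kap_def algebra_simps power2_eq_square)
      then have "(2 * kap * q) * ((W / Z) * (U * k / Z) * (gb\<^sup>2 / Z)) \<le> 1 * (1 * (1 / k) * b2)"
      proof (intro mult_mono)
        show "gb\<^sup>2 / Z \<le> b2"
        proof -
          have "gb\<^sup>2 / Z \<le> V * b2 / Z" using gb Zp by (simp add: divide_right_mono)
          also have "\<dots> = (V / Z) * b2" by simp
          also have "\<dots> \<le> 1 * b2" using VZ b2 by (intro mult_right_mono) auto
          finally show ?thesis by simp
        qed
      qed (use pos Zp WZ Uk k1 q_gt in auto)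
      then show ?thesis by (simp add: algebra_simps power2_eq_square)
    qed
    ultimately show ?thesis by linarith
  qed
  have e: "4 * (2 * (kap * (k / Z + (kap - 1) * (p - 1) * W * (k / Z\<^sup>2))) * (fa * gb))
     = 8 * kap * (k / Z) * (fa * gb) - 4 * p * kap * W * (k / Z\<^sup>2) * (fa * gb)"
    unfolding kap_p by (simp add: algebra_simps)
  have "a2 * k \<le> 2 * k * a2 - a2 * k" by simp
  then show ?thesis using T12 T3 T4a T4b T5 e
    unfolding distrib_left distrib_right by (simp only: mult.assoc[symmetric])
qed

text \<open>\<open>fa\<close> and \<open>gb\<close> stand for the inner products of F and of G with
  their derivatives, so the hypotheses are Cauchy-Schwarz inequalities. The Hessian of
  \<open>V powr (q / 2)\<close> supplies 12 * del * (b2 / k); half of it pays for the loss in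
  \<open>Psi_Hess_algebra\<close>, the other half remains.\<close>

lemma Phi_Hess_ge:
  assumes U: "0 < U" and V: "0 < V" and a2: "0 \<le> a2" and b2: "0 \<le> b2"
    and fa: "fa\<^sup>2 \<le> U * a2" and gb: "gb\<^sup>2 \<le> V * b2"
  shows "del * (Zf U V powr kap * a2 + 6 * (b2 / Zf U V powr kap)) \<le>
    2 * Phi_U U V * a2 + 2 * Phi_V U V * b2
    + 4 * (Phi_UU U V * fa\<^sup>2 + 2 * Phi_UV U V * (fa * gb) + Phi_VV U V * gb\<^sup>2)"
proof -
  define Z k W where "Z = Zf U V" and "k = Z powr kap" and "W = U powr (p - 1)"
  have Z0: "0 < Z" using Zf_pos[OF U V] by (simp add: Z_def)
  have k0: "0 < k" using Z0 by (simp add: k_def)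
  have pw: "Z powr (kap - 1) = k / Z" "Z powr (kap - 2) = k / Z\<^sup>2"
    using Z0 by (simp_all add: powr_diff k_def powr_numeral)
  have Wp: "U powr (p - 2) = W / U"
    using U by (simp add: powr_diff W_def field_simps power2_eq_square)
  define X where "X = 2 * (k + gam * W * (k / Z)) * a2 + 2 * (kap * U * (k / Z)) * b2
    + 4 * (gam * (W / U) * (p * (k / Z) + (kap - 1) * (p - 1) * W * (k / Z\<^sup>2)) * fa\<^sup>2
      + 2 * (kap * (k / Z + (kap - 1) * (p - 1) * W * (k / Z\<^sup>2))) * (fa * gb)
      + kap * (kap - 1) * U * (k / Z\<^sup>2) * gb\<^sup>2)"
  have "a2 * k - 6 * (b2 / k) \<le> X" unfolding X_def
    by (rule Psi_Hess_algebra) (use assms k0 U_Zf_le[OF U V] in \<open>auto simp: W_def Z_def k_def Zf_def\<close>)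
  from mult_left_mono[OF this, of del]
  have 1: "del * (a2 * k - 6 * (b2 / k)) \<le> del * X" using del_pos by simp
  have 2: "12 * del * (b2 / k) \<le> q * V powr (q / 2 - 1) * b2
     + 4 * (q / 2 * (q / 2 - 1) * V powr (q / 2 - 2) * gb\<^sup>2)"
  proof -
    have v: "V powr (q / 2 - 1) = V powr (q / 2 - 2) * V"
      using V powr_add[of V "q / 2 - 2" 1] by (simp add: algebra_simps)
    have "4 * (q / 2 * (1 - q / 2)) * V powr (q / 2 - 2) * gb\<^sup>2
      \<le> 4 * (q / 2 * (1 - q / 2)) * V powr (q / 2 - 2) * (V * b2)"
      using gb q_gt q_le by (intro mult_left_mono) auto
    then have "q * V powr (q / 2 - 1) * b2 + 4 * (q / 2 * (q / 2 - 1) * V powr (q / 2 - 2) * gb\<^sup>2)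
      \<ge> q * (q - 1) * V powr (q / 2 - 1) * b2"
      unfolding v by (simp add: algebra_simps)
    moreover have "q * (q - 1) * V powr (q / 2 - 1) * b2 \<ge> q * (q - 1) * (1 / k) * b2"
      using V_powr_ge[OF U V] q_gt b2 unfolding k_def Z_def by (intro mult_right_mono mult_left_mono) auto
    ultimately show ?thesis by (simp add: del_def)
  qed
  have "2 * Phi_U U V * a2 + 2 * Phi_V U V * b2
    + 4 * (Phi_UU U V * fa\<^sup>2 + 2 * Phi_UV U V * (fa * gb) + Phi_VV U V * gb\<^sup>2)
    = del * X + (q * V powr (q / 2 - 1) * b2 + 4 * (q / 2 * (q / 2 - 1) * V powr (q / 2 - 2) * gb\<^sup>2))"
    unfolding Phi_U_def Phi_V_def Phi_UU_def Phi_UV_def Phi_VV_def Z_def[symmetric] pw Wp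
      W_def[symmetric] k_def[symmetric] X_def
    by (simp add: algebra_simps)
  moreover have "del * (Zf U V powr kap * a2 + 6 * (b2 / Zf U V powr kap))
     = del * (a2 * k - 6 * (b2 / k)) + 12 * del * (b2 / k)"
    unfolding Z_def[symmetric] k_def[symmetric] by (simp add: right_diff_distrib distrib_left)
  ultimately show ?thesis
    using 1 2 by linarith
qed

text \<open>These give the zero-order term, in which \<open>Phi_U\<close> and \<open>Phi_V\<close>
  multiply the potential, the same weights k and 6 / k as the Hessian, so that the potential can be
  included in the energies.\<close>

lemma Phi_U_ge: "0 < U \<Longrightarrow> 0 < V \<Longrightarrow> del * Zf U V powr kap \<le> 2 * Phi_U U V"
  and Phi_V_ge: "0 < U \<Longrightarrow> 0 < V \<Longrightarrow> del * (6 / Zf U V powr kap) \<le> 2 * Phi_V U V"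
proof -
  assume UV: "0 < U" "0 < V"
  show "del * Zf U V powr kap \<le> 2 * Phi_U U V"
    using del_pos gam_nonneg UV by (auto simp: Phi_U_def algebra_simps intro!: add_nonneg_nonneg mult_nonneg_nonneg
      order_trans[of "Zf U V powr kap * del" "2 * (Zf U V powr kap * del)"] )
  have "q * (q - 1) * (1 / Zf U V powr kap) \<le> q * 2 * V powr (q / 2 - 1)"
    using V_powr_ge[OF UV] q_gt q_le by (intro mult_mono) auto
  then have "del * (6 / Zf U V powr kap) \<le> 2 * (q / 2 * V powr (q / 2 - 1))"
    by (simp add: del_def)
  also have "\<dots> \<le> 2 * Phi_V U V"
    using del_pos kap_bounds UV by (simp add: Phi_V_def)
  finally show "del * (6 / Zf U V powr kap) \<le> 2 * Phi_V U V" .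
qed


section \<open>Polynomial growth of \<open>Phi\<close>, of its gradient, and of the normalised
  function \<open>bel\<close>\<close>

definition "deg = nat \<lceil>p\<rceil>"

lemma Phi_U_nonneg: "0 < U \<Longrightarrow> 0 < V \<Longrightarrow> 0 \<le> Phi_U U V"
  and Phi_V_nonneg: "0 < U \<Longrightarrow> 0 < V \<Longrightarrow> 0 \<le> Phi_V U V"
  using del_pos gam_nonneg kap_bounds q_gt by (simp_all add: Phi_U_def Phi_V_def)

lemma powr_le_deg:
  assumes "0 \<le> c" "c \<le> p" "0 < U" "U \<le> S" "1 \<le> S"
  shows "U powr c \<le> S ^ deg"
proof -
  have "U powr c \<le> S powr c" using assms by (intro powr_mono2) auto
  also have "\<dots> \<le> S powr real deg"
    using assms unfolding deg_def by (intro powr_mono) linarith+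
  also have "\<dots> = S ^ deg" using assms by (simp add: powr_realpow)
  finally show ?thesis .
qed

lemma le_pow_deg: "1 \<le> S \<Longrightarrow> S \<le> S ^ deg" for S :: real
  using powr_le_deg[of 1 S S] p_ge by simp

lemma Zf_powr_le:
  assumes "0 < U" "0 < V" "1 + U + V \<le> S"
  shows "Zf U V powr kap \<le> 3 * S ^ deg"
proof -
  have "Zf U V powr kap \<le> max 1 (Zf U V)"
    using Zf_pos[OF assms(1,2)] kap_bounds
      powr_mono[of kap 1 "Zf U V"] powr_mono2[of kap "Zf U V" 1]
    by (cases "Zf U V \<le> 1") auto
  also have "\<dots> \<le> 1 + Zf U V" using Zf_pos[OF assms(1,2)] by simp
  also have "\<dots> \<le> S ^ deg + (S ^ deg + S ^ deg)"
    unfolding Zf_def using assms p_ge le_pow_deg[of S]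
    by (intro add_mono powr_le_deg) auto
  finally show ?thesis by simp
qed

text \<open>\<open>C\<close> depends on \<open>e\<close>, because V powr (q / 2 - 1) and Zf powr
  (kap - 1) may blow up at 0. That is harmless: the gradient is estimated only while the cutoffs are
  removed, with \<open>e\<close> fixed.\<close>

lemma Phi_grad_growth:
  assumes e: "0 < e"
  obtains C where "0 \<le> C" and "\<And>U V. e \<le> U \<Longrightarrow> e \<le> V \<Longrightarrow> Phi_U U V \<le> C * (1 + U + V) ^ deg"
    "\<And>U V. e \<le> U \<Longrightarrow> e \<le> V \<Longrightarrow> Phi_V U V \<le> C * (1 + U + V) ^ deg"
proof
  let ?C = "3 * del * (1 + gam) + q / 2 * e powr (q / 2 - 1) + del * kap * e powr (kap - 1)"
  show "0 \<le> ?C" using del_pos gam_nonneg q_gt kap_bounds by simp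
  fix U V assume UV: "e \<le> U" "e \<le> V"
  let ?S = "1 + U + V"
  have p0: "0 < U" "0 < V" using UV e by auto
  note Z = Zf_pos[OF p0]
  have S1: "1 \<le> ?S ^ deg" using p0 by (intro one_le_power) auto
  have SU: "U \<le> ?S ^ deg" using le_pow_deg[of ?S] p0 by linarith
  have "U powr (p - 1) * Zf U V powr (kap - 1) \<le> Zf U V * Zf U V powr (kap - 1)"
    using p0 by (intro mult_right_mono) (auto simp: Zf_def)
  also have "\<dots> = Zf U V powr kap" using Z by (simp add: powr_diff)
  finally have "gam * (U powr (p - 1) * Zf U V powr (kap - 1)) \<le> gam * Zf U V powr kap"
    using gam_nonneg by (rule mult_left_mono)
  then have "Phi_U U V \<le> del * ((1 + gam) * Zf U V powr kap)"
    unfolding Phi_U_def using del_pos by (intro mult_left_mono) (auto simp: algebra_simps)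
  also have "\<dots> \<le> del * ((1 + gam) * (3 * ?S ^ deg))"
    using del_pos gam_nonneg Zf_powr_le[OF p0] by (intro mult_left_mono) auto
  also have "\<dots> \<le> ?C * ?S ^ deg"
    using del_pos gam_nonneg q_gt kap_bounds S1 by (auto simp: algebra_simps)
  finally show "Phi_U U V \<le> ?C * ?S ^ deg" .
  have "V powr (q / 2 - 1) \<le> e powr (q / 2 - 1)"
    using e UV q_le by (intro powr_mono2') auto
  moreover have "Zf U V powr (kap - 1) \<le> e powr (kap - 1)"
    using e UV kap_bounds by (intro powr_mono2') (auto simp: Zf_def add_increasing2)
  ultimately have "Phi_V U V \<le> q / 2 * (e powr (q / 2 - 1)) + del * kap * U * e powr (kap - 1)"
    unfolding Phi_V_def using del_pos kap_bounds q_gt p0 by (intro add_mono mult_left_mono) auto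
  also have "\<dots> \<le> q / 2 * (e powr (q / 2 - 1)) * ?S ^ deg + del * kap * ?S ^ deg * e powr (kap - 1)"
    using SU del_pos kap_bounds q_gt mult_left_mono[OF S1, of "q / 2 * (e powr (q / 2 - 1))"]
    by (intro add_mono mult_right_mono mult_left_mono) auto
  also have "\<dots> \<le> ?C * ?S ^ deg"
    using del_pos gam_nonneg S1 by (simp add: algebra_simps)
  finally show "Phi_V U V \<le> ?C * ?S ^ deg" .
qed

text \<open>Vanishing at x = y = 0 is what can make the function integrable over a space of infinite
  measure.\<close>

definition "bel e x y = Phi (x + e) (y + e) - Phi e e"

lemma Zf_mono: "0 < U \<Longrightarrow> U \<le> U' \<Longrightarrow> V \<le> V' \<Longrightarrow> Zf U V \<le> Zf U' V'"
  unfolding Zf_def using p_ge by (intro add_mono powr_mono2) auto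

lemma bel_nonneg:
  assumes "0 < e" "0 \<le> x" "0 \<le> y"
  shows "0 \<le> bel e x y"
proof -
  have "e * Zf e e powr kap \<le> (x + e) * Zf (x + e) (y + e) powr kap"
    using assms kap_bounds Zf_pos[of e e] Zf_mono[of e "x + e" e "y + e"]
    by (intro mult_mono powr_mono2) auto
  moreover have "e powr (q / 2) \<le> (y + e) powr (q / 2)"
    using assms q_gt by (intro powr_mono2) auto
  ultimately show ?thesis
    using del_pos by (simp add: bel_def Phi_def add_mono)
qed

lemma powr_subadd:
  fixes a b c :: real
  assumes "0 \<le> a" "0 \<le> b" "0 \<le> c" "c \<le> 1"
  shows "(a + b) powr c \<le> a powr c + b powr c"
proof (cases "a = 0 \<or> b = 0")
  case False
  then have ab: "0 < a" "0 < b" using assms by auto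
  have *: "z / (a + b) \<le> z powr c / (a + b) powr c" if "0 < z" "z \<le> a + b" for z
  proof -
    have "(z / (a + b)) powr 1 \<le> (z / (a + b)) powr c"
      using that ab assms by (intro powr_mono') auto
    then show ?thesis using that ab by (simp add: powr_divide)
  qed
  have "1 = a / (a + b) + b / (a + b)" using ab by (simp add: add_divide_distrib[symmetric])
  also have "\<dots> \<le> a powr c / (a + b) powr c + b powr c / (a + b) powr c"
    using * ab by (intro add_mono) auto
  also have "\<dots> = (a powr c + b powr c) / (a + b) powr c"
    by (rule add_divide_distrib[symmetric])
  finally show ?thesis using ab by (simp add: field_simps)
qed (use assms in auto)

lemma powr_diff_le:
  fixes x e c :: real
  assumes "0 < e" "0 \<le> x" "0 \<le> c"
  shows "(x + e) powr (c + 1) - e powr (c + 1) \<le> (c + 1) * (x + e) powr c * x"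
proof (cases "x = 0")
  case False
  then have x: "e < x + e" using assms by auto
  have "((\<lambda>z. z powr (c + 1)) has_real_derivative (c + 1) * z powr c) (at z)" if "e \<le> z" for z
    using that assms by (auto intro!: derivative_eq_intros simp: powr_diff)
  then obtain z where z: "e < z" "z < x + e" and
    "(x + e) powr (c + 1) - e powr (c + 1) = (x + e - e) * ((c + 1) * z powr c)"
    using MVT2[OF x, of "\<lambda>z. z powr (c + 1)" "\<lambda>z. (c + 1) * z powr c"] by blast
  moreover have "(c + 1) * z powr c \<le> (c + 1) * (x + e) powr c"
    using z assms by (intro mult_left_mono powr_mono2) auto
  ultimately show ?thesis using assms by (simp add: mult.commute mult_left_mono)
qed auto

text \<open>Two features matter: the factor x + y, for integrability, and a constant that does not
  depend on \<open>e\<close>, for dominated convergence as \<open>e\<close> tends to 0.\<close>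

lemma Psi_growth:
  assumes e: "0 < e" "e \<le> 1" and x: "0 \<le> x" and y: "0 \<le> y"
  shows "(x + e) * Zf (x + e) (y + e) powr kap - e * Zf e e powr kap
    \<le> (5 + 2 * p) * (x + y) * (3 * (1 + x + y)) ^ deg"
proof -
  define Z Z0 S where "Z = Zf (x + e) (y + e)" and "Z0 = Zf e e" and "S = 3 * (1 + x + y)"
  have S: "1 + (x + e) + (y + e) \<le> S" "1 \<le> S" "x + e \<le> S" using assms by (auto simp: S_def)
  have S1: "1 \<le> S ^ deg" using S by (intro one_le_power)
  have Z0: "0 < Z0" "e \<le> Z0" "Z0 \<le> Z" "Z0 \<le> 2"
    using e x y Zf_pos[of e e] Zf_mono[of e "x + e" e "y + e"] powr_mono2[of "p - 1" e 1] p_ge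
    by (auto simp: Z_def Z0_def Zf_def)
  have 1: "x * Z powr kap \<le> x * (3 * S ^ deg)"
    unfolding Z_def using x y e S by (intro mult_left_mono Zf_powr_le) auto
  \<comment> \<open>Since kap <= 1 and Z >= Z0, the difference of the powers is at most Z0 powr kap
    * (Z - Z0) / Z0, and e / Z0 <= 1 removes the dangerous denominator uniformly in
    \<open>e\<close>.\<close>
  have "(Z / Z0) powr kap \<le> (Z / Z0) powr 1"
    using Z0 kap_bounds by (intro powr_mono) auto
  then have "Z powr kap \<le> Z0 powr kap * (Z / Z0)"
    using Z0 by (simp add: powr_divide field_simps)
  then have "e * (Z powr kap - Z0 powr kap) \<le> e * (Z0 powr kap * (Z / Z0) - Z0 powr kap)"
    using e by (intro mult_left_mono) auto
  also have "\<dots> = (e / Z0) * Z0 powr kap * (Z - Z0)"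
    using Z0 by (simp add: field_simps)
  also have "\<dots> \<le> 1 * 2 * (Z - Z0)"
  proof (intro mult_right_mono mult_mono)
    have "Z0 powr kap \<le> 2 powr kap" using Z0 kap_bounds by (intro powr_mono2) auto
    also have "\<dots> \<le> 2 powr 1" using kap_bounds by (intro powr_mono) auto
    finally show "Z0 powr kap \<le> 2" by simp
  qed (use Z0 e in auto)
  also have "Z - Z0 = y + ((x + e) powr (p - 2 + 1) - e powr (p - 2 + 1))"
    by (simp add: Z_def Z0_def Zf_def)
  also have "\<dots> \<le> y + (p - 1) * (x + e) powr (p - 2) * x"
    using powr_diff_le[of e x "p - 2"] e x p_ge by simp
  also have "\<dots> \<le> y * S ^ deg + (p - 1) * S ^ deg * x"
    using e x y p_ge S S1 by (intro add_mono mult_right_mono mult_left_mono powr_le_deg) (auto simp: mult_le_cancel_left1)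
  finally have 2: "e * (Z powr kap - Z0 powr kap) \<le> 2 * (y * S ^ deg + (p - 1) * S ^ deg * x)"
    by simp
  have "(x + e) * Z powr kap - e * Z0 powr kap = x * Z powr kap + e * (Z powr kap - Z0 powr kap)"
    by (simp add: algebra_simps)
  also have "\<dots> \<le> x * (3 * S ^ deg) + 2 * (y * S ^ deg + (p - 1) * S ^ deg * x)"
    using 1 2 by (rule add_mono)
  also have "\<dots> \<le> (5 + 2 * p) * (x + y) * S ^ deg"
    using x y p_ge S1 by (simp add: algebra_simps)
  finally show ?thesis unfolding Z_def Z0_def S_def .
qed

text \<open>The first bound is uniform in \<open>e\<close> but contains y powr (q / 2); it dominates
  in the limit e to 0. The second has a constant that depends on \<open>e\<close> but carries the
  factor x + y throughout, and so inherits the exponential decay in time.\<close>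

lemma bel_growth:
  assumes e: "0 < e" "e \<le> 1" and x: "0 \<le> x" and y: "0 \<le> y"
  shows "bel e x y \<le> y powr (q / 2) + (5 + 2 * p) * (x + y) * (3 * (1 + x + y)) ^ deg"
    and "bel e x y \<le> (e powr (q / 2 - 1) + 5 + 2 * p) * ((x + y) * (3 * (1 + x + y)) ^ deg)"
proof -
  define R where "R = (x + y) * (3 * (1 + x + y)) ^ deg"
  have R: "y \<le> R" unfolding R_def
    using mult_mono[of y "x + y" 1 "(3 * (1 + x + y)) ^ deg"] x y one_le_power[of "3 * (1 + x + y)" deg] by simp
  have b: "bel e x y = ((y + e) powr (q / 2) - e powr (q / 2))
     + del * ((x + e) * Zf (x + e) (y + e) powr kap - e * Zf e e powr kap)"
    by (simp add: bel_def Phi_def algebra_simps)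
  have "del * ((x + e) * Zf (x + e) (y + e) powr kap - e * Zf e e powr kap)
     \<le> 1 * ((5 + 2 * p) * (x + y) * (3 * (1 + x + y)) ^ deg)"
    using Psi_growth[OF assms] del_pos del_le x y p_ge
    by (intro order_trans[OF mult_left_mono[OF Psi_growth[OF assms]] mult_right_mono]) auto
  then have 1: "del * ((x + e) * Zf (x + e) (y + e) powr kap - e * Zf e e powr kap) \<le> (5 + 2 * p) * R"
    by (simp add: R_def algebra_simps)
  have "(y + e) powr (q / 2) \<le> y powr (q / 2) + e powr (q / 2)"
    using e y q_gt q_le by (intro powr_subadd) auto
  then show "bel e x y \<le> y powr (q / 2) + (5 + 2 * p) * (x + y) * (3 * (1 + x + y)) ^ deg"
    using 1 unfolding b by (simp add: R_def)
  have "((y + e) / e) powr (q / 2) \<le> ((y + e) / e) powr 1"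
    using e y q_le by (intro powr_mono) auto
  then have "(y + e) powr (q / 2) \<le> e powr (q / 2) * ((y + e) / e)"
    using e y by (simp add: powr_divide field_simps)
  then have "(y + e) powr (q / 2) - e powr (q / 2) \<le> e powr (q / 2 - 1) * y"
    using e by (simp only: powr_diff) (simp add: field_simps)
  also have "\<dots> \<le> e powr (q / 2 - 1) * R" using R by (intro mult_left_mono) auto
  finally show "bel e x y \<le> (e powr (q / 2 - 1) + 5 + 2 * p) * ((x + y) * (3 * (1 + x + y)) ^ deg)"
    using 1 unfolding b R_def[symmetric] by (simp add: algebra_simps)
qed

text \<open>The factor 7 / 6 is 1 from \<open>V powr (q / 2)\<close> plus at most 1 / 6 from del <=
  1 / 6.\<close>

lemma bel_lim:
  assumes x: "0 \<le> x" and y: "0 \<le> y"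
  obtains L where "(\<lambda>n. bel (inverse (real (Suc n))) x y) \<longlonglongrightarrow> L"
    and "L \<le> 7 / 6 * (x powr (p / 2) + y powr (q / 2))"
\<comment> \<open>For p = 2 the exponent \<open>kap\<close> is 0, where \<open>0 powr 0 = 0\<close>
  is not the limit of \<open>Zf e e powr 0 = 1\<close>; \<open>bel\<close> is then explicit.\<close>
proof (cases "p = 2")
  case True
  then have q: "q = 2" using conj by simp
  then have k0: "kap = 0" and q1: "q / 2 = 1" unfolding kap_def by simp_all
  have "bel e x y = y + del * x" if "0 < e" for e
    using that x y Zf_pos[of e e] Zf_pos[of "x + e" "y + e"]
    unfolding bel_def Phi_def k0 q1 by (simp add: algebra_simps)
  then have "(\<lambda>n. bel (inverse (real (Suc n))) x y) \<longlonglongrightarrow> y + del * x" by simp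
  moreover have "y + del * x \<le> 7 / 6 * (x powr (p / 2) + y powr (q / 2))"
    using True q x y del_le mult_right_mono[of del "1/6" x] by simp
  ultimately show ?thesis by (rule that)
next
  case False
  then have p2: "p > 2" using p_ge by simp
  then have q2: "q < 2" by (simp add: q_eq field_simps)
  have kp: "0 < kap" using q2 by (simp add: kap_def)
  let ?e = "\<lambda>n. inverse (real (Suc n))"
  have e0: "?e \<longlonglongrightarrow> 0" by (rule LIMSEQ_inverse_real_of_nat)
  let ?L = "(y + 0) powr (q / 2) + del * ((x + 0) * (y + 0 + (x + 0) powr (p - 1)) powr kap)
    - (0 powr (q / 2) + del * (0 * (0 + 0 powr (p - 1)) powr kap))"
  have "(\<lambda>n. bel (?e n) x y) \<longlonglongrightarrow> ?L"
    unfolding bel_def Phi_def Zf_def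
    by (intro tendsto_intros tendsto_powr' e0)
      (use p2 q_gt kp x y in \<open>auto intro!: always_eventually\<close>)
  moreover have "?L \<le> 7 / 6 * (x powr (p / 2) + y powr (q / 2))"
  proof -
    \<comment> \<open>With m the larger of the two powers, x <= m powr (2 / p) and y powr kap <= m
      powr (2 * kap / q); the exponents add up to 1, so x * y powr kap <= m.\<close>
    define m where "m = max (x powr (p / 2)) (y powr (q / 2))"
    have xm: "x \<le> m powr (2 / p)"
    proof -
      have "x = (x powr (p / 2)) powr (2 / p)" using x p2 by (simp add: powr_powr)
      also have "\<dots> \<le> m powr (2 / p)" using p2 by (intro powr_mono2) (auto simp: m_def)
      finally show ?thesis .
    qed
    have "y powr kap = (y powr (q / 2)) powr (2 * kap / q)" using q_gt by (simp add: powr_powr)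
    also have "\<dots> \<le> m powr (2 * kap / q)" using kp q_gt by (intro powr_mono2) (auto simp: m_def)
    finally have "x * y powr kap \<le> m powr (2 / p) * m powr (2 * kap / q)"
      using xm x by (intro mult_mono) auto
    also have "\<dots> = m powr (2 / p + 2 * kap / q)" by (simp add: powr_add)
    also have "2 / p + 2 * kap / q = 1"
      using pq p2 q_gt by (simp add: kap_def field_simps)
    also have "m powr 1 \<le> x powr (p / 2) + y powr (q / 2)" by (auto simp: m_def max_def)
    finally have 1: "x * y powr kap \<le> x powr (p / 2) + y powr (q / 2)" .
    have 2: "x * (x powr (p - 1)) powr kap = x powr (p / 2)"
    proof (cases "x = 0")
      case False
      then have "x * (x powr (p - 1)) powr kap = x powr (1 + kap * (p - 1))"
        using x by (simp add: powr_powr powr_add mult.commute)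
      also have "1 + kap * (p - 1) = p / 2" unfolding kap_gam gam_def by (simp add: field_simps)
      finally show ?thesis .
    qed (use p2 in simp)
    have "x * (y + x powr (p - 1)) powr kap \<le> x * (y powr kap + (x powr (p - 1)) powr kap)"
      using x y kap_bounds by (intro mult_left_mono powr_subadd) auto
    also have "\<dots> \<le> 2 * x powr (p / 2) + y powr (q / 2)"
      using 1 2 by (simp add: distrib_left)
    finally have "del * (x * (y + x powr (p - 1)) powr kap) \<le> 1 / 6 * (2 * x powr (p / 2) + y powr (q / 2))"
      using del_pos del_le x by (intro mult_mono) auto
    moreover have "0 \<le> x powr (p / 2)" "0 \<le> y powr (q / 2)" by simp_all
    ultimately have "y powr (q / 2) + del * (x * (y + x powr (p - 1)) powr kap)
      \<le> 7 / 6 * (x powr (p / 2) + y powr (q / 2))"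
      by argo
    then show ?thesis using q_gt by simp
  qed
  ultimately show ?thesis by (rule that)
qed

end

section \<open>Comparison of increments by derivatives, and powers of sums\<close>

lemma diff_le_of_deriv_le:
  fixes f g :: "real \<Rightarrow> real"
  assumes ab: "a \<le> b" and "\<And>y. a \<le> y \<Longrightarrow> y \<le> b \<Longrightarrow> (f has_real_derivative f' y) (at y)"
    and "\<And>y. a \<le> y \<Longrightarrow> y \<le> b \<Longrightarrow> (g has_real_derivative g' y) (at y)"
    and "\<And>y. a \<le> y \<Longrightarrow> y \<le> b \<Longrightarrow> f' y \<le> g' y"
  shows "f b - f a \<le> g b - g a"
proof -
  have "g a - f a \<le> g b - f b"
  proof (rule DERIV_nonneg_imp_nondecreasing[OF ab])
    fix y assume "a \<le> y" "y \<le> b"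
    then show "\<exists>d. ((\<lambda>y. g y - f y) has_real_derivative d) (at y) \<and> 0 \<le> d"
      using assms by (intro exI[of _ "g' y - f' y"]) (auto intro!: derivative_intros)
  qed
  then show ?thesis by simp
qed

lemma abs_diff_le_of_deriv:
  fixes f g :: "real \<Rightarrow> real"
  assumes ab: "a \<le> b" and f: "\<And>y. a \<le> y \<Longrightarrow> y \<le> b \<Longrightarrow> (f has_real_derivative f' y) (at y)"
    and g: "\<And>y. a \<le> y \<Longrightarrow> y \<le> b \<Longrightarrow> (g has_real_derivative g' y) (at y)"
    and le: "\<And>y. a \<le> y \<Longrightarrow> y \<le> b \<Longrightarrow> \<bar>f' y\<bar> \<le> c * g' y"
  shows "\<bar>f b - f a\<bar> \<le> c * (g b - g a)"
proof -
  have "f b - f a \<le> c * g b - c * g a"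
    by (rule diff_le_of_deriv_le[OF ab f DERIV_cmult[OF g]]) (use le in force)+
  moreover have "- f b - - f a \<le> c * g b - c * g a"
    by (rule diff_le_of_deriv_le[OF ab DERIV_minus[OF f] DERIV_cmult[OF g]]) (use le in force)+
  ultimately show ?thesis by (simp add: algebra_simps)
qed

text \<open>The summand \<open>0 ^ N\<close> accounts for an empty index set with N = 0, where the
  left side is 1.\<close>

lemma sum_power_le:
  fixes x :: "'a \<Rightarrow> real"
  assumes "finite I" "\<And>i. i \<in> I \<Longrightarrow> 0 \<le> x i"
  shows "(\<Sum>i\<in>I. x i) ^ N \<le> real (card I) ^ N * (\<Sum>i\<in>I. x i ^ N) + 0 ^ N"
proof (cases "I = {}")
  case False
  define m where "m = Max (x ` I)"
  have "m \<in> x ` I" using assms False by (auto simp: m_def)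
  then obtain j where j: "j \<in> I" "m = x j" by auto
  have "(\<Sum>i\<in>I. x i) \<le> real (card I) * m"
    using assms by (intro sum_bounded_above) (auto simp: m_def)
  then have "(\<Sum>i\<in>I. x i) ^ N \<le> (real (card I) * m) ^ N"
    using assms by (intro power_mono sum_nonneg) auto
  also have "\<dots> = real (card I) ^ N * x j ^ N" by (simp add: power_mult_distrib j)
  also have "\<dots> \<le> real (card I) ^ N * (\<Sum>i\<in>I. x i ^ N)"
    using assms j by (intro mult_left_mono member_le_sum) auto
  finally show ?thesis by (simp add: add_increasing2)
qed auto

section \<open>Cutoffs on an interval\<close>

text \<open>\<open>S\<close> is the natural scale: differentiation with respect to \<open>S\<close>
  is P times the ordinary derivative, so the flux P * b' is the slope of b in this scale.
  \<open>E\<close> indexes the finitely many eigenfunctions that occur in one coordinate.\<close>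

locale weighted_interval =
  fixes X :: "real set" and P S :: "real \<Rightarrow> real" and E :: "'e set" and \<eta> \<eta>' :: "'e \<Rightarrow> real \<Rightarrow> real"
  assumes X_open: "open X" and X_int: "is_interval X"
    and P_pos: "\<And>y. y \<in> X \<Longrightarrow> 0 < P y"
    and S_deriv: "\<And>y. y \<in> X \<Longrightarrow> (S has_real_derivative 1 / P y) (at y)"
    and E_fin: "finite E" and E_ne: "E \<noteq> {}"
    and \<eta>_deriv: "\<And>e y. e \<in> E \<Longrightarrow> y \<in> X \<Longrightarrow> (\<eta> e has_real_derivative \<eta>' e y) (at y)"
begin

definition "gr N y = (1 + (\<Sum>e\<in>E. (\<eta> e y)\<^sup>2)) ^ N"
definition "flux y = (\<Sum>e\<in>E. P y * \<bar>\<eta>' e y\<bar>)"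

lemma X_between: "a \<in> X \<Longrightarrow> b \<in> X \<Longrightarrow> a \<le> y \<Longrightarrow> y \<le> b \<Longrightarrow> y \<in> X"
  using X_int unfolding is_interval_1 by blast

lemma X_right:
  assumes "a \<in> X" obtains b where "b \<in> X" "a < b"
proof -
  obtain d where "0 < d" "ball a d \<subseteq> X" using X_open assms by (auto simp: open_contains_ball)
  then have "a + d / 2 \<in> X" by (auto simp: dist_real_def)
  then show ?thesis using \<open>0 < d\<close> by (intro that) auto
qed

lemma S_strict: "a \<in> X \<Longrightarrow> b \<in> X \<Longrightarrow> a < b \<Longrightarrow> S a < S b"
  by (rule DERIV_pos_imp_increasing[of a b S]) (metis S_deriv P_pos X_between zero_less_divide_1_iff)+

lemma gr_ge_1: "1 \<le> gr N y"
  unfolding gr_def by (intro one_le_power) (auto intro!: sum_nonneg)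

text \<open>
  (T2) controls the flux of each eigenfunction only against powers of that eigenfunction itself.  If the
  \<open>S\<close>-length of the interval near its end is finite, the eigenfunctions are bounded there and the
  second alternative results; otherwise their powers grow more slowly than \<open>S\<close>.
\<close>

lemma right_end:
  assumes decay: "\<And>e N \<epsilon>. e \<in> E \<Longrightarrow> 0 < \<epsilon> \<Longrightarrow>
      \<exists>c\<in>X. \<forall>y\<in>X. c \<le> y \<longrightarrow> (1 + (\<eta> e y)\<^sup>2) ^ N * (P y * \<bar>\<eta>' e y\<bar>) \<le> \<epsilon>"
    and c: "c \<in> X" and eps: "0 < \<epsilon>"
  obtains r1 r2 where "r1 \<in> X" "r2 \<in> X" "c < r1" "r1 < r2"
    "gr N r1 + gr N r2 \<le> \<epsilon> * (S r2 - S r1) \<or> (\<forall>z\<in>{r1..r2}. flux z * gr N z \<le> \<epsilon>)"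
proof -
  have decay': "\<exists>c\<in>X. \<forall>y\<in>X. c \<le> y \<longrightarrow> (\<forall>e\<in>E. (1 + (\<eta> e y)\<^sup>2) ^ N * (P y * \<bar>\<eta>' e y\<bar>) \<le> \<epsilon>)"
    if "0 < \<epsilon>" for N \<epsilon>
  proof -
    have "\<forall>e\<in>E. \<exists>c. c\<in>X \<and> (\<forall>y\<in>X. c \<le> y \<longrightarrow> (1 + (\<eta> e y)\<^sup>2) ^ N * (P y * \<bar>\<eta>' e y\<bar>) \<le> \<epsilon>)"
      using decay[OF _ that] by blast
    then obtain f where f: "\<And>e. e \<in> E \<Longrightarrow> f e \<in> X"
      "\<And>e y. e \<in> E \<Longrightarrow> y \<in> X \<Longrightarrow> f e \<le> y \<Longrightarrow> (1 + (\<eta> e y)\<^sup>2) ^ N * (P y * \<bar>\<eta>' e y\<bar>) \<le> \<epsilon>"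
      by metis
    have "Max (f ` E) \<in> f ` E" using E_fin E_ne by (intro Max_in) auto
    then have "Max (f ` E) \<in> X" using f by auto
    moreover have "f e \<le> Max (f ` E)" if "e \<in> E" for e using that E_fin by auto
    ultimately show ?thesis using f(2) by (meson order_trans)
  qed
  define m where "m = real (card E)"
  have m: "1 \<le> m" using E_fin E_ne by (simp add: m_def Suc_le_eq card_gt_0_iff)
  show ?thesis
  proof (cases "\<exists>B. \<forall>y\<in>X. c \<le> y \<longrightarrow> S y \<le> B")
    case True
    then obtain B where B: "\<And>y. y \<in> X \<Longrightarrow> c \<le> y \<Longrightarrow> S y \<le> B" by auto
    \<comment> \<open>Zeroth powers suffice here: a flux of at most 1 means that the slope of each
      eigenfunction in the scale \<open>S\<close> is at most 1, hence its oscillation is at most the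
      remaining \<open>S\<close>-length.\<close>
    obtain c1 where c1: "c1 \<in> X" "\<And>y e. y \<in> X \<Longrightarrow> c1 \<le> y \<Longrightarrow> e \<in> E \<Longrightarrow> P y * \<bar>\<eta>' e y\<bar> \<le> 1"
      using decay'[OF zero_less_one, of 0] unfolding power_0 mult_1_left by blast
    define c2 where "c2 = max c c1"
    have c2: "c2 \<in> X" "c \<le> c2" "c1 \<le> c2" using c c1 by (auto simp: c2_def max_def)
    have bd: "\<bar>\<eta> e y\<bar> \<le> \<bar>\<eta> e c2\<bar> + (B - S c2)" if "e \<in> E" "y \<in> X" "c2 \<le> y" for e y
    proof -
      have "\<bar>\<eta> e y - \<eta> e c2\<bar> \<le> 1 * (S y - S c2)"
      proof (rule abs_diff_le_of_deriv[OF that(3)])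
        fix z assume z: "c2 \<le> z" "z \<le> y"
        then have zX: "z \<in> X" using X_between c2 that by blast
        show "(\<eta> e has_real_derivative \<eta>' e z) (at z)" "(S has_real_derivative 1 / P z) (at z)"
          using \<eta>_deriv S_deriv that zX by auto
        show "\<bar>\<eta>' e z\<bar> \<le> 1 * (1 / P z)"
          using c1(2)[of z e] zX z c2 that P_pos[OF zX] by (simp add: field_simps)
      qed
      moreover have "S y \<le> B" using B that c2 by auto
      moreover have "\<bar>\<eta> e y\<bar> \<le> \<bar>\<eta> e c2\<bar> + \<bar>\<eta> e y - \<eta> e c2\<bar>" by simp
      ultimately show ?thesis by (simp add: algebra_simps)
    qed
    define R where "R = (\<Sum>e\<in>E. (\<bar>\<eta> e c2\<bar> + (B - S c2))\<^sup>2)"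
    have gr_le: "gr N y \<le> (1 + R) ^ N" if "y \<in> X" "c2 \<le> y" for y
    proof -
      have sq: "(\<eta> e y)\<^sup>2 \<le> (\<bar>\<eta> e c2\<bar> + (B - S c2))\<^sup>2" if "e \<in> E" for e
        using power_mono[OF bd[OF that \<open>y \<in> X\<close> \<open>c2 \<le> y\<close>], of 2] by simp
      show ?thesis
        unfolding gr_def R_def by (rule power_mono) (use sq in \<open>auto intro!: add_nonneg_nonneg sum_nonneg sum_mono\<close>)
    qed
    have R0: "0 \<le> R" by (simp add: R_def sum_nonneg)
    have e3: "0 < \<epsilon> / (m * (1 + R) ^ N)" using eps m R0 by simp
    obtain c3 where c3: "c3 \<in> X" "\<And>y e. y \<in> X \<Longrightarrow> c3 \<le> y \<Longrightarrow> e \<in> E \<Longrightarrow> P y * \<bar>\<eta>' e y\<bar> \<le> \<epsilon> / (m * (1 + R) ^ N)"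
      using decay'[OF e3, of 0] unfolding power_0 mult_1_left by blast
    define c4 where "c4 = max c2 c3"
    have c4: "c4 \<in> X" "c2 \<le> c4" "c3 \<le> c4" using c2 c3 by (auto simp: c4_def max_def)
    obtain r1 where r1: "r1 \<in> X" "c4 < r1" using X_right c4 by blast
    obtain r2 where r2: "r2 \<in> X" "r1 < r2" using X_right r1 by blast
    have "flux z * gr N z \<le> \<epsilon>" if z: "z \<in> {r1..r2}" for z
    proof -
      have zX: "z \<in> X" using z X_between[OF r1(1) r2(1)] by auto
      have "flux z \<le> m * (\<epsilon> / (m * (1 + R) ^ N))"
        unfolding flux_def m_def using zX z c3(2) c4 r1 by (intro sum_bounded_above) (auto simp: m_def)
      then have "flux z * gr N z \<le> (m * (\<epsilon> / (m * (1 + R) ^ N))) * (1 + R) ^ N"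
        using gr_le[OF zX] z r1 c4 gr_ge_1[of N z] eps m R0 by (intro mult_mono) auto
      also have "\<dots> = \<epsilon>" using m R0 by (simp add: field_simps)
      finally show ?thesis .
    qed
    moreover have "c < r1" using r1 c4 c2 by simp
    ultimately show ?thesis using that[OF r1(1) r2(1) _ r2(2)] by blast
  next
    case False
    \<comment> \<open>The powers of the single eigenfunctions are summed, instead of taking a power
      of the sum as in \<open>gr\<close>, because \<open>decay\<close> pairs each flux with powers
      of its own eigenfunction. The factor m ^ N compensates.\<close>
    define Bf where "Bf y = (\<Sum>e\<in>E. (1 + (\<eta> e y)\<^sup>2) ^ N)" for y
    define Bf' where "Bf' y = (\<Sum>e\<in>E. real N * (1 + (\<eta> e y)\<^sup>2) ^ (N - 1) * (2 * \<eta> e y * \<eta>' e y))" for y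
    have Bf_deriv: "(Bf has_real_derivative Bf' y) (at y)" if "y \<in> X" for y
      unfolding Bf_def Bf'_def using \<eta>_deriv that by (auto intro!: derivative_eq_intros sum.cong)
    have gr_Bf: "gr N y \<le> m ^ N * Bf y" for y
    proof (cases "N = 0")
      case False
      have "1 + (\<Sum>e\<in>E. (\<eta> e y)\<^sup>2) \<le> (\<Sum>e\<in>E. 1 + (\<eta> e y)\<^sup>2)"
        using m by (simp add: sum.distrib m_def)
      then have 1: "gr N y \<le> (\<Sum>e\<in>E. 1 + (\<eta> e y)\<^sup>2) ^ N"
        unfolding gr_def by (intro power_mono) (auto intro!: add_nonneg_nonneg sum_nonneg)
      have 2: "(\<Sum>e\<in>E. 1 + (\<eta> e y)\<^sup>2) ^ N \<le> m ^ N * Bf y + 0 ^ N"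
        unfolding m_def Bf_def by (rule sum_power_le[OF E_fin]) simp
      have "(0::real) ^ N = 0" using False by simp
      with 1 2 show ?thesis by linarith
    next
      case True
      then show ?thesis unfolding gr_def Bf_def using m by (simp flip: m_def)
    qed
    \<comment> \<open>Chosen such that m ^ N * \<epsilon>' = \<epsilon> / 2: half of the allowance
      covers the growth of \<open>Bf\<close>, the other half its value at \<open>r1\<close>.\<close>
    define \<epsilon>' where "\<epsilon>' = \<epsilon> / (2 * m ^ N)"
    have e': "0 < \<epsilon>'" using eps m unfolding \<epsilon>'_def by (intro divide_pos_pos mult_pos_pos zero_less_power) linarith+
    have e4: "0 < \<epsilon>' / (m * (1 + real N))" using e' m by (intro divide_pos_pos mult_pos_pos) linarith+
    obtain c1 where c1: "c1 \<in> X" "\<And>y e. y \<in> X \<Longrightarrow> c1 \<le> y \<Longrightarrow> e \<in> E \<Longrightarrow>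
       (1 + (\<eta> e y)\<^sup>2) ^ N * (P y * \<bar>\<eta>' e y\<bar>) \<le> \<epsilon>' / (m * (1 + real N))"
      using decay'[OF e4, of N] by blast
    define c2 where "c2 = max c c1"
    have c2: "c2 \<in> X" "c \<le> c2" "c1 \<le> c2" using c c1 by (auto simp: c2_def max_def)
    obtain r1 where r1: "r1 \<in> X" "c2 < r1" using X_right c2 by blast
    have Bf'_le: "\<bar>Bf' y\<bar> \<le> \<epsilon>' * (1 / P y)" if y: "y \<in> X" "r1 \<le> y" for y
    proof -
      have "\<bar>real N * (1 + (\<eta> e y)\<^sup>2) ^ (N - 1) * (2 * \<eta> e y * \<eta>' e y)\<bar> * P y \<le> \<epsilon>' / m" if e: "e \<in> E" for e
      proof -
        have a: "\<bar>2 * \<eta> e y\<bar> \<le> 1 + (\<eta> e y)\<^sup>2"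
          using sum_squares_ge_zero[of "\<bar>\<eta> e y\<bar> - 1" 0] by (simp add: power2_eq_square algebra_simps abs_mult)
        have "\<bar>real N * (1 + (\<eta> e y)\<^sup>2) ^ (N - 1) * (2 * \<eta> e y * \<eta>' e y)\<bar> * P y
          = real N * ((1 + (\<eta> e y)\<^sup>2) ^ (N - 1) * \<bar>2 * \<eta> e y\<bar> * (P y * \<bar>\<eta>' e y\<bar>))"
          by (simp add: abs_mult)
        also have "\<dots> \<le> real N * ((1 + (\<eta> e y)\<^sup>2) ^ (N - 1) * (1 + (\<eta> e y)\<^sup>2) * (P y * \<bar>\<eta>' e y\<bar>))"
          using a P_pos[OF y(1)] by (intro mult_left_mono mult_right_mono) auto
        also have "\<dots> = real N * ((1 + (\<eta> e y)\<^sup>2) ^ N * (P y * \<bar>\<eta>' e y\<bar>))"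
          by (cases N) (auto simp: algebra_simps)
        also have "\<dots> \<le> (1 + real N) * (\<epsilon>' / (m * (1 + real N)))"
          using c1(2)[OF y(1) _ e] y r1 c2 P_pos[OF y(1)] by (intro mult_mono) auto
        also have "\<dots> = \<epsilon>' / m" by simp
        finally show ?thesis .
      qed
      then have "(\<Sum>e\<in>E. \<bar>real N * (1 + (\<eta> e y)\<^sup>2) ^ (N - 1) * (2 * \<eta> e y * \<eta>' e y)\<bar> * P y) \<le> m * (\<epsilon>' / m)"
        unfolding m_def by (intro sum_bounded_above) (auto simp: m_def)
      then have "\<bar>Bf' y\<bar> * P y \<le> \<epsilon>'"
        unfolding Bf'_def using m P_pos[OF y(1)]
        by (simp add: sum_distrib_right[symmetric] order_trans[OF mult_right_mono[OF sum_abs]])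
      then show ?thesis using P_pos[OF y(1)] by (simp add: field_simps)
    qed
    have Bf_le: "Bf y \<le> Bf r1 + \<epsilon>' * (S y - S r1)" if y: "y \<in> X" "r1 \<le> y" for y
    proof -
      have "\<bar>Bf y - Bf r1\<bar> \<le> \<epsilon>' * (S y - S r1)"
        by (rule abs_diff_le_of_deriv[OF y(2)])
          (use Bf_deriv S_deriv Bf'_le X_between[OF r1(1) y(1)] in auto)
      then show ?thesis by linarith
    qed
    \<comment> \<open>\<epsilon> / 2 * D equals the contribution 2 * m ^ N * \<open>Bf r1\<close>;
      since \<open>S\<close> is unbounded, \<open>r2\<close> can be taken further than D from
      \<open>r1\<close> in the scale.\<close>
    define D where "D = 4 * m ^ N * Bf r1 / \<epsilon>"
    have "\<exists>y\<in>X. c \<le> y \<and> S y > max (S r1) (S r1 + D)"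
      using False by (meson not_le_imp_less)
    then obtain r2 where r2: "r2 \<in> X" "S r1 < S r2" "S r1 + D < S r2" by auto
    have "r1 < r2" using r2 S_strict[of r2 r1] r1 by (cases r1 r2 rule: linorder_cases) auto
    have "gr N r1 + gr N r2 \<le> m ^ N * (2 * Bf r1 + \<epsilon>' * (S r2 - S r1))"
      using gr_Bf[of r1] gr_Bf[of r2] mult_left_mono[OF Bf_le[of r2], of "m ^ N"] r2 \<open>r1 < r2\<close> m
      by (simp add: algebra_simps)
    also have "\<dots> = \<epsilon> / 2 * D + \<epsilon> / 2 * (S r2 - S r1)"
      using m eps by (simp add: D_def \<epsilon>'_def field_simps)
    also have "\<dots> \<le> \<epsilon> / 2 * (S r2 - S r1) + \<epsilon> / 2 * (S r2 - S r1)"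
      using r2 eps by (intro add_right_mono mult_left_mono) auto
    finally have "gr N r1 + gr N r2 \<le> \<epsilon> * (S r2 - S r1)" by simp
    moreover have "c < r1" using r1 c2 by simp
    ultimately show ?thesis using that[OF r1(1) r2(1) _ \<open>r1 < r2\<close>] by blast
  qed
qed

text \<open>The reflection y to - y turns this into \<open>right_end\<close>; the scale becomes - S
  (- y) so that it is increasing again.\<close>

lemma left_end:
  assumes decay: "\<And>e N \<epsilon>. e \<in> E \<Longrightarrow> 0 < \<epsilon> \<Longrightarrow>
      \<exists>c\<in>X. \<forall>y\<in>X. y \<le> c \<longrightarrow> (1 + (\<eta> e y)\<^sup>2) ^ N * (P y * \<bar>\<eta>' e y\<bar>) \<le> \<epsilon>"
    and c: "c \<in> X" and eps: "0 < \<epsilon>"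
  obtains l1 l2 where "l1 \<in> X" "l2 \<in> X" "l1 < l2" "l2 < c"
    "gr N l1 + gr N l2 \<le> \<epsilon> * (S l2 - S l1) \<or> (\<forall>z\<in>{l1..l2}. flux z * gr N z \<le> \<epsilon>)"
proof -
  have mirror: "uminus ` X = {y. - y \<in> X}"
    by (force simp: image_iff)
  interpret R: weighted_interval "uminus ` X" "\<lambda>y. P (- y)" "\<lambda>y. - S (- y)" E
    "\<lambda>e y. \<eta> e (- y)" "\<lambda>e y. - \<eta>' e (- y)"
  proof
    show "open (uminus ` X)" using X_open by (rule open_negations)
    show "is_interval (uminus ` X)"
      unfolding mirror is_interval_1 using X_between by (metis mem_Collect_eq neg_le_iff_le)
    show "((\<lambda>y. - S (- y)) has_real_derivative 1 / P (- y)) (at y)" if "y \<in> uminus ` X" for y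
      using DERIV_minus[OF DERIV_mirror[THEN iffD1, OF S_deriv[of "- y"]]] that by (simp add: mirror)
    show "((\<lambda>y. \<eta> e (- y)) has_real_derivative - \<eta>' e (- y)) (at y)" if "e \<in> E" "y \<in> uminus ` X" for e y
      using DERIV_mirror[THEN iffD1, OF \<eta>_deriv[of e "- y"]] that by (simp add: mirror)
  qed (use P_pos E_fin E_ne in \<open>simp_all add: mirror\<close>)
  have eq: "R.gr N (- y) = gr N y" "R.flux (- y) = flux y" for y
    by (simp_all add: R.gr_def gr_def R.flux_def flux_def)
  obtain r1 r2 where r: "r1 \<in> uminus ` X" "r2 \<in> uminus ` X" "- c < r1" "r1 < r2"
    and a: "R.gr N r1 + R.gr N r2 \<le> \<epsilon> * (- S (- r2) - - S (- r1)) \<or> (\<forall>z\<in>{r1..r2}. R.flux z * R.gr N z \<le> \<epsilon>)"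
  proof (rule R.right_end[where c = "- c" and \<epsilon> = \<epsilon> and N = N])
    fix e N and \<epsilon> :: real assume "e \<in> E" "0 < \<epsilon>"
    from decay[OF this, of N] obtain c where "c \<in> X"
      "\<And>y. y \<in> X \<Longrightarrow> y \<le> c \<Longrightarrow> (1 + (\<eta> e y)\<^sup>2) ^ N * (P y * \<bar>\<eta>' e y\<bar>) \<le> \<epsilon>" by auto
    then show "\<exists>c\<in>uminus ` X. \<forall>y\<in>uminus ` X. c \<le> y \<longrightarrow>
        (1 + (\<eta> e (- y))\<^sup>2) ^ N * (P (- y) * \<bar>- \<eta>' e (- y)\<bar>) \<le> \<epsilon>"
      by (intro bexI[of _ "- c"]) auto
  qed (use c eps in auto)
  show ?thesis
  proof (rule that[of "- r2" "- r1"])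
    show "gr N (- r2) + gr N (- r1) \<le> \<epsilon> * (S (- r1) - S (- r2)) \<or> (\<forall>z\<in>{- r2..- r1}. flux z * gr N z \<le> \<epsilon>)"
      using a
    proof
      assume *: "\<forall>z\<in>{r1..r2}. R.flux z * R.gr N z \<le> \<epsilon>"
      have "flux z * gr N z \<le> \<epsilon>" if "z \<in> {- r2..- r1}" for z
        using *[rule_format, of "- z"] that by (auto simp: eq)
      then show ?thesis by blast
    qed (use eq[of "- r1"] eq[of "- r2"] in \<open>auto simp: algebra_simps\<close>)
  qed (use r in auto)
qed

text \<open>The quotient is a mean slope in the scale \<open>S\<close>. In the first alternative the
  values at both ends are small against the length of the ramp; in the second the slope P * b' is
  small on the whole ramp.\<close>

lemma mean_slope_le:
  assumes r: "r1 \<in> X" "r2 \<in> X" "r1 < r2"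
    and alt: "gr N r1 + gr N r2 \<le> \<epsilon> * (S r2 - S r1) \<or> (\<forall>z\<in>{r1..r2}. flux z * gr N z \<le> \<epsilon>)"
    and b: "\<And>y. y \<in> X \<Longrightarrow> (b has_real_derivative b' y) (at y)"
    and D: "0 \<le> D" "\<And>y. y \<in> X \<Longrightarrow> \<bar>b y\<bar> \<le> D * gr N y"
      "\<And>y. y \<in> X \<Longrightarrow> \<bar>P y * b' y\<bar> \<le> D * (flux y * gr N y)"
  shows "\<bar>(b r2 - b r1) / (S r2 - S r1)\<bar> \<le> D * \<epsilon>"
proof -
  have dS: "0 < S r2 - S r1" using S_strict r by simp
  have "\<bar>b r2 - b r1\<bar> \<le> (D * \<epsilon>) * (S r2 - S r1)"
    using alt
  proof
    assume *: "gr N r1 + gr N r2 \<le> \<epsilon> * (S r2 - S r1)"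
    have "\<bar>b r2 - b r1\<bar> \<le> D * (gr N r1 + gr N r2)"
      using D(2)[OF r(1)] D(2)[OF r(2)] by (simp add: algebra_simps)
    also have "\<dots> \<le> D * (\<epsilon> * (S r2 - S r1))" using * D by (intro mult_left_mono) auto
    finally show ?thesis by (simp add: mult.assoc)
  next
    assume *: "\<forall>z\<in>{r1..r2}. flux z * gr N z \<le> \<epsilon>"
    show ?thesis
    proof (rule abs_diff_le_of_deriv)
      fix y assume y: "r1 \<le> y" "y \<le> r2"
      then have yX: "y \<in> X" using X_between r by blast
      show "(b has_real_derivative b' y) (at y)" "(S has_real_derivative 1 / P y) (at y)"
        using b S_deriv yX by auto
      have "\<bar>P y * b' y\<bar> \<le> D * (flux y * gr N y)" using D yX by auto
      also have "\<dots> \<le> D * \<epsilon>" using * y D by (intro mult_left_mono) auto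
      finally show "\<bar>b' y\<bar> \<le> D * \<epsilon> * (1 / P y)"
        using P_pos[OF yX] by (simp add: abs_mult field_simps)
    qed (use r in simp)
  qed
  then show ?thesis using dS by (simp add: field_simps)
qed

text \<open>On each piece the cutoff is \<alpha> + \<beta> * S, whose derivative is \<beta> / P;
  hence (\<alpha> + \<beta> * S) * P * b' - \<beta> * b is an antiderivative of the integrand. The
  fluxes at \<open>l2\<close> and \<open>r1\<close> cancel between neighbouring pieces, those at
  \<open>l1\<close> and \<open>r2\<close> are multiplied by 0, and only mean slopes remain.\<close>

lemma ramp_integral:
  assumes X: "l1 \<in> X" "r2 \<in> X" and lr: "l1 < l2" "l2 \<le> r1" "r1 < r2"
    and b: "\<And>y. y \<in> X \<Longrightarrow> (b has_real_derivative b' y) (at y)"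
    and h: "\<And>y. y \<in> X \<Longrightarrow> ((\<lambda>y. P y * b' y) has_real_derivative h y) (at y)"
  defines "\<kappa> \<equiv> \<lambda>y. if y \<le> l2 then (S y - S l1) / (S l2 - S l1) else if y \<le> r1 then 1
      else (S r2 - S y) / (S r2 - S r1)"
  shows "((\<lambda>y. \<kappa> y * h y) has_integral
    ((b r2 - b r1) / (S r2 - S r1) - (b l2 - b l1) / (S l2 - S l1))) {l1..r2}"
proof -
  have sub: "y \<in> X" if "l1 \<le> y" "y \<le> r2" for y using X_between[OF X] that by auto
  have S1: "S l2 - S l1 \<noteq> 0" "S r2 - S r1 \<noteq> 0"
    using S_strict[of l1 l2] S_strict[of r1 r2] sub lr by auto
  have aff: "((\<lambda>y. (\<alpha> + \<beta> * S y) * h y) has_integral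
      ((\<alpha> + \<beta> * S v) * (P v * b' v) - \<beta> * b v - ((\<alpha> + \<beta> * S u) * (P u * b' u) - \<beta> * b u))) {u..v}"
    if uv: "u \<le> v" "l1 \<le> u" "v \<le> r2" for \<alpha> \<beta> u v
  proof (rule fundamental_theorem_of_calculus[OF uv(1)])
    fix y assume "y \<in> {u..v}"
    then have y: "y \<in> X" using sub uv by auto
    show "((\<lambda>y. (\<alpha> + \<beta> * S y) * (P y * b' y) - \<beta> * b y) has_vector_derivative (\<alpha> + \<beta> * S y) * h y) (at y within {u..v})"
    proof -
      have "((\<lambda>y. \<alpha> + \<beta> * S y) has_real_derivative \<beta> * (1 / P y)) (at y)"
        using DERIV_add[OF DERIV_const DERIV_cmult[OF S_deriv[OF y]]] by simp
      from DERIV_diff[OF DERIV_mult'[OF this h[OF y]] DERIV_cmult[OF b[OF y], of \<beta>]]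
      have "((\<lambda>y. (\<alpha> + \<beta> * S y) * (P y * b' y) - \<beta> * b y) has_real_derivative (\<alpha> + \<beta> * S y) * h y) (at y)"
        using P_pos[OF y] by simp
      then show ?thesis
        unfolding has_real_derivative_iff_has_vector_derivative by (rule has_vector_derivative_at_within)
    qed
  qed
  let ?a = "1 / (S l2 - S l1)" and ?c = "1 / (S r2 - S r1)"
  have e: "- S l1 * ?a + ?a * S l2 = 1" "- S l1 * ?a + ?a * S l1 = 0"
    "S r2 * ?c + - ?c * S r1 = 1" "S r2 * ?c + - ?c * S r2 = 0"
    using S1 by (simp_all add: add_divide_distrib[symmetric] diff_divide_distrib[symmetric])
  have 1: "((\<lambda>y. \<kappa> y * h y) has_integral (P l2 * b' l2 - (b l2 - b l1) / (S l2 - S l1))) {l1..l2}"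
  proof (rule has_integral_eq[rotated])
    show "((\<lambda>y. (- S l1 * ?a + ?a * S y) * h y) has_integral (P l2 * b' l2 - (b l2 - b l1) / (S l2 - S l1))) {l1..l2}"
      by (rule has_integral_eq_rhs[OF aff]) (use lr in \<open>simp_all only: e\<close>, simp_all add: diff_divide_distrib)
    show "(- S l1 * ?a + ?a * S y) * h y = \<kappa> y * h y" if "y \<in> {l1..l2}" for y
      using that by (simp add: \<kappa>_def diff_divide_distrib)
  qed
  have 2: "((\<lambda>y. \<kappa> y * h y) has_integral (P r1 * b' r1 - P l2 * b' l2)) {l2..r1}"
  proof (rule has_integral_eq[rotated])
    show "((\<lambda>y. (1 + 0 * S y) * h y) has_integral (P r1 * b' r1 - P l2 * b' l2)) {l2..r1}"
      using aff[of l2 r1 1 0] lr by simp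
    show "(1 + 0 * S y) * h y = \<kappa> y * h y" if "y \<in> {l2..r1}" for y
      using that S1 by (auto simp: \<kappa>_def)
  qed
  have 3: "((\<lambda>y. \<kappa> y * h y) has_integral ((b r2 - b r1) / (S r2 - S r1) - P r1 * b' r1)) {r1..r2}"
  proof (rule has_integral_eq[rotated])
    show "((\<lambda>y. (S r2 * ?c + - ?c * S y) * h y) has_integral ((b r2 - b r1) / (S r2 - S r1) - P r1 * b' r1)) {r1..r2}"
      by (rule has_integral_eq_rhs[OF aff]) (use lr in \<open>simp_all only: e\<close>, simp_all add: diff_divide_distrib)
    show "(S r2 * ?c + - ?c * S y) * h y = \<kappa> y * h y" if "y \<in> {r1..r2}" for y
      using that S1 lr by (cases "y = r1") (auto simp: \<kappa>_def diff_divide_distrib[symmetric])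
  qed
  have "((\<lambda>y. \<kappa> y * h y) has_integral ((P l2 * b' l2 - (b l2 - b l1) / (S l2 - S l1))
      + (P r1 * b' r1 - P l2 * b' l2) + ((b r2 - b r1) / (S r2 - S r1) - P r1 * b' r1))) {l1..r2}"
    using lr by (intro has_integral_combine[OF _ _ has_integral_combine[OF _ _ 1 2] 3]) auto
  then show ?thesis by simp
qed

text \<open>The last conclusion quantifies over \<open>b\<close> after the cutoff has been fixed. A
  single cutoff in one variable must serve all times and all positions of the other coordinates at
  once.\<close>

theorem cutoff_exists:
  assumes decay_r: "\<And>e N \<epsilon>. e \<in> E \<Longrightarrow> 0 < \<epsilon> \<Longrightarrow>
      \<exists>c\<in>X. \<forall>y\<in>X. c \<le> y \<longrightarrow> (1 + (\<eta> e y)\<^sup>2) ^ N * (P y * \<bar>\<eta>' e y\<bar>) \<le> \<epsilon>"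
    and decay_l: "\<And>e N \<epsilon>. e \<in> E \<Longrightarrow> 0 < \<epsilon> \<Longrightarrow>
      \<exists>c\<in>X. \<forall>y\<in>X. y \<le> c \<longrightarrow> (1 + (\<eta> e y)\<^sup>2) ^ N * (P y * \<bar>\<eta>' e y\<bar>) \<le> \<epsilon>"
    and c: "c1 \<in> X" "c2 \<in> X" "c1 \<le> c2" and eps: "0 < \<epsilon>"
  obtains \<kappa> l r where "l \<in> X" "r \<in> X" "continuous_on {l..r} \<kappa>" "\<And>y. 0 \<le> \<kappa> y" "\<And>y. \<kappa> y \<le> 1"
    "\<And>y. y \<notin> {l..r} \<Longrightarrow> \<kappa> y = 0" "\<And>y. c1 \<le> y \<Longrightarrow> y \<le> c2 \<Longrightarrow> \<kappa> y = 1"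
    "\<And>b b' h D. (\<And>y. y \<in> X \<Longrightarrow> (b has_real_derivative b' y) (at y)) \<Longrightarrow>
      (\<And>y. y \<in> X \<Longrightarrow> ((\<lambda>y. P y * b' y) has_real_derivative h y) (at y)) \<Longrightarrow> 0 \<le> D \<Longrightarrow>
      (\<And>y. y \<in> X \<Longrightarrow> \<bar>b y\<bar> \<le> D * gr N y) \<Longrightarrow>
      (\<And>y. y \<in> X \<Longrightarrow> \<bar>P y * b' y\<bar> \<le> D * (flux y * gr N y)) \<Longrightarrow>
      \<bar>integral {l..r} (\<lambda>y. \<kappa> y * h y)\<bar> \<le> D * \<epsilon>"
proof -
  have eps2: "0 < \<epsilon> / 2" using eps by simp
  obtain r1 r2 where r: "r1 \<in> X" "r2 \<in> X" "c2 < r1" "r1 < r2"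
    and ra: "gr N r1 + gr N r2 \<le> \<epsilon> / 2 * (S r2 - S r1) \<or> (\<forall>z\<in>{r1..r2}. flux z * gr N z \<le> \<epsilon> / 2)"
    using right_end[OF decay_r c(2) eps2] by metis
  obtain l1 l2 where l: "l1 \<in> X" "l2 \<in> X" "l1 < l2" "l2 < c1"
    and la: "gr N l1 + gr N l2 \<le> \<epsilon> / 2 * (S l2 - S l1) \<or> (\<forall>z\<in>{l1..l2}. flux z * gr N z \<le> \<epsilon> / 2)"
    using left_end[OF decay_l c(1) eps2] by metis
  define \<psi> where "\<psi> y = (if y \<le> l2 then (S y - S l1) / (S l2 - S l1) else if y \<le> r1 then 1
      else (S r2 - S y) / (S r2 - S r1))" for y
  define \<kappa> where "\<kappa> y = (if y \<in> {l1..r2} then \<psi> y else 0)" for y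
  have lr: "l2 \<le> r1" using l r c by simp
  have sub: "y \<in> X" if "l1 \<le> y" "y \<le> r2" for y using X_between l r that by blast
  have mono: "S u \<le> S v" if "l1 \<le> u" "u \<le> v" "v \<le> r2" for u v
    using S_strict[of u v] sub that by (cases "u = v") auto
  have S1: "S l1 < S l2" "S r1 < S r2" using S_strict l r by auto
  have \<psi>01: "0 \<le> \<psi> y \<and> \<psi> y \<le> 1" if "y \<in> {l1..r2}" for y
    using that S1 mono[of l1 y] mono[of y l2] mono[of r1 y] mono[of y r2] lr l r
    by (auto simp: \<psi>_def divide_simps)
  have contS: "continuous_on {l1..r2} S"
    by (intro continuous_at_imp_continuous_on ballI DERIV_isCont[OF S_deriv] sub) auto
  \<comment> \<open>As a minimum of three continuous functions the ramp is visibly continuous across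
    \<open>l2\<close> and \<open>r1\<close>.\<close>
  have \<psi>_min: "\<psi> y = min ((S y - S l1) / (S l2 - S l1)) (min 1 ((S r2 - S y) / (S r2 - S r1)))" if "y \<in> {l1..r2}" for y
  proof -
    have *: "(S y - S l1) / (S l2 - S l1) \<le> 1 \<longleftrightarrow> S y \<le> S l2" "1 \<le> (S y - S l1) / (S l2 - S l1) \<longleftrightarrow> S l2 \<le> S y"
      "(S r2 - S y) / (S r2 - S r1) \<le> 1 \<longleftrightarrow> S r1 \<le> S y" "1 \<le> (S r2 - S y) / (S r2 - S r1) \<longleftrightarrow> S y \<le> S r1"
      using S1 by (auto simp: divide_simps)
    have m: "min A (min 1 C) = (if A \<le> 1 \<and> 1 \<le> C then A else if 1 \<le> A \<and> 1 \<le> C then 1 else C)"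
      if "A \<le> 1 \<and> 1 \<le> C \<or> 1 \<le> A \<and> 1 \<le> C \<or> 1 \<le> A \<and> C \<le> 1" for A C :: real
      using that by (auto simp: min_def)
    consider "y \<le> l2" | "l2 < y" "y \<le> r1" | "r1 < y" by linarith
    then show ?thesis
    proof cases
      case 1
      then have "S y \<le> S l2" "S y \<le> S r1" using mono[of y l2] mono[of y r1] that lr l r by auto
      then show ?thesis using 1 unfolding \<psi>_def by (subst m) (simp_all only: * if_True if_False simp_thms)
    next
      case 2
      have "S l2 < S y" "S y \<le> S r1" using S_strict[of l2 y] sub[of y] 2 mono[of y r1] that lr l r by auto
      then have "S l2 \<le> S y" "\<not> S y \<le> S l2" "S y \<le> S r1" "\<not> y \<le> l2" using 2 by auto
      then show ?thesis using 2 unfolding \<psi>_def by (subst m) (simp_all only: * if_True if_False simp_thms)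
    next
      case 3
      have "S l2 < S y" "S r1 < S y" using S_strict[of l2 y] S_strict[of r1 y] sub[of y] 3 that lr l r by auto
      then have "S l2 \<le> S y" "\<not> S y \<le> S l2" "\<not> S y \<le> S r1" "S r1 \<le> S y" "\<not> y \<le> l2" "\<not> y \<le> r1"
        using 3 lr by auto
      then show ?thesis unfolding \<psi>_def by (subst m) (simp_all only: * if_True if_False simp_thms)
    qed
  qed
  have "continuous_on {l1..r2} (\<lambda>y. min ((S y - S l1) / (S l2 - S l1)) (min 1 ((S r2 - S y) / (S r2 - S r1))))"
    using S1 by (intro continuous_intros contS) auto
  then have "continuous_on {l1..r2} \<kappa>"
    by (rule continuous_on_eq) (auto simp: \<kappa>_def \<psi>_min)
  moreover have "\<bar>integral {l1..r2} (\<lambda>y. \<kappa> y * h y)\<bar> \<le> D * \<epsilon>"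
    if b: "\<And>y. y \<in> X \<Longrightarrow> (b has_real_derivative b' y) (at y)"
      and h: "\<And>y. y \<in> X \<Longrightarrow> ((\<lambda>y. P y * b' y) has_real_derivative h y) (at y)"
      and D: "0 \<le> D" "\<And>y. y \<in> X \<Longrightarrow> \<bar>b y\<bar> \<le> D * gr N y"
        "\<And>y. y \<in> X \<Longrightarrow> \<bar>P y * b' y\<bar> \<le> D * (flux y * gr N y)" for b b' h D
  proof -
    have "integral {l1..r2} (\<lambda>y. \<kappa> y * h y) = integral {l1..r2} (\<lambda>y. \<psi> y * h y)"
      by (rule integral_cong) (simp add: \<kappa>_def)
    also have "\<dots> = (b r2 - b r1) / (S r2 - S r1) - (b l2 - b l1) / (S l2 - S l1)"
      unfolding \<psi>_def using l r lr b h by (intro integral_unique ramp_integral) auto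
    also have "\<bar>\<dots>\<bar> \<le> D * (\<epsilon> / 2) + D * (\<epsilon> / 2)"
      using mean_slope_le[OF r(1,2,4) ra b D] mean_slope_le[OF l(1,2,3) la b D] by linarith
    finally show ?thesis by simp
  qed
  moreover have "0 \<le> \<kappa> y" "\<kappa> y \<le> 1" for y using \<psi>01[of y] by (auto simp: \<kappa>_def)
  moreover have "\<kappa> y = 1" if "c1 \<le> y" "y \<le> c2" for y
  proof -
    have "y \<in> {l1..r2}" "\<not> y \<le> l2" "y \<le> r1" using that l r by auto
    then show ?thesis unfolding \<kappa>_def \<psi>_def by (simp only: if_True if_False)
  qed
  moreover have "\<kappa> y = 0" if "y \<notin> {l1..r2}" for y using that unfolding \<kappa>_def by (simp only: if_False)
  ultimately show ?thesis using that[of l1 r2 \<kappa>] l(1) r(2) by blast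
qed

end

section \<open>Weighted measures\<close>

lemma space_weighted_measure [simp]: "space (weighted_measure s t w) = einterval s t"
  by (simp add: weighted_measure_def space_restrict_space)

lemma sets_weighted_measure [simp, measurable_cong]:
  "sets (weighted_measure s t w) = sets (restrict_space borel (einterval s t))"
  by (simp add: weighted_measure_def sets_restrict_space)

lemma space_product_measure: "space (product_measure s t w) = {x. \<forall>i. x i \<in> einterval (s i) (t i)}"
  by (auto simp: product_measure_def space_PiM)

lemma borel_measurable_weighted_measure:
  "continuous_on (einterval s t) f \<Longrightarrow> f \<in> borel_measurable (weighted_measure s t w)"
  for f :: "real \<Rightarrow> 'b::topological_space"
  using borel_measurable_continuous_on_restrict by (subst measurable_cong_sets[OF sets_weighted_measure refl])

lemma borel_measurable_component_product_measure:
  assumes "continuous_on (einterval (s i) (t i)) f"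
  shows "(\<lambda>x. f (x i)) \<in> borel_measurable (product_measure s t w)"
proof -
  have "(\<lambda>x. x i) \<in> measurable (product_measure s t w) (weighted_measure (s i) (t i) (w i))"
    unfolding product_measure_def by (rule measurable_component_singleton) simp
  from measurable_compose[OF this borel_measurable_weighted_measure[OF assms]] show ?thesis .
qed

locale weight =
  fixes s t :: ereal and w :: "real \<Rightarrow> real"
  assumes w_cont: "continuous_on (einterval s t) w"
    and w_pos: "\<And>y. y \<in> einterval s t \<Longrightarrow> 0 < w y"
begin

lemma w_meas [measurable]: "w \<in> borel_measurable (restrict_space lborel (einterval s t))"
  using borel_measurable_continuous_on_restrict[OF w_cont]
  by (subst measurable_cong_sets[OF sets_restrict_space_cong refl]) auto

lemma sigma_finite: "sigma_finite_measure (weighted_measure s t w)"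
proof -
  have "sigma_finite_measure (restrict_space lborel (einterval s t))"
    by (intro sigma_finite_measure_restrict_space sigma_finite_lborel) auto
  then show ?thesis
    unfolding weighted_measure_def by (subst sigma_finite_measure.sigma_finite_iff_density_finite) auto
qed

lemma integral_eq:
  assumes f: "f \<in> borel_measurable (weighted_measure s t w)"
  shows "(\<integral>y. f y \<partial>weighted_measure s t w) = (\<integral>y. indicator (einterval s t) y * (w y * f y) \<partial>lborel)"
proof -
  have [measurable]: "f \<in> borel_measurable (restrict_space lborel (einterval s t))"
    using f by (simp add: weighted_measure_def)
  have "(\<integral>y. f y \<partial>weighted_measure s t w) = (\<integral>y. w y *\<^sub>R f y \<partial>restrict_space lborel (einterval s t))"
    unfolding weighted_measure_def using w_pos
    by (intro integral_density) (auto simp: AE_restrict_space_iff less_imp_le)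
  also have "\<dots> = (\<integral>y. indicator (einterval s t) y *\<^sub>R (w y *\<^sub>R f y) \<partial>lborel)"
    by (rule integral_restrict_space) auto
  finally show ?thesis by simp
qed

text \<open>Only the open interval has to lie in the domain, and the two end points are a null set.
  This covers the tent weight on (0, 2 T), where the gauge integral is over the closed
  interval.\<close>

lemma integral_compact_support:
  assumes f: "f \<in> borel_measurable (weighted_measure s t w)"
    and sub: "{l<..<r} \<subseteq> einterval s t"
    and null: "\<And>y. y \<in> einterval s t \<Longrightarrow> y \<notin> {l..r} \<Longrightarrow> f y = 0"
    and g: "continuous_on {l..r} g" "\<And>y. y \<in> einterval s t \<Longrightarrow> y \<in> {l..r} \<Longrightarrow> g y = w y * f y"
  shows "(\<integral>y. f y \<partial>weighted_measure s t w) = integral {l..r} g"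
proof -
  have m1: "(\<lambda>y. indicator (einterval s t) y * (w y * f y)) \<in> borel_measurable lborel"
  proof -
    have "(\<lambda>y. w y * f y) \<in> borel_measurable (restrict_space lborel (einterval s t))"
      using f by (auto simp: weighted_measure_def)
    then show ?thesis
      by (subst (asm) borel_measurable_restrict_space_iff) (auto simp: mult.commute)
  qed
  have m2: "(\<lambda>y. indicator {l..r} y *\<^sub>R g y) \<in> borel_measurable lborel"
    using borel_measurable_continuous_on_indicator[OF _ g(1)] by (simp add: mult.commute)
  have ae: "AE y in lborel. y \<notin> {l, r}"
    by (rule AE_not_in) (simp add: finite_imp_null_set_lborel)
  have "(\<integral>y. f y \<partial>weighted_measure s t w) = (\<integral>y. indicator (einterval s t) y * (w y * f y) \<partial>lborel)"
    by (rule integral_eq[OF f])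
  also have "\<dots> = (\<integral>y. indicator {l..r} y *\<^sub>R g y \<partial>lborel)"
  proof (rule integral_cong_AE)
    show "AE y in lborel. indicator (einterval s t) y * (w y * f y) = indicator {l..r} y *\<^sub>R g y"
      using ae
    proof eventually_elim
      case (elim y)
      then have "y \<in> einterval s t" if "y \<in> {l..r}"
        using that sub by (intro subsetD[OF sub]) (auto simp: less_le)
      then show ?case
        using sub null[of y] g(2)[of y] by (cases "y \<in> {l..r}"; cases "y \<in> einterval s t") auto
    qed
  qed (rule m1, rule m2)
  also have "\<dots> = integral {l..r} g"
    using set_borel_integral_eq_integral(2)[OF borel_integrable_atLeastAtMost'[OF g(1)]]
    by (simp add: set_lebesgue_integral_def)
  finally show ?thesis .
qed

lemma emeasure_Icc_finite:
  assumes "\<And>y. y \<in> einterval s t \<Longrightarrow> y \<in> {l..r} \<Longrightarrow> w y \<le> B"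
  shows "emeasure (weighted_measure s t w) ({l..r} \<inter> einterval s t) < \<infinity>"
proof -
  let ?X = "einterval s t"
  have A: "{l..r} \<inter> ?X \<in> sets (restrict_space lborel ?X)"
    by (auto simp: sets_restrict_space)
  have "emeasure (weighted_measure s t w) ({l..r} \<inter> ?X) =
    (\<integral>\<^sup>+y. ennreal (w y) * indicator ({l..r} \<inter> ?X) y \<partial>restrict_space lborel ?X)"
    unfolding weighted_measure_def using A by (intro emeasure_density) auto
  also have "\<dots> \<le> (\<integral>\<^sup>+y. ennreal B * indicator ({l..r} \<inter> ?X) y \<partial>restrict_space lborel ?X)"
    by (intro nn_integral_mono) (auto simp: indicator_def intro!: ennreal_leI assms)
  also have "\<dots> = ennreal B * emeasure (restrict_space lborel ?X) ({l..r} \<inter> ?X)"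
    using A by (rule nn_integral_cmult_indicator)
  also have "\<dots> \<le> ennreal B * emeasure lborel {l..r}"
    by (intro mult_left_mono) (auto simp: emeasure_restrict_space intro!: emeasure_mono)
  also have "\<dots> < \<infinity>" by (simp add: ennreal_mult_less_top emeasure_lborel_Icc_eq)
  finally show ?thesis .
qed

end

section \<open>Second time derivatives tested against a compactly supported weight\<close>

definition tent :: "real \<Rightarrow> real \<Rightarrow> real" where
  "tent T t = min t (2 * T - t)"

text \<open>The tent vanishes at both ends and the two contributions \<open>T * f' T\<close> cancel,
  so no first derivative survives. As T grows this becomes the identity that the integral of t * f''
  is f 0 for decaying f.\<close>

lemma tent_integral:
  assumes T: "0 < T"
    and f: "\<And>t. (f has_real_derivative f' t) (at t)" "\<And>t. (f' has_real_derivative f'' t) (at t)"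
  shows "((\<lambda>t. tent T t * f'' t) has_integral (f 0 - 2 * f T + f (2 * T))) {0..2 * T}"
proof -
  have aff: "((\<lambda>t. (\<alpha> + \<beta> * t) * f'' t) has_integral
      ((\<alpha> + \<beta> * v) * f' v - \<beta> * f v - ((\<alpha> + \<beta> * u) * f' u - \<beta> * f u))) {u..v}"
    if "u \<le> v" for \<alpha> \<beta> u v
  proof (rule fundamental_theorem_of_calculus[OF that])
    fix y
    have "((\<lambda>t. (\<alpha> + \<beta> * t) * f' t - \<beta> * f t) has_real_derivative (\<alpha> + \<beta> * y) * f'' y) (at y)"
      by (auto intro!: derivative_eq_intros f)
    then show "((\<lambda>t. (\<alpha> + \<beta> * t) * f' t - \<beta> * f t) has_vector_derivative (\<alpha> + \<beta> * y) * f'' y) (at y within {u..v})"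
      unfolding has_real_derivative_iff_has_vector_derivative by (rule has_vector_derivative_at_within)
  qed
  have 1: "((\<lambda>t. tent T t * f'' t) has_integral (T * f' T - f T + f 0)) {0..T}"
  proof (rule has_integral_eq[rotated])
    show "((\<lambda>t. (0 + 1 * t) * f'' t) has_integral (T * f' T - f T + f 0)) {0..T}"
      by (rule has_integral_eq_rhs[OF aff]) (use T in auto)
  qed (auto simp: tent_def min_def)
  have 2: "((\<lambda>t. tent T t * f'' t) has_integral (- (T * f' T) - f T + f (2 * T))) {T..2 * T}"
  proof (rule has_integral_eq[rotated])
    show "((\<lambda>t. (2 * T + - 1 * t) * f'' t) has_integral (- (T * f' T) - f T + f (2 * T))) {T..2 * T}"
      by (rule has_integral_eq_rhs[OF aff]) (use T in auto)
  qed (auto simp: tent_def min_def)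
  show ?thesis
    by (rule has_integral_eq_rhs[OF has_integral_combine[OF _ _ 1 2]]) (use T in auto)
qed

lemma tent_exp_integral:
  assumes "0 < T" "0 < \<theta>"
  shows "integral {0..2 * T} (\<lambda>t. tent T t * exp (- \<theta> * t)) = (1 - exp (- \<theta> * T))\<^sup>2 / \<theta>\<^sup>2"
proof -
  have "((\<lambda>t. tent T t * exp (- \<theta> * t)) has_integral
     (exp (- \<theta> * 0) / \<theta>\<^sup>2 - 2 * (exp (- \<theta> * T) / \<theta>\<^sup>2) + exp (- \<theta> * (2 * T)) / \<theta>\<^sup>2)) {0..2 * T}"
    by (rule tent_integral[where f' = "\<lambda>t. - exp (- \<theta> * t) / \<theta>"])
      (use assms in \<open>auto intro!: derivative_eq_intros simp: power2_eq_square\<close>)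
  moreover have "exp (- \<theta> * (2 * T)) = (exp (- \<theta> * T))\<^sup>2"
    by (simp add: power2_eq_square exp_add[symmetric])
  ultimately show ?thesis
    by (subst integral_unique) (auto simp: power2_eq_square add_divide_distrib diff_divide_distrib algebra_simps)
qed

lemma weight_tent: "0 < T \<Longrightarrow> weight 0 (ereal (2 * T)) (tent T)"
  by standard (auto simp: tent_def[abs_def] einterval_def zero_ereal_def intro!: continuous_intros)

section \<open>Chain rule for \<open>Phi\<close> composed with squared lengths\<close>

context bellman begin

definition "PhiW L l U V = (if l \<in> L then Phi_U U V else Phi_V U V)"

text \<open>The second derivative of z to Phi (e + |z_L|^2) (e + |z_-L|^2) at z in direction a, when
  U and V are these two arguments; the terms with a second derivative of z are kept apart.\<close>

definition "Hess L U V z a = 2 * Phi_U U V * (\<Sum>l\<in>L. (a l)\<^sup>2) + 2 * Phi_V U V * (\<Sum>l\<in>-L. (a l)\<^sup>2)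
  + 4 * (Phi_UU U V * (\<Sum>l\<in>L. z l * a l)\<^sup>2
    + 2 * Phi_UV U V * ((\<Sum>l\<in>L. z l * a l) * (\<Sum>l\<in>-L. z l * a l))
    + Phi_VV U V * (\<Sum>l\<in>-L. z l * a l)\<^sup>2)"

definition sq :: "real \<Rightarrow> 'l set \<Rightarrow> ('l \<Rightarrow> real) \<Rightarrow> real" where "sq e L z = e + (\<Sum>l\<in>L. (z l)\<^sup>2)"

lemma sq_pos: "0 < e \<Longrightarrow> 0 < sq e L z"
  unfolding sq_def by (intro add_pos_nonneg sum_nonneg) auto

lemma sq_ge: "e \<le> sq e L z"
  unfolding sq_def by (simp add: sum_nonneg)

text \<open>Cauchy-Schwarz on each of the two blocks supplies the hypotheses of
  \<open>Phi_Hess_ge\<close>.\<close>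

lemma Hess_ge:
  fixes L :: "'l::finite set"
  assumes e: "0 < e"
  shows "del * (Zf (sq e L z) (sq e (-L) z) powr kap * (\<Sum>l\<in>L. (a l)\<^sup>2)
      + 6 * ((\<Sum>l\<in>-L. (a l)\<^sup>2) / Zf (sq e L z) (sq e (-L) z) powr kap))
    \<le> Hess L (sq e L z) (sq e (-L) z) z a"
  unfolding Hess_def
proof (rule Phi_Hess_ge)
  have *: "(\<Sum>l\<in>B. z l * a l)\<^sup>2 \<le> sq e B z * (\<Sum>l\<in>B. (a l)\<^sup>2)" for B :: "'l set"
  proof -
    have "(\<Sum>l\<in>B. z l * a l)\<^sup>2 \<le> (\<Sum>l\<in>B. (z l)\<^sup>2) * (\<Sum>l\<in>B. (a l)\<^sup>2)"
      by (rule Cauchy_Schwarz_ineq_sum)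
    also have "\<dots> \<le> sq e B z * (\<Sum>l\<in>B. (a l)\<^sup>2)"
      using e by (intro mult_right_mono sum_nonneg) (auto simp: sq_def)
    finally show ?thesis .
  qed
  show "(\<Sum>l\<in>L. z l * a l)\<^sup>2 \<le> sq e L z * (\<Sum>l\<in>L. (a l)\<^sup>2)"
    "(\<Sum>l\<in>-L. z l * a l)\<^sup>2 \<le> sq e (-L) z * (\<Sum>l\<in>-L. (a l)\<^sup>2)" by (rule *)+
qed (auto intro: sq_pos[OF e] sum_nonneg)

lemma sum_split: "(\<Sum>l\<in>UNIV. f l) = (\<Sum>l\<in>L. f l) + (\<Sum>l\<in>-L. f l)" for f :: "'l::finite \<Rightarrow> real"
  by (metis Compl_eq_Diff_UNIV finite sum.subset_diff[of L UNIV f] subset_UNIV add.commute)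

lemma DERIV_sq:
  fixes z :: "'l::finite \<Rightarrow> real \<Rightarrow> real"
  assumes "\<And>l. (z l has_real_derivative z' l y) (at y)"
  shows "((\<lambda>y. sq e L (\<lambda>l. z l y)) has_real_derivative 2 * (\<Sum>l\<in>L. z l y * z' l y)) (at y)"
  unfolding sq_def by (auto intro!: derivative_eq_intros assms simp: sum_distrib_left mult_ac)

lemma DERIV_Phi_sq:
  fixes z :: "'l::finite \<Rightarrow> real \<Rightarrow> real"
  assumes e: "0 < e" and z: "\<And>l. (z l has_real_derivative z' l y) (at y)"
  shows "((\<lambda>y. Phi (sq e L (\<lambda>l. z l y)) (sq e (-L) (\<lambda>l. z l y))) has_real_derivative
    (\<Sum>l\<in>UNIV. 2 * PhiW L l (sq e L (\<lambda>l. z l y)) (sq e (-L) (\<lambda>l. z l y)) * z l y * z' l y)) (at y)"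
  by (rule DERIV_cong[OF DERIV_Phi[OF DERIV_sq[of z z', OF z] DERIV_sq[of z z', OF z] sq_pos[OF e] sq_pos[OF e]]])
    (simp add: sum_split[of _ L] PhiW_def sum_distrib_left sum_distrib_right mult_ac)

text \<open>With \<open>\<pi> = \<omega> = 1\<close> this is also used for second derivatives in time.\<close>

lemma DERIV_flux_Phi_sq:
  fixes z :: "'l::finite \<Rightarrow> real \<Rightarrow> real" and L :: "'l set" and e :: real
  assumes e: "0 < e" and z: "\<And>l. (z l has_real_derivative z' l y) (at y)"
    and zz: "\<And>l. ((\<lambda>y. \<pi> y * z' l y) has_real_derivative \<omega> * g l) (at y)"
  defines "U \<equiv> \<lambda>y. sq e L (\<lambda>l. z l y)" and "V \<equiv> \<lambda>y. sq e (-L) (\<lambda>l. z l y)"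
  shows "((\<lambda>y. \<pi> y * (\<Sum>l\<in>UNIV. 2 * PhiW L l (U y) (V y) * z l y * z' l y)) has_real_derivative
    (\<pi> y * Hess L (U y) (V y) (\<lambda>l. z l y) (\<lambda>l. z' l y)
      + \<omega> * (\<Sum>l\<in>UNIV. 2 * PhiW L l (U y) (V y) * z l y * g l))) (at y)"
proof -
  have U: "(U has_real_derivative 2 * (\<Sum>l\<in>L. z l y * z' l y)) (at y)"
    and V: "(V has_real_derivative 2 * (\<Sum>l\<in>-L. z l y * z' l y)) (at y)"
    unfolding U_def V_def by (rule DERIV_sq z)+
  have UV: "0 < U y" "0 < V y" by (simp_all add: U_def V_def sq_pos[OF e])
  have S: "((\<lambda>y. \<Sum>l\<in>B. z l y * (\<pi> y * z' l y)) has_real_derivative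
      \<pi> y * (\<Sum>l\<in>B. (z' l y)\<^sup>2) + \<omega> * (\<Sum>l\<in>B. z l y * g l)) (at y)" for B
    by (rule DERIV_cong[OF DERIV_sum[OF DERIV_mult'[OF z zz]]])
      (simp add: sum.distrib sum_distrib_left power2_eq_square mult_ac add.commute)
  have "((\<lambda>y. 2 * (Phi_U (U y) (V y) * (\<Sum>l\<in>L. z l y * (\<pi> y * z' l y))
      + Phi_V (U y) (V y) * (\<Sum>l\<in>-L. z l y * (\<pi> y * z' l y)))) has_real_derivative
    (\<pi> y * Hess L (U y) (V y) (\<lambda>l. z l y) (\<lambda>l. z' l y)
      + \<omega> * (\<Sum>l\<in>UNIV. 2 * PhiW L l (U y) (V y) * z l y * g l))) (at y)"
  proof (rule DERIV_cong[OF DERIV_cmult[OF DERIV_add[OF DERIV_mult'[OF DERIV_Phi_U[OF U V UV] S] DERIV_mult'[OF DERIV_Phi_V[OF U V UV] S]]]])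
    have pull: "(\<Sum>l\<in>B. z l y * (\<pi> y * z' l y)) = \<pi> y * (\<Sum>l\<in>B. z l y * z' l y)" for B
      by (simp add: sum_distrib_left mult_ac)
    have W: "(\<Sum>l\<in>UNIV. 2 * PhiW L l (U y) (V y) * z l y * g l)
      = 2 * Phi_U (U y) (V y) * (\<Sum>l\<in>L. z l y * g l) + 2 * Phi_V (U y) (V y) * (\<Sum>l\<in>-L. z l y * g l)"
      by (simp add: sum_split[of _ L] PhiW_def sum_distrib_left mult_ac)
    show "2 * (Phi_U (U y) (V y) * (\<pi> y * (\<Sum>l\<in>L. (z' l y)\<^sup>2) + \<omega> * (\<Sum>l\<in>L. z l y * g l)) +
         (Phi_UU (U y) (V y) * (2 * (\<Sum>l\<in>L. z l y * z' l y)) + Phi_UV (U y) (V y) * (2 * (\<Sum>l\<in>-L. z l y * z' l y))) *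
         (\<Sum>l\<in>L. z l y * (\<pi> y * z' l y)) +
         (Phi_V (U y) (V y) * (\<pi> y * (\<Sum>l\<in>-L. (z' l y)\<^sup>2) + \<omega> * (\<Sum>l\<in>-L. z l y * g l)) +
          (Phi_UV (U y) (V y) * (2 * (\<Sum>l\<in>L. z l y * z' l y)) + Phi_VV (U y) (V y) * (2 * (\<Sum>l\<in>-L. z l y * z' l y))) *
          (\<Sum>l\<in>-L. z l y * (\<pi> y * z' l y)))) =
      \<pi> y * Hess L (U y) (V y) (\<lambda>l. z l y) (\<lambda>l. z' l y) +
      \<omega> * (\<Sum>l\<in>UNIV. 2 * PhiW L l (U y) (V y) * z l y * g l)"
      unfolding W pull Hess_def by (simp add: algebra_simps power2_eq_square)
  qed
  moreover have "(\<lambda>y. \<pi> y * (\<Sum>l\<in>UNIV. 2 * PhiW L l (U y) (V y) * z l y * z' l y)) =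
     (\<lambda>y. 2 * (Phi_U (U y) (V y) * (\<Sum>l\<in>L. z l y * (\<pi> y * z' l y))
      + Phi_V (U y) (V y) * (\<Sum>l\<in>-L. z l y * (\<pi> y * z' l y))))"
    by (simp add: fun_eq_iff sum_split[of _ L] PhiW_def sum_distrib_left mult_ac distrib_left)
  ultimately show ?thesis by simp
qed

end

lemma prod_remove_UNIV: "(\<Prod>i\<in>UNIV. f i) = f j * (\<Prod>i\<in>-{j}. f i)" for f :: "'d::finite \<Rightarrow> 'a::comm_monoid_mult"
  by (metis Compl_eq_Diff_UNIV UNIV_I finite prod.remove)

text \<open>The best constant is 2 * sqrt 6 = 4.898...; 24 / 5 is a rational value just below it,
  and 6 / 25 = 6 - (12 / 5)^2 is the remainder.\<close>

lemma sqrt6_bound: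
  fixes a b k :: real
  assumes "0 < k" "0 \<le> a" "0 \<le> b"
  shows "24 / 5 * (sqrt a * sqrt b) \<le> k * a + 6 * (b / k)"
proof -
  have "24 / 5 * (x * y) \<le> k * x\<^sup>2 + 6 * (y\<^sup>2 / k)" for x y
  proof -
    have "0 \<le> (k * x - 12 / 5 * y)\<^sup>2 + 6 / 25 * y\<^sup>2" by simp
    also have "\<dots> = k * (k * x\<^sup>2 + 6 * (y\<^sup>2 / k) - 24 / 5 * (x * y))"
      using assms by (simp add: power2_eq_square field_simps)
    finally show ?thesis using assms by (simp add: zero_le_mult_iff)
  qed
  from this[of "sqrt a" "sqrt b"] show ?thesis using assms by simp
qed

text \<open>A non-integrable \<open>f\<close> has integral 0 by convention, so the bound covers
  iterated integrals whose inner parts have not been examined.\<close>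

lemma abs_integral_le:
  fixes f g :: "'a \<Rightarrow> real"
  assumes "integrable M g" "\<And>x. x \<in> space M \<Longrightarrow> \<bar>f x\<bar> \<le> g x"
  shows "\<bar>\<integral>x. f x \<partial>M\<bar> \<le> (\<integral>x. g x \<partial>M)"
proof (cases "integrable M f")
  case True
  then show ?thesis
    by (intro order_trans[OF integral_abs_bound integral_mono]) (use assms in auto)
next
  case False
  have "0 \<le> (\<integral>x. g x \<partial>M)" using assms(2) by (intro integral_nonneg_AE AE_I2) force
  then show ?thesis using False by (simp add: not_integrable_integral_eq)
qed

section \<open>Bellman function along a Poisson extension\<close>

text \<open>
  The components \<open>\<eta> l j m\<close> solve \<open>(P \<eta>')' = w (\<rho> - ev) \<eta>\<close> in coordinate \<open>j\<close>; in the application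
  \<open>l\<close> is \<open>None\<close> for \<open>F\<close> and \<open>Some i\<close> for \<open>G\<^sub>i\<close>.  The set \<open>L\<close> selects the components that enter
  \<open>Phi\<close> through its first argument, the one carrying the exponent \<open>p \<ge> 2\<close>.
\<close>

locale sl_system = bellman p q for p q :: real +
  fixes \<sigma> \<tau> :: "'d::finite \<Rightarrow> ereal" and w P :: "'d \<Rightarrow> real \<Rightarrow> real"
    and \<eta> \<eta>' :: "'l::finite \<Rightarrow> 'd \<Rightarrow> nat \<Rightarrow> real \<Rightarrow> real" and \<rho> :: "'l \<Rightarrow> 'd \<Rightarrow> real \<Rightarrow> real"
    and ev :: "'d \<Rightarrow> nat \<Rightarrow> real" and A :: "('d \<Rightarrow> nat) set" and N :: nat
    and c :: "'l \<Rightarrow> ('d \<Rightarrow> nat) \<Rightarrow> real" and s :: "('d \<Rightarrow> nat) \<Rightarrow> real"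
    and L :: "'l set" and R :: "('d \<Rightarrow> real) \<Rightarrow> real"
  assumes interval: "\<And>j. \<sigma> j < \<tau> j"
    and w_cont: "\<And>j. continuous_on (einterval (\<sigma> j) (\<tau> j)) (w j)"
    and w_pos: "\<And>j y. y \<in> einterval (\<sigma> j) (\<tau> j) \<Longrightarrow> 0 < w j y"
    and P_cont: "\<And>j. continuous_on (einterval (\<sigma> j) (\<tau> j)) (P j)"
    and P_pos: "\<And>j y. y \<in> einterval (\<sigma> j) (\<tau> j) \<Longrightarrow> 0 < P j y"
    and \<rho>_cont: "\<And>l j. continuous_on (einterval (\<sigma> j) (\<tau> j)) (\<rho> l j)"
    and \<eta>_deriv: "\<And>l j m y. y \<in> einterval (\<sigma> j) (\<tau> j) \<Longrightarrow>
      (\<eta> l j m has_real_derivative \<eta>' l j m y) (at y)"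
    and flux_deriv: "\<And>l j m y. y \<in> einterval (\<sigma> j) (\<tau> j) \<Longrightarrow>
      ((\<lambda>y. P j y * \<eta>' l j m y) has_real_derivative w j y * ((\<rho> l j y - ev j m) * \<eta> l j m y)) (at y)"
    and decay_r: "\<And>l j m n \<epsilon>. 0 < \<epsilon> \<Longrightarrow> \<exists>a\<in>einterval (\<sigma> j) (\<tau> j). \<forall>y\<in>einterval (\<sigma> j) (\<tau> j). a \<le> y \<longrightarrow>
      (1 + (\<eta> l j m y)\<^sup>2) ^ n * (P j y * \<bar>\<eta>' l j m y\<bar>) \<le> \<epsilon>"
    and decay_l: "\<And>l j m n \<epsilon>. 0 < \<epsilon> \<Longrightarrow> \<exists>a\<in>einterval (\<sigma> j) (\<tau> j). \<forall>y\<in>einterval (\<sigma> j) (\<tau> j). y \<le> a \<longrightarrow>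
      (1 + (\<eta> l j m y)\<^sup>2) ^ n * (P j y * \<bar>\<eta>' l j m y\<bar>) \<le> \<epsilon>"
    and \<eta>_int: "\<And>l j m n. 1 \<le> n \<Longrightarrow>
      integrable (weighted_measure (\<sigma> j) (\<tau> j) (w j)) (\<lambda>y. (\<eta> l j m y) ^ (2 * n))"
    and A_fin: "finite A" and A_le: "\<And>k j. k \<in> A \<Longrightarrow> k j \<le> N"
    and s_pos: "\<And>k. k \<in> A \<Longrightarrow> 0 < s k" and s_sq: "\<And>k. k \<in> A \<Longrightarrow> (s k)\<^sup>2 = (\<Sum>j\<in>UNIV. ev j (k j))"
    and R_nonneg: "\<And>x. (\<And>j. x j \<in> einterval (\<sigma> j) (\<tau> j)) \<Longrightarrow> 0 \<le> R x"
    and R_le: "\<And>l x. (\<And>j. x j \<in> einterval (\<sigma> j) (\<tau> j)) \<Longrightarrow> R x \<le> (\<Sum>j\<in>UNIV. \<rho> l j (x j))"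
begin

abbreviation "X j \<equiv> einterval (\<sigma> j) (\<tau> j)"
definition "XX = {x. \<forall>j. x j \<in> X j}"
abbreviation "\<mu> j \<equiv> weighted_measure (\<sigma> j) (\<tau> j) (w j)"
abbreviation "M \<equiv> product_measure \<sigma> \<tau> w"

definition "pr l k x = (\<Prod>j\<in>UNIV. \<eta> l j (k j) (x j))"
definition "pr' j l k x = \<eta>' l j (k j) (x j) * (\<Prod>i\<in>-{j}. \<eta> l i (k i) (x i))"
definition "u l t x = (\<Sum>k\<in>A. c l k * exp (- s k * t) * pr l k x)"
definition "ut l t x = (\<Sum>k\<in>A. c l k * (- s k * exp (- s k * t)) * pr l k x)"
definition "utt l t x = (\<Sum>k\<in>A. c l k * ((s k)\<^sup>2 * exp (- s k * t)) * pr l k x)"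
definition "ud j l t x = (\<Sum>k\<in>A. c l k * exp (- s k * t) * pr' j l k x)"
text \<open>This is (1 / w) times the derivative of P * \<open>ud\<close> in coordinate j, already
  evaluated by the eigenvalue equation; it is not a plain second derivative.\<close>

definition "udd j l t x = (\<Sum>k\<in>A. c l k * exp (- s k * t) * ((\<rho> l j (x j) - ev j (k j)) * pr l k x))"

lemma weight_w: "weight (\<sigma> j) (\<tau> j) (w j)"
  by standard (use w_cont w_pos in auto)

sublocale product_sigma_finite \<mu>
  using weight.sigma_finite[OF weight_w] by (simp add: product_sigma_finite_def)

lemma integral_split:
  fixes f :: "('d \<Rightarrow> real) \<Rightarrow> real"
  assumes "integrable (Pi\<^sub>M UNIV \<mu>) f"
  shows "integral\<^sup>L (Pi\<^sub>M UNIV \<mu>) f = (\<integral>x. (\<integral>y. f (x(j := y)) \<partial>\<mu> j) \<partial>Pi\<^sub>M (-{j}) \<mu>)"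
proof -
  have U: "insert j (-{j}) = (UNIV :: 'd set)" by auto
  show ?thesis using product_integral_insert[of "-{j}" j f] assms unfolding U by auto
qed

lemma M_eq: "M = Pi\<^sub>M UNIV \<mu>"
  by (simp add: product_measure_def)

lemma space_M: "space M = XX"
  by (auto simp: space_product_measure XX_def)

lemma XX_D: "x \<in> XX \<Longrightarrow> x j \<in> X j"
  by (simp add: XX_def)

lemma XX_upd: "x \<in> XX \<Longrightarrow> y \<in> X j \<Longrightarrow> x(j := y) \<in> XX"
  by (simp add: XX_def)

lemma pr_upd: "pr l k (x(j := y)) = \<eta> l j (k j) y * (\<Prod>i\<in>-{j}. \<eta> l i (k i) (x i))"
  unfolding pr_def by (subst prod_remove_UNIV[of _ j]) (auto intro!: prod.cong)

lemma pr'_upd: "pr' j l k (x(j := y)) = \<eta>' l j (k j) y * (\<Prod>i\<in>-{j}. \<eta> l i (k i) (x i))"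
  unfolding pr'_def by (auto intro!: prod.cong)

lemma DERIV_u_t: "((\<lambda>t. u l t x) has_real_derivative ut l t x) (at t)"
  unfolding u_def ut_def by (auto intro!: derivative_eq_intros sum.cong)

lemma DERIV_ut_t: "((\<lambda>t. ut l t x) has_real_derivative utt l t x) (at t)"
  unfolding ut_def utt_def by (auto intro!: derivative_eq_intros sum.cong simp: power2_eq_square)

lemma DERIV_u_x:
  assumes "y \<in> X j"
  shows "((\<lambda>y. u l t (x(j := y))) has_real_derivative ud j l t (x(j := y))) (at y)"
  unfolding u_def ud_def pr_upd pr'_upd
  by (auto intro!: derivative_eq_intros \<eta>_deriv assms sum.cong simp: mult_ac)

lemma DERIV_ud_x:
  assumes "y \<in> X j"
  shows "((\<lambda>y. P j y * ud j l t (x(j := y))) has_real_derivative w j y * udd j l t (x(j := y))) (at y)"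
proof -
  have "((\<lambda>y. \<Sum>k\<in>A. c l k * exp (- s k * t) * (\<Prod>i\<in>-{j}. \<eta> l i (k i) (x i)) * (P j y * \<eta>' l j (k j) y)) has_real_derivative
     w j y * udd j l t (x(j := y))) (at y)"
    by (rule DERIV_cong[OF DERIV_sum[OF DERIV_cmult[OF flux_deriv[OF assms]]]])
      (simp add: udd_def pr_upd sum_distrib_left mult_ac)
  moreover have "(\<lambda>y. P j y * ud j l t (x(j := y))) =
    (\<lambda>y. \<Sum>k\<in>A. c l k * exp (- s k * t) * (\<Prod>i\<in>-{j}. \<eta> l i (k i) (x i)) * (P j y * \<eta>' l j (k j) y))"
    by (simp add: fun_eq_iff ud_def pr'_upd sum_distrib_left mult_ac)
  ultimately show ?thesis by simp
qed

text \<open>The equation of the Poisson extension: the square of the damping rate \<open>s k\<close>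
  is the sum of the one-dimensional eigenvalues, so these cancel and only the potential is
  left.\<close>

lemma utt_udd: "utt l t x + (\<Sum>j\<in>UNIV. udd j l t x) = (\<Sum>j\<in>UNIV. \<rho> l j (x j)) * u l t x"
proof -
  have "(\<Sum>j\<in>UNIV. udd j l t x) = (\<Sum>k\<in>A. \<Sum>j\<in>UNIV. c l k * exp (- s k * t) * ((\<rho> l j (x j) - ev j (k j)) * pr l k x))"
    unfolding udd_def by (rule sum.swap)
  also have "\<dots> = (\<Sum>k\<in>A. c l k * exp (- s k * t) * (((\<Sum>j\<in>UNIV. \<rho> l j (x j)) - (s k)\<^sup>2) * pr l k x))"
    by (intro sum.cong refl)
      (simp add: s_sq sum_distrib_left[symmetric] sum_distrib_right[symmetric] sum_subtractf)
  finally show ?thesis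
    unfolding utt_def u_def by (simp add: sum.distrib[symmetric] sum_distrib_left algebra_simps)
qed

section \<open>Integrable bounds that factorise over the coordinates\<close>

lemma \<eta>_cont: "continuous_on (X j) (\<eta> l j m)"
  using DERIV_isCont[OF \<eta>_deriv] by (intro continuous_at_imp_continuous_on) auto

lemma \<eta>'_cont: "continuous_on (X j) (\<eta>' l j m)"
proof -
  have "continuous_on (X j) (\<lambda>y. P j y * \<eta>' l j m y)"
    using DERIV_isCont[OF flux_deriv] by (intro continuous_at_imp_continuous_on) auto
  then have "continuous_on (X j) (\<lambda>y. (P j y * \<eta>' l j m y) / P j y)"
    by (rule continuous_on_divide[OF _ P_cont]) (use P_pos in force)
  then show ?thesis
    by (rule continuous_on_eq) (use P_pos in force)
qed

text \<open>One function per coordinate that bounds the square of every eigenfunction of index at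
  most \<open>N\<close>, for all components at once.\<close>

definition "en j y = (\<Sum>e\<in>UNIV \<times> {..N}. (\<eta> (fst e) j (snd e) y)\<^sup>2)"

lemma en_nonneg: "0 \<le> en j y"
  unfolding en_def by (intro sum_nonneg) auto

lemma \<eta>_le_en: "m \<le> N \<Longrightarrow> \<bar>\<eta> l j m y\<bar> \<le> sqrt (en j y)"
proof -
  assume "m \<le> N"
  then have "(\<eta> l j m y)\<^sup>2 \<le> en j y"
    using member_le_sum[of "(l, m)" "UNIV \<times> {..N}" "\<lambda>e. (\<eta> (fst e) j (snd e) y)\<^sup>2"] by (simp add: en_def)
  then show ?thesis by (intro real_le_rsqrt) simp
qed

lemma en_int:
  assumes "1 \<le> n"
  shows "integrable (\<mu> j) (\<lambda>y. en j y ^ n)"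
proof (rule Bochner_Integration.integrable_bound)
  let ?I = "(UNIV :: 'l set) \<times> {..N}"
  show "integrable (\<mu> j) (\<lambda>y. real (card ?I) ^ n * (\<Sum>e\<in>?I. (\<eta> (fst e) j (snd e) y) ^ (2 * n)))"
    by (intro integrable_mult_right Bochner_Integration.integrable_sum \<eta>_int assms)
  show "(\<lambda>y. en j y ^ n) \<in> borel_measurable (\<mu> j)"
    unfolding en_def by (intro borel_measurable_weighted_measure continuous_intros \<eta>_cont)
  have "en j y ^ n \<le> real (card ?I) ^ n * (\<Sum>e\<in>?I. (\<eta> (fst e) j (snd e) y) ^ (2 * n))" for y
  proof -
    have "(0::real) ^ n = 0" using assms by simp
    moreover have "en j y ^ n \<le> real (card ?I) ^ n * (\<Sum>e\<in>?I. ((\<eta> (fst e) j (snd e) y)\<^sup>2) ^ n) + 0 ^ n"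
      unfolding en_def by (rule sum_power_le) auto
    ultimately show ?thesis unfolding power_mult by linarith
  qed
  then show "AE y in \<mu> j. norm (en j y ^ n) \<le> norm (real (card ?I) ^ n * (\<Sum>e\<in>?I. (\<eta> (fst e) j (snd e) y) ^ (2 * n)))"
    using en_nonneg by (intro AE_I2) (auto intro: order_trans[OF _ abs_ge_self])
qed

text \<open>The factor \<open>en\<close> outside the power keeps this integrable when the
  one-dimensional measure is infinite; an integer exponent lets the binomial theorem reduce it to
  powers of \<open>en\<close> with positive exponent.\<close>

definition "gg j y = en j y * (1 + en j y) ^ deg"

lemma gg_nonneg: "0 \<le> gg j y"
  using en_nonneg[of j y] by (simp add: gg_def)

lemma gg_int: "integrable (\<mu> j) (gg j)"
proof -
  have "gg j = (\<lambda>y. \<Sum>i\<le>deg. of_nat (deg choose i) * en j y ^ Suc i)"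
    unfolding gg_def by (simp add: fun_eq_iff add.commute[of 1] binomial_ring sum_distrib_left mult_ac)
  then show ?thesis
    by (simp only:) (intro Bochner_Integration.integrable_sum integrable_mult_right en_int, simp)
qed

lemma gg_prod_int: "integrable (Pi\<^sub>M I \<mu>) (\<lambda>x. \<Prod>j\<in>I. gg j (x j))" for I :: "'d set"
  by (rule product_integrable_prod) (auto intro: gg_int)

definition "C0 = 1 + (\<Sum>l\<in>UNIV. \<Sum>k\<in>A. \<bar>c l k\<bar>)"

lemma C0_ge: "(\<Sum>k\<in>A. \<bar>c l k\<bar>) \<le> C0" "0 < C0"
proof -
  have "0 \<le> (\<Sum>l\<in>UNIV. \<Sum>k\<in>A. \<bar>c l k\<bar>)" by (intro sum_nonneg) auto
  moreover have "(\<Sum>k\<in>A. \<bar>c l k\<bar>) \<le> (\<Sum>l\<in>UNIV. \<Sum>k\<in>A. \<bar>c l k\<bar>)"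
    by (rule member_le_sum) (auto intro: sum_nonneg)
  ultimately show "(\<Sum>k\<in>A. \<bar>c l k\<bar>) \<le> C0" "0 < C0" by (simp_all add: C0_def)
qed

text \<open>The common decay rate in time; the value 1 for empty \<open>A\<close> only keeps it
  positive.\<close>

definition "s0 = (if A = {} then 1 else Min (s ` A))"

lemma s0: "0 < s0" "k \<in> A \<Longrightarrow> s0 \<le> s k"
  using A_fin s_pos by (auto simp: s0_def)

lemma pr_le: "k \<in> A \<Longrightarrow> \<bar>pr l k x\<bar> \<le> (\<Prod>j\<in>UNIV. sqrt (en j (x j)))"
  unfolding pr_def abs_prod by (intro prod_mono) (auto intro: \<eta>_le_en A_le)

lemma u_le:
  assumes "0 \<le> t"
  shows "\<bar>u l t x\<bar> \<le> exp (- s0 * t) * C0 * (\<Prod>j\<in>UNIV. sqrt (en j (x j)))"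
proof -
  let ?Q = "\<Prod>j\<in>UNIV. sqrt (en j (x j))"
  have Q: "0 \<le> ?Q" by (intro prod_nonneg) (auto simp: en_nonneg)
  have "\<bar>u l t x\<bar> \<le> (\<Sum>k\<in>A. \<bar>c l k\<bar> * (exp (- s0 * t) * ?Q))"
    unfolding u_def
  proof (rule order_trans[OF sum_abs sum_mono])
    fix k assume k: "k \<in> A"
    have "exp (- s k * t) \<le> exp (- s0 * t)" using s0(2)[OF k] assms by (simp add: mult_right_mono)
    then show "\<bar>c l k * exp (- s k * t) * pr l k x\<bar> \<le> \<bar>c l k\<bar> * (exp (- s0 * t) * ?Q)"
      unfolding abs_mult mult.assoc using pr_le[OF k] by (intro mult_left_mono mult_mono) auto
  qed
  also have "\<dots> = (\<Sum>k\<in>A. \<bar>c l k\<bar>) * (exp (- s0 * t) * ?Q)" by (rule sum_distrib_right[symmetric])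
  also have "\<dots> \<le> C0 * (exp (- s0 * t) * ?Q)"
    using C0_ge Q by (intro mult_right_mono) auto
  finally show ?thesis by (simp add: mult_ac)
qed

definition "C1 = real CARD('l) * C0\<^sup>2"

lemma C1_nonneg: "0 \<le> C1" by (simp add: C1_def)

lemma sum_u_le:
  assumes "0 \<le> t"
  shows "(\<Sum>l\<in>UNIV. (u l t x)\<^sup>2) \<le> exp (- s0 * t) * (C1 * (\<Prod>j\<in>UNIV. en j (x j)))"
proof -
  have "(u l t x)\<^sup>2 \<le> exp (- s0 * t) * (C0\<^sup>2 * (\<Prod>j\<in>UNIV. en j (x j)))" for l
  proof -
    have "\<bar>u l t x\<bar>\<^sup>2 \<le> (exp (- s0 * t) * C0 * (\<Prod>j\<in>UNIV. sqrt (en j (x j))))\<^sup>2"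
      by (rule power_mono[OF u_le[OF assms]]) simp
    also have "\<dots> = exp (- s0 * t) * exp (- s0 * t) * (C0\<^sup>2 * (\<Prod>j\<in>UNIV. en j (x j)))"
      by (simp add: power_mult_distrib prod_power_distrib[symmetric] en_nonneg power2_eq_square mult_ac prod.distrib[symmetric])
    also have "\<dots> \<le> 1 * exp (- s0 * t) * (C0\<^sup>2 * (\<Prod>j\<in>UNIV. en j (x j)))"
      using s0(1) assms by (intro mult_right_mono) (auto intro!: mult_nonneg_nonneg prod_nonneg en_nonneg)
    finally show ?thesis by simp
  qed
  then have "(\<Sum>l\<in>UNIV. (u l t x)\<^sup>2) \<le> of_nat (card (UNIV::'l set)) * (exp (- s0 * t) * (C0\<^sup>2 * (\<Prod>j\<in>UNIV. en j (x j))))"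
    by (intro sum_bounded_above)
  then show ?thesis by (simp add: C1_def mult_ac)
qed

lemma prod_en_le: "1 + C1 * (\<Prod>j\<in>UNIV. en j (x j)) \<le> (1 + C1) * (\<Prod>j\<in>UNIV. 1 + en j (x j))"
proof -
  have "1 \<le> (\<Prod>j\<in>UNIV. 1 + en j (x j))" by (intro prod_ge_1) (auto simp: en_nonneg)
  moreover have "C1 * (\<Prod>j\<in>UNIV. en j (x j)) \<le> C1 * (\<Prod>j\<in>UNIV. 1 + en j (x j))"
    by (intro mult_left_mono prod_mono C1_nonneg) (auto simp: en_nonneg)
  ultimately show ?thesis by (simp add: distrib_right)
qed

text \<open>This matches the growth bounds of \<open>bel\<close>. One exponential factor is retained
  for the limit of large times, and the rest is a product over the coordinates, integrable by
  Fubini.\<close>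

lemma sum_u_growth:
  assumes "0 \<le> t"
  shows "(\<Sum>l\<in>UNIV. (u l t x)\<^sup>2) * (3 * (1 + (\<Sum>l\<in>UNIV. (u l t x)\<^sup>2))) ^ deg
    \<le> exp (- s0 * t) * (C1 * (3 * (1 + C1)) ^ deg * (\<Prod>j\<in>UNIV. gg j (x j)))"
proof -
  let ?E = "\<Prod>j\<in>UNIV. en j (x j)" and ?S = "\<Sum>l\<in>UNIV. (u l t x)\<^sup>2"
  have E: "0 \<le> ?E" by (intro prod_nonneg) (auto simp: en_nonneg)
  have S: "0 \<le> ?S" by (intro sum_nonneg) auto
  have e1: "exp (- s0 * t) \<le> 1" using s0(1) assms by simp
  have "?S \<le> 1 * (C1 * ?E)"
    using sum_u_le[OF assms, of x] e1 C1_nonneg E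
    by (intro order_trans[OF sum_u_le[OF assms, of x]] mult_right_mono) auto
  then have "3 * (1 + ?S) \<le> 3 * (1 + C1) * (\<Prod>j\<in>UNIV. 1 + en j (x j))"
  proof -
    assume "?S \<le> 1 * (C1 * ?E)"
    then have "1 + ?S \<le> 1 + C1 * ?E" by simp
    from mult_left_mono[OF order_trans[OF this prod_en_le], of 3] show ?thesis by (simp only: mult.assoc)
  qed
  then have "(3 * (1 + ?S)) ^ deg \<le> (3 * (1 + C1) * (\<Prod>j\<in>UNIV. 1 + en j (x j))) ^ deg"
    using S by (intro power_mono) auto
  then have "?S * (3 * (1 + ?S)) ^ deg
     \<le> (exp (- s0 * t) * (C1 * ?E)) * (3 * (1 + C1) * (\<Prod>j\<in>UNIV. 1 + en j (x j))) ^ deg"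
    using sum_u_le[OF assms, of x] S C1_nonneg E by (intro mult_mono) auto
  also have "\<dots> = exp (- s0 * t) * (C1 * (3 * (1 + C1)) ^ deg * (\<Prod>j\<in>UNIV. gg j (x j)))"
    by (simp add: gg_def power_mult_distrib prod_power_distrib prod.distrib mult_ac)
  finally show ?thesis .
qed

text \<open>The flux in direction j is kept explicitly and the other coordinates enter only through
  their bounds, since smallness near the ends is available for one variable at a time.\<close>

lemma ud_le:
  assumes "0 \<le> t" "0 < P j (x j)"
  shows "P j (x j) * \<bar>ud j l t x\<bar> \<le> C0 * (\<Sum>e\<in>UNIV \<times> {..N}. P j (x j) * \<bar>\<eta>' (fst e) j (snd e) (x j)\<bar>)
    * (\<Prod>i\<in>-{j}. sqrt (en i (x i)))"
proof -
  let ?Q = "\<Prod>i\<in>-{j}. sqrt (en i (x i))"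
  let ?F = "\<Sum>e\<in>UNIV \<times> {..N}. P j (x j) * \<bar>\<eta>' (fst e) j (snd e) (x j)\<bar>"
  have Q: "0 \<le> ?Q" by (intro prod_nonneg) (auto simp: en_nonneg)
  have F0: "0 \<le> ?F" using assms by (intro sum_nonneg) auto
  have F: "P j (x j) * \<bar>\<eta>' l j (k j) (x j)\<bar> \<le> ?F" if "k \<in> A" for k
    using member_le_sum[of "(l, k j)" "UNIV \<times> {..N}" "\<lambda>e. P j (x j) * \<bar>\<eta>' (fst e) j (snd e) (x j)\<bar>"] A_le[OF that] assms
    by auto
  have "P j (x j) * \<bar>ud j l t x\<bar> = \<bar>\<Sum>k\<in>A. P j (x j) * (c l k * exp (- s k * t) * pr' j l k x)\<bar>"
    unfolding ud_def sum_distrib_left[symmetric] using assms by (simp add: abs_mult)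
  also have "\<dots> \<le> (\<Sum>k\<in>A. \<bar>c l k\<bar> * (?F * ?Q))"
  proof (rule order_trans[OF sum_abs sum_mono])
    fix k assume k: "k \<in> A"
    have Qk: "(\<Prod>i\<in>-{j}. \<bar>\<eta> l i (k i) (x i)\<bar>) \<le> ?Q" by (intro prod_mono) (auto intro: \<eta>_le_en A_le[OF k])
    have "\<bar>P j (x j) * (c l k * exp (- s k * t) * pr' j l k x)\<bar>
      = exp (- s k * t) * \<bar>c l k\<bar> * ((P j (x j) * \<bar>\<eta>' l j (k j) (x j)\<bar>) * (\<Prod>i\<in>-{j}. \<bar>\<eta> l i (k i) (x i)\<bar>))"
      using assms by (simp add: pr'_def abs_mult abs_prod mult_ac)
    also have "\<dots> \<le> 1 * \<bar>c l k\<bar> * (?F * ?Q)"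
      using assms s_pos[OF k] F[OF k] Qk F0
      by (intro mult_mono) (auto intro!: mult_nonneg_nonneg prod_nonneg)
    finally show "\<bar>P j (x j) * (c l k * exp (- s k * t) * pr' j l k x)\<bar> \<le> \<bar>c l k\<bar> * (?F * ?Q)" by simp
  qed
  also have "\<dots> = (\<Sum>k\<in>A. \<bar>c l k\<bar>) * (?F * ?Q)" by (rule sum_distrib_right[symmetric])
  also have "\<dots> \<le> C0 * (?F * ?Q)" using C0_ge Q F0 by (intro mult_right_mono) auto
  finally show ?thesis by (simp add: mult.assoc)
qed

lemma continuous_on_comp:
  assumes "continuous_on (X j) f"
  shows "continuous_on (UNIV \<times> XX) (\<lambda>z. f (snd z j))"
  by (rule continuous_on_compose2[OF assms])
    (use continuous_on_product_then_coordinatewise[OF continuous_on_snd[OF continuous_on_id]] in \<open>auto simp: XX_def\<close>)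

lemma u_continuous:
  "continuous_on (UNIV \<times> XX) (\<lambda>z. u l (fst z) (snd z))"
  "continuous_on (UNIV \<times> XX) (\<lambda>z. ut l (fst z) (snd z))"
  "continuous_on (UNIV \<times> XX) (\<lambda>z. utt l (fst z) (snd z))"
  "continuous_on (UNIV \<times> XX) (\<lambda>z. ud j l (fst z) (snd z))"
  "continuous_on (UNIV \<times> XX) (\<lambda>z. udd j l (fst z) (snd z))"
proof -
  have c: "continuous_on (UNIV \<times> XX) (\<lambda>z. \<eta> l j m (snd z j))"
    "continuous_on (UNIV \<times> XX) (\<lambda>z. \<eta>' l j m (snd z j))"
    "continuous_on (UNIV \<times> XX) (\<lambda>z. \<rho> l j (snd z j))" for l j m
    by (rule continuous_on_comp, rule \<eta>_cont \<eta>'_cont \<rho>_cont)+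
  show "continuous_on (UNIV \<times> XX) (\<lambda>z. u l (fst z) (snd z))"
    "continuous_on (UNIV \<times> XX) (\<lambda>z. ut l (fst z) (snd z))"
    "continuous_on (UNIV \<times> XX) (\<lambda>z. utt l (fst z) (snd z))"
    "continuous_on (UNIV \<times> XX) (\<lambda>z. ud j l (fst z) (snd z))"
    "continuous_on (UNIV \<times> XX) (\<lambda>z. udd j l (fst z) (snd z))"
    unfolding u_def ut_def utt_def ud_def udd_def pr_def pr'_def
    by (intro continuous_on_sum continuous_on_mult continuous_on_prod continuous_on_exp continuous_on_diff
        continuous_on_const continuous_on_fst continuous_on_id c)+
qed

end

section \<open>Continuity of the derivatives of \<open>Phi\<close> along continuous families\<close>

context bellman begin

lemma continuous_on_Phi:
  assumes f: "continuous_on S f" and g: "continuous_on S g"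
    and pos: "\<And>z. z \<in> S \<Longrightarrow> 0 < f z" "\<And>z. z \<in> S \<Longrightarrow> 0 < g z"
  shows "continuous_on S (\<lambda>z. Phi_U (f z) (g z))" "continuous_on S (\<lambda>z. Phi_V (f z) (g z))"
    "continuous_on S (\<lambda>z. Phi_UU (f z) (g z))" "continuous_on S (\<lambda>z. Phi_UV (f z) (g z))"
    "continuous_on S (\<lambda>z. Phi_VV (f z) (g z))"
proof -
  have Z: "continuous_on S (\<lambda>z. Zf (f z) (g z) powr a)" "continuous_on S (\<lambda>z. f z powr a)"
    "continuous_on S (\<lambda>z. g z powr a)" for a
  proof -
    show *: "continuous_on S (\<lambda>z. f z powr a)" "continuous_on S (\<lambda>z. g z powr a)" for a
      by (intro continuous_on_powr f g continuous_on_const; use pos in force)+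
    have "continuous_on S (\<lambda>z. Zf (f z) (g z))"
      unfolding Zf_def by (intro continuous_on_add g *)
    then show "continuous_on S (\<lambda>z. Zf (f z) (g z) powr a)"
      by (rule continuous_on_powr[OF _ continuous_on_const]) (use Zf_pos[OF pos] in force)
  qed
  show "continuous_on S (\<lambda>z. Phi_U (f z) (g z))" "continuous_on S (\<lambda>z. Phi_V (f z) (g z))"
    "continuous_on S (\<lambda>z. Phi_UU (f z) (g z))" "continuous_on S (\<lambda>z. Phi_UV (f z) (g z))"
    "continuous_on S (\<lambda>z. Phi_VV (f z) (g z))"
    unfolding Phi_U_def Phi_V_def Phi_UU_def Phi_UV_def Phi_VV_def
    by (intro continuous_on_add continuous_on_mult continuous_on_const f g Z)+
qed

lemma continuous_on_sq:
  fixes z :: "'l::finite \<Rightarrow> 'a::topological_space \<Rightarrow> real"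
  shows "(\<And>l. continuous_on S (z l)) \<Longrightarrow> continuous_on S (\<lambda>y. sq e L (\<lambda>l. z l y))"
  unfolding sq_def by (intro continuous_intros)

lemma continuous_on_PhiW:
  assumes "continuous_on S f" "continuous_on S g" "\<And>z. z \<in> S \<Longrightarrow> 0 < f z" "\<And>z. z \<in> S \<Longrightarrow> 0 < g z"
  shows "continuous_on S (\<lambda>z. PhiW L l (f z) (g z))"
  unfolding PhiW_def using continuous_on_Phi[OF assms] by (cases "l \<in> L") auto

lemma continuous_on_Hess:
  fixes z a :: "'l::finite \<Rightarrow> 'a::topological_space \<Rightarrow> real"
  assumes f: "continuous_on S f" "continuous_on S g" "\<And>z. z \<in> S \<Longrightarrow> 0 < f z" "\<And>z. z \<in> S \<Longrightarrow> 0 < g z"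
    and z: "\<And>l. continuous_on S (z l)" and a: "\<And>l. continuous_on S (a l)"
  shows "continuous_on S (\<lambda>y. Hess L (f y) (g y) (\<lambda>l. z l y) (\<lambda>l. a l y))"
  unfolding Hess_def
  by (intro continuous_on_add continuous_on_mult continuous_on_const continuous_on_sum continuous_on_power z a
      continuous_on_Phi f)

end

context sl_system begin

text \<open>In the application P j / w j is the square of the coefficient of the derivative and
  \<open>R\<close> is the potential r, so this is the squared length of the full gradient.\<close>

definition "energy B t x = (\<Sum>l\<in>B. (ut l t x)\<^sup>2 + (\<Sum>j\<in>UNIV. P j (x j) / w j (x j) * (ud j l t x)\<^sup>2)
  + R x * (u l t x)\<^sup>2)"

lemma energy_nonneg: "x \<in> XX \<Longrightarrow> 0 \<le> energy B t x"
  unfolding energy_def using R_nonneg[of x]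
  by (intro sum_nonneg add_nonneg_nonneg mult_nonneg_nonneg divide_nonneg_nonneg)
    (auto simp: XX_def less_imp_le[OF P_pos] less_imp_le[OF w_pos])

end

locale sl_bellman = sl_system p q \<sigma> \<tau> w P \<eta> \<eta>' \<rho> ev A N c s L R
  for p q :: real and \<sigma> \<tau> :: "'d::finite \<Rightarrow> ereal" and w P :: "'d \<Rightarrow> real \<Rightarrow> real"
    and \<eta> \<eta>' :: "'l::finite \<Rightarrow> 'd \<Rightarrow> nat \<Rightarrow> real \<Rightarrow> real" and \<rho> :: "'l \<Rightarrow> 'd \<Rightarrow> real \<Rightarrow> real"
    and ev :: "'d \<Rightarrow> nat \<Rightarrow> real" and A :: "('d \<Rightarrow> nat) set" and N :: nat
    and c :: "'l \<Rightarrow> ('d \<Rightarrow> nat) \<Rightarrow> real" and s :: "('d \<Rightarrow> nat) \<Rightarrow> real"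
    and L :: "'l set" and R :: "('d \<Rightarrow> real) \<Rightarrow> real" +
  fixes e :: real
  assumes e_pos: "0 < e" and e_le: "e \<le> 1"
begin

definition "UU t x = sq e L (\<lambda>l. u l t x)"
definition "VV t x = sq e (-L) (\<lambda>l. u l t x)"
definition "b t x = bel e (\<Sum>l\<in>L. (u l t x)\<^sup>2) (\<Sum>l\<in>-L. (u l t x)\<^sup>2)"
definition "bt t x = (\<Sum>l\<in>UNIV. 2 * PhiW L l (UU t x) (VV t x) * u l t x * ut l t x)"
definition "btt t x = Hess L (UU t x) (VV t x) (\<lambda>l. u l t x) (\<lambda>l. ut l t x)
  + (\<Sum>l\<in>UNIV. 2 * PhiW L l (UU t x) (VV t x) * u l t x * utt l t x)"
definition "bd j t x = (\<Sum>l\<in>UNIV. 2 * PhiW L l (UU t x) (VV t x) * u l t x * ud j l t x)"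
text \<open>(1 / w) times the derivative of P * \<open>bd\<close> in coordinate j: together with
  \<open>btt\<close> it forms the elliptic operator applied to \<open>b\<close>.\<close>

definition "bdd j t x = P j (x j) / w j (x j) * Hess L (UU t x) (VV t x) (\<lambda>l. u l t x) (\<lambda>l. ud j l t x)
  + (\<Sum>l\<in>UNIV. 2 * PhiW L l (UU t x) (VV t x) * u l t x * udd j l t x)"

lemma UU_pos: "0 < UU t x" and VV_pos: "0 < VV t x"
  by (simp_all add: UU_def VV_def sq_pos[OF e_pos])

lemma b_eq: "b t x = Phi (UU t x) (VV t x) - Phi e e"
  by (simp add: b_def bel_def UU_def VV_def sq_def add.commute)

lemma b_nonneg: "0 \<le> b t x"
  unfolding b_def using e_pos by (intro bel_nonneg sum_nonneg) auto

lemma DERIV_b_t: "((\<lambda>t. b t x) has_real_derivative bt t x) (at t)"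
  unfolding b_eq bt_def UU_def VV_def
  using DERIV_diff[OF DERIV_Phi_sq[where z = "\<lambda>l t. u l t x" and z' = "\<lambda>l t. ut l t x", OF e_pos DERIV_u_t] DERIV_const]
  by simp

lemma DERIV_bt_t: "((\<lambda>t. bt t x) has_real_derivative btt t x) (at t)"
  using DERIV_flux_Phi_sq[where z = "\<lambda>l t. u l t x" and z' = "\<lambda>l t. ut l t x" and y = t and L = L
      and \<pi> = "\<lambda>_. 1" and \<omega> = 1 and g = "\<lambda>l. utt l t x", OF e_pos DERIV_u_t] DERIV_ut_t
  unfolding bt_def btt_def UU_def VV_def by simp

lemma DERIV_b_x:
  assumes "y \<in> X j"
  shows "((\<lambda>y. b t (x(j := y))) has_real_derivative bd j t (x(j := y))) (at y)"
  unfolding b_eq bd_def UU_def VV_def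
  using DERIV_diff[OF DERIV_Phi_sq[where z = "\<lambda>l y. u l t (x(j := y))" and z' = "\<lambda>l y. ud j l t (x(j := y))",
    OF e_pos DERIV_u_x[OF assms]] DERIV_const]
  by simp

lemma DERIV_bd_x:
  assumes y: "y \<in> X j"
  shows "((\<lambda>y. P j y * bd j t (x(j := y))) has_real_derivative w j y * bdd j t (x(j := y))) (at y)"
proof -
  have w: "w j y \<noteq> 0" using w_pos[OF y] by simp
  show ?thesis
    using DERIV_flux_Phi_sq[where z = "\<lambda>l y. u l t (x(j := y))" and z' = "\<lambda>l y. ud j l t (x(j := y))"
      and y = y and \<pi> = "P j" and \<omega> = "w j y" and g = "\<lambda>l. udd j l t (x(j := y))" and L = L,
      OF e_pos DERIV_u_x[OF y] DERIV_ud_x[OF y]] w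
    unfolding bd_def bdd_def UU_def VV_def by (simp add: distrib_left)
qed

text \<open>The Hessian is bounded below for the time derivative and for each coordinate derivative,
  the zero-order part by the equation of the extension. All three have the same weights k and 6 / k,
  which then disappear by the inequality of means.\<close>

lemma lower_bound:
  assumes x: "x \<in> XX"
  shows "24 / 5 * del * (sqrt (energy L t x) * sqrt (energy (-L) t x)) \<le> btt t x + (\<Sum>j\<in>UNIV. bdd j t x)"
proof -
  define k where "k = Zf (UU t x) (VV t x) powr kap"
  have k: "0 < k" using Zf_pos[OF UU_pos[of t x] VV_pos[of t x]] by (simp add: k_def)
  define h where "h a = del * (k * (\<Sum>l\<in>L. (a l)\<^sup>2) + 6 * ((\<Sum>l\<in>-L. (a l)\<^sup>2) / k))" for a :: "'l \<Rightarrow> real"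
  have H: "h a \<le> Hess L (UU t x) (VV t x) (\<lambda>l. u l t x) a" for a
    using Hess_ge[OF e_pos, of L "\<lambda>l. u l t x" a] unfolding h_def k_def UU_def VV_def by simp
  have Pw: "0 \<le> P j (x j) / w j (x j)" for j
    using P_pos[OF XX_D[OF x]] w_pos[OF XX_D[OF x]] by (simp add: less_imp_le)
  have R0: "0 \<le> R x" and Rl: "R x \<le> (\<Sum>j\<in>UNIV. \<rho> l j (x j))" for l
    using R_nonneg[of x] R_le[of x] x by (auto simp: XX_def)
  let ?W = "\<lambda>l. 2 * PhiW L l (UU t x) (VV t x)"
  have W: "?W l \<ge> (if l \<in> L then del * k else del * (6 / k))" for l
    using Phi_U_ge[OF UU_pos[of t x] VV_pos[of t x]] Phi_V_ge[OF UU_pos[of t x] VV_pos[of t x]] by (simp add: PhiW_def k_def)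
  have W0: "0 \<le> ?W l" for l
    using Phi_U_nonneg[OF UU_pos[of t x] VV_pos[of t x]] Phi_V_nonneg[OF UU_pos[of t x] VV_pos[of t x]]
    by (simp add: PhiW_def)
  \<comment> \<open>By the equation the bracket on the right is the potential times u, so the
    summand is a nonnegative weight times potential times u^2. The weights are bounded below by
    \<open>Phi_U_ge\<close> and \<open>Phi_V_ge\<close>, the potential by \<open>R\<close>.\<close>
  have low: "R x * h (\<lambda>l. u l t x) \<le> (\<Sum>l\<in>UNIV. ?W l * u l t x * (utt l t x + (\<Sum>j\<in>UNIV. udd j l t x)))"
  proof -
    have "R x * h (\<lambda>l. u l t x) = (\<Sum>l\<in>UNIV. (if l \<in> L then del * k else del * (6 / k)) * (R x * (u l t x)\<^sup>2))"
      unfolding sum_split[of _ L] h_def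
      by (simp add: sum_distrib_left[symmetric] sum_divide_distrib[symmetric] algebra_simps)
    also have "\<dots> \<le> (\<Sum>l\<in>UNIV. ?W l * ((\<Sum>j\<in>UNIV. \<rho> l j (x j)) * (u l t x)\<^sup>2))"
      by (intro sum_mono mult_mono W mult_right_mono Rl W0 mult_nonneg_nonneg R0) auto
    also have "\<dots> = (\<Sum>l\<in>UNIV. ?W l * u l t x * (utt l t x + (\<Sum>j\<in>UNIV. udd j l t x)))"
      by (simp add: utt_udd power2_eq_square mult_ac)
    finally show ?thesis .
  qed
  have "24 / 5 * (sqrt (energy L t x) * sqrt (energy (-L) t x)) \<le> k * energy L t x + 6 * (energy (-L) t x / k)"
    by (intro sqrt6_bound k energy_nonneg x)
  from mult_left_mono[OF this, of del]
  have "24 / 5 * del * (sqrt (energy L t x) * sqrt (energy (-L) t x))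
     \<le> del * (k * energy L t x + 6 * (energy (-L) t x / k))"
    using del_pos by (simp add: mult_ac)
  also have "\<dots> = h (\<lambda>l. ut l t x) + (\<Sum>j\<in>UNIV. P j (x j) / w j (x j) * h (\<lambda>l. ud j l t x)) + R x * h (\<lambda>l. u l t x)"
  proof -
    have en: "energy B t x = (\<Sum>l\<in>B. (ut l t x)\<^sup>2) + (\<Sum>j\<in>UNIV. P j (x j) / w j (x j) * (\<Sum>l\<in>B. (ud j l t x)\<^sup>2))
      + R x * (\<Sum>l\<in>B. (u l t x)\<^sup>2)" for B
      unfolding energy_def sum.distrib sum_distrib_left
      by (simp add: sum.swap[of _ B UNIV])
    have "(\<Sum>j\<in>UNIV. P j (x j) / w j (x j) * h (\<lambda>l. ud j l t x))
      = del * (k * (\<Sum>j\<in>UNIV. P j (x j) / w j (x j) * (\<Sum>l\<in>L. (ud j l t x)\<^sup>2))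
        + 6 * ((\<Sum>j\<in>UNIV. P j (x j) / w j (x j) * (\<Sum>l\<in>-L. (ud j l t x)\<^sup>2)) / k))"
    proof -
      have "(\<Sum>j\<in>UNIV. v j * (del * (k * f j + 6 * (g j / k)))) = del * (k * (\<Sum>j\<in>UNIV. v j * f j) + 6 * ((\<Sum>j\<in>UNIV. v j * g j) / k))"
        for v f g :: "'d \<Rightarrow> real"
        by (simp add: sum_distrib_left sum_divide_distrib sum.distrib algebra_simps)
      then show ?thesis unfolding h_def .
    qed
    then show ?thesis unfolding en unfolding h_def using k by (simp add: field_simps)
  qed
  also have "\<dots> \<le> Hess L (UU t x) (VV t x) (\<lambda>l. u l t x) (\<lambda>l. ut l t x)
    + (\<Sum>j\<in>UNIV. P j (x j) / w j (x j) * Hess L (UU t x) (VV t x) (\<lambda>l. u l t x) (\<lambda>l. ud j l t x))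
    + (\<Sum>l\<in>UNIV. ?W l * u l t x * (utt l t x + (\<Sum>j\<in>UNIV. udd j l t x)))"
    by (intro add_mono sum_mono mult_left_mono H low Pw)
  also have "\<dots> = btt t x + (\<Sum>j\<in>UNIV. bdd j t x)"
  proof -
    have "(\<Sum>l\<in>UNIV. ?W l * u l t x * (\<Sum>j\<in>UNIV. udd j l t x)) = (\<Sum>j\<in>UNIV. \<Sum>l\<in>UNIV. ?W l * u l t x * udd j l t x)"
      unfolding sum_distrib_left by (rule sum.swap)
    then show ?thesis by (simp add: btt_def bdd_def sum.distrib distrib_left)
  qed
  finally show ?thesis .
qed

section \<open>Growth of the Bellman function and of its fluxes, and the cutoffs adapted to
  it\<close>

definition "C2 = (e powr (q / 2 - 1) + 5 + 2 * p) * (C1 * (3 * (1 + C1)) ^ deg)"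

lemma C2_nonneg: "0 \<le> C2"
  using C1_nonneg p_ge by (simp add: C2_def)

lemma b_le:
  assumes "0 \<le> t"
  shows "b t x \<le> exp (- s0 * t) * (C2 * (\<Prod>j\<in>UNIV. gg j (x j)))"
proof -
  let ?K = "e powr (q / 2 - 1) + 5 + 2 * p"
  have "b t x \<le> ?K * ((\<Sum>l\<in>UNIV. (u l t x)\<^sup>2) * (3 * (1 + (\<Sum>l\<in>UNIV. (u l t x)\<^sup>2))) ^ deg)"
    using bel_growth(2)[OF e_pos e_le, of "\<Sum>l\<in>L. (u l t x)\<^sup>2" "\<Sum>l\<in>-L. (u l t x)\<^sup>2"]
    unfolding b_def by (simp add: sum_split[of _ L] sum_nonneg add.assoc)
  also have "\<dots> \<le> ?K * (exp (- s0 * t) * (C1 * (3 * (1 + C1)) ^ deg * (\<Prod>j\<in>UNIV. gg j (x j))))"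
    using p_ge by (intro mult_left_mono sum_u_growth[OF assms]) auto
  finally show ?thesis by (simp add: C2_def mult_ac)
qed

definition "fl j y = (\<Sum>e\<in>UNIV \<times> {..N}. P j y * \<bar>\<eta>' (fst e) j (snd e) y\<bar>)"

text \<open>This has the shape that \<open>cutoff_exists\<close> asks for: in the variable x j a
  flux times a power of 1 + \<open>en\<close>, and integrable factors in all others.\<close>

lemma bd_le:
  obtains C where "0 \<le> C" "\<And>j t x. 0 \<le> t \<Longrightarrow> x \<in> XX \<Longrightarrow>
    \<bar>P j (x j) * bd j t x\<bar> \<le> C * (\<Prod>i\<in>-{j}. gg i (x i)) * (fl j (x j) * (1 + en j (x j)) ^ Suc deg)"
proof -
  obtain C where C: "0 \<le> C" "\<And>U V. e \<le> U \<Longrightarrow> e \<le> V \<Longrightarrow> Phi_U U V \<le> C * (1 + U + V) ^ deg"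
    "\<And>U V. e \<le> U \<Longrightarrow> e \<le> V \<Longrightarrow> Phi_V U V \<le> C * (1 + U + V) ^ deg"
    using Phi_grad_growth[OF e_pos] by metis
  define D where "D = real CARD('l) * (2 * (C * (3 * (1 + C1)) ^ deg) * C0 * C0)"
  show ?thesis
  proof (rule that[of D])
    show "0 \<le> D" using C(1) C0_ge(2) C1_nonneg by (simp add: D_def)
    fix j :: 'd and t :: real and x :: "'d \<Rightarrow> real" assume t: "0 \<le> t" and x: "x \<in> XX"
    let ?E1 = "\<Prod>i\<in>UNIV. 1 + en i (x i)" and ?Q = "\<Prod>i\<in>UNIV. sqrt (en i (x i))"
    let ?Qj = "\<Prod>i\<in>-{j}. sqrt (en i (x i))"
    have Pj: "0 < P j (x j)" using P_pos XX_D[OF x] by blast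
    have fl0: "0 \<le> fl j (x j)" unfolding fl_def using Pj by (intro sum_nonneg) auto
    have nn: "0 \<le> ?Q" "0 \<le> ?Qj" "0 \<le> ?E1" by (auto intro!: prod_nonneg simp: en_nonneg add_nonneg_nonneg)
    have S: "(\<Sum>l\<in>UNIV. (u l t x)\<^sup>2) \<le> C1 * (\<Prod>i\<in>UNIV. en i (x i))"
    proof -
      have "exp (- s0 * t) * (C1 * (\<Prod>i\<in>UNIV. en i (x i))) \<le> 1 * (C1 * (\<Prod>i\<in>UNIV. en i (x i)))"
        using s0(1) t C1_nonneg by (intro mult_right_mono mult_nonneg_nonneg prod_nonneg) (auto simp: en_nonneg)
      then show ?thesis using sum_u_le[OF t, of x] by linarith
    qed
    have UV: "(1 + UU t x + VV t x) ^ deg \<le> (3 * (1 + C1)) ^ deg * ?E1 ^ deg"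
    proof -
      have "UU t x + VV t x = 2 * e + (\<Sum>l\<in>UNIV. (u l t x)\<^sup>2)"
        by (simp add: UU_def VV_def sq_def sum_split[of _ L])
      moreover have "0 \<le> C1 * (\<Prod>i\<in>UNIV. en i (x i))"
        using C1_nonneg by (intro mult_nonneg_nonneg prod_nonneg) (auto simp: en_nonneg)
      ultimately have "1 + UU t x + VV t x \<le> 3 * (1 + C1 * (\<Prod>i\<in>UNIV. en i (x i)))"
        using S e_le by simp
      also have "\<dots> \<le> 3 * ((1 + C1) * ?E1)" using prod_en_le[of x] by (rule mult_left_mono) simp
      finally have "1 + UU t x + VV t x \<le> 3 * (1 + C1) * ?E1" by (simp only: mult.assoc)
      then show ?thesis using UU_pos[of t x] VV_pos[of t x]
        unfolding power_mult_distrib[symmetric] by (intro power_mono) auto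
    qed
    have W: "\<bar>PhiW L l (UU t x) (VV t x)\<bar> \<le> C * ((3 * (1 + C1)) ^ deg * ?E1 ^ deg)" for l
    proof -
      have "PhiW L l (UU t x) (VV t x) \<le> C * (1 + UU t x + VV t x) ^ deg"
        using C(2,3)[of "UU t x" "VV t x"] sq_ge[of e] unfolding PhiW_def UU_def VV_def by auto
      moreover have "0 \<le> PhiW L l (UU t x) (VV t x)"
        using Phi_U_nonneg[OF UU_pos[of t x] VV_pos[of t x]] Phi_V_nonneg[OF UU_pos[of t x] VV_pos[of t x]] by (simp add: PhiW_def)
      ultimately show ?thesis using mult_left_mono[OF UV C(1)] by linarith
    qed
    have ul: "\<bar>u l t x\<bar> \<le> C0 * ?Q" for l
    proof -
      have "exp (- s0 * t) * (C0 * ?Q) \<le> 1 * (C0 * ?Q)"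
        using s0(1) t C0_ge(2) nn by (intro mult_right_mono) auto
      then show ?thesis using u_le[OF t, of l x] by (simp only: mult.assoc)
    qed
    let ?K = "2 * (C * ((3 * (1 + C1)) ^ deg * ?E1 ^ deg)) * (C0 * ?Q) * (C0 * fl j (x j) * ?Qj)"
    have K: "\<bar>P j (x j) * (2 * PhiW L l (UU t x) (VV t x) * u l t x * ud j l t x)\<bar> \<le> ?K" for l
    proof -
      have "\<bar>P j (x j) * (2 * PhiW L l (UU t x) (VV t x) * u l t x * ud j l t x)\<bar>
        = 2 * \<bar>PhiW L l (UU t x) (VV t x)\<bar> * \<bar>u l t x\<bar> * (P j (x j) * \<bar>ud j l t x\<bar>)"
        using Pj by (simp add: abs_mult mult_ac)
      also have "\<dots> \<le> ?K"
        by (rule mult_mono[OF mult_mono[OF mult_left_mono[OF W] ul] ud_le[of t j x l, OF t Pj, folded fl_def]])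
          (use C(1) C1_nonneg C0_ge(2) nn Pj fl0 in auto)
      finally show ?thesis .
    qed
    have "\<bar>P j (x j) * bd j t x\<bar> \<le> (\<Sum>l\<in>UNIV. \<bar>P j (x j) * (2 * PhiW L l (UU t x) (VV t x) * u l t x * ud j l t x)\<bar>)"
      unfolding bd_def sum_distrib_left by (rule sum_abs)
    also have "\<dots> \<le> (\<Sum>l\<in>(UNIV::'l set). ?K)" by (rule sum_mono[OF K])
    also have "\<dots> = D * fl j (x j) * (?E1 ^ deg * (?Q * ?Qj))"
      by (simp add: D_def mult_ac)
    \<comment> \<open>Every other coordinate receives one square root of \<open>en\<close> from u
      and one from its derivative, which complete the factor \<open>en\<close> of \<open>gg\<close>.
      Coordinate j receives only one, and it is afterwards bounded by 1 + \<open>en\<close>; hence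
      the exponent \<open>Suc deg\<close>.\<close>
    also have "?E1 ^ deg * (?Q * ?Qj) = sqrt (en j (x j)) * (1 + en j (x j)) ^ deg * (\<Prod>i\<in>-{j}. gg i (x i))"
    proof -
      have 1: "?E1 ^ deg = (1 + en j (x j)) ^ deg * (\<Prod>i\<in>-{j}. (1 + en i (x i)) ^ deg)"
        unfolding prod_remove_UNIV[of _ j] by (simp only: power_mult_distrib prod_power_distrib)
      have "?Qj * ?Qj = (\<Prod>i\<in>-{j}. en i (x i))"
        by (simp add: prod.distrib[symmetric] en_nonneg)
      then have 2: "?Q * ?Qj = sqrt (en j (x j)) * (\<Prod>i\<in>-{j}. en i (x i))"
        unfolding prod_remove_UNIV[of _ j] by (simp only: mult.assoc)
      show ?thesis unfolding 1 2 gg_def prod.distrib by (simp only: mult_ac)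
    qed
    also have "D * fl j (x j) * \<dots> \<le> D * fl j (x j) * ((1 + en j (x j)) * (1 + en j (x j)) ^ deg * (\<Prod>i\<in>-{j}. gg i (x i)))"
    proof (intro mult_left_mono mult_right_mono)
      show "sqrt (en j (x j)) \<le> 1 + en j (x j)"
        using en_nonneg[of j "x j"] by (intro real_le_lsqrt) (auto simp: power2_eq_square algebra_simps)
      show "0 \<le> D * fl j (x j)" using \<open>0 \<le> D\<close> fl0 by simp
    qed (auto intro!: prod_nonneg simp: gg_nonneg en_nonneg add_nonneg_nonneg)
    finally show "\<bar>P j (x j) * bd j t x\<bar> \<le> D * (\<Prod>i\<in>-{j}. gg i (x i)) * (fl j (x j) * (1 + en j (x j)) ^ Suc deg)"
      by (simp add: mult_ac)
  qed
qed

definition "cutoff B j c1 c2 \<kappa> l r \<longleftrightarrow> l \<in> X j \<and> r \<in> X j \<and> continuous_on {l..r} \<kappa> \<and> (\<forall>y. 0 \<le> \<kappa> y \<and> \<kappa> y \<le> 1) \<and>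
  (\<forall>y. y \<notin> {l..r} \<longrightarrow> \<kappa> y = 0) \<and> (\<forall>y. c1 \<le> y \<and> y \<le> c2 \<longrightarrow> \<kappa> y = 1) \<and>
  (\<forall>t x. 0 \<le> t \<longrightarrow> x \<in> XX \<longrightarrow>
    \<bar>integral {l..r} (\<lambda>y. \<kappa> y * (w j y * bdd j t (x(j := y))))\<bar> \<le> B * (\<Prod>i\<in>-{j}. gg i (x i)))"

text \<open>\<open>C\<close> is chosen before \<epsilon> and before the interval on which the cutoff
  equals 1. So the error can tend to 0 while these intervals exhaust the domain.\<close>

lemma cutoffs:
  "\<exists>C\<ge>0. \<forall>j \<epsilon> c1 c2. 0 < \<epsilon> \<longrightarrow> c1 \<in> X j \<longrightarrow> c2 \<in> X j \<longrightarrow> c1 \<le> c2 \<longrightarrow> (\<exists>\<kappa> l r. cutoff (C * \<epsilon>) j c1 c2 \<kappa> l r)"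
proof -
  obtain C3 where C3: "0 \<le> C3" "\<And>j t x. 0 \<le> t \<Longrightarrow> x \<in> XX \<Longrightarrow>
    \<bar>P j (x j) * bd j t x\<bar> \<le> C3 * (\<Prod>i\<in>-{j}. gg i (x i)) * (fl j (x j) * (1 + en j (x j)) ^ Suc deg)"
    using bd_le by metis
  define C where "C = max C2 C3"
  have C: "0 \<le> C" "C2 \<le> C" "C3 \<le> C" using C3(1) by (auto simp: C_def)
  show ?thesis
  proof (intro exI[of _ C] conjI C(1) allI impI)
    fix j :: 'd and \<epsilon> c1 c2 :: real assume eps: "0 < (\<epsilon>::real)" and c: "c1 \<in> X j" "c2 \<in> X j" "c1 \<le> c2"
    obtain S where S: "\<And>y. y \<in> X j \<Longrightarrow> (S has_real_derivative 1 / P j y) (at y)"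
    proof -
      have "isCont (\<lambda>y. 1 / P j y) y" if "ereal y > \<sigma> j" "ereal y < \<tau> j" for y
      proof -
        have y: "y \<in> X j" using that by (simp add: einterval_def)
        have "isCont (P j) y" using P_cont y continuous_on_eq_continuous_at[of "X j" "P j"] by auto
        then show ?thesis using P_pos[OF y] by (intro continuous_intros) auto
      qed
      from einterval_antiderivative[OF interval this]
      obtain F where "\<And>y. \<sigma> j < ereal y \<Longrightarrow> ereal y < \<tau> j \<Longrightarrow> (F has_vector_derivative 1 / P j y) (at y)"
        by blast
      then show ?thesis
        by (intro that[of F]) (auto simp: einterval_def has_real_derivative_iff_has_vector_derivative)
    qed
    interpret W: weighted_interval "X j" "P j" S "UNIV \<times> {..N}" "\<lambda>e. \<eta> (fst e) j (snd e)" "\<lambda>e. \<eta>' (fst e) j (snd e)"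
    proof
      show "is_interval (X j)" unfolding is_interval_1
      proof (intro ballI allI impI)
        fix u v y assume "u \<in> X j" "v \<in> X j" "u \<le> y \<and> y \<le> v"
        then have "\<sigma> j < ereal u" "ereal u \<le> ereal y" "ereal y \<le> ereal v" "ereal v < \<tau> j"
          by (auto simp: einterval_def)
        then show "y \<in> X j" unfolding einterval_def
          using less_le_trans[of "\<sigma> j" "ereal u" "ereal y"] le_less_trans[of "ereal y" "ereal v" "\<tau> j"] by simp
      qed
    qed (use P_pos S \<eta>_deriv in auto)
    have gr: "W.gr n y = (1 + en j y) ^ n" and flux: "W.flux y = fl j y" for n y
      by (simp_all add: W.gr_def en_def W.flux_def fl_def)
    obtain \<kappa> l r where k: "l \<in> X j" "r \<in> X j" "continuous_on {l..r} \<kappa>" "\<And>y. 0 \<le> \<kappa> y" "\<And>y. \<kappa> y \<le> 1"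
      "\<And>y. y \<notin> {l..r} \<Longrightarrow> \<kappa> y = 0" "\<And>y. c1 \<le> y \<Longrightarrow> y \<le> c2 \<Longrightarrow> \<kappa> y = 1"
      and kb: "\<And>b b' h D. (\<And>y. y \<in> X j \<Longrightarrow> (b has_real_derivative b' y) (at y)) \<Longrightarrow>
      (\<And>y. y \<in> X j \<Longrightarrow> ((\<lambda>y. P j y * b' y) has_real_derivative h y) (at y)) \<Longrightarrow> 0 \<le> D \<Longrightarrow>
      (\<And>y. y \<in> X j \<Longrightarrow> \<bar>b y\<bar> \<le> D * W.gr (Suc deg) y) \<Longrightarrow>
      (\<And>y. y \<in> X j \<Longrightarrow> \<bar>P j y * b' y\<bar> \<le> D * (W.flux y * W.gr (Suc deg) y)) \<Longrightarrow>
      \<bar>integral {l..r} (\<lambda>y. \<kappa> y * h y)\<bar> \<le> D * \<epsilon>"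
      by (rule W.cutoff_exists[where N = "Suc deg", OF _ _ c eps]) (use decay_r decay_l in blast)+
    have "\<bar>integral {l..r} (\<lambda>y. \<kappa> y * (w j y * bdd j t (x(j := y))))\<bar> \<le> C * (\<Prod>i\<in>-{j}. gg i (x i)) * \<epsilon>"
      if t: "0 \<le> t" and x: "x \<in> XX" for t x
    proof (rule kb[OF DERIV_b_x DERIV_bd_x])
      let ?G = "\<Prod>i\<in>-{j}. gg i (x i)"
      have G: "0 \<le> ?G" by (intro prod_nonneg) (auto simp: gg_nonneg)
      then show "0 \<le> C * ?G" using C by simp
      fix y assume y: "y \<in> X j"
      have upd: "(\<Prod>i\<in>-{j}. gg i ((x(j := y)) i)) = ?G" by (intro prod.cong) auto
      have "b t (x(j := y)) \<le> exp (- s0 * t) * (C2 * (gg j y * ?G))"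
        using b_le[OF t, of "x(j := y)"] unfolding prod_remove_UNIV[of _ j] upd by simp
      also have "\<dots> \<le> 1 * (C * ((1 + en j y) ^ Suc deg * ?G))"
      proof (intro mult_mono)
        show "gg j y \<le> (1 + en j y) ^ Suc deg"
          unfolding gg_def power_Suc using en_nonneg[of j y] by (intro mult_right_mono) auto
      qed (use C C2_nonneg s0(1) t G gg_nonneg en_nonneg in auto)
      finally show "\<bar>b t (x(j := y))\<bar> \<le> C * ?G * W.gr (Suc deg) y"
        using b_nonneg by (simp add: gr mult_ac)
      have "\<bar>P j y * bd j t (x(j := y))\<bar> \<le> C3 * ?G * (fl j y * (1 + en j y) ^ Suc deg)"
        using C3(2)[OF t XX_upd[OF x y], of j] unfolding upd by simp
      also have "\<dots> \<le> C * ?G * (fl j y * (1 + en j y) ^ Suc deg)"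
        using C G P_pos[OF y] en_nonneg by (intro mult_right_mono mult_nonneg_nonneg) (auto simp: fl_def intro!: sum_nonneg add_nonneg_nonneg)
      finally show "\<bar>P j y * bd j t (x(j := y))\<bar> \<le> C * ?G * (W.flux y * W.gr (Suc deg) y)"
        by (simp only: gr flux)
    qed
    then have "cutoff (C * \<epsilon>) j c1 c2 \<kappa> l r"
      unfolding cutoff_def using k by (simp add: mult_ac)
    then show "\<exists>\<kappa> l r. cutoff (C * \<epsilon>) j c1 c2 \<kappa> l r" by blast
  qed
qed

end

section \<open>Measurability of continuous functions and of cutoffs on the product space\<close>

lemma continuous_on_measurable_product:
  fixes F :: "real \<times> ('d::finite \<Rightarrow> real) \<Rightarrow> real"
  assumes F: "continuous_on (UNIV \<times> {x. \<forall>j. x j \<in> einterval (\<sigma> j) (\<tau> j)}) F"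
  shows "F \<in> borel_measurable (weighted_measure a b v \<Otimes>\<^sub>M product_measure \<sigma> \<tau> w)"
proof -
  let ?S = "UNIV \<times> {x. \<forall>j. x j \<in> einterval (\<sigma> j) (\<tau> j)} :: (real \<times> ('d \<Rightarrow> real)) set"
  let ?N = "weighted_measure a b v \<Otimes>\<^sub>M product_measure \<sigma> \<tau> w"
  have id1: "(\<lambda>t. t) \<in> measurable (weighted_measure a b v) borel"
    by (intro borel_measurable_weighted_measure continuous_on_id)
  have "(\<lambda>x j. x j) \<in> measurable (product_measure \<sigma> \<tau> w) (Pi\<^sub>M UNIV (\<lambda>_. borel))"
    by (rule measurable_PiM_single')
      (auto intro: borel_measurable_component_product_measure continuous_on_id)
  then have id2: "(\<lambda>x. x) \<in> measurable (product_measure \<sigma> \<tau> w) borel"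
    using measurable_cong_sets[OF refl sets_PiM_equal_borel] by auto
  have "(\<lambda>z. (fst z, snd z)) \<in> measurable ?N (borel \<Otimes>\<^sub>M borel)"
    using measurable_compose[OF measurable_fst id1] measurable_compose[OF measurable_snd id2]
    by (intro measurable_Pair) auto
  then have "(\<lambda>z. z) \<in> measurable ?N (borel :: (real \<times> ('d \<Rightarrow> real)) measure)"
    by (simp add: borel_prod)
  then have "(\<lambda>z. z) \<in> measurable ?N (restrict_space borel ?S)"
    by (rule measurable_restrict_space2[rotated]) (auto simp: space_pair_measure space_product_measure)
  from measurable_compose[OF this borel_measurable_continuous_on_restrict[OF F]] show ?thesis .
qed

lemma borel_measurable_compact_support:
  fixes \<kappa> :: "real \<Rightarrow> real"
  assumes "continuous_on {l..r} \<kappa>" "\<And>y. y \<notin> {l..r} \<Longrightarrow> \<kappa> y = 0"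
  shows "\<kappa> \<in> borel_measurable borel"
proof -
  have "(\<lambda>y. indicator {l..r} y *\<^sub>R \<kappa> y) \<in> borel_measurable borel"
    by (rule borel_measurable_continuous_on_indicator[OF _ assms(1)]) simp
  moreover have "(\<lambda>y. indicator {l..r} y *\<^sub>R \<kappa> y) = \<kappa>"
    using assms(2) by (auto simp: fun_eq_iff indicator_def)
  ultimately show ?thesis by simp
qed

lemma borel_measurable_prod_compact_support:
  fixes \<kappa> :: "'d::finite \<Rightarrow> real \<Rightarrow> real"
  assumes "\<And>j. continuous_on {l j..r j} (\<kappa> j)" "\<And>j y. y \<notin> {l j..r j} \<Longrightarrow> \<kappa> j y = 0"
  shows "(\<lambda>x. \<Prod>j\<in>UNIV. \<kappa> j (x j)) \<in> borel_measurable (product_measure \<sigma> \<tau> w)"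
  by (intro borel_measurable_prod measurable_compose[OF _ borel_measurable_compact_support[OF assms]]
      borel_measurable_component_product_measure continuous_on_id)

section \<open>The integrated inequality with cutoffs, and their removal\<close>

context sl_bellman begin

lemma UV_continuous:
  "continuous_on (UNIV \<times> XX) (\<lambda>z. UU (fst z) (snd z))" "continuous_on (UNIV \<times> XX) (\<lambda>z. VV (fst z) (snd z))"
  unfolding UU_def VV_def by (intro continuous_on_sq u_continuous)+

lemma b_continuous:
  "continuous_on (UNIV \<times> XX) (\<lambda>z. btt (fst z) (snd z))"
  "continuous_on (UNIV \<times> XX) (\<lambda>z. bdd j (fst z) (snd z))"
proof -
  have W: "continuous_on (UNIV \<times> XX) (\<lambda>z. PhiW L l (UU (fst z) (snd z)) (VV (fst z) (snd z)))" for l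
    by (intro continuous_on_PhiW UV_continuous UU_pos VV_pos)
  have H: "continuous_on (UNIV \<times> XX) (\<lambda>z. Hess L (UU (fst z) (snd z)) (VV (fst z) (snd z)) (\<lambda>l. u l (fst z) (snd z)) (\<lambda>l. a l z))"
    if "\<And>l. continuous_on (UNIV \<times> XX) (a l)" for a
    by (intro continuous_on_Hess[where z = "\<lambda>l z. u l (fst z) (snd z)"] UV_continuous UU_pos VV_pos u_continuous that)
  have Pw: "continuous_on (UNIV \<times> XX) (\<lambda>z. P j (snd z j) / w j (snd z j))"
    by (intro continuous_on_divide continuous_on_comp[of j] P_cont w_cont) (use w_pos XX_D in force)
  show "continuous_on (UNIV \<times> XX) (\<lambda>z. btt (fst z) (snd z))"
    unfolding btt_def
    by (intro continuous_on_add continuous_on_sum continuous_on_mult continuous_on_const W H u_continuous)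
  show "continuous_on (UNIV \<times> XX) (\<lambda>z. bdd j (fst z) (snd z))"
    unfolding bdd_def
    by (intro continuous_on_add continuous_on_sum continuous_on_mult continuous_on_const W H u_continuous Pw)
qed

lemma continuous_slice:
  assumes "continuous_on (UNIV \<times> XX) (\<lambda>z. F (fst z) (snd z) :: real)" "continuous_on S f" "continuous_on S g" "g ` S \<subseteq> XX"
  shows "continuous_on S (\<lambda>y. F (f y) (g y))"
  by (rule continuous_on_compose2[OF assms(1), of S "\<lambda>y. (f y, g y)", simplified])
    (use assms in \<open>auto intro!: continuous_on_Pair\<close>)

lemma b_measurable: "(\<lambda>x. b t x) \<in> borel_measurable M"
proof -
  have c: "continuous_on (UNIV \<times> XX) (\<lambda>z. UU t (snd z))" "continuous_on (UNIV \<times> XX) (\<lambda>z. VV t (snd z))"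
    by (intro continuous_slice[OF UV_continuous(1)] continuous_slice[OF UV_continuous(2)] continuous_on_snd
        continuous_on_id continuous_on_const; auto)+
  have "continuous_on (UNIV \<times> XX) (\<lambda>z. b t (snd z))"
    unfolding b_eq Phi_def Zf_def
    by (intro continuous_on_diff continuous_on_add continuous_on_mult continuous_on_const continuous_on_powr c)
      (use UU_pos VV_pos in \<open>force simp: less_imp_neq[symmetric] add_pos_nonneg\<close>)+
  \<comment> \<open>The time factor is a dummy that makes the measurability result for pairs
    applicable; fixing its value at 1 / 2 gives the statement on \<open>M\<close>.\<close>
  then have m: "(\<lambda>z. b t (snd z)) \<in> borel_measurable (weighted_measure 0 1 (\<lambda>_. 1) \<Otimes>\<^sub>M M)"
    unfolding XX_def by (rule continuous_on_measurable_product)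
  have "1 / 2 \<in> space (weighted_measure 0 1 (\<lambda>_. 1))"
    by (simp add: einterval_def zero_ereal_def one_ereal_def)
  from measurable_compose[OF measurable_Pair1'[OF this] m] show ?thesis by simp
qed

lemma b_integrable:
  assumes t: "0 \<le> t"
  shows "integrable M (\<lambda>x. b t x)"
    "(\<integral>x. b t x \<partial>M) \<le> exp (- s0 * t) * (C2 * (\<integral>x. (\<Prod>j\<in>UNIV. gg j (x j)) \<partial>M))"
proof -
  have i: "integrable M (\<lambda>x. exp (- s0 * t) * (C2 * (\<Prod>j\<in>UNIV. gg j (x j))))"
    unfolding M_eq by (intro integrable_mult_right gg_prod_int)
  show 1: "integrable M (\<lambda>x. b t x)"
  proof (rule Bochner_Integration.integrable_bound[OF i])
    show "AE x in M. norm (b t x) \<le> norm (exp (- s0 * t) * (C2 * (\<Prod>j\<in>UNIV. gg j (x j))))"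
      using b_le[OF t] b_nonneg by (intro AE_I2) (auto intro: order_trans[OF _ abs_ge_self])
  qed (rule b_measurable)
  show "(\<integral>x. b t x \<partial>M) \<le> exp (- s0 * t) * (C2 * (\<integral>x. (\<Prod>j\<in>UNIV. gg j (x j)) \<partial>M))"
    using integral_mono[OF 1 i b_le[OF t]] by simp
qed

text \<open>Fubini is used in a different order for each term. The time derivative is integrated in
  t first, where the tent leaves values of \<open>b\<close>; the derivative in coordinate j is
  integrated in x j first, where the cutoff leaves an error with the factor
  \<open>d\<close>.\<close>

lemma cut_inequality:
  fixes J :: "real \<Rightarrow> ('d \<Rightarrow> real) \<Rightarrow> real"
  assumes T: "0 < T"
    and lr: "\<And>j. l j \<in> X j" "\<And>j. r j \<in> X j"
    and k: "\<And>j. continuous_on {l j..r j} (\<kappa> j)" "\<And>j y. 0 \<le> \<kappa> j y" "\<And>j y. \<kappa> j y \<le> 1"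
      "\<And>j y. y \<notin> {l j..r j} \<Longrightarrow> \<kappa> j y = 0"
    and d: "0 \<le> d" "\<And>j t x. 0 \<le> t \<Longrightarrow> x \<in> XX \<Longrightarrow>
      \<bar>integral {l j..r j} (\<lambda>y. \<kappa> j y * (w j y * bdd j t (x(j := y))))\<bar> \<le> d * (\<Prod>i\<in>-{j}. gg i (x i))"
    and Jc: "continuous_on (UNIV \<times> XX) (\<lambda>z. J (fst z) (snd z))"
    and Jle: "\<And>t x. 0 \<le> t \<Longrightarrow> x \<in> XX \<Longrightarrow> J t x \<le> btt t x + (\<Sum>j\<in>UNIV. bdd j t x)"
  defines "\<nu> \<equiv> weighted_measure 0 (ereal (2 * T)) (tent T)"
  shows "(\<integral>t. (\<integral>x. (\<Prod>j\<in>UNIV. \<kappa> j (x j)) * J t x \<partial>M) \<partial>\<nu>)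
    \<le> (\<integral>x. b 0 x \<partial>M) + (\<integral>x. b (2 * T) x \<partial>M)
      + d * (measure \<nu> (space \<nu>) * (\<Sum>j\<in>UNIV. \<integral>x. (\<Prod>i\<in>-{j}. gg i (x i)) \<partial>Pi\<^sub>M (-{j}) \<mu>))"
proof -
  interpret nu: weight 0 "ereal (2 * T)" "tent T" by (rule weight_tent[OF T])
  have sp: "space \<nu> = {0<..<2 * T}"
    by (auto simp: \<nu>_def einterval_def zero_ereal_def)
  interpret N: sigma_finite_measure \<nu> unfolding \<nu>_def by (rule nu.sigma_finite)
  interpret MM: sigma_finite_measure M unfolding M_eq by (rule sigma_finite) simp
  interpret NM: pair_sigma_finite \<nu> M ..
  define Ch where "Ch x = (\<Prod>j\<in>UNIV. \<kappa> j (x j))" for x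
  define Box where "Box = {x. \<forall>j. x j \<in> {l j..r j}}"
  have sub: "y \<in> X j" if "y \<in> {l j..r j}" for y j
    using that lr[of j] by (auto simp: einterval_def intro: less_le_trans le_less_trans)
       (metis ereal_less_eq(3) less_le_trans le_less_trans)+
  have Box_XX: "Box \<subseteq> XX" using sub by (auto simp: Box_def XX_def)
  have Box_compact: "compact Box"
  proof -
    have "compactin (product_topology (\<lambda>_. euclidean) UNIV) (PiE UNIV (\<lambda>j. {l j..r j}))"
      by (simp add: compactin_PiE)
    then show ?thesis by (simp add: euclidean_product_topology Box_def PiE_UNIV_domain Pi_def)
  qed
  have Ch0: "Ch x = 0" if "x \<notin> Box" for x
    using that k(4) by (auto simp: Ch_def Box_def)
  have Ch01: "0 \<le> Ch x" "Ch x \<le> 1" for x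
    unfolding Ch_def using k by (auto intro!: prod_nonneg prod_le_1)
  have k_meas: "\<kappa> j \<in> borel_measurable borel" for j
    by (rule borel_measurable_compact_support[OF k(1,4)])
  have Ch_meas [measurable]: "Ch \<in> borel_measurable M"
    unfolding Ch_def by (rule borel_measurable_prod_compact_support[OF k(1,4)])
  have Box_sets: "Box \<in> sets M"
  proof -
    have "Pi\<^sub>E UNIV (\<lambda>j. {l j..r j}) \<in> sets (Pi\<^sub>M UNIV \<mu>)"
      by (rule sets_PiM_I_finite) (use sub in \<open>auto simp: sets_restrict_space intro!: image_eqI[of _ _ "{l _..r _}"]\<close>)
    then show ?thesis unfolding M_eq Box_def by (simp add: PiE_UNIV_domain Pi_def)
  qed
  have emBox: "emeasure M Box < \<infinity>"
  proof -
    have fin: "emeasure (\<mu> j) {l j..r j} < \<infinity>" for j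
    proof -
      have "continuous_on {l j..r j} (w j)" using continuous_on_subset[OF w_cont] sub by blast
      then obtain B where "\<And>y. y \<in> {l j..r j} \<Longrightarrow> w j y \<le> B"
        using compact_continuous_image[of "{l j..r j}" "w j"] compact_imp_bounded bounded_real
        by (smt (verit, best) compact_Icc image_eqI)
      then have "emeasure (\<mu> j) ({l j..r j} \<inter> X j) < \<infinity>"
        by (intro weight.emeasure_Icc_finite[OF weight_w]) auto
      moreover have "{l j..r j} \<inter> X j = {l j..r j}" using sub by auto
      ultimately show ?thesis by simp
    qed
    have "emeasure M Box = (\<Prod>j\<in>UNIV. emeasure (\<mu> j) {l j..r j})"
      unfolding M_eq Box_def
      by (subst emeasure_PiM[symmetric])
        (use sub in \<open>auto simp: PiE_UNIV_domain Pi_def sets_restrict_space intro!: image_eqI[of _ _ "{l _..r _}"]\<close>)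
    also have "\<dots> < \<infinity>" using fin by (auto simp: less_top[symmetric] ennreal_prod_eq_top)
    finally show ?thesis .
  qed
  have em\<nu>: "emeasure \<nu> (space \<nu>) < \<infinity>"
  proof -
    have "emeasure \<nu> ({0..2 * T} \<inter> einterval 0 (ereal (2 * T))) < \<infinity>"
      unfolding \<nu>_def by (rule nu.emeasure_Icc_finite[of _ _ "2 * T"]) (use T in \<open>auto simp: tent_def\<close>)
    moreover have "{0..2 * T} \<inter> einterval 0 (ereal (2 * T)) = space \<nu>"
      unfolding sp by (auto simp: einterval_def zero_ereal_def)
    ultimately show ?thesis by simp
  qed
  have meas: "(\<lambda>z. F (fst z) (snd z)) \<in> borel_measurable (\<nu> \<Otimes>\<^sub>M M)"
    if "continuous_on (UNIV \<times> XX) (\<lambda>z. F (fst z) (snd z))" for F :: "real \<Rightarrow> ('d \<Rightarrow> real) \<Rightarrow> real"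
    unfolding \<nu>_def by (rule continuous_on_measurable_product) (use that in \<open>simp add: XX_def\<close>)
  \<comment> \<open>The cutoff confines everything to a compact box of finite measure, on which
    continuous functions are bounded; this justifies all exchanges of integrals below.\<close>
  have int: "integrable (\<nu> \<Otimes>\<^sub>M M) (\<lambda>z. Ch (snd z) * F (fst z) (snd z))"
    if F: "continuous_on (UNIV \<times> XX) (\<lambda>z. F (fst z) (snd z))" for F :: "real \<Rightarrow> ('d \<Rightarrow> real) \<Rightarrow> real"
  proof -
    have "compact ((\<lambda>z. F (fst z) (snd z)) ` ({0..2 * T} \<times> Box))"
      by (intro compact_continuous_image compact_Times Box_compact compact_Icc continuous_on_subset[OF F])
        (use Box_XX in auto)
    from compact_imp_bounded[OF this] obtain B
      where B': "\<And>v. v \<in> (\<lambda>z. F (fst z) (snd z)) ` ({0..2 * T} \<times> Box) \<Longrightarrow> norm v \<le> B"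
      unfolding bounded_iff by blast
    have B: "\<bar>F t x\<bar> \<le> B" if "t \<in> {0..2 * T}" "x \<in> Box" for t x
      using B'[OF imageI[of "(t, x)"]] that by simp
    show ?thesis
    proof (rule integrableI_bounded_set[where A = "space \<nu> \<times> Box" and B = B])
      show "space \<nu> \<times> Box \<in> sets (\<nu> \<Otimes>\<^sub>M M)" using Box_sets by auto
      show "(\<lambda>z. Ch (snd z) * F (fst z) (snd z)) \<in> borel_measurable (\<nu> \<Otimes>\<^sub>M M)"
        by (intro borel_measurable_times meas F measurable_compose[OF measurable_snd Ch_meas])
      show "emeasure (\<nu> \<Otimes>\<^sub>M M) (space \<nu> \<times> Box) < \<infinity>"
        using em\<nu> emBox Box_sets by (simp add: MM.emeasure_pair_measure_Times ennreal_mult_less_top)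
      have "\<bar>Ch x * F t x\<bar> \<le> B" if "t \<in> space \<nu>" "x \<in> Box" for t x
      proof -
        have "\<bar>Ch x * F t x\<bar> \<le> 1 * \<bar>F t x\<bar>" unfolding abs_mult using Ch01[of x] by (intro mult_right_mono) auto
        also have "\<dots> \<le> B" using B[of t x] that by (auto simp: sp)
        finally show ?thesis by simp
      qed
      then show "AE z in \<nu> \<Otimes>\<^sub>M M. z \<in> space \<nu> \<times> Box \<longrightarrow> norm (Ch (snd z) * F (fst z) (snd z)) \<le> B"
        by (intro AE_I2) auto
      show "AE z in \<nu> \<Otimes>\<^sub>M M. z \<notin> space \<nu> \<times> Box \<longrightarrow> Ch (snd z) * F (fst z) (snd z) = 0"
      proof (intro AE_I2 impI)
        fix z assume "z \<in> space (\<nu> \<Otimes>\<^sub>M M)" "z \<notin> space \<nu> \<times> Box"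
        then have "snd z \<notin> Box" by (auto simp: space_pair_measure)
        then show "Ch (snd z) * F (fst z) (snd z) = 0" using Ch0 by simp
      qed
    qed
  qed
  note intJ = int[OF Jc] and int1 = int[OF b_continuous(1)] and int2 = int[OF b_continuous(2)]
  have "(\<integral>t. (\<integral>x. Ch x * J t x \<partial>M) \<partial>\<nu>) = (\<integral>z. Ch (snd z) * J (fst z) (snd z) \<partial>(\<nu> \<Otimes>\<^sub>M M))"
    using NM.integral_fst'[OF intJ] by simp
  also have "\<dots> \<le> (\<integral>z. Ch (snd z) * btt (fst z) (snd z) + (\<Sum>j\<in>UNIV. Ch (snd z) * bdd j (fst z) (snd z)) \<partial>(\<nu> \<Otimes>\<^sub>M M))"
  proof (rule integral_mono[OF intJ])
    show "integrable (\<nu> \<Otimes>\<^sub>M M) (\<lambda>z. Ch (snd z) * btt (fst z) (snd z) + (\<Sum>j\<in>UNIV. Ch (snd z) * bdd j (fst z) (snd z)))"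
      by (intro Bochner_Integration.integrable_add Bochner_Integration.integrable_sum int1 int2)
    fix z assume "z \<in> space (\<nu> \<Otimes>\<^sub>M M)"
    then have z: "0 \<le> fst z" "snd z \<in> XX" by (auto simp: space_pair_measure sp space_M)
    show "Ch (snd z) * J (fst z) (snd z) \<le> Ch (snd z) * btt (fst z) (snd z) + (\<Sum>j\<in>UNIV. Ch (snd z) * bdd j (fst z) (snd z))"
      using mult_left_mono[OF Jle[OF z] Ch01(1)[of "snd z"]] by (simp add: distrib_left sum_distrib_left)
  qed
  also have "\<dots> = (\<integral>z. Ch (snd z) * btt (fst z) (snd z) \<partial>(\<nu> \<Otimes>\<^sub>M M))
     + (\<Sum>j\<in>UNIV. \<integral>z. Ch (snd z) * bdd j (fst z) (snd z) \<partial>(\<nu> \<Otimes>\<^sub>M M))"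
    by (subst Bochner_Integration.integral_add)
      (auto intro: int1 int2 Bochner_Integration.integrable_sum simp: Bochner_Integration.integral_sum[OF int2])
  finally have main: "(\<integral>t. (\<integral>x. Ch x * J t x \<partial>M) \<partial>\<nu>) \<le> \<dots>" .
  have part1: "(\<integral>z. Ch (snd z) * btt (fst z) (snd z) \<partial>(\<nu> \<Otimes>\<^sub>M M)) \<le> (\<integral>x. b 0 x \<partial>M) + (\<integral>x. b (2 * T) x \<partial>M)"
  proof -
    have inner: "(\<integral>t. Ch x * btt t x \<partial>\<nu>) = Ch x * (b 0 x - 2 * b T x + b (2 * T) x)" if x: "x \<in> XX" for x
    proof -
      have c: "continuous_on S (\<lambda>t. btt t x)" for S
        by (intro continuous_slice[OF b_continuous(1)] continuous_intros) (use x in auto)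
      have "(\<integral>t. btt t x \<partial>\<nu>) = integral {0..2 * T} (\<lambda>t. tent T t * btt t x)"
        unfolding \<nu>_def
        by (rule nu.integral_compact_support)
          (auto intro!: borel_measurable_weighted_measure c continuous_on_mult simp: einterval_def zero_ereal_def tent_def[abs_def] continuous_intros)
      also have "\<dots> = b 0 x - 2 * b T x + b (2 * T) x"
        by (rule integral_unique[OF tent_integral[OF T DERIV_b_t DERIV_bt_t]])
      finally show ?thesis by simp
    qed
    have "(\<integral>z. Ch (snd z) * btt (fst z) (snd z) \<partial>(\<nu> \<Otimes>\<^sub>M M)) = (\<integral>x. (\<integral>t. Ch x * btt t x \<partial>\<nu>) \<partial>M)"
      using NM.integral_snd[of "\<lambda>t x. Ch x * btt t x"] int1 by (simp add: case_prod_unfold)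
    also have "\<dots> = (\<integral>x. Ch x * (b 0 x - 2 * b T x + b (2 * T) x) \<partial>M)"
      by (rule Bochner_Integration.integral_cong[OF refl]) (simp only: space_M inner)
    also have "\<dots> \<le> (\<integral>x. b 0 x + b (2 * T) x \<partial>M)"
    proof (rule integral_mono)
      have i: "integrable M (\<lambda>x. b 0 x - 2 * b T x + b (2 * T) x)"
        using T by (intro Bochner_Integration.integrable_add Bochner_Integration.integrable_diff integrable_mult_right b_integrable) auto
      show "integrable M (\<lambda>x. Ch x * (b 0 x - 2 * b T x + b (2 * T) x))"
      proof (rule Bochner_Integration.integrable_bound[OF i])
        show "(\<lambda>x. Ch x * (b 0 x - 2 * b T x + b (2 * T) x)) \<in> borel_measurable M"
          using borel_measurable_integrable[OF i] by measurable
        have "\<bar>Ch x\<bar> * \<bar>g\<bar> \<le> 1 * \<bar>g\<bar>" for x g using Ch01[of x] by (intro mult_right_mono) auto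
        then show "AE x in M. norm (Ch x * (b 0 x - 2 * b T x + b (2 * T) x)) \<le> norm (b 0 x - 2 * b T x + b (2 * T) x)"
          unfolding real_norm_def abs_mult by (intro AE_I2) simp
      qed
      show "integrable M (\<lambda>x. b 0 x + b (2 * T) x)"
        using T by (intro Bochner_Integration.integrable_add b_integrable) auto
      \<comment> \<open>The middle value - 2 * b T x is dropped, which is allowed because
        \<open>b\<close> is nonnegative.\<close>
      show "Ch x * (b 0 x - 2 * b T x + b (2 * T) x) \<le> b 0 x + b (2 * T) x" for x
      proof -
        have "Ch x * (b 0 x - 2 * b T x + b (2 * T) x) \<le> Ch x * (b 0 x + b (2 * T) x)"
          using b_nonneg[of T x] Ch01[of x] by (intro mult_left_mono) auto
        also have "\<dots> \<le> 1 * (b 0 x + b (2 * T) x)"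
          using Ch01[of x] b_nonneg by (intro mult_right_mono add_nonneg_nonneg) auto
        finally show ?thesis by simp
      qed
    qed
    also have "\<dots> = (\<integral>x. b 0 x \<partial>M) + (\<integral>x. b (2 * T) x \<partial>M)"
      using T by (intro Bochner_Integration.integral_add b_integrable) auto
    finally show ?thesis .
  qed
  have part2: "(\<integral>z. Ch (snd z) * bdd j (fst z) (snd z) \<partial>(\<nu> \<Otimes>\<^sub>M M))
     \<le> d * (measure \<nu> (space \<nu>) * (\<integral>x. (\<Prod>i\<in>-{j}. gg i (x i)) \<partial>Pi\<^sub>M (-{j}) \<mu>))" for j
  proof -
    let ?G = "\<integral>x. (\<Prod>i\<in>-{j}. gg i (x i)) \<partial>Pi\<^sub>M (-{j}) \<mu>"
    have G: "0 \<le> ?G" by (intro integral_nonneg_AE AE_I2 prod_nonneg) (auto simp: gg_nonneg)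
    have inner: "\<bar>\<integral>x. Ch x * bdd j t x \<partial>M\<bar> \<le> d * ?G" if t: "0 \<le> t" for t
    proof (cases "integrable M (\<lambda>x. Ch x * bdd j t x)")
      case True
      then have eq: "(\<integral>x. Ch x * bdd j t x \<partial>M) = (\<integral>x. (\<integral>y. Ch (x(j := y)) * bdd j t (x(j := y)) \<partial>\<mu> j) \<partial>Pi\<^sub>M (-{j}) \<mu>)"
        unfolding M_eq by (rule integral_split)
      have "\<bar>\<integral>x. (\<integral>y. Ch (x(j := y)) * bdd j t (x(j := y)) \<partial>\<mu> j) \<partial>Pi\<^sub>M (-{j}) \<mu>\<bar> \<le> (\<integral>x. d * (\<Prod>i\<in>-{j}. gg i (x i)) \<partial>Pi\<^sub>M (-{j}) \<mu>)"
      proof (rule abs_integral_le)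
        show "integrable (Pi\<^sub>M (-{j}) \<mu>) (\<lambda>x. d * (\<Prod>i\<in>-{j}. gg i (x i)))"
          by (intro integrable_mult_right gg_prod_int)
        fix x assume "x \<in> space (Pi\<^sub>M (-{j}) \<mu>)"
        then have xi: "\<And>i. i \<noteq> j \<Longrightarrow> x i \<in> X i" by (auto simp: space_PiM PiE_def Pi_def)
        \<comment> \<open>A point of the product over the remaining coordinates says nothing about
          coordinate j; any point of \<open>X j\<close> completes it to a point of the
          domain.\<close>
        define x' where "x' = x(j := l j)"
        have x': "x' \<in> XX" using xi lr by (auto simp: XX_def x'_def)
        have upd: "x(j := y) = x'(j := y)" for y by (simp add: x'_def)
        have G': "(\<Prod>i\<in>-{j}. gg i (x' i)) = (\<Prod>i\<in>-{j}. gg i (x i))"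
          unfolding x'_def by (intro prod.cong) auto
        have Chu: "Ch (x(j := y)) = (\<Prod>i\<in>-{j}. \<kappa> i (x i)) * \<kappa> j y" for y
          unfolding Ch_def by (subst prod_remove_UNIV[of _ j]) (auto intro!: prod.cong simp: mult.commute)
        have c: "continuous_on (X j) (\<lambda>y. bdd j t (x'(j := y)))"
        proof (intro continuous_slice[OF b_continuous(2)] continuous_on_const)
          show "continuous_on (X j) (\<lambda>y. x'(j := y))"
          proof (rule continuous_on_coordinatewise_then_product)
            show "continuous_on (X j) (\<lambda>y. (x'(j := y)) i)" for i
              by (cases "i = j") (auto intro: continuous_on_id)
          qed
        qed (intro image_subsetI XX_upd[OF x'])
        have "(\<integral>y. \<kappa> j y * bdd j t (x'(j := y)) \<partial>\<mu> j) = integral {l j..r j} (\<lambda>y. \<kappa> j y * (w j y * bdd j t (x'(j := y))))"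
        proof (rule weight.integral_compact_support[OF weight_w])
          show "(\<lambda>y. \<kappa> j y * bdd j t (x'(j := y))) \<in> borel_measurable (\<mu> j)"
            by (intro borel_measurable_times borel_measurable_weighted_measure[OF c]
                measurable_compose[OF borel_measurable_weighted_measure k_meas] continuous_on_id)
          show "continuous_on {l j..r j} (\<lambda>y. \<kappa> j y * (w j y * bdd j t (x'(j := y))))"
            by (intro continuous_on_mult k(1) continuous_on_subset[OF w_cont] continuous_on_subset[OF c]) (use sub in auto)
        qed (use sub k(4) in auto)
        then have "\<bar>\<integral>y. Ch (x(j := y)) * bdd j t (x(j := y)) \<partial>\<mu> j\<bar>
          = (\<Prod>i\<in>-{j}. \<kappa> i (x i)) * \<bar>integral {l j..r j} (\<lambda>y. \<kappa> j y * (w j y * bdd j t (x'(j := y))))\<bar>"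
          unfolding upd Chu[unfolded upd] mult.assoc using k(2) by (simp add: abs_mult prod_nonneg)
        also have "\<dots> \<le> 1 * (d * (\<Prod>i\<in>-{j}. gg i (x' i)))"
          using d(2)[OF t x', of j] k(2,3) by (intro mult_mono prod_le_1) auto
        finally show "\<bar>\<integral>y. Ch (x(j := y)) * bdd j t (x(j := y)) \<partial>\<mu> j\<bar> \<le> d * (\<Prod>i\<in>-{j}. gg i (x i))"
          by (simp add: G')
      qed
      then show ?thesis unfolding eq by simp
    next
      case False
      then show ?thesis using d(1) G by (simp add: not_integrable_integral_eq)
    qed
    have "(\<integral>z. Ch (snd z) * bdd j (fst z) (snd z) \<partial>(\<nu> \<Otimes>\<^sub>M M)) = (\<integral>t. (\<integral>x. Ch x * bdd j t x \<partial>M) \<partial>\<nu>)"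
      using NM.integral_fst'[OF int2[of j]] by simp
    also have "\<dots> \<le> \<bar>\<dots>\<bar>" by simp
    also have "\<dots> \<le> (\<integral>t. d * ?G \<partial>\<nu>)"
      by (rule abs_integral_le) (use em\<nu> inner in \<open>auto simp: sp intro!: finite_measure.integrable_const finite_measureI\<close>)
    also have "\<dots> = d * (measure \<nu> (space \<nu>) * ?G)" by simp
    finally show ?thesis .
  qed
  have "(\<Sum>j\<in>UNIV. \<integral>z. Ch (snd z) * bdd j (fst z) (snd z) \<partial>(\<nu> \<Otimes>\<^sub>M M))
    \<le> (\<Sum>j\<in>UNIV. d * (measure \<nu> (space \<nu>) * (\<integral>x. (\<Prod>i\<in>-{j}. gg i (x i)) \<partial>Pi\<^sub>M (-{j}) \<mu>)))"
    by (intro sum_mono part2)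
  then show ?thesis using main part1 unfolding Ch_def[symmetric] by (simp add: sum_distrib_left)
qed

lemma main_inequality:
  fixes Q :: "'q set" and \<gamma> \<theta> :: "'q \<Rightarrow> real" and F :: "'q \<Rightarrow> ('d \<Rightarrow> real) \<Rightarrow> real"
  assumes Q: "finite Q" and \<theta>: "\<And>a. a \<in> Q \<Longrightarrow> 0 < \<theta> a"
    and Fc: "\<And>a. a \<in> Q \<Longrightarrow> continuous_on XX (F a)" and Fi: "\<And>a. a \<in> Q \<Longrightarrow> integrable M (F a)"
    and le: "\<And>t x. 0 \<le> t \<Longrightarrow> x \<in> XX \<Longrightarrow>
      (\<Sum>a\<in>Q. \<gamma> a * exp (- \<theta> a * t) * F a x) \<le> btt t x + (\<Sum>j\<in>UNIV. bdd j t x)"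
  shows "(\<Sum>a\<in>Q. \<gamma> a / (\<theta> a)\<^sup>2 * (\<integral>x. F a x \<partial>M)) \<le> (\<integral>x. b 0 x \<partial>M)"
proof -
  define J where "J t x = (\<Sum>a\<in>Q. \<gamma> a * exp (- \<theta> a * t) * F a x)" for t x
  have Jc: "continuous_on (UNIV \<times> XX) (\<lambda>z. J (fst z) (snd z))"
    unfolding J_def
    by (intro continuous_on_sum continuous_on_mult continuous_on_const continuous_on_exp continuous_on_fst continuous_on_id
        continuous_on_compose2[OF Fc continuous_on_snd[OF continuous_on_id]]) auto
  obtain C where CC: "0 \<le> C \<and> (\<forall>j \<epsilon> c1 c2. 0 < \<epsilon> \<longrightarrow> c1 \<in> X j \<longrightarrow> c2 \<in> X j \<longrightarrow> c1 \<le> c2 \<longrightarrow>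
    (\<exists>\<kappa> l r. cutoff (C * \<epsilon>) j c1 c2 \<kappa> l r))"
    using cutoffs by (rule exE)
  note C = conjunct1[OF CC] and cut = conjunct2[OF CC]
  \<comment> \<open>Compact intervals exhausting the domain in each coordinate; the n-th cutoff
    equals 1 on the n-th of them.\<close>
  define ap where "ap j v u \<longleftrightarrow> X j = (\<Union>n. {v n..u n}) \<and> incseq u \<and> decseq v \<and> (\<forall>n. v n < u n)
    \<and> (\<forall>n. v n \<in> X j \<and> u n \<in> X j)" for j and v u :: "nat \<Rightarrow> real"
  have "\<forall>j. \<exists>v u. ap j v u"
  proof
    fix j
    obtain u v :: "nat \<Rightarrow> real" where uv: "X j = (\<Union>n. {v n..u n})" "incseq u" "decseq v"
      "\<And>n. v n < u n" "\<And>n. \<sigma> j < ereal (v n)" "\<And>n. ereal (u n) < \<tau> j"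
      by (rule einterval_Icc_approximation[OF interval[of j]]) (rule that)
    have "v n \<in> X j \<and> u n \<in> X j" for n
      unfolding uv(1) using uv(4)[of n] by (auto intro!: exI[of _ n])
    then have "ap j v u" unfolding ap_def using uv by simp
    then show "\<exists>v u. ap j v u" by (intro exI)
  qed
  then have "\<exists>v u. \<forall>j. ap j (v j) (u j)"
    unfolding choice_iff .
  then obtain v u where "\<forall>j. ap j (v j) (u j)"
    by (elim exE)
  then have uv: "X j = (\<Union>n. {v j n..u j n})" "incseq (u j)" "decseq (v j)" "v j n < u j n" "v j n \<in> X j" "u j n \<in> X j" for j n
    unfolding ap_def by meson+
  define \<epsilon> where "\<epsilon> n = inverse (real (Suc n))" for n
  have eps: "0 < \<epsilon> n" for n by (simp add: \<epsilon>_def)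
  have "\<forall>n j. \<exists>\<kappa> l r. cutoff (C * \<epsilon> n) j (v j n) (u j n) \<kappa> l r"
    by (intro allI cut[rule_format] eps uv less_imp_le)
  then have "\<exists>\<kappa> l r. \<forall>n j. cutoff (C * \<epsilon> n) j (v j n) (u j n) (\<kappa> n j) (l n j) (r n j)"
    unfolding choice_iff .
  then obtain \<kappa> l r where "\<forall>n j. cutoff (C * \<epsilon> n) j (v j n) (u j n) (\<kappa> n j) (l n j) (r n j)"
    by (elim exE)
  then have k: "\<And>n j. l n j \<in> X j" "\<And>n j. r n j \<in> X j" "\<And>n j. continuous_on {l n j..r n j} (\<kappa> n j)"
    "\<And>n j y. 0 \<le> \<kappa> n j y" "\<And>n j y. \<kappa> n j y \<le> 1" "\<And>n j y. y \<notin> {l n j..r n j} \<Longrightarrow> \<kappa> n j y = 0"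
    "\<And>n j y. v j n \<le> y \<Longrightarrow> y \<le> u j n \<Longrightarrow> \<kappa> n j y = 1"
    and kb: "\<And>n j t x. 0 \<le> t \<Longrightarrow> x \<in> XX \<Longrightarrow>
        \<bar>integral {l n j..r n j} (\<lambda>y. \<kappa> n j y * (w j y * bdd j t (x(j := y))))\<bar> \<le> C * \<epsilon> n * (\<Prod>i\<in>-{j}. gg i (x i))"
    unfolding cutoff_def by meson+
  define Ch where "Ch n x = (\<Prod>j\<in>UNIV. \<kappa> n j (x j))" for n x
  have Ch01: "0 \<le> Ch n x" "Ch n x \<le> 1" for n x
    unfolding Ch_def using k by (auto intro!: prod_nonneg prod_le_1)
  have Chm: "Ch n \<in> borel_measurable M" for n
    unfolding Ch_def by (rule borel_measurable_prod_compact_support[OF k(3,6)])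
  have Ch_lim: "(\<lambda>n. Ch n x) \<longlonglongrightarrow> 1" if x: "x \<in> XX" for x
  proof -
    have "eventually (\<lambda>n. \<kappa> n j (x j) = 1) sequentially" for j
    proof -
      obtain m where m: "x j \<in> {v j m..u j m}" using XX_D[OF x, of j] uv(1)[of j] by auto
      show ?thesis
        using eventually_ge_at_top[of m]
      proof eventually_elim
        case (elim n)
        then have "v j n \<le> v j m" "u j m \<le> u j n" using uv(2,3)[of j] by (auto simp: incseq_def decseq_def)
        then show ?case using m by (intro k(7)) auto
      qed
    qed
    then have "eventually (\<lambda>n. \<forall>j\<in>UNIV. \<kappa> n j (x j) = 1) sequentially"
      by (intro eventually_ball_finite) auto
    then have "eventually (\<lambda>n. Ch n x = 1) sequentially"
      by eventually_elim (simp add: Ch_def)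
    then show ?thesis by (rule tendsto_eventually)
  qed
  have ChF_int: "integrable M (\<lambda>x. Ch n x * F a x)" if a: "a \<in> Q" for n a
  proof (rule Bochner_Integration.integrable_bound[OF Fi[OF a]])
    show "(\<lambda>x. Ch n x * F a x) \<in> borel_measurable M"
      by (intro borel_measurable_times Chm borel_measurable_integrable Fi a)
    have "\<bar>Ch n x\<bar> * \<bar>F a x\<bar> \<le> 1 * \<bar>F a x\<bar>" for x using Ch01[of n x] by (intro mult_right_mono) auto
    then show "AE x in M. norm (Ch n x * F a x) \<le> norm (F a x)"
      unfolding real_norm_def abs_mult by (intro AE_I2) simp
  qed
  have lim: "(\<lambda>n. \<integral>x. Ch n x * F a x \<partial>M) \<longlonglongrightarrow> (\<integral>x. F a x \<partial>M)" if a: "a \<in> Q" for a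
  proof (rule integral_dominated_convergence[where w = "\<lambda>x. \<bar>F a x\<bar>"])
    show "AE x in M. (\<lambda>n. Ch n x * F a x) \<longlonglongrightarrow> F a x"
      using tendsto_mult[OF Ch_lim tendsto_const] by (intro AE_I2) (force simp: space_M)
    have "\<bar>Ch n x\<bar> * \<bar>F a x\<bar> \<le> 1 * \<bar>F a x\<bar>" for n x using Ch01[of n x] by (intro mult_right_mono) auto
    then show "AE x in M. norm (Ch n x * F a x) \<le> \<bar>F a x\<bar>" for n
      unfolding real_norm_def abs_mult by (intro AE_I2) simp
  qed (use ChF_int Fi a in auto)
  define I where "I a T = (1 - exp (- \<theta> a * T))\<^sup>2 / (\<theta> a)\<^sup>2" for a T
  \<comment> \<open>This factor of the cutoff error contains the mass of the tent, which grows with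
    T. Therefore the cutoffs are removed for fixed T, and only then does T tend to infinity.\<close>
  define K where "K T = measure (weighted_measure 0 (ereal (2 * T)) (tent T)) (space (weighted_measure 0 (ereal (2 * T)) (tent T)))
    * (\<Sum>j\<in>UNIV. \<integral>x. (\<Prod>i\<in>-{j}. gg i (x i)) \<partial>Pi\<^sub>M (-{j}) \<mu>)" for T
  have step: "(\<Sum>a\<in>Q. \<gamma> a * I a T * (\<integral>x. Ch n x * F a x \<partial>M)) \<le> (\<integral>x. b 0 x \<partial>M) + (\<integral>x. b (2 * T) x \<partial>M) + C * \<epsilon> n * K T"
    if T: "0 < T" for n T
  proof -
    interpret nu: weight 0 "ereal (2 * T)" "tent T" by (rule weight_tent[OF T])
    have "(\<integral>x. Ch n x * J t x \<partial>M) = (\<Sum>a\<in>Q. \<gamma> a * exp (- \<theta> a * t) * (\<integral>x. Ch n x * F a x \<partial>M))" for t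
    proof -
      have "(\<lambda>x. Ch n x * J t x) = (\<lambda>x. \<Sum>a\<in>Q. \<gamma> a * exp (- \<theta> a * t) * (Ch n x * F a x))"
        by (simp add: fun_eq_iff J_def sum_distrib_left mult_ac)
      then show ?thesis
        using ChF_int by (simp add: Bochner_Integration.integral_sum)
    qed
    then have "(\<integral>t. (\<integral>x. Ch n x * J t x \<partial>M) \<partial>weighted_measure 0 (ereal (2 * T)) (tent T))
      = (\<integral>t. (\<Sum>a\<in>Q. \<gamma> a * exp (- \<theta> a * t) * (\<integral>x. Ch n x * F a x \<partial>M)) \<partial>weighted_measure 0 (ereal (2 * T)) (tent T))"
      by simp
    also have "\<dots> = integral {0..2 * T} (\<lambda>t. \<Sum>a\<in>Q. \<gamma> a * (\<integral>x. Ch n x * F a x \<partial>M) * (tent T t * exp (- \<theta> a * t)))"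
      by (rule nu.integral_compact_support)
        (auto intro!: borel_measurable_weighted_measure continuous_intros simp: einterval_def zero_ereal_def tent_def[abs_def] sum_distrib_left mult_ac)
    also have "\<dots> = (\<Sum>a\<in>Q. \<gamma> a * (\<integral>x. Ch n x * F a x \<partial>M) * integral {0..2 * T} (\<lambda>t. tent T t * exp (- \<theta> a * t)))"
    proof (subst integral_sum[OF Q])
      show "(\<lambda>t. \<gamma> a * (\<integral>x. Ch n x * F a x \<partial>M) * (tent T t * exp (- \<theta> a * t))) integrable_on {0..2 * T}" for a
        by (intro integrable_continuous_interval continuous_intros) (auto simp: tent_def[abs_def] intro!: continuous_intros)
    qed simp
    also have "\<dots> = (\<Sum>a\<in>Q. \<gamma> a * I a T * (\<integral>x. Ch n x * F a x \<partial>M))"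
    proof (intro sum.cong refl)
      fix a assume "a \<in> Q"
      then have "integral {0..2 * T} (\<lambda>t. tent T t * exp (- \<theta> a * t)) = I a T"
        unfolding I_def by (intro tent_exp_integral T \<theta>)
      then show "\<gamma> a * (\<integral>x. Ch n x * F a x \<partial>M) * integral {0..2 * T} (\<lambda>t. tent T t * exp (- \<theta> a * t))
        = \<gamma> a * I a T * (\<integral>x. Ch n x * F a x \<partial>M)" by (simp only: mult_ac)
    qed
    finally have eq: "(\<integral>t. (\<integral>x. Ch n x * J t x \<partial>M) \<partial>weighted_measure 0 (ereal (2 * T)) (tent T)) = \<dots>" .
    have "(\<integral>t. (\<integral>x. (\<Prod>j\<in>UNIV. \<kappa> n j (x j)) * J t x \<partial>M) \<partial>weighted_measure 0 (ereal (2 * T)) (tent T))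
      \<le> (\<integral>x. b 0 x \<partial>M) + (\<integral>x. b (2 * T) x \<partial>M) + (C * \<epsilon> n) * K T"
      unfolding K_def
    proof (rule cut_inequality[OF T k(1,2,3,4,5,6) _ _ Jc])
      show "0 \<le> C * \<epsilon> n" using C eps[of n] by simp
      show "\<bar>integral {l n j..r n j} (\<lambda>y. \<kappa> n j y * (w j y * bdd j t (x(j := y))))\<bar> \<le> C * \<epsilon> n * (\<Prod>i\<in>-{j}. gg i (x i))"
        if "0 \<le> t" "x \<in> XX" for j t x
        using kb[OF that, of n j] .
    qed (use le in \<open>auto simp: J_def\<close>)
    then show ?thesis unfolding Ch_def[symmetric] eq by simp
  qed
  have stepT: "(\<Sum>a\<in>Q. \<gamma> a * I a T * (\<integral>x. F a x \<partial>M)) \<le> (\<integral>x. b 0 x \<partial>M) + (\<integral>x. b (2 * T) x \<partial>M)"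
    if T: "0 < T" for T
  proof -
    have "(\<lambda>n. (\<integral>x. b 0 x \<partial>M) + (\<integral>x. b (2 * T) x \<partial>M) + C * \<epsilon> n * K T)
      \<longlonglongrightarrow> (\<integral>x. b 0 x \<partial>M) + (\<integral>x. b (2 * T) x \<partial>M) + C * 0 * K T"
      unfolding \<epsilon>_def by (intro tendsto_intros LIMSEQ_inverse_real_of_nat)
    moreover have "(\<lambda>n. \<Sum>a\<in>Q. \<gamma> a * I a T * (\<integral>x. Ch n x * F a x \<partial>M))
       \<longlonglongrightarrow> (\<Sum>a\<in>Q. \<gamma> a * I a T * (\<integral>x. F a x \<partial>M))"
      by (intro tendsto_sum tendsto_mult tendsto_const lim)
    ultimately show ?thesis
      using LIMSEQ_le step[OF T] by fastforce
  qed
  \<comment> \<open>The remaining value of \<open>b\<close> at time 2 T decays exponentially by the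
    spectral gap \<open>s0\<close>.\<close>
  define B where "B = C2 * (\<integral>x. (\<Prod>j\<in>UNIV. gg j (x j)) \<partial>M)"
  have exp_lim: "(\<lambda>m. exp (- c * real (Suc m))) \<longlonglongrightarrow> 0" if "0 < c" for c :: real
  proof -
    have "filterlim (\<lambda>m. - c * real (Suc m)) at_bot sequentially"
      using that by (intro filterlim_tendsto_neg_mult_at_bot[OF tendsto_const] filterlim_compose[OF filterlim_real_sequentially filterlim_Suc]) auto
    then show ?thesis by (rule filterlim_compose[OF exp_at_bot])
  qed
  have "(\<lambda>m. \<Sum>a\<in>Q. \<gamma> a * I a (real (Suc m)) * (\<integral>x. F a x \<partial>M)) \<longlonglongrightarrow> (\<Sum>a\<in>Q. \<gamma> a * ((1 - 0)\<^sup>2 / (\<theta> a)\<^sup>2) * (\<integral>x. F a x \<partial>M))"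
    unfolding I_def using \<theta> by (intro tendsto_sum tendsto_intros exp_lim) force+
  moreover have "(\<lambda>m. (\<integral>x. b 0 x \<partial>M) + exp (- (2 * s0) * real (Suc m)) * B) \<longlonglongrightarrow> (\<integral>x. b 0 x \<partial>M) + 0 * B"
    using s0(1) by (intro tendsto_intros exp_lim) auto
  moreover have "(\<Sum>a\<in>Q. \<gamma> a * I a (real (Suc m)) * (\<integral>x. F a x \<partial>M)) \<le> (\<integral>x. b 0 x \<partial>M) + exp (- (2 * s0) * real (Suc m)) * B" for m
  proof -
    have "- s0 * (2 * real (Suc m)) = - (2 * s0) * real (Suc m)" by (simp only: mult_ac mult_minus_left)
    then have "(\<integral>x. b (2 * real (Suc m)) x \<partial>M) \<le> exp (- (2 * s0) * real (Suc m)) * B"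
      using b_integrable(2)[of "2 * real (Suc m)"] unfolding B_def by (simp only:)
    then show ?thesis using stepT[of "real (Suc m)"] by simp
  qed
  ultimately have "(\<Sum>a\<in>Q. \<gamma> a * ((1 - 0)\<^sup>2 / (\<theta> a)\<^sup>2) * (\<integral>x. F a x \<partial>M)) \<le> (\<integral>x. b 0 x \<partial>M) + 0 * B"
    using LIMSEQ_le by blast
  then show ?thesis by simp
qed

end

section \<open>Removal of the regularisation \<open>e\<close>\<close>

context sl_system begin

text \<open>The left side does not contain \<open>e\<close>. On the right, dominated convergence
  applies because the first bound of \<open>bel_growth\<close> is uniform in \<open>e\<close>, and
  the limit is estimated by \<open>bel_lim\<close>.\<close>

lemma embedding:
  fixes Q :: "'q set" and \<gamma> \<theta> :: "'q \<Rightarrow> real" and F :: "'q \<Rightarrow> ('d \<Rightarrow> real) \<Rightarrow> real"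
  defines "f \<equiv> \<lambda>x. \<Sum>l\<in>L. (u l 0 x)\<^sup>2" and "g \<equiv> \<lambda>x. \<Sum>l\<in>-L. (u l 0 x)\<^sup>2"
  assumes Q: "finite Q" and \<theta>: "\<And>a. a \<in> Q \<Longrightarrow> 0 < \<theta> a"
    and Fc: "\<And>a. a \<in> Q \<Longrightarrow> continuous_on XX (F a)" and Fi: "\<And>a. a \<in> Q \<Longrightarrow> integrable M (F a)"
    and le: "\<And>t x. 0 \<le> t \<Longrightarrow> x \<in> XX \<Longrightarrow>
      (\<Sum>a\<in>Q. \<gamma> a * exp (- \<theta> a * t) * F a x) \<le> 24 / 5 * del * (sqrt (energy L t x) * sqrt (energy (-L) t x))"
    and fi: "integrable M (\<lambda>x. f x powr (p / 2))" and gi: "integrable M (\<lambda>x. g x powr (q / 2))"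
  shows "(\<Sum>a\<in>Q. \<gamma> a / (\<theta> a)\<^sup>2 * (\<integral>x. F a x \<partial>M))
    \<le> 7 / 6 * ((\<integral>x. f x powr (p / 2) \<partial>M) + (\<integral>x. g x powr (q / 2) \<partial>M))"
proof -
  define e where "e n = inverse (real (Suc n))" for n
  have e: "0 < e n" "e n \<le> 1" for n by (auto simp: e_def field_simps)
  have step: "(\<Sum>a\<in>Q. \<gamma> a / (\<theta> a)\<^sup>2 * (\<integral>x. F a x \<partial>M)) \<le> (\<integral>x. bel (e n) (f x) (g x) \<partial>M)
      \<and> (\<lambda>x. bel (e n) (f x) (g x)) \<in> borel_measurable M" for n
  proof -
    interpret B: sl_bellman p q \<sigma> \<tau> w P \<eta> \<eta>' \<rho> ev A N c s L R "e n"
      by standard (use e in auto)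
    have b: "B.b 0 = (\<lambda>x. bel (e n) (f x) (g x))" by (simp add: fun_eq_iff B.b_def f_def g_def)
    have "(\<Sum>a\<in>Q. \<gamma> a / (\<theta> a)\<^sup>2 * (\<integral>x. F a x \<partial>M)) \<le> (\<integral>x. B.b 0 x \<partial>M)"
      by (rule B.main_inequality[OF Q \<theta> Fc Fi order_trans[OF le B.lower_bound]])
    then show ?thesis using B.b_measurable[of 0] unfolding b by simp
  qed
  have f0: "0 \<le> f x" "0 \<le> g x" for x by (auto simp: f_def g_def sum_nonneg)
  have "\<forall>x. \<exists>l. (\<lambda>n. bel (e n) (f x) (g x)) \<longlonglongrightarrow> l \<and> l \<le> 7 / 6 * (f x powr (p / 2) + g x powr (q / 2))"
  proof
    fix x
    show "\<exists>l. (\<lambda>n. bel (e n) (f x) (g x)) \<longlonglongrightarrow> l \<and> l \<le> 7 / 6 * (f x powr (p / 2) + g x powr (q / 2))"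
      unfolding e_def by (rule bel_lim[OF f0(1)[of x] f0(2)[of x]]) (intro exI conjI)
  qed
  then have "\<exists>l. \<forall>x. (\<lambda>n. bel (e n) (f x) (g x)) \<longlonglongrightarrow> l x \<and> l x \<le> 7 / 6 * (f x powr (p / 2) + g x powr (q / 2))"
    unfolding choice_iff .
  then obtain l where "\<forall>x. (\<lambda>n. bel (e n) (f x) (g x)) \<longlonglongrightarrow> l x \<and> l x \<le> 7 / 6 * (f x powr (p / 2) + g x powr (q / 2))"
    by (rule exE)
  then have l: "(\<lambda>n. bel (e n) (f x) (g x)) \<longlonglongrightarrow> l x" "l x \<le> 7 / 6 * (f x powr (p / 2) + g x powr (q / 2))" for x
    by auto
  define W where "W x = g x powr (q / 2) + (5 + 2 * p) * (C1 * (3 * (1 + C1)) ^ deg * (\<Prod>j\<in>UNIV. gg j (x j)))" for x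
  have Wi: "integrable M W"
    unfolding W_def
    by (intro Bochner_Integration.integrable_add gi integrable_mult_right) (unfold M_eq, rule gg_prod_int)
  have bW: "bel (e n) (f x) (g x) \<le> W x" for n x
  proof -
    have fg: "f x + g x = (\<Sum>l\<in>UNIV. (u l 0 x)\<^sup>2)" by (simp add: f_def g_def sum_split[of _ L])
    have "bel (e n) (f x) (g x) \<le> g x powr (q / 2) + (5 + 2 * p) * (f x + g x) * (3 * (1 + f x + g x)) ^ deg"
      by (rule bel_growth(1)) (use e f0 in auto)
    also have "\<dots> = g x powr (q / 2) + (5 + 2 * p) * ((\<Sum>l\<in>UNIV. (u l 0 x)\<^sup>2) * (3 * (1 + (\<Sum>l\<in>UNIV. (u l 0 x)\<^sup>2))) ^ deg)"
      unfolding fg[symmetric] by (simp add: add.assoc mult.assoc)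
    finally have 1: "bel (e n) (f x) (g x) \<le> \<dots>" .
    have "(\<Sum>l\<in>UNIV. (u l 0 x)\<^sup>2) * (3 * (1 + (\<Sum>l\<in>UNIV. (u l 0 x)\<^sup>2))) ^ deg
      \<le> C1 * (3 * (1 + C1)) ^ deg * (\<Prod>j\<in>UNIV. gg j (x j))"
      using sum_u_growth[of 0 x] by (simp only: mult_zero_right exp_zero mult_1_left order_refl)
    from mult_left_mono[OF this, of "5 + 2 * p"] 1 p_ge show ?thesis unfolding W_def by linarith
  qed
  have lm: "l \<in> borel_measurable M"
    by (rule borel_measurable_LIMSEQ_metric[of "\<lambda>n x. bel (e n) (f x) (g x)"]) (use step l in auto)
  have b_abs: "norm (bel (e n) (f x) (g x)) \<le> W x" for n x
    using bW[of n x] bel_nonneg[OF e(1) f0, of n x x] by simp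
  have bm: "(\<lambda>x. bel (e n) (f x) (g x)) \<in> borel_measurable M" for n using step by simp
  have ae: "AE x in M. (\<lambda>n. bel (e n) (f x) (g x)) \<longlonglongrightarrow> l x" using l by simp
  have dom: "integrable M l" "(\<lambda>n. \<integral>x. bel (e n) (f x) (g x) \<partial>M) \<longlonglongrightarrow> (\<integral>x. l x \<partial>M)"
    using integrable_dominated_convergence[OF lm bm Wi ae AE_I2[OF b_abs]]
      integral_dominated_convergence[OF lm bm Wi ae AE_I2[OF b_abs]] by auto
  have "(\<Sum>a\<in>Q. \<gamma> a / (\<theta> a)\<^sup>2 * (\<integral>x. F a x \<partial>M)) \<le> (\<integral>x. l x \<partial>M)"
    by (rule LIMSEQ_le_const[OF dom(2)]) (use step in auto)
  also have "\<dots> \<le> (\<integral>x. 7 / 6 * (f x powr (p / 2) + g x powr (q / 2)) \<partial>M)"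
    by (intro integral_mono dom integrable_mult_right Bochner_Integration.integrable_add fi gi l)
  also have "\<dots> = 7 / 6 * ((\<integral>x. f x powr (p / 2) \<partial>M) + (\<integral>x. g x powr (q / 2) \<partial>M))"
    using fi gi by (simp add: Bochner_Integration.integral_add)
  finally show ?thesis .
qed

end

section \<open>Lebesgue spaces\<close>

lemma LpI: "f \<in> borel_measurable M \<Longrightarrow> integrable M (\<lambda>x. norm (f x) powr s) \<Longrightarrow> f \<in> Lp M s"
  by (simp add: Lp_def)

lemma Lp_measurable [dest]: "f \<in> Lp M s \<Longrightarrow> f \<in> borel_measurable M"
  and Lp_integrable [dest]: "f \<in> Lp M s \<Longrightarrow> integrable M (\<lambda>x. norm (f x) powr s)"
  by (simp_all add: Lp_def)

lemma Lp_norm_nonneg [simp]: "0 \<le> Lp_norm M s f"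
  by (simp add: Lp_norm_def)

lemma Lp_norm_powr: "0 < s \<Longrightarrow> Lp_norm M s f powr s = (\<integral>x. norm (f x) powr s \<partial>M)"
  by (simp add: Lp_norm_def powr_powr)

lemma Lp_norm_le_iff: "0 < s \<Longrightarrow> 0 \<le> B \<Longrightarrow> Lp_norm M s f \<le> B \<longleftrightarrow> (\<integral>x. norm (f x) powr s \<partial>M) \<le> B powr s"
  unfolding Lp_norm_powr[symmetric]
  by (metis Lp_norm_nonneg less_eq_real_def not_le powr_less_mono2 powr_mono2)

lemma Lp_norm_cong: "(\<And>x. x \<in> space M \<Longrightarrow> norm (f x) = norm (g x)) \<Longrightarrow> Lp_norm M s f = Lp_norm M s g"
proof -
  assume "\<And>x. x \<in> space M \<Longrightarrow> norm (f x) = norm (g x)"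
  then have "(\<integral>x. norm (f x) powr s \<partial>M) = (\<integral>x. norm (g x) powr s \<partial>M)"
    by (intro Bochner_Integration.integral_cong) auto
  then show ?thesis by (simp add: Lp_norm_def)
qed

lemma Lp_norm_cong_AE:
  assumes "f \<in> borel_measurable M" "g \<in> borel_measurable M" "AE x in M. norm (f x) = norm (g x)"
  shows "Lp_norm M s f = Lp_norm M s g"
proof -
  have "(\<integral>x. norm (f x) powr s \<partial>M) = (\<integral>x. norm (g x) powr s \<partial>M)"
    using assms by (intro integral_cong_AE) auto
  then show ?thesis by (simp add: Lp_norm_def)
qed

lemma Lp_norm_minus_commute: "Lp_norm M s (\<lambda>x. f x - g x) = Lp_norm M s (\<lambda>x. g x - f x)"
  by (rule Lp_norm_cong) (simp add: norm_minus_commute)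

lemma Lp_bound:
  assumes "g \<in> Lp M s" "f \<in> borel_measurable M" "0 \<le> s" "\<And>x. x \<in> space M \<Longrightarrow> norm (f x) \<le> norm (g x)"
  shows "f \<in> Lp M s"
proof (rule LpI[OF assms(2)])
  show "integrable M (\<lambda>x. norm (f x) powr s)"
    by (rule Bochner_Integration.integrable_bound[OF Lp_integrable[OF assms(1)]])
      (use assms in \<open>auto intro!: AE_I2 powr_mono2\<close>)
qed

lemma Lp_scaleR:
  assumes "f \<in> Lp M s"
  shows "(\<lambda>x. c *\<^sub>R f x) \<in> Lp M s"
  using assms by (auto simp: Lp_def powr_mult)

lemma Lp_norm_scaleR: "0 < s \<Longrightarrow> Lp_norm M s (\<lambda>x. c *\<^sub>R f x) = \<bar>c\<bar> * Lp_norm M s f"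
  by (simp add: Lp_norm_def powr_mult powr_powr integral_nonneg)

lemma Lp_add:
  assumes f: "f \<in> Lp M s" and g: "g \<in> Lp M s" and s: "0 \<le> s"
  shows "(\<lambda>x. f x + g x) \<in> Lp M s"
proof (rule LpI)
  have [measurable]: "f \<in> borel_measurable M" "g \<in> borel_measurable M" using f g by auto
  show "integrable M (\<lambda>x. norm (f x + g x) powr s)"
  proof (rule Bochner_Integration.integrable_bound)
    show "integrable M (\<lambda>x. 2 powr s * (norm (f x) powr s + norm (g x) powr s))"
      using f g by auto
    have "norm (f x + g x) powr s \<le> 2 powr s * (norm (f x) powr s + norm (g x) powr s)" for x
    proof -
      have "norm (f x + g x) powr s \<le> (2 * max (norm (f x)) (norm (g x))) powr s"
        using norm_triangle_ineq[of "f x" "g x"] s by (intro powr_mono2) auto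
      also have "\<dots> = 2 powr s * max (norm (f x)) (norm (g x)) powr s" by (simp add: powr_mult)
      also have "\<dots> \<le> 2 powr s * (norm (f x) powr s + norm (g x) powr s)"
        by (intro mult_left_mono) (auto simp: max_def)
      finally show ?thesis .
    qed
    then show "AE x in M. norm (norm (f x + g x) powr s) \<le> norm (2 powr s * (norm (f x) powr s + norm (g x) powr s))"
      by (intro AE_I2) (auto intro: order_trans[OF _ abs_ge_self])
  qed measurable
qed (intro borel_measurable_add Lp_measurable[OF f] Lp_measurable[OF g])

lemma Lp_diff: "f \<in> Lp M s \<Longrightarrow> g \<in> Lp M s \<Longrightarrow> 0 \<le> s \<Longrightarrow> (\<lambda>x. f x - g x) \<in> Lp M s"
  using Lp_add[of f M s "\<lambda>x. (-1) *\<^sub>R g x"] Lp_scaleR[of g M s "-1"] by simp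

lemma Lp_zero: "(\<lambda>x. 0) \<in> Lp M s"
  by (simp add: Lp_def)

lemma Lp_sum: "(\<And>i. i \<in> A \<Longrightarrow> f i \<in> Lp M s) \<Longrightarrow> 0 \<le> s \<Longrightarrow> (\<lambda>x. \<Sum>i\<in>A. f i x) \<in> Lp M s"
  by (induction A rule: infinite_finite_induct) (auto intro: Lp_add Lp_zero)

lemma powr_convex_combination:
  fixes u v l s :: real
  assumes "0 \<le> u" "0 \<le> v" "0 \<le> l" "l \<le> 1" "1 \<le> s"
  shows "(l * u + (1 - l) * v) powr s \<le> l * u powr s + (1 - l) * v powr s"
proof -
  have z: "(m * z) powr s \<le> m * z powr s" if "0 \<le> m" "m \<le> 1" "0 \<le> z" for m z
  proof -
    have "m powr s \<le> m powr 1" using that assms by (intro powr_mono') auto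
    then show ?thesis using that by (simp add: powr_mult mult_right_mono)
  qed
  consider "u = 0" | "v = 0" | "0 < u" "0 < v" using assms by linarith
  then show ?thesis
  proof cases
    case 3
    then show ?thesis using convex_onD[OF powr_convex[OF assms(5)], of "1 - l" u v] assms by (simp add: algebra_simps)
  qed (use z[of "1 - l" v] z[of l u] assms in auto)
qed

text \<open>Convexity of the s-th power with weights a / (a + b) and b / (a + b), where a and b are
  strictly larger than the two norms. This avoids division by a vanishing norm; letting a and b
  decrease gives Minkowski's inequality.\<close>

lemma Lp_norm_triangle:
  assumes f: "f \<in> Lp M s" and g: "g \<in> Lp M s" and s: "1 \<le> s"
  shows "Lp_norm M s (\<lambda>x. f x + g x) \<le> Lp_norm M s f + Lp_norm M s g"
proof -
  have *: "Lp_norm M s (\<lambda>x. f x + g x) \<le> a + b" if a: "Lp_norm M s f < a" and b: "Lp_norm M s g < b" for a b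
  proof -
    have pos: "0 < a" "0 < b" using a b Lp_norm_nonneg[of M s f] Lp_norm_nonneg[of M s g] by linarith+
    define l where "l = a / (a + b)"
    have l: "0 \<le> l" "l \<le> 1" "1 - l = b / (a + b)" using pos by (auto simp: l_def field_simps)
    let ?B = "\<lambda>x. (a + b) powr s * (l * (norm (f x) powr s / a powr s) + (1 - l) * (norm (g x) powr s / b powr s))"
    have pt: "norm (f x + g x) powr s \<le> ?B x" for x
    proof -
      have "norm (f x + g x) \<le> (a + b) * (l * (norm (f x) / a) + (1 - l) * (norm (g x) / b))"
      proof -
        have "(a + b) * (a / (a + b) * (norm (f x) / a) + b / (a + b) * (norm (g x) / b)) = norm (f x) + norm (g x)"
          using pos by (simp add: distrib_left)
        then show ?thesis using norm_triangle_ineq[of "f x" "g x"] unfolding l(3) by (simp add: l_def)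
      qed
      then have "norm (f x + g x) powr s \<le> ((a + b) * (l * (norm (f x) / a) + (1 - l) * (norm (g x) / b))) powr s"
        using s by (intro powr_mono2) auto
      also have "\<dots> = (a + b) powr s * (l * (norm (f x) / a) + (1 - l) * (norm (g x) / b)) powr s"
        using pos l by (simp add: powr_mult)
      also have "\<dots> \<le> (a + b) powr s * (l * (norm (f x) / a) powr s + (1 - l) * (norm (g x) / b) powr s)"
        using l pos s by (intro mult_left_mono powr_convex_combination) auto
      finally show ?thesis using pos by (simp add: powr_divide)
    qed
    have Bi: "integrable M ?B"
      by (intro integrable_mult_right Bochner_Integration.integrable_add integrable_divide Lp_integrable f g)
    have "(\<integral>x. norm (f x + g x) powr s \<partial>M) \<le> (\<integral>x. ?B x \<partial>M)"
      by (rule integral_mono[OF Lp_integrable[OF Lp_add[OF f g]] Bi pt]) (use s in auto)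
    also have "\<dots> = (a + b) powr s * (l * ((\<integral>x. norm (f x) powr s \<partial>M) / a powr s) + (1 - l) * ((\<integral>x. norm (g x) powr s \<partial>M) / b powr s))"
      using f g by (simp add: Bochner_Integration.integral_add integrable_mult_right Lp_integrable)
    also have "\<dots> \<le> (a + b) powr s * (l * 1 + (1 - l) * 1)"
    proof (intro mult_left_mono add_mono)
      show "(\<integral>x. norm (f x) powr s \<partial>M) / a powr s \<le> 1"
        using a s pos Lp_norm_le_iff[of s a M f] by (simp add: divide_le_eq_1)
      show "(\<integral>x. norm (g x) powr s \<partial>M) / b powr s \<le> 1"
        using b s pos Lp_norm_le_iff[of s b M g] by (simp add: divide_le_eq_1)
    qed (use l in auto)
    finally show ?thesis using s pos by (subst Lp_norm_le_iff) auto
  qed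
  show ?thesis
  proof (rule field_le_epsilon)
    fix e :: real assume "0 < e"
    then show "Lp_norm M s (\<lambda>x. f x + g x) \<le> Lp_norm M s f + Lp_norm M s g + e"
      using *[of "Lp_norm M s f + e / 2" "Lp_norm M s g + e / 2"] by simp
  qed
qed

lemma Lp_norm_triangle_diff:
  assumes "f \<in> Lp M s" "g \<in> Lp M s" "h \<in> Lp M s" "1 \<le> s"
  shows "Lp_norm M s (\<lambda>x. f x - h x) \<le> Lp_norm M s (\<lambda>x. f x - g x) + Lp_norm M s (\<lambda>x. g x - h x)"
  using Lp_norm_triangle[of "\<lambda>x. f x - g x" M s "\<lambda>x. g x - h x"] assms by (simp add: Lp_diff)

lemma Lp_norm_sum_le:
  assumes "finite A" "\<And>i. i \<in> A \<Longrightarrow> f i \<in> Lp M s" "1 \<le> s"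
  shows "Lp_norm M s (\<lambda>x. \<Sum>i\<in>A. f i x) \<le> (\<Sum>i\<in>A. Lp_norm M s (f i))"
  using assms
proof (induction A)
  case empty
  then show ?case by (simp add: Lp_norm_def)
next
  case (insert i A)
  have "Lp_norm M s (\<lambda>x. f i x + (\<Sum>i\<in>A. f i x)) \<le> Lp_norm M s (f i) + Lp_norm M s (\<lambda>x. \<Sum>i\<in>A. f i x)"
    using insert by (intro Lp_norm_triangle Lp_sum) auto
  with insert show ?case by fastforce
qed

text \<open>Young's inequality after dividing by numbers a and b strictly above the norms, followed
  by the limit; again no case of vanishing norm arises.\<close>

lemma Holder:
  fixes f g :: "'a \<Rightarrow> 'b::euclidean_space"
  assumes pq: "1 < p" "1 < q" "1 / p + 1 / q = 1" and f: "f \<in> Lp M p" and g: "g \<in> Lp M q"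
  shows "integrable M (\<lambda>x. f x \<bullet> g x)" "\<bar>\<integral>x. f x \<bullet> g x \<partial>M\<bar> \<le> Lp_norm M p f * Lp_norm M q g"
proof -
  have [measurable]: "f \<in> borel_measurable M" "g \<in> borel_measurable M" using f g by auto
  have young: "\<bar>f x \<bullet> g x\<bar> \<le> a * b * (norm (f x) powr p / a powr p / p + norm (g x) powr q / b powr q / q)"
    if "0 < a" "0 < b" for a b x
  proof -
    have "\<bar>f x \<bullet> g x\<bar> \<le> norm (f x) * norm (g x)" by (rule Cauchy_Schwarz_ineq2)
    also have "\<dots> = a * b * ((norm (f x) / a) * (norm (g x) / b))" using that by simp
    also have "\<dots> \<le> a * b * ((norm (f x) / a) powr p / p + (norm (g x) / b) powr q / q)"
      using that pq by (intro mult_left_mono Youngs_inequality) auto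
    finally show ?thesis using that by (simp add: powr_divide)
  qed
  have int: "integrable M (\<lambda>x. a * b * (norm (f x) powr p / a powr p / p + norm (g x) powr q / b powr q / q))" for a b
    by (intro integrable_mult_right Bochner_Integration.integrable_add integrable_divide Lp_integrable f g)
  show i: "integrable M (\<lambda>x. f x \<bullet> g x)"
    by (rule Bochner_Integration.integrable_bound[OF int[of 1 1]])
      (use young[of 1 1] in \<open>auto intro!: AE_I2 order_trans[OF _ abs_ge_self]\<close>)
  have *: "\<bar>\<integral>x. f x \<bullet> g x \<partial>M\<bar> \<le> a * b" if a: "Lp_norm M p f < a" and b: "Lp_norm M q g < b" for a b
  proof -
    have pos: "0 < a" "0 < b" using a b Lp_norm_nonneg[of M p f] Lp_norm_nonneg[of M q g] by linarith+
    have "\<bar>\<integral>x. f x \<bullet> g x \<partial>M\<bar> \<le> (\<integral>x. a * b * (norm (f x) powr p / a powr p / p + norm (g x) powr q / b powr q / q) \<partial>M)"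
      using i int young[OF pos] by (intro order_trans[OF integral_abs_bound integral_mono]) auto
    also have "\<dots> = a * b * ((\<integral>x. norm (f x) powr p \<partial>M) / a powr p / p + (\<integral>x. norm (g x) powr q \<partial>M) / b powr q / q)"
      using f g by (simp add: Bochner_Integration.integral_add Lp_integrable)
    also have "\<dots> \<le> a * b * (1 / p + 1 / q)"
    proof (intro mult_left_mono add_mono divide_right_mono)
      show "(\<integral>x. norm (f x) powr p \<partial>M) / a powr p \<le> 1"
        using a pq pos Lp_norm_le_iff[of p a M f] by (simp add: divide_le_eq_1)
      show "(\<integral>x. norm (g x) powr q \<partial>M) / b powr q \<le> 1"
        using b pq pos Lp_norm_le_iff[of q b M g] by (simp add: divide_le_eq_1)
    qed (use pq pos in auto)
    finally show ?thesis using pq by simp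
  qed
  define A B where "A = Lp_norm M p f" and "B = Lp_norm M q g"
  have "(\<lambda>n. (A + inverse (real (Suc n))) * (B + inverse (real (Suc n)))) \<longlonglongrightarrow> (A + 0) * (B + 0)"
    by (intro tendsto_intros LIMSEQ_inverse_real_of_nat)
  moreover have "\<bar>\<integral>x. f x \<bullet> g x \<partial>M\<bar> \<le> (A + inverse (real (Suc n))) * (B + inverse (real (Suc n)))" for n
    by (rule *) (simp_all add: A_def B_def)
  ultimately show "\<bar>\<integral>x. f x \<bullet> g x \<partial>M\<bar> \<le> Lp_norm M p f * Lp_norm M q g"
    using LIMSEQ_le_const[of _ "(A + 0) * (B + 0)" "\<bar>\<integral>x. f x \<bullet> g x \<partial>M\<bar>"] by (auto simp: A_def B_def)
qed

section \<open>Vector-valued functions and duality\<close>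

lemma Lp_vec_component:
  fixes h :: "'a \<Rightarrow> real ^ 'd"
  assumes "h \<in> Lp M s" "0 \<le> s"
  shows "(\<lambda>x. h x $ i) \<in> Lp M s"
proof (rule Lp_bound[OF assms(1) _ assms(2)])
  have "(\<lambda>x. h x \<bullet> axis i 1) \<in> borel_measurable M" using assms by auto
  then show "(\<lambda>x. h x $ i) \<in> borel_measurable M" by (simp add: cart_eq_inner_axis)
qed (simp add: component_le_norm_cart)

lemma Lp_vec_axis:
  fixes f :: "'a \<Rightarrow> real"
  assumes "f \<in> Lp M s"
  shows "(\<lambda>x. axis i (f x) :: real ^ 'd) \<in> Lp M s" "Lp_norm M s (\<lambda>x. axis i (f x) :: real ^ 'd) = Lp_norm M s f"
proof -
  have [measurable]: "f \<in> borel_measurable M" using assms by auto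
  have n: "norm (axis i r :: real ^ 'd) = \<bar>r\<bar>" for r :: real
    by (simp add: norm_eq_sqrt_inner inner_axis_axis)
  have e: "(\<lambda>x. axis i (f x) :: real ^ 'd) = (\<lambda>x. f x *\<^sub>R axis i 1)"
    by (auto simp: fun_eq_iff axis_def vec_eq_iff)
  have "(\<lambda>x. axis i (f x) :: real ^ 'd) \<in> borel_measurable M" unfolding e by measurable
  then show "(\<lambda>x. axis i (f x) :: real ^ 'd) \<in> Lp M s"
    using assms by (simp add: Lp_def n)
  show "Lp_norm M s (\<lambda>x. axis i (f x) :: real ^ 'd) = Lp_norm M s f"
    by (rule Lp_norm_cong) (simp add: n)
qed

lemma vec_eq_sum_axis: "(v :: real ^ 'd) = (\<Sum>i\<in>UNIV. axis i (v $ i))"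
  by (simp add: vec_eq_iff axis_def if_distrib cong: if_cong)

lemma Lp_vec:
  fixes h :: "'a \<Rightarrow> real ^ 'd"
  assumes h: "\<And>i. (\<lambda>x. h x $ i) \<in> Lp M s" and s: "1 \<le> s"
  shows "h \<in> Lp M s" "Lp_norm M s h \<le> (\<Sum>i\<in>UNIV. Lp_norm M s (\<lambda>x. h x $ i))"
proof -
  have e: "h = (\<lambda>x. \<Sum>i\<in>UNIV. axis i (h x $ i))" using vec_eq_sum_axis by blast
  show "h \<in> Lp M s" by (subst e) (intro Lp_sum Lp_vec_axis h, use s in simp)
  have "Lp_norm M s h = Lp_norm M s (\<lambda>x. \<Sum>i\<in>UNIV. axis i (h x $ i))" using e by simp
  also have "\<dots> \<le> (\<Sum>i\<in>UNIV. Lp_norm M s (\<lambda>x. axis i (h x $ i) :: real ^ 'd))"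
    by (rule Lp_norm_sum_le) (auto intro: Lp_vec_axis h s)
  finally show "Lp_norm M s h \<le> (\<Sum>i\<in>UNIV. Lp_norm M s (\<lambda>x. h x $ i))"
    by (simp add: Lp_vec_axis[OF h])
qed

text \<open>The extremal test function need not have components in the dense spaces, so it is
  approximated there; the error is controlled by Hoelder's inequality because \<open>h\<close> is
  already known to lie in L^p.\<close>

lemma Lp_norm_le_by_duality:
  fixes h :: "'a \<Rightarrow> real ^ 'd"
  assumes pq: "1 < p" "1 < q" "1 / p + 1 / q = 1" and h: "h \<in> Lp M p" and B: "0 \<le> B"
    and dense: "\<And>i. dense_in_Lp M q (V i)"
    and le: "\<And>g. (\<And>i. (\<lambda>x. g x $ i) \<in> V i) \<Longrightarrow> (\<integral>x. h x \<bullet> g x \<partial>M) \<le> B * Lp_norm M q g"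
  shows "Lp_norm M p h \<le> B"
proof -
  have [measurable]: "h \<in> borel_measurable M" using h by auto
  have pq': "(p - 1) * q = p" using pq by (simp add: field_simps)
  \<comment> \<open>The extremal function |h|^(p-2) h: it gives the pairing |h|^p and has length
    |h|^(p-1), whose q-th power is |h|^p.\<close>
  define H where "H x = norm (h x) powr (p - 2) *\<^sub>R h x" for x
  have nH: "norm (H x) = norm (h x) powr (p - 1)" for x
    by (cases "h x = 0") (simp_all add: H_def powr_diff powr_numeral field_simps power2_eq_square)
  have hH: "h x \<bullet> H x = norm (h x) powr p" for x
    by (cases "h x = 0")
      (simp_all add: H_def powr_diff powr_numeral field_simps power2_eq_square dot_square_norm)
  have HLq: "H \<in> Lp M q"
  proof (rule LpI)
    show "H \<in> borel_measurable M" unfolding H_def by measurable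
    show "integrable M (\<lambda>x. norm (H x) powr q)" using Lp_integrable[OF h] by (simp add: nH powr_powr pq')
  qed
  have NH: "Lp_norm M q H = Lp_norm M p h powr (p - 1)"
  proof -
    have "1 / q = (1 / p) * (p - 1)" using pq by (simp add: field_simps)
    then show ?thesis by (simp only: Lp_norm_def nH powr_powr pq')
  qed
  have key: "Lp_norm M p h powr p \<le> B * Lp_norm M p h powr (p - 1)"
  proof (rule field_le_epsilon)
    fix e :: real assume e: "0 < e"
    define d where "d = e / (B + Lp_norm M p h + 1)"
    have BN: "0 < B + Lp_norm M p h + 1" using B Lp_norm_nonneg[of M p h] by linarith
    have d: "0 < d" using e BN by (simp add: d_def)
    have "\<forall>i. \<exists>g\<in>V i. Lp_norm M q (\<lambda>x. H x $ i - g x) < d / CARD('d)"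
      using dense Lp_vec_component[OF HLq] d pq unfolding dense_in_Lp_def by simp
    then obtain g where g: "\<And>i. g i \<in> V i" "\<And>i. Lp_norm M q (\<lambda>x. H x $ i - g i x) < d / CARD('d)" by metis
    have gL: "g i \<in> Lp M q" for i using dense[of i] g(1)[of i] unfolding dense_in_Lp_def by blast
    define G :: "'a \<Rightarrow> real ^ 'd" where "G x = (\<chi> i. g i x)" for x
    have GL: "G \<in> Lp M q" using gL pq by (intro Lp_vec) (simp_all add: G_def)
    have D: "(\<lambda>x. H x - G x) \<in> Lp M q" using HLq GL pq by (intro Lp_diff) auto
    have "Lp_norm M q (\<lambda>x. H x - G x) \<le> (\<Sum>i\<in>UNIV. Lp_norm M q (\<lambda>x. (H x - G x) $ i))"
      by (rule Lp_vec(2)[OF Lp_vec_component[OF D]]) (use pq in auto)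
    also have "\<dots> \<le> (\<Sum>i\<in>(UNIV::'d set). d / CARD('d))"
      using g(2) by (intro sum_mono) (simp add: G_def less_imp_le)
    finally have nD: "Lp_norm M q (\<lambda>x. H x - G x) \<le> d" by simp
    have nG: "Lp_norm M q G \<le> Lp_norm M q H + d"
    proof -
      have "Lp_norm M q (\<lambda>x. H x + (G x - H x)) \<le> Lp_norm M q H + Lp_norm M q (\<lambda>x. G x - H x)"
        using HLq GL pq by (intro Lp_norm_triangle Lp_diff) auto
      then show ?thesis using nD by (simp add: Lp_norm_minus_commute[of M q G H])
    qed
    have "Lp_norm M p h powr p = (\<integral>x. h x \<bullet> H x \<partial>M)" using pq by (simp add: Lp_norm_powr hH)
    also have "\<dots> = (\<integral>x. h x \<bullet> G x + h x \<bullet> (H x - G x) \<partial>M)" by (simp add: inner_diff_right)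
    also have "\<dots> = (\<integral>x. h x \<bullet> G x \<partial>M) + (\<integral>x. h x \<bullet> (H x - G x) \<partial>M)"
      by (intro Bochner_Integration.integral_add Holder[OF pq] h GL D)
    also have "\<dots> \<le> B * Lp_norm M q G + Lp_norm M p h * Lp_norm M q (\<lambda>x. H x - G x)"
    proof (intro add_mono le)
      show "(\<lambda>x. G x $ i) \<in> V i" for i using g(1) by (simp add: G_def)
    qed (use Holder(2)[OF pq h D] in linarith)
    also have "\<dots> \<le> B * (Lp_norm M q H + d) + Lp_norm M p h * d"
      using nG nD B by (intro add_mono mult_left_mono) auto
    also have "\<dots> = B * Lp_norm M p h powr (p - 1) + (B + Lp_norm M p h) * d"
      by (simp add: NH algebra_simps)
    also have "(B + Lp_norm M p h) * d \<le> e"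
      using BN e by (simp add: d_def field_simps)
    finally show "Lp_norm M p h powr p \<le> B * Lp_norm M p h powr (p - 1) + e" by simp
  qed
  show ?thesis
  proof (cases "Lp_norm M p h = 0")
    case False
    then have N: "0 < Lp_norm M p h" using Lp_norm_nonneg[of M p h] by linarith
    then have "Lp_norm M p h powr p = Lp_norm M p h * Lp_norm M p h powr (p - 1)"
      by (simp add: powr_diff)
    with key N show ?thesis by simp
  qed (use B in simp)
qed

text \<open>The heart of the Riesz-Fischer theorem: geometrically small steps in norm force absolute
  convergence of the telescoping series almost everywhere.\<close>

lemma Lp_limit:
  fixes h :: "nat \<Rightarrow> 'a \<Rightarrow> 'b::euclidean_space"
  assumes s: "1 \<le> s" and h: "\<And>n. h n \<in> Lp M s"
    and cau: "\<And>n. Lp_norm M s (\<lambda>x. h (Suc n) x - h n x) \<le> D * (1/4) ^ n" and D: "0 \<le> D"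
  obtains H where "H \<in> borel_measurable M" "AE x in M. (\<lambda>n. h n x) \<longlonglongrightarrow> H x"
proof -
  have hm [measurable]: "h n \<in> borel_measurable M" for n using h by auto
  have s0: "0 < s" using s by simp
  \<comment> \<open>The factor 2 ^ n uses up half of the rate (1/4) ^ n: the integrals stay
    summable, and finiteness of the sum at a point makes the steps there O((1/2) ^ n).\<close>
  define G where "G n x = (2 ^ n * norm (h (Suc n) x - h n x)) powr s" for n x
  have Gm [measurable]: "G n \<in> borel_measurable M" for n unfolding G_def by measurable
  have d: "(\<lambda>x. h (Suc n) x - h n x) \<in> Lp M s" for n using h s by (intro Lp_diff) auto
  have Gint: "integrable M (G n)" and Gle: "(\<integral>x. G n x \<partial>M) \<le> D powr s * (1/2) ^ n" for n
  proof -
    have e: "G n = (\<lambda>x. (2 ^ n) powr s * norm (h (Suc n) x - h n x) powr s)"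
      by (simp add: G_def fun_eq_iff powr_mult)
    show "integrable M (G n)" unfolding e using Lp_integrable[OF d] by simp
    have "(\<integral>x. G n x \<partial>M) = (2 ^ n) powr s * Lp_norm M s (\<lambda>x. h (Suc n) x - h n x) powr s"
      unfolding e Lp_norm_powr[OF s0] by simp
    also have "\<dots> \<le> (2 ^ n) powr s * (D * (1/4) ^ n) powr s"
      using cau s0 by (intro mult_left_mono powr_mono2) auto
    also have "\<dots> = (D * (1/2) ^ n) powr s"
      using D by (simp add: powr_mult[symmetric] power_mult_distrib[symmetric] mult.left_commute flip: power_mult_distrib)
    also have "\<dots> = D powr s * ((1/2) ^ n) powr s" using D by (simp add: powr_mult)
    also have "\<dots> \<le> D powr s * ((1/2) ^ n) powr 1"
      using s by (intro mult_left_mono powr_mono') (auto simp: power_le_one)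
    finally show "(\<integral>x. G n x \<partial>M) \<le> D powr s * (1/2) ^ n" by simp
  qed
  have "(\<integral>\<^sup>+x. (\<Sum>n. ennreal (G n x)) \<partial>M) = (\<Sum>n. \<integral>\<^sup>+x. ennreal (G n x) \<partial>M)"
    by (rule nn_integral_suminf) simp
  also have "\<dots> \<le> (\<Sum>n. ennreal (D powr s * (1/2) ^ n))"
  proof (intro suminf_le)
    show "(\<integral>\<^sup>+x. ennreal (G n x) \<partial>M) \<le> ennreal (D powr s * (1/2) ^ n)" for n
    proof -
      have "AE x in M. 0 \<le> G n x" by (simp add: G_def)
      from nn_integral_eq_integral[OF Gint this] show ?thesis using ennreal_leI[OF Gle[of n]] by (simp only:)
    qed
  qed auto
  also have "\<dots> = ennreal (\<Sum>n. D powr s * (1/2) ^ n)"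
    by (intro suminf_ennreal2 summable_mult summable_geometric) auto
  finally have fin: "(\<integral>\<^sup>+x. (\<Sum>n. ennreal (G n x)) \<partial>M) \<noteq> \<infinity>"
    by (auto simp: top_unique)
  have "AE x in M. (\<Sum>n. ennreal (G n x)) \<noteq> \<infinity>"
    by (rule nn_integral_noteq_infinite[OF _ fin]) simp
  then have conv: "AE x in M. convergent (\<lambda>n. h n x)"
  proof eventually_elim
    case (elim x)
    then obtain B where B: "(\<Sum>n. ennreal (G n x)) = ennreal B" "0 \<le> B"
      by (cases "\<Sum>n. ennreal (G n x)") auto
    have GB: "G n x \<le> B" for n
    proof -
      have "ennreal (G n x) \<le> (\<Sum>n. ennreal (G n x))"
        using sum_le_suminf[of "\<lambda>n. ennreal (G n x)" "{n}"] by simp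
      then show ?thesis using B by simp
    qed
    have "norm (h (Suc n) x - h n x) \<le> B powr (1 / s) * (1/2) ^ n" for n
    proof -
      have "2 ^ n * norm (h (Suc n) x - h n x) = G n x powr (1 / s)"
        using s0 by (simp add: G_def powr_powr)
      also have "\<dots> \<le> B powr (1 / s)" using GB s0 by (intro powr_mono2) (auto simp: G_def)
      finally show ?thesis by (simp add: field_simps power_divide)
    qed
    then have "summable (\<lambda>n. h (Suc n) x - h n x)"
      by (intro summable_comparison_test[OF _ summable_mult[OF summable_geometric[of "1/2::real"]]]) auto
    then have "convergent (\<lambda>n. h n x - h 0 x)"
      unfolding summable_iff_convergent using sum_lessThan_telescope[of "\<lambda>n. h n x"] by simp
    from convergent_add[OF this convergent_const[of "h 0 x"]] show "convergent (\<lambda>n. h n x)" by simp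
  qed
  show ?thesis
  proof
    show "(\<lambda>x. lim (\<lambda>n. h n x)) \<in> borel_measurable M" by measurable
    show "AE x in M. (\<lambda>n. h n x) \<longlonglongrightarrow> lim (\<lambda>n. h n x)"
      using conv by eventually_elim (simp add: convergent_LIMSEQ_iff)
  qed
qed

text \<open>Passes from pointwise convergence with bounded norms back to a norm bound for the limit;
  it replaces convergence in norm in the construction of the extension.\<close>

lemma Lp_Fatou:
  fixes h :: "nat \<Rightarrow> 'a \<Rightarrow> 'b::euclidean_space"
  assumes s: "0 < s" and h: "\<And>n. h n \<in> Lp M s" and H: "H \<in> borel_measurable M"
    and lim: "AE x in M. (\<lambda>n. h n x) \<longlonglongrightarrow> H x"
    and le: "eventually (\<lambda>n. Lp_norm M s (h n) \<le> B) sequentially" and B: "0 \<le> B"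
  shows "H \<in> Lp M s" "Lp_norm M s H \<le> B"
proof -
  have [measurable]: "h n \<in> borel_measurable M" for n using h by auto
  note H [measurable]
  have "(\<integral>\<^sup>+x. ennreal (norm (H x) powr s) \<partial>M) = (\<integral>\<^sup>+x. liminf (\<lambda>n. ennreal (norm (h n x) powr s)) \<partial>M)"
  proof (rule nn_integral_cong_AE)
    show "AE x in M. ennreal (norm (H x) powr s) = liminf (\<lambda>n. ennreal (norm (h n x) powr s))"
      using lim
    proof eventually_elim
      case (elim x)
      have "(\<lambda>n. ennreal (norm (h n x) powr s)) \<longlonglongrightarrow> ennreal (norm (H x) powr s)"
        using s by (intro tendsto_ennrealI tendsto_powr' tendsto_norm elim tendsto_const) auto
      then show ?case by (intro lim_imp_Liminf[symmetric] sequentially_bot)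
    qed
  qed
  also have "\<dots> \<le> liminf (\<lambda>n. \<integral>\<^sup>+x. ennreal (norm (h n x) powr s) \<partial>M)"
    by (rule nn_integral_liminf) simp
  also have "\<dots> \<le> liminf (\<lambda>n. ennreal (B powr s))"
  proof (rule Liminf_mono)
    show "eventually (\<lambda>n. (\<integral>\<^sup>+x. ennreal (norm (h n x) powr s) \<partial>M) \<le> ennreal (B powr s)) sequentially"
      using le
    proof eventually_elim
      case (elim n)
      then have "(\<integral>x. norm (h n x) powr s \<partial>M) \<le> B powr s" using s B by (simp add: Lp_norm_le_iff)
      then show ?case using Lp_integrable[OF h] by (subst nn_integral_eq_integral) (auto intro: ennreal_leI)
    qed
  qed
  also have "\<dots> = ennreal (B powr s)" by (simp add: Liminf_const)
  finally have nn: "(\<integral>\<^sup>+x. ennreal (norm (H x) powr s) \<partial>M) \<le> ennreal (B powr s)" .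
  then have i: "integrable M (\<lambda>x. norm (H x) powr s)"
    by (intro integrableI_nonneg) (auto simp: less_top[symmetric] top_unique)
  then show "H \<in> Lp M s" by (simp add: Lp_def)
  have "ennreal (\<integral>x. norm (H x) powr s \<partial>M) \<le> ennreal (B powr s)"
    using nn i by (subst (asm) nn_integral_eq_integral) auto
  then show "Lp_norm M s H \<le> B" using s B by (simp add: Lp_norm_le_iff)
qed

text \<open>The value at one \<open>f\<close> is built from a fast approximating sequence, but the
  conclusion compares it with every g in \<open>V\<close>; this yields both the continuity of the
  extension and its agreement with \<open>R0\<close> almost everywhere.\<close>

lemma Lp_extension:
  fixes R0 :: "('a \<Rightarrow> real) \<Rightarrow> 'a \<Rightarrow> 'b::euclidean_space"
  assumes s: "1 \<le> s" and dense: "dense_in_Lp M s V" and f: "f \<in> Lp M s" and C: "0 \<le> C"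
    and R: "\<And>g. g \<in> V \<Longrightarrow> R0 g \<in> Lp M s"
    and lip: "\<And>g g'. g \<in> V \<Longrightarrow> g' \<in> V \<Longrightarrow>
      Lp_norm M s (\<lambda>x. R0 g x - R0 g' x) \<le> C * Lp_norm M s (\<lambda>x. g x - g' x)"
  shows "\<exists>H\<in>Lp M s. \<forall>g\<in>V. Lp_norm M s (\<lambda>x. H x - R0 g x) \<le> C * Lp_norm M s (\<lambda>x. f x - g x)"
proof -
  have VL: "g \<in> Lp M s" if "g \<in> V" for g using dense that by (auto simp: dense_in_Lp_def)
  have "\<forall>n. \<exists>g\<in>V. Lp_norm M s (\<lambda>x. f x - g x) < (1/4) ^ n"
    using dense f unfolding dense_in_Lp_def by (auto simp: zero_less_power)
  then obtain g where g: "\<And>n. g n \<in> V" "\<And>n. Lp_norm M s (\<lambda>x. f x - g n x) < (1/4) ^ n" by metis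
  have gf: "Lp_norm M s (\<lambda>x. g n x - g' x) \<le> (1/4) ^ n + Lp_norm M s (\<lambda>x. f x - g' x)" if "g' \<in> Lp M s" for n g'
    using Lp_norm_triangle_diff[OF VL[OF g(1)[of n]] f that s] g(2)[of n]
    by (simp add: Lp_norm_minus_commute[of M s "g n" f])
  have cau: "Lp_norm M s (\<lambda>x. R0 (g (Suc n)) x - R0 (g n) x) \<le> (2 * C) * (1/4) ^ n" for n
  proof -
    have "Lp_norm M s (\<lambda>x. g (Suc n) x - g n x) \<le> (1/4) ^ Suc n + (1/4) ^ n"
      using gf[OF VL[OF g(1)[of n]], of "Suc n"] g(2)[of n] by simp
    also have "\<dots> \<le> 2 * (1/4) ^ n" by simp
    finally have "C * Lp_norm M s (\<lambda>x. g (Suc n) x - g n x) \<le> C * (2 * (1/4) ^ n)" using C by (rule mult_left_mono)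
    then show ?thesis using lip[OF g(1)[of "Suc n"] g(1)[of n]] by simp
  qed
  obtain H where H: "H \<in> borel_measurable M" "AE x in M. (\<lambda>n. R0 (g n) x) \<longlonglongrightarrow> H x"
    by (rule Lp_limit[OF s R[OF g(1)] cau]) (use C in auto)
  have main: "(\<lambda>x. H x - R0 g' x) \<in> Lp M s \<and> Lp_norm M s (\<lambda>x. H x - R0 g' x) \<le> C * (Lp_norm M s (\<lambda>x. f x - g' x) + e)"
    if g': "g' \<in> V" and e: "0 < e" for g' e
  proof -
    have "eventually (\<lambda>n. (1/4::real) ^ n < e) sequentially"
      using e by (intro order_tendstoD(2)[OF LIMSEQ_power_zero]) auto
    then have ev: "eventually (\<lambda>n. Lp_norm M s (\<lambda>x. R0 (g n) x - R0 g' x) \<le> C * (Lp_norm M s (\<lambda>x. f x - g' x) + e)) sequentially"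
    proof eventually_elim
      case (elim n)
      have "C * Lp_norm M s (\<lambda>x. g n x - g' x) \<le> C * (Lp_norm M s (\<lambda>x. f x - g' x) + e)"
        using gf[OF VL[OF g'], of n] elim C by (intro mult_left_mono) auto
      then show ?case using lip[OF g(1)[of n] g'] by linarith
    qed
    have lim: "AE x in M. (\<lambda>n. R0 (g n) x - R0 g' x) \<longlonglongrightarrow> H x - R0 g' x"
      using H(2) by eventually_elim (intro tendsto_intros)
    have m: "(\<lambda>x. H x - R0 g' x) \<in> borel_measurable M" using H(1) R[OF g'] by auto
    have L: "(\<lambda>x. R0 (g n) x - R0 g' x) \<in> Lp M s" for n using s by (intro Lp_diff R g(1) g') auto
    show ?thesis
      using Lp_Fatou[OF _ L m lim ev] s C e by auto
  qed
  have "H \<in> Lp M s"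
  proof -
    have "(\<lambda>x. (H x - R0 (g 0) x) + R0 (g 0) x) \<in> Lp M s"
      using main[OF g(1)[of 0], of 1] R[OF g(1)[of 0]] s by (intro Lp_add) auto
    then show ?thesis by simp
  qed
  moreover have "Lp_norm M s (\<lambda>x. H x - R0 g' x) \<le> C * Lp_norm M s (\<lambda>x. f x - g' x)" if g': "g' \<in> V" for g'
  proof (rule field_le_epsilon)
    fix e :: real assume e: "0 < e"
    have "C * (e / (C + 1)) \<le> e" using C e by (simp add: field_simps)
    then show "Lp_norm M s (\<lambda>x. H x - R0 g' x) \<le> C * Lp_norm M s (\<lambda>x. f x - g' x) + e"
      using main[OF g', of "e / (C + 1)"] e C by (simp add: distrib_left)
  qed
  ultimately show ?thesis by blast
qed

section \<open>Riesz transforms\<close>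

lemma smooth_fun_on_DERIV:
  assumes "smooth_fun_on S f" "y \<in> S"
  shows "(f has_real_derivative deriv f y) (at y)"
    "(deriv f has_real_derivative deriv (deriv f) y) (at y)"
    "(deriv (deriv f) has_real_derivative deriv (deriv (deriv f)) y) (at y)"
proof -
  have d: "((deriv ^^ n) f has_real_derivative deriv ((deriv ^^ n) f) y) (at y)" for n
    using assms unfolding smooth_fun_on_def by (simp add: DERIV_deriv_iff_real_differentiable)
  show "(f has_real_derivative deriv f y) (at y)"
    "(deriv f has_real_derivative deriv (deriv f) y) (at y)"
    "(deriv (deriv f) has_real_derivative deriv (deriv (deriv f)) y) (at y)"
    using d[of 0] d[of 1] d[of 2] by (simp_all add: numeral_2_eq_2)
qed

lemma smooth_fun_on_continuous:
  assumes "smooth_fun_on S f"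
  shows "continuous_on S f" "continuous_on S (deriv f)" "continuous_on S (deriv (deriv f))"
  using DERIV_isCont[OF smooth_fun_on_DERIV(1)[OF assms]] DERIV_isCont[OF smooth_fun_on_DERIV(2)[OF assms]]
    DERIV_isCont[OF smooth_fun_on_DERIV(3)[OF assms]]
  by (auto intro: continuous_at_imp_continuous_on)

section \<open>Flux equations for an eigenfunction f and for delta f\<close>

locale eigenfunction =
  fixes S :: "real set" and w p q f :: "real \<Rightarrow> real" and a ev :: real
  assumes S: "open S" and w: "smooth_fun_on S w" and wpos: "\<And>y. y \<in> S \<Longrightarrow> 0 < w y"
    and p: "smooth_fun_on S p" and q: "smooth_fun_on S q" and f: "smooth_fun_on S f"
    and p0: "\<And>y. y \<in> S \<Longrightarrow> p y \<noteq> 0"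
    and eig: "\<And>y. y \<in> S \<Longrightarrow> L_op w p q a f y = ev * f y"
begin

lemma delta_DERIV:
  assumes y: "y \<in> S"
  shows "(delta p q f has_real_derivative deriv (delta p q f) y) (at y)"
proof -
  note d = smooth_fun_on_DERIV[OF p y] smooth_fun_on_DERIV[OF q y] smooth_fun_on_DERIV[OF f y]
  have "((\<lambda>y. p y * deriv f y + q y * f y) has_real_derivative
     (p y * deriv (deriv f) y + deriv p y * deriv f y + (q y * deriv f y + deriv q y * f y))) (at y)"
    by (intro DERIV_add DERIV_mult' d)
  moreover have "(\<lambda>y. p y * deriv f y + q y * f y) = delta p q f"
    by (simp add: fun_eq_iff delta_def)
  ultimately show ?thesis by (metis DERIV_imp_deriv)
qed

text \<open>The eigenvalue equation read as a first-order equation for delta f. It expresses the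
  derivative of delta f through delta f and f alone.\<close>

lemma first_order:
  assumes y: "y \<in> S"
  shows "((\<lambda>y. p y * w y * delta p q f y) has_real_derivative
    w y * (q y * delta p q f y + (a - ev) * f y)) (at y)"
    and "p y * w y * deriv (delta p q f) y
    = w y * (q y * delta p q f y + (a - ev) * f y) - (deriv p y * w y + p y * deriv w y) * delta p q f y"
proof -
  note d = smooth_fun_on_DERIV[OF p y] smooth_fun_on_DERIV[OF w y] delta_DERIV[OF y]
  have D: "((\<lambda>y. p y * w y * delta p q f y) has_real_derivative
    (p y * w y * deriv (delta p q f) y + (p y * deriv w y + deriv p y * w y) * delta p q f y)) (at y)"
    by (intro DERIV_mult' d)
  have "- (1 / w y) * deriv (\<lambda>y. p y * w y * delta p q f y) y + q y * delta p q f y + a * f y = ev * f y"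
    using eig[OF y] by (simp add: L_op_def delta_star_def)
  then have "deriv (\<lambda>y. p y * w y * delta p q f y) y = w y * (q y * delta p q f y + (a - ev) * f y)"
    using wpos[OF y] by (simp add: field_simps)
  then have e: "p y * w y * deriv (delta p q f) y + (p y * deriv w y + deriv p y * w y) * delta p q f y
    = w y * (q y * delta p q f y + (a - ev) * f y)"
    using DERIV_imp_deriv[OF D] by simp
  show "((\<lambda>y. p y * w y * delta p q f y) has_real_derivative
    w y * (q y * delta p q f y + (a - ev) * f y)) (at y)"
    using D unfolding e .
  show "p y * w y * deriv (delta p q f) y
    = w y * (q y * delta p q f y + (a - ev) * f y) - (deriv p y * w y + p y * deriv w y) * delta p q f y"
    using e by (simp add: algebra_simps)
qed

text \<open>The decomposition of the operator into its principal part and the potential r, in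
  divergence form.\<close>

lemma flux_f:
  assumes y: "y \<in> S"
  shows "((\<lambda>y. (p y)\<^sup>2 * w y * deriv f y) has_real_derivative w y * ((r_fun w p q a y - ev) * f y)) (at y)"
proof -
  note d = smooth_fun_on_DERIV[OF p y] smooth_fun_on_DERIV[OF w y] smooth_fun_on_DERIV[OF q y] smooth_fun_on_DERIV[OF f y]
  have "((\<lambda>y. p y * w y * delta p q f y - p y * w y * q y * f y) has_real_derivative
     (w y * (q y * delta p q f y + (a - ev) * f y)
      - (p y * w y * q y * deriv f y + (p y * w y * deriv q y + (p y * deriv w y + deriv p y * w y) * q y) * f y))) (at y)"
    by (intro DERIV_diff first_order(1)[OF y] DERIV_mult' d)
  moreover have "(\<lambda>y. p y * w y * delta p q f y - p y * w y * q y * f y) = (\<lambda>y. (p y)\<^sup>2 * w y * deriv f y)"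
    by (simp add: fun_eq_iff delta_def power2_eq_square algebra_simps)
  moreover have "w y * (q y * delta p q f y + (a - ev) * f y)
      - (p y * w y * q y * deriv f y + (p y * w y * deriv q y + (p y * deriv w y + deriv p y * w y) * q y) * f y)
      = w y * ((r_fun w p q a y - ev) * f y)"
    using wpos[OF y] by (simp add: delta_def r_fun_def power2_eq_square field_simps)
  ultimately show ?thesis by simp
qed

lemma v_fun_eq:
  assumes y: "y \<in> S"
  shows "v_fun w p q y = p y * (2 * deriv q y - (deriv p y * (deriv w y / w y)
    + p y * (deriv (deriv w) y / w y - (deriv w y / w y)\<^sup>2)) - deriv (deriv p) y)"
proof -
  note d = smooth_fun_on_DERIV[OF p y] smooth_fun_on_DERIV[OF w y]
  have w0: "w y \<noteq> 0" using wpos[OF y] by simp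
  have "((\<lambda>y. p y * (deriv w y / w y)) has_real_derivative
    (p y * ((deriv (deriv w) y * w y - deriv w y * deriv w y) / (w y * w y)) + deriv p y * (deriv w y / w y))) (at y)"
    by (intro DERIV_mult' DERIV_divide d w0)
  from DERIV_imp_deriv[OF this] show ?thesis
    unfolding v_fun_def using w0 by (simp add: power2_eq_square diff_divide_distrib add.commute)
qed

text \<open>Applying delta to the eigenvalue equation and exchanging delta with its adjoint adds the
  commutator v to the operator. So delta f has the same eigenvalue, with the potential r +
  v.\<close>

lemma flux_delta:
  assumes y: "y \<in> S"
  shows "((\<lambda>y. (p y)\<^sup>2 * w y * deriv (delta p q f) y) has_real_derivative
    w y * ((r_fun w p q a y + v_fun w p q y - ev) * delta p q f y)) (at y)"
proof -
  let ?d = "delta p q f"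
  note d = smooth_fun_on_DERIV[OF p y] smooth_fun_on_DERIV[OF w y] smooth_fun_on_DERIV[OF q y] smooth_fun_on_DERIV[OF f y]
    delta_DERIV[OF y]
  have w0: "w y \<noteq> 0" using wpos[OF y] by simp
  let ?G = "\<lambda>y. p y * (w y * (q y * ?d y + (a - ev) * f y) - (deriv p y * w y + p y * deriv w y) * ?d y)"
  let ?D = "p y * (w y * (q y * deriv ?d y + deriv q y * ?d y + ((a - ev) * deriv f y)) + deriv w y * (q y * ?d y + (a - ev) * f y)
     - ((deriv p y * w y + p y * deriv w y) * deriv ?d y
       + ((deriv p y * deriv w y + deriv (deriv p) y * w y) + (p y * deriv (deriv w) y + deriv p y * deriv w y)) * ?d y))
     + deriv p y * (w y * (q y * ?d y + (a - ev) * f y) - (deriv p y * w y + p y * deriv w y) * ?d y)"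
  have G: "(?G has_real_derivative ?D) (at y)"
    by (intro DERIV_mult' DERIV_diff DERIV_add DERIV_cmult d)
  \<comment> \<open>With the derivative of delta f replaced by \<open>first_order\<close>,
    differentiating the flux calls only for first derivatives of f and delta f, and for derivatives
    of the coefficients.\<close>
  have eqn: "(p z)\<^sup>2 * w z * deriv ?d z = ?G z" if "z \<in> S" for z
  proof -
    have "(p z)\<^sup>2 * w z * deriv ?d z = p z * (p z * w z * deriv ?d z)" by (simp add: power2_eq_square)
    then show ?thesis unfolding first_order(2)[OF that] .
  qed
  have "((\<lambda>y. (p y)\<^sup>2 * w y * deriv ?d y) has_real_derivative ?D) (at y)"
    by (rule has_field_derivative_transform_within_open[OF G S y]) (simp only: eqn)
  moreover have "?D = w y * ((r_fun w p q a y + v_fun w p q y - ev) * ?d y)"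
  proof -
    \<comment> \<open>In terms of the logarithmic derivative m every summand carries the factor w,
      and the rest is polynomial algebra.\<close>
    define m where "m = deriv w y / w y"
    define W2 where "W2 = deriv (deriv w) y / w y"
    have W: "deriv w y = m * w y" "deriv (deriv w) y = W2 * w y" using w0 by (simp_all add: m_def W2_def)
    have e1: "p y * deriv f y = ?d y - q y * f y" by (simp add: delta_def)
    have "w y * (p y * deriv ?d y) = w y * ((q y * ?d y + (a - ev) * f y) - (deriv p y + p y * m) * ?d y)"
      using first_order(2)[OF y] unfolding W by (simp add: algebra_simps)
    then have e2: "p y * deriv ?d y = (q y * ?d y + (a - ev) * f y) - (deriv p y + p y * m) * ?d y"
      using w0 by simp
    have "?D = w y * (q y * (p y * deriv ?d y) + p y * deriv q y * ?d y + (a - ev) * (p y * deriv f y)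
       + m * p y * (q y * ?d y + (a - ev) * f y)
       - ((deriv p y + p y * m) * (p y * deriv ?d y)
         + p y * ((deriv p y * m + deriv (deriv p) y) + (p y * W2 + deriv p y * m)) * ?d y)
       + deriv p y * ((q y * ?d y + (a - ev) * f y) - (deriv p y + p y * m) * ?d y))"
      unfolding W by (simp add: algebra_simps)
    also have "\<dots> = w y * ((r_fun w p q a y + v_fun w p q y - ev) * ?d y)"
      unfolding e1 e2 r_fun_def v_fun_eq[OF y] m_def[symmetric] W2_def[symmetric]
      by (simp add: algebra_simps power2_eq_square)
    finally show ?thesis .
  qed
  ultimately show ?thesis by simp
qed

end

section \<open>Limits at the ends of the intervals\<close>

lemma tendsto_at_left_einterval:
  assumes "s < t" "((g \<circ> real_of_ereal) \<longlongrightarrow> (0::real)) (at_left t)" "0 < e"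
  shows "\<exists>c\<in>einterval s t. \<forall>y\<in>einterval s t. c \<le> y \<longrightarrow> \<bar>g y\<bar> < e"
proof -
  have "eventually (\<lambda>z. \<bar>g (real_of_ereal z)\<bar> < e) (at_left t)"
    using tendstoD[OF assms(2,3)] by (simp add: dist_real_def)
  then obtain b where b: "b < t" "\<And>z. b < z \<Longrightarrow> z < t \<Longrightarrow> \<bar>g (real_of_ereal z)\<bar> < e"
    unfolding eventually_at_left[OF assms(1)] by auto
  obtain c where c: "max b s < ereal c" "ereal c < t"
    using ereal_dense2[of "max b s" t] b assms(1) by auto
  have "\<bar>g y\<bar> < e" if "y \<in> einterval s t" "c \<le> y" for y
  proof -
    have "b < ereal y" using c that less_le_trans[of b "ereal c" "ereal y"] by simp
    then show ?thesis using b(2)[of "ereal y"] that by (simp add: einterval_def)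
  qed
  then show ?thesis using c by (intro bexI[of _ c]) (auto simp: einterval_def)
qed

lemma tendsto_at_right_einterval:
  assumes "s < t" "((g \<circ> real_of_ereal) \<longlongrightarrow> (0::real)) (at_right s)" "0 < e"
  shows "\<exists>c\<in>einterval s t. \<forall>y\<in>einterval s t. y \<le> c \<longrightarrow> \<bar>g y\<bar> < e"
proof -
  have "eventually (\<lambda>z. \<bar>g (real_of_ereal z)\<bar> < e) (at_right s)"
    using tendstoD[OF assms(2,3)] by (simp add: dist_real_def)
  then obtain b where b: "s < b" "\<And>z. s < z \<Longrightarrow> z < b \<Longrightarrow> \<bar>g (real_of_ereal z)\<bar> < e"
    unfolding eventually_at_right[OF assms(1)] by auto
  obtain c where c: "s < ereal c" "ereal c < min b t"
    using ereal_dense2[of s "min b t"] b assms(1) by auto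
  have "\<bar>g y\<bar> < e" if "y \<in> einterval s t" "y \<le> c" for y
  proof -
    have "ereal y < b" using c that le_less_trans[of "ereal y" "ereal c" b] by simp
    then show ?thesis using b(2)[of "ereal y"] that by (simp add: einterval_def)
  qed
  then show ?thesis using c by (intro bexI[of _ c]) (auto simp: einterval_def)
qed

text \<open>The exponent is 2 n + 1 and not 2 n because (T2) admits only positive exponents, and n =
  0 occurs.\<close>

lemma one_plus_square_power_le: "(1 + z\<^sup>2) ^ n \<le> 2 ^ n * (1 + \<bar>z\<bar> powr (2 * real n + 1))" for z :: real
proof (cases "\<bar>z\<bar> \<le> 1")
  case True
  then have "1 + z\<^sup>2 \<le> 2" by (simp add: abs_square_le_1)
  then have "(1 + z\<^sup>2) ^ n \<le> 2 ^ n" by (intro power_mono) auto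
  also have "\<dots> \<le> 2 ^ n * (1 + \<bar>z\<bar> powr (2 * real n + 1))" by simp
  finally show ?thesis .
next
  case False
  have "1 + z\<^sup>2 \<le> 2 * \<bar>z\<bar>\<^sup>2" using one_le_power[of "\<bar>z\<bar>" 2] False by simp
  then have "(1 + z\<^sup>2) ^ n \<le> (2 * \<bar>z\<bar>\<^sup>2) ^ n" by (rule power_mono) simp
  then have "(1 + z\<^sup>2) ^ n \<le> 2 ^ n * \<bar>z\<bar> ^ (2 * n)" by (simp only: power_mult_distrib power_mult)
  moreover have "\<bar>z\<bar> ^ (2 * n) = \<bar>z\<bar> powr (2 * real n)"
    using False by (simp add: powr_realpow[symmetric])
  moreover have "\<bar>z\<bar> powr (2 * real n) \<le> \<bar>z\<bar> powr (2 * real n + 1)"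
    using False by (intro powr_mono) auto
  ultimately show ?thesis
    by (smt (verit) mult_left_mono zero_le_power)
qed

lemma decay_aux:
  fixes eta f g P d \<epsilon> :: real
  assumes P: "0 \<le> P" and eta: "eta = f \<or> eta = g"
    and l: "\<bar>(1 + \<bar>f\<bar> powr (2 * real n + 1) + \<bar>g\<bar> powr (2 * real n + 1)) * P * d\<bar> < \<epsilon> / 2 ^ n"
  shows "(1 + eta\<^sup>2) ^ n * (P * \<bar>d\<bar>) \<le> \<epsilon>"
proof -
  have "(1 + eta\<^sup>2) ^ n \<le> 2 ^ n * (1 + \<bar>eta\<bar> powr (2 * real n + 1))" by (rule one_plus_square_power_le)
  also have "\<dots> \<le> 2 ^ n * (1 + \<bar>f\<bar> powr (2 * real n + 1) + \<bar>g\<bar> powr (2 * real n + 1))"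
    using eta by (intro mult_left_mono) auto
  finally have "(1 + eta\<^sup>2) ^ n * (P * \<bar>d\<bar>)
    \<le> 2 ^ n * (1 + \<bar>f\<bar> powr (2 * real n + 1) + \<bar>g\<bar> powr (2 * real n + 1)) * (P * \<bar>d\<bar>)"
    using P by (intro mult_right_mono) auto
  also have "\<dots> = 2 ^ n * \<bar>(1 + \<bar>f\<bar> powr (2 * real n + 1) + \<bar>g\<bar> powr (2 * real n + 1)) * P * d\<bar>"
    using P by (simp add: abs_mult)
  also have "\<dots> \<le> 2 ^ n * (\<epsilon> / 2 ^ n)" using l by (intro mult_left_mono) auto
  finally show ?thesis by simp
qed

lemma lin_memI: "e k \<in> lin e"
  unfolding lin_def by (intro CollectI exI[of _ "{k}"] exI[of _ "\<lambda>_. 1"]) auto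

section \<open>The setting of the theorem: eigenfunctions, orthogonality, potentials\<close>

locale riesz_setting =
  fixes \<sigma> \<tau> :: "'d :: finite \<Rightarrow> ereal"
    and w p q :: "'d \<Rightarrow> real \<Rightarrow> real"
    and a :: "'d \<Rightarrow> real"
    and \<phi> :: "'d \<Rightarrow> nat \<Rightarrow> real \<Rightarrow> real"
    and ev :: "'d \<Rightarrow> nat \<Rightarrow> real"
    and K :: real
  assumes interval: "\<And>i. \<sigma> i < \<tau> i"
    and w_smooth: "\<And>i. smooth_fun_on (einterval (\<sigma> i) (\<tau> i)) (w i)"
    and w_pos: "\<And>i y. y \<in> einterval (\<sigma> i) (\<tau> i) \<Longrightarrow> w i y > 0"
    and p_smooth: "\<And>i. smooth_fun_on (einterval (\<sigma> i) (\<tau> i)) (p i)"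
    and p_nonzero: "\<And>i y. y \<in> einterval (\<sigma> i) (\<tau> i) \<Longrightarrow> p i y \<noteq> 0"
    and q_smooth: "\<And>i. smooth_fun_on (einterval (\<sigma> i) (\<tau> i)) (q i)"
    and a_nonneg: "\<And>i. a i \<ge> 0"
    and basis: "\<And>i. orthonormal_basis_L2 (weighted_measure (\<sigma> i) (\<tau> i) (w i)) (\<phi> i)"
    and phi_smooth: "\<And>i k. smooth_fun_on (einterval (\<sigma> i) (\<tau> i)) (\<phi> i k)"
    and eigen: "\<And>i k y. y \<in> einterval (\<sigma> i) (\<tau> i) \<Longrightarrow>
      L_op (w i) (p i) (q i) (a i) (\<phi> i k) y = ev i k * \<phi> i k y"
    and ev_nonneg: "\<And>i k. ev i k \<ge> 0"
    and ev_mono: "\<And>i. strict_mono (ev i)"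
    and A1: "\<And>i y. y \<in> einterval (\<sigma> i) (\<tau> i) \<Longrightarrow> v_fun (w i) (p i) (q i) y \<ge> 0"
    and K_nonneg: "K \<ge> 0"
    and A2: "\<And>x. (\<And>i. x i \<in> einterval (\<sigma> i) (\<tau> i)) \<Longrightarrow>
      (\<Sum>i\<in>UNIV. (q i (x i))\<^sup>2) \<le> K * (\<Sum>i\<in>UNIV. r_fun (w i) (p i) (q i) (a i) (x i))"
    and T1: "\<And>i k m.
      L2_inner (weighted_measure (\<sigma> i) (\<tau> i) (w i)) (delta (p i) (q i) (\<phi> i k)) (delta (p i) (q i) (\<phi> i m)) =
      L2_inner (weighted_measure (\<sigma> i) (\<tau> i) (w i))
        (delta_star (w i) (p i) (q i) (delta (p i) (q i) (\<phi> i k))) (\<phi> i m)"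
    and T2: "\<And>i k s1 s2 F. s1 > 0 \<Longrightarrow> s2 > 0 \<Longrightarrow>
      F \<in> {at_right (\<sigma> i), at_left (\<tau> i)} \<Longrightarrow>
      (((\<lambda>y. (1 + \<bar>\<phi> i k y\<bar> powr s1 + \<bar>delta (p i) (q i) (\<phi> i k) y\<bar> powr s2) *
              (p i y)\<^sup>2 * w i y * deriv (\<phi> i k) y) \<circ> real_of_ereal) \<longlongrightarrow> 0) F \<and>
      (((\<lambda>y. (1 + \<bar>\<phi> i k y\<bar> powr s1 + \<bar>delta (p i) (q i) (\<phi> i k) y\<bar> powr s2) *
              (p i y)\<^sup>2 * w i y * deriv (delta (p i) (q i) (\<phi> i k)) y) \<circ> real_of_ereal) \<longlongrightarrow> 0) F"
    and T3: "\<And>u. 1 \<le> u \<Longrightarrow> dense_in_Lp (product_measure \<sigma> \<tau> w) u (lin (tensor \<phi>)) \<and>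
      (\<forall>i. dense_in_Lp (product_measure \<sigma> \<tau> w) u (lin (\<lambda>k. delta_coord p q i (tensor \<phi> k))))"
begin

abbreviation "X i \<equiv> einterval (\<sigma> i) (\<tau> i)"
abbreviation "\<mu> i \<equiv> weighted_measure (\<sigma> i) (\<tau> i) (w i)"
abbreviation "M \<equiv> product_measure \<sigma> \<tau> w"
abbreviation "dl i k \<equiv> delta (p i) (q i) (\<phi> i k)"
abbreviation "r i \<equiv> r_fun (w i) (p i) (q i) (a i)"

lemma weight_w: "weight (\<sigma> i) (\<tau> i) (w i)"
  by standard (use smooth_fun_on_continuous(1)[OF w_smooth] w_pos in auto)

sublocale product_sigma_finite \<mu>
  using weight.sigma_finite[OF weight_w] by (simp add: product_sigma_finite_def)

lemma M_eq: "M = Pi\<^sub>M UNIV \<mu>"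
  by (simp add: product_measure_def)

lemma eigenfunction: "eigenfunction (X i) (w i) (p i) (q i) (\<phi> i k) (a i) (ev i k)"
  by standard (use w_smooth w_pos p_smooth q_smooth phi_smooth p_nonzero eigen in auto)

definition "\<eta> l j m = (if l = Some j then dl j m else \<phi> j m)"
definition "\<rho> l j y = r j y + (if l = Some j then v_fun (w j) (p j) (q j) y else 0)"
definition "pr l k x = (\<Prod>j\<in>UNIV. \<eta> l j (k j) (x j))"

lemma pr_None: "pr None k x = tensor \<phi> k x"
  by (simp add: pr_def \<eta>_def tensor_def)

lemma \<eta>_DERIV: "y \<in> X j \<Longrightarrow> (\<eta> l j m has_real_derivative deriv (\<eta> l j m) y) (at y)"
  using eigenfunction.delta_DERIV[OF eigenfunction] smooth_fun_on_DERIV(1)[OF phi_smooth]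
  by (simp add: \<eta>_def)

lemma \<eta>_flux: "y \<in> X j \<Longrightarrow> ((\<lambda>y. ((p j y)\<^sup>2 * w j y) * deriv (\<eta> l j m) y) has_real_derivative
    w j y * ((\<rho> l j y - ev j m) * \<eta> l j m y)) (at y)"
  using eigenfunction.flux_delta[OF eigenfunction, of y j m] eigenfunction.flux_f[OF eigenfunction, of y j m]
  by (simp add: \<eta>_def \<rho>_def)

lemma \<eta>_cont: "continuous_on (X j) (\<eta> l j m)"
  using DERIV_isCont[OF \<eta>_DERIV] by (intro continuous_at_imp_continuous_on) auto

lemma r_cont: "continuous_on (X j) (r j)"
  unfolding r_fun_def
  by (intro continuous_intros smooth_fun_on_continuous[OF p_smooth] smooth_fun_on_continuous[OF q_smooth]
      smooth_fun_on_continuous[OF w_smooth]) (use w_pos in force)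

lemma v_cont: "continuous_on (X j) (v_fun (w j) (p j) (q j))"
proof -
  have "continuous_on (X j) (\<lambda>y. p j y * (2 * deriv (q j) y - (deriv (p j) y * (deriv (w j) y / w j y)
    + p j y * (deriv (deriv (w j)) y / w j y - (deriv (w j) y / w j y)\<^sup>2)) - deriv (deriv (p j)) y))"
    by (intro continuous_intros smooth_fun_on_continuous[OF p_smooth] smooth_fun_on_continuous[OF q_smooth]
        smooth_fun_on_continuous[OF w_smooth]) (use w_pos in force)+
  then show ?thesis
    by (rule continuous_on_eq) (simp add: eigenfunction.v_fun_eq[OF eigenfunction])
qed

lemma \<rho>_cont: "continuous_on (X j) (\<rho> l j)"
  unfolding \<rho>_def using r_cont v_cont by (cases "l = Some j") (auto intro: continuous_on_add)

lemma P_pos: "y \<in> X j \<Longrightarrow> 0 < (p j y)\<^sup>2 * w j y"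
  using p_nonzero w_pos by simp

lemma decay_right:
  assumes "0 < \<epsilon>"
  shows "\<exists>c\<in>X j. \<forall>y\<in>X j. c \<le> y \<longrightarrow> (1 + (\<eta> l j m y)\<^sup>2) ^ n * ((p j y)\<^sup>2 * w j y * \<bar>deriv (\<eta> l j m) y\<bar>) \<le> \<epsilon>"
proof -
  have s: "0 < 2 * real n + 1" and e: "0 < \<epsilon> / 2 ^ n" using assms by auto
  have "(((\<lambda>y. (1 + \<bar>\<phi> j m y\<bar> powr (2 * real n + 1) + \<bar>dl j m y\<bar> powr (2 * real n + 1)) *
      ((p j y)\<^sup>2 * w j y) * deriv (\<eta> l j m) y) \<circ> real_of_ereal) \<longlongrightarrow> 0) (at_left (\<tau> j))"
    using T2[OF s s, of "at_left (\<tau> j)" j m] unfolding \<eta>_def by (simp add: mult.assoc)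
  from tendsto_at_left_einterval[OF interval this e]
  obtain c where c: "c \<in> X j" "\<And>y. y \<in> X j \<Longrightarrow> c \<le> y \<Longrightarrow>
    \<bar>(1 + \<bar>\<phi> j m y\<bar> powr (2 * real n + 1) + \<bar>dl j m y\<bar> powr (2 * real n + 1)) *
      ((p j y)\<^sup>2 * w j y) * deriv (\<eta> l j m) y\<bar> < \<epsilon> / 2 ^ n" by auto
  have "(1 + (\<eta> l j m y)\<^sup>2) ^ n * ((p j y)\<^sup>2 * w j y * \<bar>deriv (\<eta> l j m) y\<bar>) \<le> \<epsilon>" if "y \<in> X j" "c \<le> y" for y
    by (rule decay_aux[OF less_imp_le[OF P_pos] _ c(2)]) (use that in \<open>auto simp: \<eta>_def\<close>)
  then show ?thesis using c by blast
qed

lemma decay_left: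
  assumes "0 < \<epsilon>"
  shows "\<exists>c\<in>X j. \<forall>y\<in>X j. y \<le> c \<longrightarrow> (1 + (\<eta> l j m y)\<^sup>2) ^ n * ((p j y)\<^sup>2 * w j y * \<bar>deriv (\<eta> l j m) y\<bar>) \<le> \<epsilon>"
proof -
  have s: "0 < 2 * real n + 1" and e: "0 < \<epsilon> / 2 ^ n" using assms by auto
  have "(((\<lambda>y. (1 + \<bar>\<phi> j m y\<bar> powr (2 * real n + 1) + \<bar>dl j m y\<bar> powr (2 * real n + 1)) *
      ((p j y)\<^sup>2 * w j y) * deriv (\<eta> l j m) y) \<circ> real_of_ereal) \<longlongrightarrow> 0) (at_right (\<sigma> j))"
    using T2[OF s s, of "at_right (\<sigma> j)" j m] unfolding \<eta>_def by (simp add: mult.assoc)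
  from tendsto_at_right_einterval[OF interval this e]
  obtain c where c: "c \<in> X j" "\<And>y. y \<in> X j \<Longrightarrow> y \<le> c \<Longrightarrow>
    \<bar>(1 + \<bar>\<phi> j m y\<bar> powr (2 * real n + 1) + \<bar>dl j m y\<bar> powr (2 * real n + 1)) *
      ((p j y)\<^sup>2 * w j y) * deriv (\<eta> l j m) y\<bar> < \<epsilon> / 2 ^ n" by auto
  have "(1 + (\<eta> l j m y)\<^sup>2) ^ n * ((p j y)\<^sup>2 * w j y * \<bar>deriv (\<eta> l j m) y\<bar>) \<le> \<epsilon>" if "y \<in> X j" "y \<le> c" for y
    by (rule decay_aux[OF less_imp_le[OF P_pos] _ c(2)]) (use that in \<open>auto simp: \<eta>_def\<close>)
  then show ?thesis using c by blast
qed

lemma tensor_upd: "tensor \<phi> k (x(i := y)) = (\<Prod>j\<in>-{i}. \<phi> j (k j) (x j)) * \<phi> i (k i) y"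
  unfolding tensor_def by (subst prod_remove_UNIV[of _ i]) (auto intro!: prod.cong simp: mult.commute)

lemma delta_coord_tensor:
  assumes x: "x i \<in> X i"
  shows "delta_coord p q i (tensor \<phi> k) x = pr (Some i) k x"
proof -
  have "((\<lambda>y. tensor \<phi> k (x(i := y))) has_real_derivative (\<Prod>j\<in>-{i}. \<phi> j (k j) (x j)) * deriv (\<phi> i (k i)) (x i)) (at (x i))"
    unfolding tensor_upd by (intro DERIV_cmult smooth_fun_on_DERIV(1)[OF phi_smooth x])
  from DERIV_imp_deriv[OF this]
  have "delta_coord p q i (tensor \<phi> k) x = (\<Prod>j\<in>-{i}. \<phi> j (k j) (x j)) * dl i (k i) (x i)"
    unfolding delta_coord_def delta_def by (simp only: tensor_upd) (simp add: algebra_simps)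
  also have "\<dots> = pr (Some i) k x"
    unfolding pr_def by (subst prod_remove_UNIV[of _ i]) (auto simp: \<eta>_def intro!: prod.cong)
  finally show ?thesis .
qed

lemma delta_coord_tensor_space: "x \<in> space M \<Longrightarrow> delta_coord p q i (tensor \<phi> k) x = pr (Some i) k x"
  by (rule delta_coord_tensor) (simp add: space_product_measure)

lemma pr_measurable: "pr l k \<in> borel_measurable M"
  unfolding pr_def[abs_def] by (intro borel_measurable_prod borel_measurable_component_product_measure \<eta>_cont)

lemma pr_Lp: "1 \<le> u \<Longrightarrow> pr l k \<in> Lp M u"
proof (cases l)
  case None
  assume "1 \<le> u"
  then have "tensor \<phi> k \<in> Lp M u" using T3[of u] lin_memI[of "tensor \<phi>" k] by (auto simp: dense_in_Lp_def)
  then show ?thesis using None by (simp add: pr_None[abs_def])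
next
  case (Some i)
  assume u: "1 \<le> u"
  then have "delta_coord p q i (tensor \<phi> k) \<in> Lp M u"
    using T3[of u] lin_memI[of "\<lambda>k. delta_coord p q i (tensor \<phi> k)" k] unfolding dense_in_Lp_def by blast
  from Lp_bound[OF this pr_measurable] show ?thesis
    using Some u delta_coord_tensor_space by simp
qed

lemma phi_L2: "\<phi> i k \<in> Lp (\<mu> i) 2"
  using basis[of i] lin_memI[of "\<phi> i" k] by (auto simp: orthonormal_basis_L2_def dense_in_Lp_def)

lemma phi_inner: "(\<integral>y. \<phi> i k y * \<phi> i m y \<partial>\<mu> i) = (if k = m then 1 else 0)"
  using basis[of i] by (simp add: orthonormal_basis_L2_def L2_inner_def)

lemma \<eta>_measurable: "\<eta> l j m \<in> borel_measurable (\<mu> j)"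
  by (intro borel_measurable_weighted_measure \<eta>_cont)

text \<open>A vanishing integral would make the eigenfunction zero almost everywhere, contrary to
  its norm 1.\<close>

lemma phi_nn_pos:
  assumes "0 < u"
  shows "(\<integral>\<^sup>+y. ennreal (\<bar>\<phi> i k y\<bar> powr u) \<partial>\<mu> i) \<noteq> 0"
proof
  have [measurable]: "\<phi> i k \<in> borel_measurable (\<mu> i)" using phi_L2 by auto
  assume "(\<integral>\<^sup>+y. ennreal (\<bar>\<phi> i k y\<bar> powr u) \<partial>\<mu> i) = 0"
  then have "AE y in \<mu> i. ennreal (\<bar>\<phi> i k y\<bar> powr u) = 0"
    by (subst (asm) nn_integral_0_iff_AE) auto
  then have "AE y in \<mu> i. \<phi> i k y * \<phi> i k y = 0"
    by eventually_elim (use assms in \<open>auto simp: ennreal_eq_0_iff\<close>)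
  then have "(\<integral>y. \<phi> i k y * \<phi> i k y \<partial>\<mu> i) = (\<integral>y. 0 \<partial>\<mu> i)"
    by (intro integral_cong_AE) auto
  then show False by (simp add: phi_inner)
qed

text \<open>
  (T3) makes the tensor products integrable to any power; a single factor inherits this because
  no other factor can have norm zero.
\<close>

lemma \<eta>_powr_integrable:
  assumes u: "1 \<le> u"
  shows "integrable (\<mu> j) (\<lambda>y. \<bar>\<eta> l j m y\<bar> powr u)"
proof -
  \<comment> \<open>In all coordinates other than j the component is switched to \<phi>, which has
    nonzero norm; a factor delta \<phi> might vanish identically.\<close>
  define l' where "l' = (if l = Some j then Some j else None)"
  have l': "\<eta> l j m = \<eta> l' j m" by (simp add: l'_def \<eta>_def)
  let ?k = "\<lambda>_::'d. m"
  let ?n = "\<lambda>i. \<integral>\<^sup>+y. ennreal (\<bar>\<eta> l' i m y\<bar> powr u) \<partial>\<mu> i"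
  have m: "(\<lambda>y. ennreal (\<bar>\<eta> l' i m y\<bar> powr u)) \<in> borel_measurable (\<mu> i)" for i
    using \<eta>_measurable[of l' i m] by measurable
  have "(\<integral>\<^sup>+x. ennreal (norm (pr l' ?k x) powr u) \<partial>M) < \<infinity>"
    using Lp_integrable[OF pr_Lp[OF u, of l' ?k]] by (simp add: integrable_iff_bounded)
  moreover have "ennreal (norm (pr l' ?k x) powr u) = (\<Prod>i\<in>UNIV. ennreal (\<bar>\<eta> l' i m (x i)\<bar> powr u))" for x
  proof -
    have "(\<Prod>i\<in>A. z i) powr u = (\<Prod>i\<in>A. z i powr u)" if "\<And>i. 0 \<le> z i" for z :: "'d \<Rightarrow> real" and A
      by (induction A rule: infinite_finite_induct) (auto simp: powr_mult that prod_nonneg)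
    then show ?thesis by (simp add: pr_def abs_prod prod_ennreal)
  qed
  ultimately have "(\<Prod>i\<in>UNIV. ?n i) < \<infinity>"
    unfolding M_eq using product_nn_integral_prod[of UNIV "\<lambda>i y. ennreal (\<bar>\<eta> l' i m y\<bar> powr u)"] m by simp
  moreover have "?n i \<noteq> 0" if "i \<noteq> j" for i
    using phi_nn_pos[of u i m] that u by (simp add: \<eta>_def l'_def)
  ultimately have "?n j < \<infinity>"
    unfolding prod_remove_UNIV[of _ j] by (auto simp: ennreal_mult_less_top prod_zero_iff)
  then show ?thesis
    unfolding l' using \<eta>_measurable[of l' j m] by (intro integrableI_bounded) auto
qed

lemma \<eta>_L2: "\<eta> l j m \<in> Lp (\<mu> j) 2"
  using \<eta>_powr_integrable[of 2 j l m] \<eta>_measurable by (intro LpI) auto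

lemma \<eta>_mult_integrable: "integrable (\<mu> j) (\<lambda>y. \<eta> l j m y * \<eta> l j n y)"
  using Holder(1)[of 2 2, OF _ _ _ \<eta>_L2 \<eta>_L2] by simp

text \<open>The squared L^2 norm of \<open>pr l k\<close>; for \<open>Some i\<close> the value
  follows from (T1) and the eigenvalue equation.\<close>

definition "nrm l k = (case l of None \<Rightarrow> 1 | Some i \<Rightarrow> ev i (k i) - a i)"

lemma dl_inner: "(\<integral>y. dl i k y * dl i m y \<partial>\<mu> i) = (if k = m then ev i k - a i else 0)"
proof -
  have "(\<integral>y. dl i k y * dl i m y \<partial>\<mu> i) = (\<integral>y. delta_star (w i) (p i) (q i) (dl i k) y * \<phi> i m y \<partial>\<mu> i)"
    using T1[of i k m] by (simp add: L2_inner_def)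
  also have "\<dots> = (\<integral>y. (ev i k - a i) * (\<phi> i k y * \<phi> i m y) \<partial>\<mu> i)"
  proof (rule Bochner_Integration.integral_cong[OF refl])
    fix y assume "y \<in> space (\<mu> i)"
    then have "delta_star (w i) (p i) (q i) (dl i k) y = (ev i k - a i) * \<phi> i k y"
      using eigen[of y i k] by (simp add: L_op_def algebra_simps)
    then show "delta_star (w i) (p i) (q i) (dl i k) y * \<phi> i m y = (ev i k - a i) * (\<phi> i k y * \<phi> i m y)" by simp
  qed
  finally show ?thesis by (simp add: phi_inner)
qed

lemma pr_mult_integrable: "integrable M (\<lambda>x. pr l k x * pr l m x)"
  unfolding M_eq pr_def prod.distrib[symmetric] by (intro product_integrable_prod \<eta>_mult_integrable) simp

lemma pr_inner: "(\<integral>x. pr l k x * pr l m x \<partial>M) = (if k = m then nrm l k else 0)"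
proof -
  have "(\<integral>x. pr l k x * pr l m x \<partial>M) = (\<Prod>j\<in>UNIV. \<integral>y. \<eta> l j (k j) y * \<eta> l j (m j) y \<partial>\<mu> j)"
    unfolding M_eq pr_def prod.distrib[symmetric]
    by (intro product_integral_prod \<eta>_mult_integrable) simp
  also have "\<dots> = (\<Prod>j\<in>UNIV. if k j = m j then (if l = Some j then ev j (k j) - a j else 1) else 0)"
    by (intro prod.cong refl) (simp add: \<eta>_def phi_inner dl_inner)
  also have "\<dots> = (if k = m then nrm l k else 0)"
  proof (cases "k = m")
    case True
    then show ?thesis by (cases l) (auto simp: nrm_def prod.delta)
  next
    case False
    then obtain j where "k j \<noteq> m j" by auto
    then show ?thesis using False by (auto simp: prod_zero_iff intro!: bexI[of _ j])
  qed
  finally show ?thesis .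
qed

text \<open>For \<open>K = 0\<close>, (A2) says nothing about the sign of \<open>r\<close>, but forces all \<open>q\<^sub>i\<close> to vanish.\<close>

lemma R_nonneg:
  assumes x: "\<And>i. x i \<in> X i"
  shows "0 \<le> (\<Sum>i\<in>UNIV. r i (x i))"
proof (cases "K = 0")
  case False
  have "0 \<le> (\<Sum>i\<in>UNIV. (q i (x i))\<^sup>2)" by (intro sum_nonneg) auto
  then have "0 \<le> K * (\<Sum>i\<in>UNIV. r i (x i))" using A2[OF x] by linarith
  then show ?thesis using K_nonneg False by (simp add: zero_le_mult_iff)
next
  case True
  have q0: "q i y = 0" if y: "y \<in> X i" for i y
  proof -
    have "(\<Sum>j\<in>UNIV. (q j ((x(i := y)) j))\<^sup>2) \<le> 0"
      using A2[of "x(i := y)"] x y True by auto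
    moreover have "(q i ((x(i := y)) i))\<^sup>2 \<le> (\<Sum>j\<in>UNIV. (q j ((x(i := y)) j))\<^sup>2)"
      by (rule member_le_sum) auto
    ultimately have "(q i ((x(i := y)) i))\<^sup>2 \<le> 0" by (rule order_trans[rotated])
    then show ?thesis by simp
  qed
  have "r i y = a i" if y: "y \<in> X i" for i y
  proof -
    \<comment> \<open>Since q vanishes on the whole open interval, its derivative vanishes as well,
      and r reduces to the constant a, which is nonnegative.\<close>
    have "(q i has_real_derivative 0) (at y)"
      by (rule has_field_derivative_transform_within_open[OF DERIV_const[of 0] open_einterval y]) (simp add: q0)
    then show ?thesis using q0[OF y] by (simp add: r_fun_def DERIV_imp_deriv)
  qed
  then show ?thesis using x a_nonneg by (simp add: sum_nonneg)
qed

lemma R_le_\<rho>: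
  assumes x: "\<And>i. x i \<in> X i"
  shows "(\<Sum>i\<in>UNIV. r i (x i)) \<le> (\<Sum>i\<in>UNIV. \<rho> l i (x i))"
  by (intro sum_mono) (use A1 x in \<open>simp add: \<rho>_def\<close>)

definition "sk k = sqrt (eigval ev k)"

lemma eigval_nonneg: "0 \<le> eigval ev k"
  unfolding eigval_def by (intro sum_nonneg ev_nonneg)

lemma eigval_pos:
  assumes "k \<in> index_set ev"
  shows "0 < eigval ev k"
proof (cases "eigval ev (\<lambda>_. 0) > 0")
  case True
  have "eigval ev (\<lambda>_. 0) \<le> eigval ev k"
    unfolding eigval_def by (intro sum_mono) (use strict_mono_leD[OF ev_mono] in auto)
  with True show ?thesis by simp
next
  case False
  then have "k \<noteq> (\<lambda>_. 0)" using assms by (simp add: index_set_def)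
  then obtain i where i: "k i \<noteq> 0" by auto
  have "0 < ev i (k i)" using strict_monoD[OF ev_mono, of 0 "k i" i] ev_nonneg[of i 0] i by simp
  also have "\<dots> \<le> eigval ev k"
    unfolding eigval_def by (rule member_le_sum) (auto intro: ev_nonneg)
  finally show ?thesis .
qed

lemma sk_pos: "k \<in> index_set ev \<Longrightarrow> 0 < sk k"
  by (simp add: sk_def eigval_pos)

lemma \<eta>_even_integrable: "1 \<le> n \<Longrightarrow> integrable (\<mu> j) (\<lambda>y. \<eta> l j m y ^ (2 * n))"
proof -
  assume n: "1 \<le> n"
  have "\<bar>z\<bar> powr real (2 * n) = z ^ (2 * n)" for z :: real
  proof (cases "z = 0")
    case False
    then have "\<bar>z\<bar> powr real (2 * n) = \<bar>z\<bar> ^ (2 * n)" by (intro powr_realpow) simp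
    then show ?thesis by (simp add: power_even_abs del: of_nat_mult)
  qed (use n in simp)
  then show ?thesis
    using \<eta>_powr_integrable[of "real (2 * n)" j l m] n by (simp del: of_nat_mult)
qed

lemma sl_instance:
  assumes b: "bellman P Q" and A: "finite A" "A \<subseteq> index_set ev" and N: "\<And>k j. k \<in> A \<Longrightarrow> k j \<le> N"
  shows "sl_system P Q \<sigma> \<tau> w (\<lambda>j y. (p j y)\<^sup>2 * w j y) \<eta> (\<lambda>l j m. deriv (\<eta> l j m)) \<rho> ev A N sk
    (\<lambda>x. \<Sum>j\<in>UNIV. r j (x j))"
proof -
  interpret bellman P Q by fact
  show ?thesis
  proof
    show "continuous_on (X j) (\<lambda>y. (p j y)\<^sup>2 * w j y)" for j
      by (intro continuous_intros smooth_fun_on_continuous(1)[OF p_smooth] smooth_fun_on_continuous(1)[OF w_smooth])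
    show "continuous_on (X j) (w j)" for j by (rule smooth_fun_on_continuous(1)[OF w_smooth])
    show "(sk k)\<^sup>2 = (\<Sum>j\<in>UNIV. ev j (k j))" for k
      using eigval_nonneg[of k] by (simp add: sk_def eigval_def)
    show "0 < sk k" if "k \<in> A" for k using that A sk_pos by auto
  qed (fact interval w_pos P_pos \<rho>_cont \<eta>_DERIV \<eta>_flux decay_right decay_left \<eta>_even_integrable A(1) N R_nonneg R_le_\<rho>)+
qed

section \<open>The bilinear estimate for finite sums\<close>

lemma sum_Compl_None: "(\<Sum>l\<in>-{None}. h l) = (\<Sum>i\<in>UNIV. h (Some i))" for h :: "'d option \<Rightarrow> real"
proof -
  have "-{None} = range (Some :: 'd \<Rightarrow> 'd option)" by (auto simp: image_iff)
  then show ?thesis by (simp add: sum.reindex)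
qed

text \<open>The sum on the left is the pairing of the Riesz transforms of f with g. It arises from
  the pairing of delta_i F with the time derivative of G_i, integrated against t: by orthogonality
  only equal indices survive, and there sk / (2 * sk)^2 = 1 / (4 * sk).\<close>

lemma bilinear_aux:
  fixes P Q :: real and L :: "'d option set" and A :: "('d \<Rightarrow> nat) set"
    and \<alpha> :: "('d \<Rightarrow> nat) \<Rightarrow> real" and \<beta> :: "'d \<Rightarrow> ('d \<Rightarrow> nat) \<Rightarrow> real"
  assumes b: "bellman P Q" and L: "L = {None} \<or> L = -{None}"
    and A: "finite A" "A \<subseteq> index_set ev"
  defines "f \<equiv> \<lambda>x. \<Sum>k\<in>A. \<alpha> k * pr None k x" and "g \<equiv> \<lambda>i x. \<Sum>k\<in>A. \<beta> i k * pr (Some i) k x"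
    and "sf \<equiv> (if L = {None} then P else Q)" and "sg \<equiv> (if L = {None} then Q else P)"
  shows "6 / 5 * (Q * (Q - 1) / 12) / (1 + sqrt K) * (\<Sum>i\<in>UNIV. \<Sum>k\<in>A. \<alpha> k * \<beta> i k / sk k * nrm (Some i) k)
    \<le> 7 / 6 * ((\<integral>x. \<bar>f x\<bar> powr sf \<partial>M) + (\<integral>x. (\<Sum>i\<in>UNIV. (g i x)\<^sup>2) powr (sg / 2) \<partial>M))"
proof -
  define N where "N = Max (insert 0 ((\<lambda>(k, j). k j) ` (A \<times> (UNIV :: 'd set))))"
  have N: "k j \<le> N" if "k \<in> A" for k j
    unfolding N_def using A(1) that by (intro Max_ge) auto
  define c where "c l k = (case l of None \<Rightarrow> \<alpha> k | Some i \<Rightarrow> \<beta> i k)" for l k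
  interpret S: sl_system P Q \<sigma> \<tau> w "\<lambda>j y. (p j y)\<^sup>2 * w j y" \<eta> "\<lambda>l j m. deriv (\<eta> l j m)" \<rho> ev A N c sk L
    "\<lambda>x. \<Sum>j\<in>UNIV. r j (x j)"
    by (rule sl_instance[OF b A]) (rule N)
  have Spr: "S.pr = pr" by (simp add: fun_eq_iff S.pr_def pr_def)
  have XX: "S.XX = space M" by (auto simp: S.XX_def space_product_measure)
  have PQ: "1 < Q" "1 \<le> P" using S.q_gt S.p_ge by auto
  define C0 where "C0 = 24 / 5 * S.del / (1 + sqrt K)"
  have C0: "0 \<le> C0" using S.del_pos K_nonneg by (simp add: C0_def)
  define J where "J = (UNIV :: 'd set) \<times> A \<times> A"
  define \<gamma> where "\<gamma> = (\<lambda>(i, k, m). C0 * (\<alpha> k * \<beta> i m * sk m))"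
  define \<theta> where "\<theta> = (\<lambda>(i :: 'd, k, m). sk k + sk m)"
  define F where "F = (\<lambda>(i, k, m) x. pr (Some i) k x * pr (Some i) m x)"
  \<comment> \<open>This is delta_i F, with F the scalar extension.\<close>
  define D where "D i t x = (\<Sum>k\<in>A. \<alpha> k * exp (- sk k * t) * pr (Some i) k x)" for i t x
  have u0: "S.u None 0 x = f x" "S.u (Some i) 0 x = g i x" for i x
    by (simp_all add: S.u_def Spr c_def f_def g_def)
  have fL: "f \<in> Lp M v" and gL: "g i \<in> Lp M v" if "1 \<le> v" for v i
  proof -
    have *: "(\<lambda>x. h k * pr l k x) \<in> Lp M v" for h l k
      using Lp_scaleR[OF pr_Lp[OF that, of l k], of "h k"] by simp
    show "f \<in> Lp M v" "g i \<in> Lp M v" unfolding f_def g_def using that by (auto intro!: Lp_sum *)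
  qed
  define G where "G x = (\<chi> i. g i x)" for x
  have GL: "G \<in> Lp M v" if "1 \<le> v" for v
    using gL[OF that] that by (intro Lp_vec(1)) (auto simp: G_def)
  have nG: "norm (G x) powr v = (\<Sum>i\<in>UNIV. (g i x)\<^sup>2) powr (v / 2)" for x v
    by (simp add: norm_vec_def L2_set_def G_def powr_half_sqrt[symmetric] sum_nonneg powr_powr)
  have nf: "(f x)\<^sup>2 powr (v / 2) = \<bar>f x\<bar> powr v" for x v
  proof -
    have "(f x)\<^sup>2 powr (v / 2) = (\<bar>f x\<bar> powr 2) powr (v / 2)" by (simp add: powr_numeral)
    then show ?thesis by (simp only: powr_powr) simp
  qed
  have SL: "(\<Sum>l\<in>{None}. (S.u l 0 x)\<^sup>2) = (f x)\<^sup>2" "(\<Sum>l\<in>-{None}. (S.u l 0 x)\<^sup>2) = (\<Sum>i\<in>UNIV. (g i x)\<^sup>2)" for x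
    by (simp_all add: sum_Compl_None u0)
  have intf: "integrable M (\<lambda>x. (f x)\<^sup>2 powr (v / 2))" if "1 \<le> v" for v
    using Lp_integrable[OF fL[OF that]] by (simp add: nf)
  have intg: "integrable M (\<lambda>x. (\<Sum>i\<in>UNIV. (g i x)\<^sup>2) powr (v / 2))" if "1 \<le> v" for v
    using Lp_integrable[OF GL[OF that]] by (simp add: nG)
  have le: "(\<Sum>a\<in>J. \<gamma> a * exp (- \<theta> a * t) * F a x)
     \<le> 24 / 5 * S.del * (sqrt (S.energy L t x) * sqrt (S.energy (-L) t x))" if x: "x \<in> S.XX" for t x
  proof -
    have xi: "x i \<in> X i" for i using x by (simp add: S.XX_def)
    have p2: "(p j (x j))\<^sup>2 * w j (x j) / w j (x j) = (p j (x j))\<^sup>2" for j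
      using w_pos[OF xi[of j]] by simp
    define R where "R = (\<Sum>j\<in>UNIV. r j (x j))"
    have R0: "0 \<le> R" unfolding R_def by (rule R_nonneg[OF xi])
    have E1: "S.energy {None} t x = (S.ut None t x)\<^sup>2 + (\<Sum>j\<in>UNIV. (p j (x j) * S.ud j None t x)\<^sup>2) + R * (S.u None t x)\<^sup>2"
      unfolding S.energy_def p2 R_def by (simp add: power_mult_distrib)
    have E2: "(\<Sum>i\<in>UNIV. (S.ut (Some i) t x)\<^sup>2) \<le> S.energy (-{None}) t x"
      unfolding S.energy_def sum_Compl_None p2 R_def[symmetric]
      by (intro sum_mono) (auto intro!: add_increasing2 add_nonneg_nonneg sum_nonneg mult_nonneg_nonneg R0)
    have E10: "0 \<le> S.energy {None} t x"
      unfolding E1 by (intro add_nonneg_nonneg sum_nonneg mult_nonneg_nonneg R0) auto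
    have Deq: "D i t x = p i (x i) * S.ud i None t x + q i (x i) * S.u None t x" for i
    proof -
      have "pr (Some i) k x = p i (x i) * S.pr' i None k x + q i (x i) * pr None k x" for k
      proof -
        have e: "(\<Prod>j\<in>-{i}. \<eta> (Some i) j (k j) (x j)) = (\<Prod>j\<in>-{i}. \<eta> None j (k j) (x j))"
          by (intro prod.cong) (auto simp: \<eta>_def)
        show ?thesis
          unfolding pr_def S.pr'_def prod_remove_UNIV[of _ i] e
          by (simp add: \<eta>_def delta_def algebra_simps)
      qed
      then show ?thesis
        unfolding D_def S.ud_def S.u_def Spr
        by (simp add: sum_distrib_left sum.distrib[symmetric] c_def algebra_simps)
    qed
    \<comment> \<open>delta_i is the derivative part plus multiplication by q. The first is
      contained in the energy, the second is at most sqrt K times it by (A2); hence the factor 1 +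
      sqrt K.\<close>
    have "L2_set (\<lambda>i. D i t x) UNIV \<le> L2_set (\<lambda>i. p i (x i) * S.ud i None t x) UNIV + L2_set (\<lambda>i. q i (x i) * S.u None t x) UNIV"
      unfolding Deq by (rule L2_set_triangle_ineq)
    also have "L2_set (\<lambda>i. p i (x i) * S.ud i None t x) UNIV \<le> sqrt (S.energy {None} t x)"
      unfolding L2_set_def E1 using R0 by (intro real_sqrt_le_mono) auto
    also have "L2_set (\<lambda>i. q i (x i) * S.u None t x) UNIV \<le> sqrt K * sqrt (S.energy {None} t x)"
    proof -
      have "(\<Sum>i\<in>UNIV. (q i (x i) * S.u None t x)\<^sup>2) = (\<Sum>i\<in>UNIV. (q i (x i))\<^sup>2) * (S.u None t x)\<^sup>2"
        by (simp add: power_mult_distrib sum_distrib_right)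
      also have "\<dots> \<le> (K * R) * (S.u None t x)\<^sup>2"
        unfolding R_def by (intro mult_right_mono A2 xi) auto
      also have "\<dots> \<le> K * S.energy {None} t x"
        unfolding E1 mult.assoc using K_nonneg by (intro mult_left_mono) (auto intro!: add_nonneg_nonneg sum_nonneg)
      finally show ?thesis unfolding L2_set_def real_sqrt_mult[symmetric] by (rule real_sqrt_le_mono)
    qed
    finally have LD: "L2_set (\<lambda>i. D i t x) UNIV \<le> (1 + sqrt K) * sqrt (S.energy {None} t x)"
      by (simp add: distrib_right)
    \<comment> \<open>The time derivative brings down - \<open>sk\<close>; the sign is turned so
      that the coefficients \<open>\<gamma>\<close> carry + \<open>sk\<close>.\<close>
    have "(\<Sum>i\<in>UNIV. D i t x * (- S.ut (Some i) t x)) \<le> (\<Sum>i\<in>UNIV. \<bar>D i t x\<bar> * \<bar>S.ut (Some i) t x\<bar>)"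
      by (intro sum_mono) (simp add: abs_mult[symmetric])
    also have "\<dots> \<le> L2_set (\<lambda>i. D i t x) UNIV * L2_set (\<lambda>i. S.ut (Some i) t x) UNIV"
      by (rule L2_set_mult_ineq)
    also have "\<dots> \<le> ((1 + sqrt K) * sqrt (S.energy {None} t x)) * sqrt (S.energy (-{None}) t x)"
      using LD E2 K_nonneg E10 by (intro mult_mono) (auto simp: L2_set_def intro!: sum_nonneg)
    finally have 1: "(\<Sum>i\<in>UNIV. D i t x * (- S.ut (Some i) t x)) \<le> \<dots>" .
    have "(\<Sum>a\<in>J. \<gamma> a * exp (- \<theta> a * t) * F a x) = C0 * (\<Sum>i\<in>UNIV. D i t x * (- S.ut (Some i) t x))"
    proof -
      have "D i t x * (- S.ut (Some i) t x) = (\<Sum>k\<in>A. \<Sum>m\<in>A. \<alpha> k * \<beta> i m * sk m * exp (- (sk k + sk m) * t) * (pr (Some i) k x * pr (Some i) m x))" for i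
      proof -
        have e: "exp (- (sk k + sk m) * t) = exp (- sk k * t) * exp (- sk m * t)" for k m
          by (simp add: exp_add[symmetric] algebra_simps)
        show ?thesis
          unfolding D_def S.ut_def Spr sum_negf[symmetric] sum_product e
          by (intro sum.cong refl) (simp add: c_def mult_ac)
      qed
      then show ?thesis
        unfolding J_def \<gamma>_def \<theta>_def F_def sum.cartesian_product'
        by (simp add: sum_distrib_left mult.assoc)
    qed
    also have "\<dots> \<le> C0 * (((1 + sqrt K) * sqrt (S.energy {None} t x)) * sqrt (S.energy (-{None}) t x))"
      using 1 C0 by (rule mult_left_mono)
    also have "\<dots> = (C0 * (1 + sqrt K)) * (sqrt (S.energy {None} t x) * sqrt (S.energy (-{None}) t x))"
      by (simp add: mult_ac)
    also have "C0 * (1 + sqrt K) = 24 / 5 * S.del"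
    proof -
      have "1 + sqrt K \<noteq> 0" using real_sqrt_ge_zero[OF K_nonneg] by linarith
      then show ?thesis unfolding C0_def by (rule nonzero_eq_divide_eq[THEN iffD1]) simp
    qed
    finally show ?thesis using L by (auto simp: mult.commute[of "sqrt (S.energy {None} t x)"])
  qed
  have main: "(\<Sum>a\<in>J. \<gamma> a / (\<theta> a)\<^sup>2 * (\<integral>x. F a x \<partial>M))
    \<le> 7 / 6 * ((\<integral>x. (\<Sum>l\<in>L. (S.u l 0 x)\<^sup>2) powr (P / 2) \<partial>M) + (\<integral>x. (\<Sum>l\<in>-L. (S.u l 0 x)\<^sup>2) powr (Q / 2) \<partial>M))"
  proof (rule S.embedding)
    show "finite J" using A by (simp add: J_def)
    show "0 < \<theta> a" if "a \<in> J" for a using that A sk_pos by (auto simp: J_def \<theta>_def intro!: add_pos_pos)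
    show "continuous_on S.XX (F a)" if "a \<in> J" for a
    proof -
      have c: "continuous_on S.XX (\<lambda>x. \<eta> l j m (x j))" for l j m
        by (rule continuous_on_compose2[OF \<eta>_cont continuous_on_product_then_coordinatewise[OF continuous_on_id]])
          (auto simp: S.XX_def)
      show ?thesis unfolding F_def pr_def case_prod_unfold by (intro continuous_on_mult continuous_on_prod c)
    qed
    show "integrable M (F a)" if "a \<in> J" for a
      unfolding F_def case_prod_unfold by (rule pr_mult_integrable)
    show "integrable M (\<lambda>x. (\<Sum>l\<in>L. (S.u l 0 x)\<^sup>2) powr (P / 2))"
      using L intf[OF PQ(2)] intg[OF PQ(2)] by (auto simp only: SL)
    show "integrable M (\<lambda>x. (\<Sum>l\<in>-L. (S.u l 0 x)\<^sup>2) powr (Q / 2))"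
      using L intf[of Q] intg[of Q] PQ by (auto simp only: SL double_complement less_imp_le)
  qed (rule le)
  have sum1: "(\<Sum>a\<in>J. \<gamma> a / (\<theta> a)\<^sup>2 * (\<integral>x. F a x \<partial>M)) = C0 / 4 * (\<Sum>i\<in>UNIV. \<Sum>k\<in>A. \<alpha> k * \<beta> i k / sk k * nrm (Some i) k)"
  proof -
    have "(\<Sum>a\<in>J. \<gamma> a / (\<theta> a)\<^sup>2 * (\<integral>x. F a x \<partial>M)) = (\<Sum>i\<in>UNIV. \<Sum>k\<in>A. \<Sum>m\<in>A.
      C0 * (\<alpha> k * \<beta> i m * sk m) / (sk k + sk m)\<^sup>2 * (if k = m then nrm (Some i) k else 0))"
      unfolding J_def \<gamma>_def \<theta>_def F_def sum.cartesian_product' by (simp add: pr_inner)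
    also have "\<dots> = (\<Sum>i\<in>UNIV. \<Sum>k\<in>A. C0 / 4 * (\<alpha> k * \<beta> i k / sk k * nrm (Some i) k))"
    proof (intro sum.cong refl)
      fix i k assume k: "k \<in> A"
      have "(\<Sum>m\<in>A. C0 * (\<alpha> k * \<beta> i m * sk m) / (sk k + sk m)\<^sup>2 * (if k = m then nrm (Some i) k else 0))
        = C0 * (\<alpha> k * \<beta> i k * sk k) / (sk k + sk k)\<^sup>2 * nrm (Some i) k"
        using A(1) k by (subst sum.remove[OF A(1) k]) (auto intro!: sum.neutral split: if_splits)
      also have "\<dots> = C0 / 4 * (\<alpha> k * \<beta> i k / sk k * nrm (Some i) k)"
        using sk_pos[of k] k A by (auto simp: power2_eq_square field_simps)
      finally show "(\<Sum>m\<in>A. C0 * (\<alpha> k * \<beta> i m * sk m) / (sk k + sk m)\<^sup>2 * (if k = m then nrm (Some i) k else 0))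
        = C0 / 4 * (\<alpha> k * \<beta> i k / sk k * nrm (Some i) k)" .
    qed
    finally show ?thesis by (simp add: sum_distrib_left)
  qed
  \<comment> \<open>6 / 5 is a quarter of 24 / 5, the quarter stemming from the diagonal
    terms.\<close>
  have "6 / 5 * (Q * (Q - 1) / 12) / (1 + sqrt K) = C0 / 4"
  proof -
    have "6 / 5 * z / k = 24 / 5 * z / k / 4" for z k :: real by simp
    then show ?thesis unfolding C0_def S.del_def .
  qed
  moreover have "((\<integral>x. (\<Sum>l\<in>L. (S.u l 0 x)\<^sup>2) powr (P / 2) \<partial>M) + (\<integral>x. (\<Sum>l\<in>-L. (S.u l 0 x)\<^sup>2) powr (Q / 2) \<partial>M))
     = ((\<integral>x. \<bar>f x\<bar> powr sf \<partial>M) + (\<integral>x. (\<Sum>i\<in>UNIV. (g i x)\<^sup>2) powr (sg / 2) \<partial>M))"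
  proof (cases "L = {None}")
    case True
    then show ?thesis unfolding True SL nf sf_def sg_def by simp
  next
    case False
    then have L': "L = -{None}" using L by simp
    show ?thesis using False unfolding L' SL double_complement nf sf_def sg_def by simp
  qed
  ultimately show ?thesis using main unfolding sum1 by (simp only:)
qed

abbreviation "\<Delta> i k \<equiv> delta_coord p q i (tensor \<phi> k)"
abbreviation "C\<^sub>R s \<equiv> 24 * (1 + sqrt K) * (max s (s / (s - 1)) - 1)"

text \<open>Allows scaling by the norms enlarged by e, so that a vanishing norm never has to be
  divided by.\<close>

lemma le_mult_limit:
  fixes B c F G :: real
  assumes "\<And>e. 0 < e \<Longrightarrow> B \<le> c * (F + e) * (G + e)"
  shows "B \<le> c * F * G"
proof (rule tendsto_lowerbound)
  show "((\<lambda>e. c * (F + e) * (G + e)) \<longlongrightarrow> c * F * G) (at_right 0)"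
    by (auto intro!: tendsto_eq_intros)
  show "eventually (\<lambda>e. B \<le> c * (F + e) * (G + e)) (at_right 0)"
    using assms by (auto simp: eventually_at_right_less eventually_at_filter)
qed simp

text \<open>The left side is bilinear and the bound of \<open>bilinear_aux\<close> is a sum of
  powers; scaling f and g to norm at most 1 turns the latter into 7 / 6 * 2, and scaling back gives
  the product of the norms.\<close>

lemma bilinear_bound:
  fixes s :: real and A :: "('d \<Rightarrow> nat) set" and \<alpha> :: "('d \<Rightarrow> nat) \<Rightarrow> real" and \<beta> :: "'d \<Rightarrow> ('d \<Rightarrow> nat) \<Rightarrow> real"
  assumes s: "1 < s" and A: "finite A" "A \<subseteq> index_set ev"
  shows "(\<Sum>i\<in>UNIV. \<Sum>k\<in>A. \<alpha> k * \<beta> i k / sk k * nrm (Some i) k)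
    \<le> C\<^sub>R s * Lp_norm M s (\<lambda>x. \<Sum>k\<in>A. \<alpha> k * pr None k x)
      * Lp_norm M (s / (s - 1)) (\<lambda>x. \<chi> i. \<Sum>k\<in>A. \<beta> i k * pr (Some i) k x)" (is "?B \<le> _ * ?F * ?G")
proof (rule le_mult_limit)
  fix e :: real assume e: "0 < e"
  define s' where "s' = s / (s - 1)"
  have s': "1 < s'" "s = s' / (s' - 1)" using s by (auto simp: s'_def field_simps)
  define P where "P = max s s'"
  define Q where "Q = min s s'"
  \<comment> \<open>The larger exponent must accompany the first argument of \<open>Phi\<close>: the
    scalar part if it is s, the vector part if it is the conjugate exponent.\<close>
  define L where "L = (if s \<ge> s' then {None} else - {None :: 'd option})"
  have ss: "(s - 1) * (s' - 1) = 1" using s by (simp add: s'_def field_simps)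
  have PQ1: "(P - 1) * (Q - 1) = 1" using ss by (auto simp: P_def Q_def max_def min_def mult.commute)
  have Q1: "1 < Q" and PQ: "Q \<le> P" using s s' by (auto simp: P_def Q_def)
  have P2: "2 \<le> P"
  proof (rule ccontr)
    assume "\<not> 2 \<le> P"
    then have "(P - 1) * (Q - 1) < 1 * 1" using PQ Q1 by (intro mult_strict_mono) auto
    then show False using PQ1 by simp
  qed
  have b: "bellman P Q" using P2 PQ1 by (rule bellman.intro)
  have sfg: "(if L = {None} then P else Q) = s" "(if L = {None} then Q else P) = s'"
  proof -
    have "- {None} \<noteq> {None :: 'd option}" by blast
    then show "(if L = {None} then P else Q) = s" "(if L = {None} then Q else P) = s'"
      by (auto simp: L_def P_def Q_def)
  qed
  define F where "F = ?F + e"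
  define G where "G = ?G + e"
  have F: "0 < F" "?F \<le> F" and G: "0 < G" "?G \<le> G" using e by (auto simp: F_def G_def add_nonneg_pos)
  define x where "x = 1 / F"
  define y where "y = 1 / G"
  have xy: "0 < x" "0 < y" using F G by (auto simp: x_def y_def)
  have L: "L = {None} \<or> L = -{None}" by (simp add: L_def)
  have 1: "6 / 5 * (Q * (Q - 1) / 12) / (1 + sqrt K) * (\<Sum>i\<in>UNIV. \<Sum>k\<in>A. (x * \<alpha> k) * (y * \<beta> i k) / sk k * nrm (Some i) k)
    \<le> 7 / 6 * ((\<integral>z. \<bar>\<Sum>k\<in>A. x * \<alpha> k * pr None k z\<bar> powr s \<partial>M)
      + (\<integral>z. (\<Sum>i\<in>UNIV. (\<Sum>k\<in>A. y * \<beta> i k * pr (Some i) k z)\<^sup>2) powr (s' / 2) \<partial>M))"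
    using bilinear_aux[OF b L A, of "\<lambda>k. x * \<alpha> k" "\<lambda>i k. y * \<beta> i k"] unfolding sfg .
  have "(\<integral>z. \<bar>\<Sum>k\<in>A. x * \<alpha> k * pr None k z\<bar> powr s \<partial>M) = Lp_norm M s (\<lambda>z. x *\<^sub>R (\<Sum>k\<in>A. \<alpha> k * pr None k z)) powr s"
    using s by (subst Lp_norm_powr) (auto simp: sum_distrib_left mult.assoc)
  also have "\<dots> = (x * ?F) powr s" using s xy by (subst Lp_norm_scaleR) auto
  also have "\<dots> \<le> 1 powr s" using s F xy by (intro powr_mono2) (auto simp: x_def)
  finally have 2: "(\<integral>z. \<bar>\<Sum>k\<in>A. x * \<alpha> k * pr None k z\<bar> powr s \<partial>M) \<le> 1" by simp
  have "(\<Sum>i\<in>UNIV. (\<Sum>k\<in>A. y * \<beta> i k * pr (Some i) k z)\<^sup>2) powr (s' / 2)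
      = norm (y *\<^sub>R (\<chi> i. \<Sum>k\<in>A. \<beta> i k * pr (Some i) k z)) powr s'" for z
  proof -
    have "norm (y *\<^sub>R (\<chi> i. \<Sum>k\<in>A. \<beta> i k * pr (Some i) k z)) = sqrt (\<Sum>i\<in>UNIV. (\<Sum>k\<in>A. y * \<beta> i k * pr (Some i) k z)\<^sup>2)"
      by (simp add: norm_vec_def L2_set_def sum_distrib_left mult.assoc)
    then show ?thesis by (simp add: powr_half_sqrt[symmetric] sum_nonneg powr_powr)
  qed
  then have "(\<integral>z. (\<Sum>i\<in>UNIV. (\<Sum>k\<in>A. y * \<beta> i k * pr (Some i) k z)\<^sup>2) powr (s' / 2) \<partial>M)
    = Lp_norm M s' (\<lambda>z. y *\<^sub>R (\<chi> i. \<Sum>k\<in>A. \<beta> i k * pr (Some i) k z)) powr s'"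
    using s' by (subst Lp_norm_powr) auto
  also have "\<dots> = (y * ?G) powr s'" using s' xy unfolding s'_def[symmetric] by (simp add: Lp_norm_scaleR)
  also have "\<dots> \<le> 1 powr s'" using s' G xy by (intro powr_mono2) (auto simp: y_def)
  finally have 3: "(\<integral>z. (\<Sum>i\<in>UNIV. (\<Sum>k\<in>A. y * \<beta> i k * pr (Some i) k z)\<^sup>2) powr (s' / 2) \<partial>M) \<le> 1" by simp
  have e: "(\<Sum>i\<in>UNIV. \<Sum>k\<in>A. (x * \<alpha> k) * (y * \<beta> i k) / sk k * nrm (Some i) k) = ?B / (F * G)"
    by (simp add: x_def y_def sum_divide_distrib mult_ac)
  have 4: "6 / 5 * (Q * (Q - 1) / 12) / (1 + sqrt K) * (?B / (F * G)) \<le> 7 / 6 * (1 + 1)"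
    by (rule order_trans[OF 1[unfolded e]]) (intro mult_left_mono add_mono 2 3, simp)
  define k where "k = 1 + sqrt K"
  have k: "0 < k" using K_nonneg by (simp add: k_def add_pos_nonneg)
  define t where "t = ?B / (F * G)"
  \<comment> \<open>6 / 5 / 12 = 1 / 10 and 7 / 6 * 2 = 7 / 3, whence 70 / 3. Multiplication by P -
    1 cancels Q - 1, and Q > 1 is then discarded.\<close>
  have 5: "Q * (Q - 1) * t \<le> 70 / 3 * k"
    using 4 k unfolding k_def[symmetric] t_def[symmetric] by (simp add: field_simps)
  have "Q * t = (P - 1) * (Q * (Q - 1) * t)" using PQ1 by (metis mult.assoc mult.commute mult.left_neutral)
  also have "\<dots> \<le> (P - 1) * (70 / 3 * k)" using P2 by (intro mult_left_mono 5) simp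
  finally have "Q * t \<le> 70 / 3 * k * (P - 1)" by (simp add: mult_ac)
  moreover have "0 \<le> k * (P - 1)" using k P2 by simp
  ultimately have "t \<le> 24 * k * (P - 1)"
  proof -
    assume a: "Q * t \<le> 70 / 3 * k * (P - 1)" and kp: "0 \<le> k * (P - 1)"
    show ?thesis
    proof (cases "0 \<le> t")
      case True
      then have "1 * t \<le> Q * t" using Q1 by (intro mult_right_mono) auto
      then show ?thesis using a kp by linarith
    next
      case False
      then show ?thesis using kp by linarith
    qed
  qed
  then have "?B \<le> 24 * k * (P - 1) * (F * G)"
    using F G by (simp add: t_def divide_le_eq)
  then show "?B \<le> C\<^sub>R s * (?F + e) * (?G + e)"
    by (simp add: F_def G_def k_def P_def s'_def mult_ac)
qed

lemma C\<^sub>R_nonneg: "1 < s \<Longrightarrow> 0 \<le> C\<^sub>R s"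
  using K_nonneg by (intro mult_nonneg_nonneg) auto

section \<open>Riesz transforms of finite sums\<close>

definition "co f k = L2_inner M f (tensor \<phi> k)"
definition "supp f = {k \<in> index_set ev. co f k \<noteq> 0}"
text \<open>Written with the coefficients of f itself, so that it is independent of how f is
  represented as a finite sum.\<close>

definition "R\<^sub>0 f x = (\<chi> i. \<Sum>k\<in>supp f. co f k / sk k * \<Delta> i k x)"

lemma co_lin:
  assumes A: "finite A"
  shows "co (\<lambda>x. \<Sum>k\<in>A. c k * tensor \<phi> k x) m = (if m \<in> A then c m else 0)"
proof -
  have "co (\<lambda>x. \<Sum>k\<in>A. c k * tensor \<phi> k x) m = (\<integral>x. (\<Sum>k\<in>A. c k * (pr None k x * pr None m x)) \<partial>M)"
    by (simp add: co_def L2_inner_def pr_None sum_distrib_right mult.assoc)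
  also have "\<dots> = (\<Sum>k\<in>A. c k * (if k = m then 1 else 0))"
    by (subst Bochner_Integration.integral_sum) (auto intro!: integrable_mult_right pr_mult_integrable sum.cong simp: pr_inner nrm_def)
  also have "\<dots> = (if m \<in> A then c m else 0)" using A by (auto simp: sum.delta' if_distrib cong: if_cong)
  finally show ?thesis .
qed

lemma lin_expand:
  assumes "f \<in> lin (tensor \<phi>)"
  shows "finite {k. co f k \<noteq> 0}" "f = (\<lambda>x. \<Sum>k | co f k \<noteq> 0. co f k * tensor \<phi> k x)"
proof -
  obtain A c where A: "finite A" and f: "f = (\<lambda>x. \<Sum>k\<in>A. c k * tensor \<phi> k x)"
    using assms unfolding lin_def by auto
  have c: "co f k = (if k \<in> A then c k else 0)" for k unfolding f using A by (rule co_lin)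
  show fin: "finite {k. co f k \<noteq> 0}" by (rule finite_subset[OF _ A]) (auto simp: c)
  have "(\<Sum>k\<in>A. c k * tensor \<phi> k x) = (\<Sum>k | co f k \<noteq> 0. co f k * tensor \<phi> k x)" for x
    by (rule sum.mono_neutral_cong_right) (use A in \<open>auto simp: c\<close>)
  then show "f = (\<lambda>x. \<Sum>k | co f k \<noteq> 0. co f k * tensor \<phi> k x)" by (subst (1) f) auto
qed

lemma finite_supp: "f \<in> lin (tensor \<phi>) \<Longrightarrow> finite (supp f)"
  by (rule finite_subset[OF _ lin_expand(1)]) (auto simp: supp_def)

lemma R\<^sub>0_eq:
  assumes "finite A" "A \<subseteq> index_set ev" "supp f \<subseteq> A"
  shows "R\<^sub>0 f x $ i = (\<Sum>k\<in>A. co f k / sk k * \<Delta> i k x)"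
  unfolding R\<^sub>0_def vec_lambda_beta using assms by (intro sum.mono_neutral_left) (auto simp: supp_def)

lemma lin_diff:
  assumes "f \<in> lin (tensor \<phi>)" "g \<in> lin (tensor \<phi>)"
  shows "(\<lambda>x. f x - g x) \<in> lin (tensor \<phi>)" "R\<^sub>0 (\<lambda>x. f x - g x) x = R\<^sub>0 f x - R\<^sub>0 g x"
proof -
  define A where "A = {k. co f k \<noteq> 0} \<union> {k. co g k \<noteq> 0}"
  have A: "finite A" using assms by (simp add: A_def lin_expand)
  have f: "f x = (\<Sum>k\<in>A. co f k * tensor \<phi> k x)" for x
    by (subst lin_expand(2)[OF assms(1)]) (intro sum.mono_neutral_left A, auto simp: A_def)
  have g: "g x = (\<Sum>k\<in>A. co g k * tensor \<phi> k x)" for x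
    by (subst lin_expand(2)[OF assms(2)]) (intro sum.mono_neutral_left A, auto simp: A_def)
  have e: "(\<lambda>x. f x - g x) = (\<lambda>x. \<Sum>k\<in>A. (co f k - co g k) * tensor \<phi> k x)"
    by (rule ext, subst f, subst g) (simp only: sum_subtractf left_diff_distrib)
  show "(\<lambda>x. f x - g x) \<in> lin (tensor \<phi>)" unfolding e lin_def using A by auto
  have c: "co (\<lambda>x. f x - g x) k = co f k - co g k" for k
    unfolding e co_lin[OF A] by (auto simp: A_def)
  let ?A = "A \<inter> index_set ev"
  have "supp f \<subseteq> ?A" "supp g \<subseteq> ?A" "supp (\<lambda>x. f x - g x) \<subseteq> ?A"
    by (auto simp: supp_def A_def c)
  then show "R\<^sub>0 (\<lambda>x. f x - g x) x = R\<^sub>0 f x - R\<^sub>0 g x"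
    using A by (simp add: vec_eq_iff R\<^sub>0_eq[of ?A] c sum_subtractf[symmetric] diff_divide_distrib left_diff_distrib)
qed

lemma \<Delta>_Lp: "1 \<le> u \<Longrightarrow> \<Delta> i k \<in> Lp M u"
  using T3[of u] lin_memI[of "\<lambda>k. \<Delta> i k" k] unfolding dense_in_Lp_def by blast

text \<open>If \<open>supp f\<close> is infinite the sum is 0 by convention, so no restriction on f
  arises.\<close>

lemma R\<^sub>0_Lp: "1 \<le> u \<Longrightarrow> R\<^sub>0 f \<in> Lp M u"
proof (rule Lp_vec(1))
  assume u: "1 \<le> u"
  have *: "(\<lambda>x. c * \<Delta> i k x) \<in> Lp M u" for c i k using Lp_scaleR[OF \<Delta>_Lp[OF u], of c i k] by simp
  show "(\<lambda>x. R\<^sub>0 f x $ i) \<in> Lp M u" for i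
    unfolding R\<^sub>0_def vec_lambda_beta by (rule Lp_sum[OF *]) (use u in simp)
qed simp

lemma eigval_powr: "k \<in> index_set ev \<Longrightarrow> eigval ev k powr - (1 / 2) = 1 / sk k"
  using eigval_pos[of k] by (simp add: sk_def powr_minus_divide powr_half_sqrt)

text \<open>The partial sums are constant as soon as the index set contains \<open>supp f\<close>,
  so the net of errors is eventually 0.\<close>

lemma R\<^sub>0_is_Riesz:
  assumes f: "f \<in> lin (tensor \<phi>)"
  shows "is_Riesz M p q \<phi> ev i f (\<lambda>x. R\<^sub>0 f x $ i)"
  unfolding is_Riesz_def has_L2_sum_def co_def[symmetric]
proof (intro conjI ballI)
  show "(\<lambda>x. R\<^sub>0 f x $ i) \<in> Lp M 2" by (rule Lp_vec_component[OF R\<^sub>0_Lp]) auto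
  show "(\<lambda>x. eigval ev k powr (- 1 / 2) * co f k * \<Delta> i k x) \<in> Lp M 2" for k
    using Lp_scaleR[OF \<Delta>_Lp, of 2 "eigval ev k powr (- 1 / 2) * co f k" i k] by simp
  have "eventually (\<lambda>B. finite B \<and> supp f \<subseteq> B \<and> B \<subseteq> index_set ev) (finite_subsets_at_top (index_set ev))"
    unfolding eventually_finite_subsets_at_top
    using finite_supp[OF f] by (intro exI[of _ "supp f"]) (auto simp: supp_def)
  then have "eventually (\<lambda>B. Lp_norm M 2 (\<lambda>x. R\<^sub>0 f x $ i - (\<Sum>k\<in>B. eigval ev k powr (- 1 / 2) * co f k * \<Delta> i k x)) = 0)
    (finite_subsets_at_top (index_set ev))"
  proof eventually_elim
    case (elim B)
    then have "(\<Sum>k\<in>B. eigval ev k powr (- 1 / 2) * co f k * \<Delta> i k x) = R\<^sub>0 f x $ i" for x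
      by (subst R\<^sub>0_eq[of B]) (auto intro!: sum.cong simp: eigval_powr subset_iff)
    then show ?case by (simp add: Lp_norm_def)
  qed
  then show "((\<lambda>B. Lp_norm M 2 (\<lambda>x. R\<^sub>0 f x $ i - (\<Sum>k\<in>B. eigval ev k powr (- 1 / 2) * co f k * \<Delta> i k x))) \<longlongrightarrow> 0)
    (finite_subsets_at_top (index_set ev))" by (rule tendsto_eventually)
qed

text \<open>The only omitted index is 0, with eigenvalue 0. The squared norm of delta_i \<phi>_0 is
  then - a i\<open>plus 0, at most 0, so the function vanishes\<close>. The dense spaces of (T3)
  contain this function, although the Riesz series omits it.\<close>

lemma pr_zero:
  assumes "k \<notin> index_set ev"
  shows "AE x in M. pr (Some i) k x = 0"
proof -
  have k: "k = (\<lambda>_. 0)" "eigval ev (\<lambda>_. 0) \<le> 0" using assms by (auto simp: index_set_def split: if_splits)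
  have "ev i 0 \<le> eigval ev (\<lambda>_. 0)"
    unfolding eigval_def by (rule member_le_sum) (auto intro: ev_nonneg)
  then have "nrm (Some i) k \<le> 0" using k a_nonneg[of i] by (simp add: nrm_def)
  moreover have "0 \<le> (\<integral>x. pr (Some i) k x * pr (Some i) k x \<partial>M)" by (rule Bochner_Integration.integral_nonneg) simp
  ultimately have "(\<integral>x. pr (Some i) k x * pr (Some i) k x \<partial>M) = 0" by (simp add: pr_inner)
  then have "AE x in M. pr (Some i) k x * pr (Some i) k x = 0"
    using integral_nonneg_eq_0_iff_AE[OF pr_mult_integrable[of "Some i" k k]] by simp
  then show ?thesis by simp
qed

lemma Pi_proj_lin:
  assumes f: "f \<in> lin (tensor \<phi>)" and A: "finite A" "A \<subseteq> index_set ev" "supp f \<subseteq> A"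
  shows "Pi_proj M \<phi> ev f x = (\<Sum>k\<in>A. co f k * pr None k x)"
proof -
  have fin: "finite {k. co f k \<noteq> 0}" by (rule lin_expand(1)[OF f])
  have "(\<Sum>k\<in>A. co f k * pr None k x) = (\<Sum>k\<in>supp f. co f k * pr None k x)"
    using A by (intro sum.mono_neutral_right) (auto simp: supp_def)
  also have "\<dots> = Pi_proj M \<phi> ev f x"
  proof (cases "eigval ev (\<lambda>_. 0) > 0")
    case True
    then have "supp f = {k. co f k \<noteq> 0}" by (auto simp: supp_def index_set_def)
    then show ?thesis using True by (subst (2) lin_expand(2)[OF f]) (simp add: Pi_proj_def pr_None)
  next
    case False
    define D where "D = insert (\<lambda>_. 0) {k. co f k \<noteq> 0}"
    have D: "finite D" "(\<lambda>_. 0) \<in> D" using fin by (auto simp: D_def)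
    have "f x = (\<Sum>k\<in>D. co f k * pr None k x)"
      by (subst lin_expand(2)[OF f]) (simp only: pr_None, intro sum.mono_neutral_left D, auto simp: D_def)
    also have "\<dots> = co f (\<lambda>_. 0) * pr None (\<lambda>_. 0) x + (\<Sum>k\<in>D - {\<lambda>_. 0}. co f k * pr None k x)"
      by (rule sum.remove[OF D])
    also have "D - {\<lambda>_. 0} = supp f" using False by (auto simp: D_def supp_def index_set_def)
    finally show ?thesis using False by (simp add: Pi_proj_def co_def[symmetric] pr_None)
  qed
  finally show ?thesis ..
qed

text \<open>Duality with test functions whose i-th component is a finite sum of the functions
  delta_i \<phi>_k, followed by \<open>bilinear_bound\<close>; the projection appears because that
  bound sees only indices in \<open>index_set ev\<close>.\<close>

lemma R\<^sub>0_bound: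
  assumes s: "1 < s" and f: "f \<in> lin (tensor \<phi>)"
  shows "Lp_norm M s (R\<^sub>0 f) \<le> C\<^sub>R s * Lp_norm M s (Pi_proj M \<phi> ev f)"
proof (rule Lp_norm_le_by_duality[where q = "s / (s - 1)" and V = "\<lambda>i. lin (\<Delta> i)"])
  have s': "1 < s / (s - 1)" using s by simp
  show "1 < s" "1 < s / (s - 1)" by fact+
  show "1 / s + 1 / (s / (s - 1)) = 1" using s by (simp add: field_simps)
  show "R\<^sub>0 f \<in> Lp M s" using s by (intro R\<^sub>0_Lp) simp
  show "0 \<le> C\<^sub>R s * Lp_norm M s (Pi_proj M \<phi> ev f)" using C\<^sub>R_nonneg[OF s] by simp
  show "dense_in_Lp M (s / (s - 1)) (lin (\<Delta> i))" for i using T3[of "s / (s - 1)"] s' by simp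
  fix g :: "('d \<Rightarrow> real) \<Rightarrow> real ^ 'd" assume "\<And>i. (\<lambda>x. g x $ i) \<in> lin (\<Delta> i)"
  then have "\<forall>i. \<exists>B c. finite B \<and> (\<lambda>x. g x $ i) = (\<lambda>x. \<Sum>k\<in>B. c k * \<Delta> i k x)" unfolding lin_def by blast
  then obtain B c where B: "\<And>i. finite (B i)" and g: "\<And>i x. g x $ i = (\<Sum>k\<in>B i. c i k * \<Delta> i k x)"
    unfolding choice_iff fun_eq_iff by blast
  \<comment> \<open>A common finite index set for f and for all components of g, without the index 0
    if its eigenvalue is 0; \<open>gG\<close> shows that the latter changes g only on a null
    set.\<close>
  define A where "A = (supp f \<union> (\<Union>i. B i)) \<inter> index_set ev"
  have A: "finite A" "A \<subseteq> index_set ev" "supp f \<subseteq> A"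
    using B finite_supp[OF f] by (auto simp: A_def supp_def)
  define \<beta> where "\<beta> i k = (if k \<in> B i then c i k else 0)" for i k
  define G where "G x = (\<chi> i. \<Sum>k\<in>A. \<beta> i k * pr (Some i) k x)" for x
  have gG: "AE x in M. g x = G x"
  proof -
    have "AE x in M. \<forall>k\<in>B i - index_set ev. pr (Some i) k x = 0" for i
      by (subst AE_ball_countable) (auto simp: B countable_finite pr_zero)
    then have "AE x in M. \<forall>i. \<forall>k\<in>B i - index_set ev. pr (Some i) k x = 0"
      by (simp only: AE_all_countable) simp
    then show ?thesis
    proof (rule AE_mp, intro AE_I2 impI)
      fix x assume x: "x \<in> space M" and z: "\<forall>i. \<forall>k\<in>B i - index_set ev. pr (Some i) k x = 0"
      have "g x $ i = G x $ i" for i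
      proof -
        have "g x $ i = (\<Sum>k\<in>B i. c i k * pr (Some i) k x)"
          unfolding g using x by (simp add: delta_coord_tensor_space)
        also have "\<dots> = (\<Sum>k\<in>B i \<inter> index_set ev. c i k * pr (Some i) k x)"
          using B z by (intro sum.mono_neutral_right) auto
        also have "\<dots> = (\<Sum>k\<in>A. \<beta> i k * pr (Some i) k x)"
          by (rule sum.mono_neutral_cong_left) (use A in \<open>auto simp: A_def \<beta>_def\<close>)
        finally show ?thesis by (simp add: G_def)
      qed
      then show "g x = G x" by (simp add: vec_eq_iff)
    qed
  qed
  have gm: "g \<in> borel_measurable M"
  proof -
    have *: "(\<lambda>x. c i k * \<Delta> i k x) \<in> Lp M 1" for i k using Lp_scaleR[OF \<Delta>_Lp, of 1 "c i k" i k] by simp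
    have "(\<lambda>x. g x $ i) \<in> Lp M 1" for i unfolding g by (rule Lp_sum[OF *]) simp
    from Lp_vec(1)[OF this] show ?thesis by auto
  qed
  have Gm: "G \<in> borel_measurable M"
  proof -
    have *: "(\<lambda>x. \<beta> i k * pr (Some i) k x) \<in> Lp M 1" for i k using Lp_scaleR[OF pr_Lp, of 1 "\<beta> i k" "Some i" k] by simp
    have "(\<lambda>x. G x $ i) \<in> Lp M 1" for i unfolding G_def vec_lambda_beta by (rule Lp_sum[OF *]) simp
    from Lp_vec(1)[OF this] show ?thesis by auto
  qed
  have R0m: "R\<^sub>0 f \<in> borel_measurable M" using R\<^sub>0_Lp[of 1 f] by auto
  have "(\<integral>x. R\<^sub>0 f x \<bullet> g x \<partial>M) = (\<integral>x. R\<^sub>0 f x \<bullet> G x \<partial>M)"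
    by (rule integral_cong_AE) (use gG gm Gm R0m in auto)
  also have "\<dots> = (\<integral>x. (\<Sum>i\<in>UNIV. \<Sum>k\<in>A. \<Sum>m\<in>A. co f k / sk k * \<beta> i m * (pr (Some i) k x * pr (Some i) m x)) \<partial>M)"
  proof (intro Bochner_Integration.integral_cong refl)
    fix x assume x: "x \<in> space M"
    have "co f k / sk k * \<Delta> i k x * (\<beta> i m * pr (Some i) m x)
      = co f k / sk k * \<beta> i m * (pr (Some i) k x * pr (Some i) m x)" for i k m
      using x by (simp add: delta_coord_tensor_space)
    then show "R\<^sub>0 f x \<bullet> G x = (\<Sum>i\<in>UNIV. \<Sum>k\<in>A. \<Sum>m\<in>A. co f k / sk k * \<beta> i m * (pr (Some i) k x * pr (Some i) m x))"
      by (simp only: inner_vec_def inner_real_def G_def vec_lambda_beta R\<^sub>0_eq[OF A] sum_product)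
  qed
  also have "\<dots> = (\<Sum>i\<in>UNIV. \<Sum>k\<in>A. \<Sum>m\<in>A. co f k / sk k * \<beta> i m * (if k = m then nrm (Some i) k else 0))"
  proof -
    have i: "integrable M (\<lambda>x. co f k / sk k * \<beta> i m * (pr (Some i) k x * pr (Some i) m x))" for i k m
      by (intro integrable_mult_right pr_mult_integrable)
    have v: "(\<integral>x. co f k / sk k * \<beta> i m * (pr (Some i) k x * pr (Some i) m x) \<partial>M)
      = co f k / sk k * \<beta> i m * (if k = m then nrm (Some i) k else 0)" for i k m
      by (simp add: pr_inner)
    show ?thesis
      by (subst Bochner_Integration.integral_sum, intro Bochner_Integration.integrable_sum i, rule sum.cong[OF refl])
        (subst Bochner_Integration.integral_sum, intro Bochner_Integration.integrable_sum i, rule sum.cong[OF refl],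
         subst Bochner_Integration.integral_sum, rule i, simp only: v)
  qed
  also have "\<dots> = (\<Sum>i\<in>UNIV. \<Sum>k\<in>A. co f k * \<beta> i k / sk k * nrm (Some i) k)"
    using A(1) by (simp add: if_distrib sum.delta cong: if_cong)
  also have "\<dots> \<le> C\<^sub>R s * Lp_norm M s (\<lambda>x. \<Sum>k\<in>A. co f k * pr None k x) * Lp_norm M (s / (s - 1)) G"
    unfolding G_def[abs_def] by (rule bilinear_bound[OF s A(1,2)])
  also have "(\<lambda>x. \<Sum>k\<in>A. co f k * pr None k x) = Pi_proj M \<phi> ev f"
    by (simp add: fun_eq_iff Pi_proj_lin[OF f A])
  also have "Lp_norm M (s / (s - 1)) G = Lp_norm M (s / (s - 1)) g"
    by (rule Lp_norm_cong_AE[OF Gm gm]) (use gG in auto)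
  finally show "(\<integral>x. R\<^sub>0 f x \<bullet> g x \<partial>M) \<le> C\<^sub>R s * Lp_norm M s (Pi_proj M \<phi> ev f) * Lp_norm M (s / (s - 1)) g" .
qed

text \<open>A crude norm of the projection on L^s, from Hoelder's inequality. It serves
  approximation arguments only and does not enter the final constant.\<close>

definition "B\<^sub>\<Pi> s = 1 + Lp_norm M (s / (s - 1)) (tensor \<phi> (\<lambda>_. 0)) * Lp_norm M s (tensor \<phi> (\<lambda>_. 0))"

lemma B\<^sub>\<Pi>_nonneg: "0 \<le> B\<^sub>\<Pi> s"
  by (simp add: B\<^sub>\<Pi>_def add_nonneg_nonneg)

lemma tensor_Lp: "1 \<le> u \<Longrightarrow> tensor \<phi> k \<in> Lp M u"
  using pr_Lp[of u None k] by (simp add: pr_None[abs_def])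

lemma Pi_proj_bound:
  assumes s: "1 < s" and f: "f \<in> Lp M s"
  shows "Pi_proj M \<phi> ev f \<in> Lp M s" "Lp_norm M s (Pi_proj M \<phi> ev f) \<le> B\<^sub>\<Pi> s * Lp_norm M s f"
proof -
  let ?e = "tensor \<phi> (\<lambda>_. 0)"
  define c where "c = L2_inner M f ?e"
  have e: "?e \<in> Lp M s" "?e \<in> Lp M (s / (s - 1))" using s by (auto intro!: tensor_Lp)
  have ce: "(\<lambda>x. c * ?e x) \<in> Lp M s" using Lp_scaleR[OF e(1), of c] by simp
  have "\<bar>c\<bar> \<le> Lp_norm M s f * Lp_norm M (s / (s - 1)) ?e"
    using Holder(2)[of s "s / (s - 1)", OF _ _ _ f e(2)] s by (simp add: c_def L2_inner_def field_simps)
  then have n: "Lp_norm M s (\<lambda>x. (-c) * ?e x) \<le> Lp_norm M s f * Lp_norm M (s / (s - 1)) ?e * Lp_norm M s ?e"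
    using Lp_norm_scaleR[of s M "-c" ?e] s by (simp add: mult_right_mono)
  have "Lp_norm M s (\<lambda>x. f x + (-c) * ?e x) \<le> Lp_norm M s f + Lp_norm M s (\<lambda>x. (-c) * ?e x)"
    using s Lp_scaleR[OF e(1), of "-c"] by (intro Lp_norm_triangle f) auto
  also have "\<dots> \<le> B\<^sub>\<Pi> s * Lp_norm M s f" using n by (simp add: B\<^sub>\<Pi>_def algebra_simps)
  finally have 1: "Lp_norm M s (\<lambda>x. f x - c * ?e x) \<le> B\<^sub>\<Pi> s * Lp_norm M s f" by simp
  have 2: "Lp_norm M s f \<le> B\<^sub>\<Pi> s * Lp_norm M s f"
    by (simp add: B\<^sub>\<Pi>_def distrib_right)
  show "Pi_proj M \<phi> ev f \<in> Lp M s"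
    using f Lp_diff[OF f ce] s by (simp add: Pi_proj_def c_def)
  show "Lp_norm M s (Pi_proj M \<phi> ev f) \<le> B\<^sub>\<Pi> s * Lp_norm M s f"
    using 1 2 by (simp add: Pi_proj_def c_def)
qed

lemma Pi_proj_diff:
  assumes s: "1 < s" and f: "f \<in> Lp M s" and g: "g \<in> Lp M s"
  shows "Pi_proj M \<phi> ev (\<lambda>x. f x - g x) = (\<lambda>x. Pi_proj M \<phi> ev f x - Pi_proj M \<phi> ev g x)"
proof -
  have e: "tensor \<phi> (\<lambda>_. 0) \<in> Lp M (s / (s - 1))" using s by (auto intro!: tensor_Lp)
  have i: "integrable M (\<lambda>x. h x * tensor \<phi> (\<lambda>_. 0) x)" if "h \<in> Lp M s" for h
    using Holder(1)[of s "s / (s - 1)", OF _ _ _ that e] s by (simp add: field_simps)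
  have "L2_inner M (\<lambda>x. f x - g x) (tensor \<phi> (\<lambda>_. 0)) = L2_inner M f (tensor \<phi> (\<lambda>_. 0)) - L2_inner M g (tensor \<phi> (\<lambda>_. 0))"
    unfolding L2_inner_def left_diff_distrib by (intro Bochner_Integration.integral_diff i f g)
  then show ?thesis unfolding Pi_proj_def by (simp only:) (simp add: fun_eq_iff left_diff_distrib)
qed

section \<open>Extension from finite sums to L^s\<close>

lemma lin_Lp: "1 \<le> u \<Longrightarrow> f \<in> lin (tensor \<phi>) \<Longrightarrow> f \<in> Lp M u"
  using T3[of u] unfolding dense_in_Lp_def by blast

lemma lin_approx:
  assumes "1 \<le> s" "f \<in> Lp M s" "0 < e"
  obtains h where "h \<in> lin (tensor \<phi>)" "Lp_norm M s (\<lambda>x. f x - h x) < e"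
  using assms T3[of s] unfolding dense_in_Lp_def by blast

text \<open>Needed because an arbitrary extension is tied to the Riesz transforms only through the
  L^2 series, while its norm is measured in L^s; equality almost everywhere links the two.\<close>

lemma has_L2_sum_unique:
  assumes "has_L2_sum M F A g" "has_L2_sum M F A g'"
  shows "AE x in M. g x = g' x"
proof -
  have L: "g \<in> Lp M 2" "g' \<in> Lp M 2" and FL: "\<And>k. k \<in> A \<Longrightarrow> F k \<in> Lp M 2"
    and l: "((\<lambda>B. Lp_norm M 2 (\<lambda>x. g x - (\<Sum>k\<in>B. F k x))) \<longlongrightarrow> 0) (finite_subsets_at_top A)"
      "((\<lambda>B. Lp_norm M 2 (\<lambda>x. g' x - (\<Sum>k\<in>B. F k x))) \<longlongrightarrow> 0) (finite_subsets_at_top A)"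
    using assms unfolding has_L2_sum_def by auto
  have "Lp_norm M 2 (\<lambda>x. g x - g' x) \<le> 0 + 0"
  proof (rule tendsto_lowerbound[OF tendsto_add[OF l]])
    show "eventually (\<lambda>B. Lp_norm M 2 (\<lambda>x. g x - g' x) \<le> Lp_norm M 2 (\<lambda>x. g x - (\<Sum>k\<in>B. F k x)) + Lp_norm M 2 (\<lambda>x. g' x - (\<Sum>k\<in>B. F k x)))
      (finite_subsets_at_top A)"
      unfolding eventually_finite_subsets_at_top
    proof (intro exI[of _ "{}"] conjI allI impI)
      fix B assume "finite B \<and> {} \<subseteq> B \<and> B \<subseteq> A"
      then have "(\<lambda>x. \<Sum>k\<in>B. F k x) \<in> Lp M 2" by (intro Lp_sum FL) auto
      from Lp_norm_triangle_diff[OF L(1) this L(2)]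
      show "Lp_norm M 2 (\<lambda>x. g x - g' x) \<le> Lp_norm M 2 (\<lambda>x. g x - (\<Sum>k\<in>B. F k x)) + Lp_norm M 2 (\<lambda>x. g' x - (\<Sum>k\<in>B. F k x))"
        by (simp add: Lp_norm_minus_commute[of M 2 g'])
    qed auto
  qed simp
  then have "(\<integral>x. norm (g x - g' x) powr 2 \<partial>M) = 0"
    using Lp_norm_powr[of 2 M "\<lambda>x. g x - g' x"] Lp_norm_nonneg[of M 2 "\<lambda>x. g x - g' x"] by simp
  then have "AE x in M. norm (g x - g' x) powr 2 = 0"
    using integral_nonneg_eq_0_iff_AE[OF Lp_integrable[OF Lp_diff[OF L]]] by simp
  then show ?thesis by simp
qed

lemma Riesz_extension_exists:
  assumes s: "1 < s"
  shows "\<exists>T. Riesz_extension M p q \<phi> ev s T"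
proof -
  define C where "C = C\<^sub>R s * B\<^sub>\<Pi> s"
  have C: "0 \<le> C" unfolding C_def by (intro mult_nonneg_nonneg C\<^sub>R_nonneg B\<^sub>\<Pi>_nonneg s)
  have s1: "1 \<le> s" using s by simp
  have lip: "Lp_norm M s (\<lambda>x. R\<^sub>0 g x - R\<^sub>0 h x) \<le> C * Lp_norm M s (\<lambda>x. g x - h x)"
    if g: "g \<in> lin (tensor \<phi>)" and h: "h \<in> lin (tensor \<phi>)" for g h
  proof -
    have d: "(\<lambda>x. g x - h x) \<in> lin (tensor \<phi>)" by (rule lin_diff(1)[OF g h])
    have "Lp_norm M s (\<lambda>x. R\<^sub>0 g x - R\<^sub>0 h x) = Lp_norm M s (R\<^sub>0 (\<lambda>x. g x - h x))"
      by (simp only: lin_diff(2)[OF g h, symmetric])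
    also have "\<dots> \<le> C\<^sub>R s * Lp_norm M s (Pi_proj M \<phi> ev (\<lambda>x. g x - h x))" by (rule R\<^sub>0_bound[OF s d])
    also have "\<dots> \<le> C\<^sub>R s * (B\<^sub>\<Pi> s * Lp_norm M s (\<lambda>x. g x - h x))"
      by (intro mult_left_mono Pi_proj_bound(2) C\<^sub>R_nonneg s lin_Lp[OF s1 d])
    finally show ?thesis by (simp only: C_def mult.assoc)
  qed
  have "\<forall>f. \<exists>H. f \<in> Lp M s \<longrightarrow> H \<in> Lp M s \<and> (\<forall>g\<in>lin (tensor \<phi>). Lp_norm M s (\<lambda>x. H x - R\<^sub>0 g x) \<le> C * Lp_norm M s (\<lambda>x. f x - g x))"
    using Lp_extension[OF s1 _ _ C R\<^sub>0_Lp[OF s1] lip] T3[OF s1] by blast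
  then obtain H where H: "\<And>f. f \<in> Lp M s \<Longrightarrow> H f \<in> Lp M s"
    "\<And>f g. f \<in> Lp M s \<Longrightarrow> g \<in> lin (tensor \<phi>) \<Longrightarrow> Lp_norm M s (\<lambda>x. H f x - R\<^sub>0 g x) \<le> C * Lp_norm M s (\<lambda>x. f x - g x)"
    unfolding choice_iff by blast
  \<comment> \<open>On finite sums \<open>H\<close> agrees with \<open>R\<^sub>0\<close> only almost
    everywhere; choosing \<open>R\<^sub>0\<close> itself there makes the series condition
    immediate.\<close>
  define T where "T f = (if f \<in> lin (tensor \<phi>) then R\<^sub>0 f else H f)" for f
  have TL: "T f \<in> Lp M s" if "f \<in> Lp M s" for f using H(1)[OF that] R\<^sub>0_Lp[OF s1] by (simp add: T_def)
  have TR: "Lp_norm M s (\<lambda>x. T f x - R\<^sub>0 g x) \<le> C * Lp_norm M s (\<lambda>x. f x - g x)"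
    if "f \<in> Lp M s" "g \<in> lin (tensor \<phi>)" for f g
    using H(2)[OF that] lip[OF _ that(2)] by (simp add: T_def)
  have "Riesz_extension M p q \<phi> ev s T"
    unfolding Riesz_extension_def
  proof (intro conjI ballI allI impI)
    show "T f \<in> Lp M s" if "f \<in> Lp M s" for f by (rule TL[OF that])
    show "is_Riesz M p q \<phi> ev i f (\<lambda>x. T f x $ i)" if "f \<in> lin (tensor \<phi>)" for f i
      using R\<^sub>0_is_Riesz[OF that] that by (simp add: T_def)
    fix \<epsilon> :: real and f :: "('d \<Rightarrow> real) \<Rightarrow> real" assume f: "f \<in> Lp M s" and \<epsilon>: "0 < \<epsilon>"
    \<comment> \<open>Through a finite sum h near f the error is C * \<eta>' for f and C * 2 *
      \<eta>' for g.\<close>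
    define \<eta>' where "\<eta>' = \<epsilon> / (3 * (C + 1))"
    have \<eta>': "0 < \<eta>'" using \<epsilon> C by (simp add: \<eta>'_def)
    have "C * (3 * \<eta>') < (C + 1) * (3 * \<eta>')" using \<eta>' by simp
    also have "\<dots> = \<epsilon>" using C by (simp add: \<eta>'_def field_simps)
    finally have small: "C * (3 * \<eta>') < \<epsilon>" .
    obtain h where h: "h \<in> lin (tensor \<phi>)" "Lp_norm M s (\<lambda>x. f x - h x) < \<eta>'"
      by (rule lin_approx[OF s1 f \<eta>'])
    have hL: "h \<in> Lp M s" by (rule lin_Lp[OF s1 h(1)])
    show "\<exists>\<eta>>0. \<forall>g\<in>Lp M s. Lp_norm M s (\<lambda>x. f x - g x) < \<eta> \<longrightarrow> Lp_norm M s (\<lambda>x. T f x - T g x) < \<epsilon>"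
    proof (intro exI[of _ \<eta>'] conjI ballI impI \<eta>')
      fix g assume g: "g \<in> Lp M s" and fg: "Lp_norm M s (\<lambda>x. f x - g x) < \<eta>'"
      have "Lp_norm M s (\<lambda>x. T f x - T g x) \<le> Lp_norm M s (\<lambda>x. T f x - R\<^sub>0 h x) + Lp_norm M s (\<lambda>x. R\<^sub>0 h x - T g x)"
        by (intro Lp_norm_triangle_diff TL f g R\<^sub>0_Lp s1)
      also have "Lp_norm M s (\<lambda>x. R\<^sub>0 h x - T g x) = Lp_norm M s (\<lambda>x. T g x - R\<^sub>0 h x)"
        by (rule Lp_norm_minus_commute)
      also have "\<dots> \<le> C * Lp_norm M s (\<lambda>x. g x - h x)" by (rule TR[OF g h(1)])
      also have "\<dots> \<le> C * (Lp_norm M s (\<lambda>x. g x - f x) + Lp_norm M s (\<lambda>x. f x - h x))"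
        by (intro mult_left_mono C Lp_norm_triangle_diff g f hL s1)
      also have "Lp_norm M s (\<lambda>x. g x - f x) = Lp_norm M s (\<lambda>x. f x - g x)" by (rule Lp_norm_minus_commute)
      also have "C * (Lp_norm M s (\<lambda>x. f x - g x) + Lp_norm M s (\<lambda>x. f x - h x)) \<le> C * (2 * \<eta>')"
        using fg h(2) by (intro mult_left_mono C) linarith
      also have "Lp_norm M s (\<lambda>x. T f x - R\<^sub>0 h x) \<le> C * \<eta>'"
        by (rule order_trans[OF TR[OF f h(1)]]) (intro mult_left_mono C less_imp_le h(2))
      finally show "Lp_norm M s (\<lambda>x. T f x - T g x) < \<epsilon>" using small by (simp add: algebra_simps)
    qed
  qed
  then show ?thesis by blast
qed

text \<open>Any extension T equals \<open>R\<^sub>0\<close> almost everywhere at a finite sum h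
  close to f. Continuity of T at f and of the projection then carries \<open>R\<^sub>0_bound\<close>
  from h to f with the same constant.\<close>

lemma Riesz_extension_bound:
  assumes s: "1 < s" and T: "Riesz_extension M p q \<phi> ev s T" and f: "f \<in> Lp M s"
  shows "Lp_norm M s (T f) \<le> C\<^sub>R s * Lp_norm M s (Pi_proj M \<phi> ev f)"
proof (rule field_le_epsilon)
  fix \<epsilon>' :: real assume \<epsilon>': "0 < \<epsilon>'"
  define C where "C = C\<^sub>R s * B\<^sub>\<Pi> s"
  have C: "0 \<le> C" unfolding C_def by (intro mult_nonneg_nonneg C\<^sub>R_nonneg B\<^sub>\<Pi>_nonneg s)
  have s1: "1 \<le> s" using s by simp
  \<comment> \<open>One \<epsilon> is lost by the continuity of T, and C * \<epsilon> by the
    projection of h - f.\<close>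
  define \<epsilon> where "\<epsilon> = \<epsilon>' / (1 + C)"
  have \<epsilon>: "0 < \<epsilon>" using C \<epsilon>' by (simp add: \<epsilon>_def)
  have "(1 + C) * \<epsilon> = \<epsilon>'" using C by (simp add: \<epsilon>_def)
  then have \<epsilon>_eq: "\<epsilon> + C * \<epsilon> = \<epsilon>'" by (simp add: distrib_right)
  have TL: "T h \<in> Lp M s" if "h \<in> Lp M s" for h using T that by (simp add: Riesz_extension_def)
  have "\<exists>\<eta>>0. \<forall>g\<in>Lp M s. Lp_norm M s (\<lambda>x. f x - g x) < \<eta> \<longrightarrow> Lp_norm M s (\<lambda>x. T f x - T g x) < \<epsilon>"
    using T f \<epsilon> unfolding Riesz_extension_def by blast
  then obtain \<eta>' where \<eta>': "0 < \<eta>'" "\<And>g. g \<in> Lp M s \<Longrightarrow> Lp_norm M s (\<lambda>x. f x - g x) < \<eta>' \<Longrightarrow> Lp_norm M s (\<lambda>x. T f x - T g x) < \<epsilon>"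
    by blast
  have "0 < min \<eta>' \<epsilon>" using \<eta>' \<epsilon> by simp
  then obtain h where h: "h \<in> lin (tensor \<phi>)" "Lp_norm M s (\<lambda>x. f x - h x) < min \<eta>' \<epsilon>"
    by (rule lin_approx[OF s1 f])
  have hL: "h \<in> Lp M s" by (rule lin_Lp[OF s1 h(1)])
  have "AE x in M. T h x $ i = R\<^sub>0 h x $ i" for i
    by (rule has_L2_sum_unique) (use T h(1) R\<^sub>0_is_Riesz[OF h(1)] in \<open>auto simp: Riesz_extension_def is_Riesz_def\<close>)
  then have "AE x in M. T h x = R\<^sub>0 h x" by (simp add: vec_eq_iff AE_all_countable)
  then have Th: "Lp_norm M s (T h) = Lp_norm M s (R\<^sub>0 h)"
    using TL[OF hL] R\<^sub>0_Lp[OF s1, of h] by (intro Lp_norm_cong_AE) auto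
  let ?P = "Pi_proj M \<phi> ev"
  have d: "(\<lambda>x. h x - f x) \<in> Lp M s" using s by (intro Lp_diff hL f) simp
  have "Lp_norm M s (\<lambda>x. ?P f x + ?P (\<lambda>x. h x - f x) x) \<le> Lp_norm M s (?P f) + Lp_norm M s (?P (\<lambda>x. h x - f x))"
    by (intro Lp_norm_triangle Pi_proj_bound(1) s f d s1)
  also have "(\<lambda>x. ?P f x + ?P (\<lambda>x. h x - f x) x) = ?P h" by (simp add: Pi_proj_diff[OF s hL f])
  also have "Lp_norm M s (?P (\<lambda>x. h x - f x)) \<le> B\<^sub>\<Pi> s * \<epsilon>"
    using h(2) by (intro order_trans[OF Pi_proj_bound(2)[OF s d]] mult_left_mono B\<^sub>\<Pi>_nonneg)
      (simp add: Lp_norm_minus_commute[of M s h])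
  finally have P: "Lp_norm M s (?P h) \<le> Lp_norm M s (?P f) + B\<^sub>\<Pi> s * \<epsilon>" by simp
  have "Lp_norm M s (\<lambda>x. T h x + (T f x - T h x)) \<le> Lp_norm M s (T h) + Lp_norm M s (\<lambda>x. T f x - T h x)"
    using s by (intro Lp_norm_triangle Lp_diff TL f hL) auto
  then have "Lp_norm M s (T f) \<le> Lp_norm M s (R\<^sub>0 h) + Lp_norm M s (\<lambda>x. T f x - T h x)" by (simp add: Th)
  also have "Lp_norm M s (\<lambda>x. T f x - T h x) \<le> \<epsilon>" using \<eta>'(2)[OF hL] h(2) by simp
  also have "Lp_norm M s (R\<^sub>0 h) \<le> C\<^sub>R s * Lp_norm M s (?P h)" by (rule R\<^sub>0_bound[OF s h(1)])
  also have "\<dots> \<le> C\<^sub>R s * (Lp_norm M s (?P f) + B\<^sub>\<Pi> s * \<epsilon>)" by (intro mult_left_mono P C\<^sub>R_nonneg s)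
  also have "\<dots> + \<epsilon> = C\<^sub>R s * Lp_norm M s (?P f) + \<epsilon>'"
    unfolding \<epsilon>_eq[symmetric] C_def by (simp only: distrib_left mult.assoc add_ac)
  finally show "Lp_norm M s (T f) \<le> C\<^sub>R s * Lp_norm M s (?P f) + \<epsilon>'" by simp
qed

end

theorem theorem2:
  fixes \<sigma> \<tau> :: "'d :: finite \<Rightarrow> ereal"
    and w p q :: "'d \<Rightarrow> real \<Rightarrow> real"
    and a :: "'d \<Rightarrow> real"
    and \<phi> :: "'d \<Rightarrow> nat \<Rightarrow> real \<Rightarrow> real"
    and ev :: "'d \<Rightarrow> nat \<Rightarrow> real"
    and K s :: real
  defines "X \<equiv> \<lambda>i. einterval (\<sigma> i) (\<tau> i)"
    and "\<mu> \<equiv> \<lambda>i. weighted_measure (\<sigma> i) (\<tau> i) (w i)"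
    and "M \<equiv> product_measure \<sigma> \<tau> w"
  assumes interval: "\<And>i. \<sigma> i < \<tau> i"
    and w_smooth: "\<And>i. smooth_fun_on (X i) (w i)"
    and w_pos: "\<And>i y. y \<in> X i \<Longrightarrow> w i y > 0"
    and p_smooth: "\<And>i. smooth_fun_on (X i) (p i)"
    and p_nonzero: "\<And>i y. y \<in> X i \<Longrightarrow> p i y \<noteq> 0"
    and q_smooth: "\<And>i. smooth_fun_on (X i) (q i)"
    and a_nonneg: "\<And>i. a i \<ge> 0"
    and basis: "\<And>i. orthonormal_basis_L2 (\<mu> i) (\<phi> i)"
    and phi_smooth: "\<And>i k. smooth_fun_on (X i) (\<phi> i k)"
    and eigen: "\<And>i k y. y \<in> X i \<Longrightarrow> L_op (w i) (p i) (q i) (a i) (\<phi> i k) y = ev i k * \<phi> i k y"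
    and ev_nonneg: "\<And>i k. ev i k \<ge> 0"
    and ev_mono: "\<And>i. strict_mono (ev i)"
    and ev_lim: "\<And>i. filterlim (ev i) at_top sequentially"
    and A1: "\<And>i y. y \<in> X i \<Longrightarrow> v_fun (w i) (p i) (q i) y \<ge> 0"
    and K_nonneg: "K \<ge> 0"
    and A2: "\<And>x. (\<And>i. x i \<in> X i) \<Longrightarrow>
      (\<Sum>i\<in>UNIV. (q i (x i))\<^sup>2) \<le> K * (\<Sum>i\<in>UNIV. r_fun (w i) (p i) (q i) (a i) (x i))"
    and T1: "\<And>i k m.
      L2_inner (\<mu> i) (delta (p i) (q i) (\<phi> i k)) (delta (p i) (q i) (\<phi> i m)) =
      L2_inner (\<mu> i) (delta_star (w i) (p i) (q i) (delta (p i) (q i) (\<phi> i k))) (\<phi> i m)"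
    and T2: "\<And>i k s1 s2 F. s1 > 0 \<Longrightarrow> s2 > 0 \<Longrightarrow>
      F \<in> {at_right (\<sigma> i), at_left (\<tau> i)} \<Longrightarrow>
      (((\<lambda>y. (1 + \<bar>\<phi> i k y\<bar> powr s1 + \<bar>delta (p i) (q i) (\<phi> i k) y\<bar> powr s2) *
              (p i y)\<^sup>2 * w i y * deriv (\<phi> i k) y) \<circ> real_of_ereal) \<longlongrightarrow> 0) F \<and>
      (((\<lambda>y. (1 + \<bar>\<phi> i k y\<bar> powr s1 + \<bar>delta (p i) (q i) (\<phi> i k) y\<bar> powr s2) *
              (p i y)\<^sup>2 * w i y * deriv (delta (p i) (q i) (\<phi> i k)) y) \<circ> real_of_ereal) \<longlongrightarrow> 0) F"
    and T3: "\<And>u. 1 \<le> u \<Longrightarrow> dense_in_Lp M u (lin (tensor \<phi>)) \<and>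
      (\<forall>i. dense_in_Lp M u (lin (\<lambda>k. delta_coord p q i (tensor \<phi> k))))"
    and s: "1 < s"
  shows "(\<exists>T. Riesz_extension M p q \<phi> ev s T) \<and>
    (\<forall>T. Riesz_extension M p q \<phi> ev s T \<longrightarrow>
      (\<forall>f\<in>Lp M s. Lp_norm M s (T f) \<le>
         24 * (1 + sqrt K) * (max s (s / (s - 1)) - 1) * Lp_norm M s (Pi_proj M \<phi> ev f)))"
  unfolding X_def \<mu>_def M_def
proof -
  interpret riesz_setting \<sigma> \<tau> w p q a \<phi> ev K
    by (rule riesz_setting.intro) (fact assms[unfolded X_def \<mu>_def M_def])+
  show "(\<exists>T. Riesz_extension (product_measure \<sigma> \<tau> w) p q \<phi> ev s T) \<and>
    (\<forall>T. Riesz_extension (product_measure \<sigma> \<tau> w) p q \<phi> ev s T \<longrightarrow>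
      (\<forall>f\<in>Lp (product_measure \<sigma> \<tau> w) s. Lp_norm (product_measure \<sigma> \<tau> w) s (T f) \<le>
         24 * (1 + sqrt K) * (max s (s / (s - 1)) - 1) * Lp_norm (product_measure \<sigma> \<tau> w) s (Pi_proj (product_measure \<sigma> \<tau> w) \<phi> ev f)))"
    using Riesz_extension_exists[OF s] Riesz_extension_bound[OF s] by blast
qed

end
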